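(* Let $A$ be the monogenic extension of $K$ associated with $\alpha$ and $f$. Let $D_r\colon C^S_r(A)\to C^S_{r+1}(A)$ be the composition $D_r=\psi_{r+1}B_r\phi_r$. Then $(C^S_*(A),d_*,D_* )$ is a mixed complex, giving the cyclic homology of $A$ (relative to $K$); that is, the cyclic homology of the mixed complex $(C^S_*(A),d_*,D_* )$ is $\mathrm{HC}^K_*(A)$.
   Context: Setting: $k$ is a commutative ring with $1$, $K$ is an associative unital $k$-algebra (not necessarily commutative), $\alpha$ is a $k$-algebra endomorphism of $K$, and $B=K[x,\alpha]$ is the Ore extension: the algebra generated by $K$ and $x$ subject to $x\lambda=\alpha(\lambda)x$ for $\lambda\in K$. Let $f=\sum_{i=0}^n\lambda_ix^{n-i}$ with $\lambda_0=1$, $n\ge 2$, $\lambda_i\in K$, $\alpha(\lambda_i)=\lambda_i$ and $\lambda_i\lambda=\alpha^i(\lambda)\lambda_i$ for all $\lambda\in K$ and $1\le i\le n$. The monogenic extension of $K$ associated with $\alpha$ and $f$ is $A=K[x,\alpha]/\langle f\rangle$; $\{1,x,\dots,x^{n-1}\}$ is a left $K$-basis of $A$. Here $\otimes$ means $\otimes_K$, $\overline A=A/K$, and for a $K$-bimodule $N$, $N\otimes$ denotes $N/[N,K]$, where $[N,K]$ is the $k$-submodule generated by all $m\lambda-\lambda m$ ($m\in N,\lambda\in K$). Square brackets denote classes. Mixed complexes. A mixed complex $(X,b,B)$ is a graded module $(X_r)_{r\ge0}$ with morphisms $b\colon X_r\to X_{r-1}$, $B\colon X_r\to X_{r+1}$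 with $bb=0$, $BB=0$, $Bb+bB=0$. Its cyclic homology is the homology of the total complex with $r$-th module $X_r\oplus X_{r-2}\oplus X_{r-4}\oplus\cdots$ and differential $b+B$ (where the component of $B$ on the summand $X_r$ of top degree is dropped). The normalized mixed complex of $A$ relative to $K$ is $(A\otimes\overline A^{\otimes^*}\otimes,b,B)$, where $b$ is the canonical Hochschild boundary and $B_r([a_0\otimes\cdots\otimes a_r])=\sum_{i=0}^r(-1)^{ir}[1\otimes a_i\otimes\cdots\otimes a_r\otimes a_0\otimes\cdots\otimes a_{i-1}]$; its cyclic homology is $\mathrm{HC}^K_*(A)$. The complex $C^S(A)$. $[A,K]_{\alpha^j}$ is the $k$-submodule of $A$ generated by all $a\alpha^j(\lambda)-\lambda a$ ($a\in A,\lambda\in K$). $C^S_{2m}(A)=A/[A,K]_{\alpha^{mn}}$, $C^S_{2m+1}(A)=A/[A,K]_{\alpha^{mn+1}}$ ($m\ge0$), with boundary maps $d_{2m+1}([a])=[ax-xa]$ ($m\ge0$), $d_{2m}([a])=\sum_{i=1}^n\sum_{\ell=0}^{i-1}[\lambda_{n-i}x^{i-\ell-1}ax^\ell]$ ($m\ge1$). The maps $\phi,\psi$. For $P\in K[x,\alpha]$, $\overline P$ denotes the unique element of $K[x,\alpha]$ with $P=\overline Pf+R$, $R=0$ or $\deg R<n$ (viewed in $A$ when needed). $\mathbb I_m=\{(i_1,\dots,i_m)\in\mathbb Z^m:1\le i_j\le n\}$; $\mathbb J_{\mathbf i}=\{(\ell_1,\dots,\ell_m)\in\mathbb Z^m:1\le\ell_j<i_j\}$;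 $\boldsymbol\lambda_{\mathbf n-\mathbf i}=\lambda_{n-i_1}\cdots\lambda_{n-i_m}$; $\widetilde{\mathbf x}^{\boldsymbol\ell_{m,1}}=x\otimes x^{\ell_m}\otimes\cdots\otimes x\otimes x^{\ell_1}$; $|\mathbf i-\boldsymbol\ell|=\sum_j(i_j-\ell_j)$. The maps $\phi_r\colon C^S_r(A)\to A\otimes\overline A^{\otimes^r}\otimes$ and $\psi_r\colon A\otimes\overline A^{\otimes^r}\otimes\to C^S_r(A)$ are given by $\phi_{2m}([a])=\sum_{\mathbf i\in\mathbb I_m}\sum_{\boldsymbol\ell\in\mathbb J_{\mathbf i}}[\boldsymbol\lambda_{\mathbf n-\mathbf i}ax^{|\mathbf i-\boldsymbol\ell|-m}\otimes\widetilde{\mathbf x}^{\boldsymbol\ell_{m,1}}]$, $\phi_{2m+1}([a])=\sum_{\mathbf i\in\mathbb I_m}\sum_{\boldsymbol\ell\in\mathbb J_{\mathbf i}}[\boldsymbol\lambda_{\mathbf n-\mathbf i}ax^{|\mathbf i-\boldsymbol\ell|-m}\otimes\widetilde{\mathbf x}^{\boldsymbol\ell_{m,1}}\otimes x]$ (so $\phi_0([a])=[a]$, $\phi_1([a])=[a\otimes x]$), $\psi_{2m}([a\otimes x^{i_1}\otimes\cdots\otimes x^{i_{2m}}])=[a\,\overline{x^{i_1+i_2}}\cdots\overline{x^{i_{2m-1}+i_{2m}}}]$, $\psi_{2m+1}([a\otimes x^{i_1}\otimes\cdots\otimes x^{i_{2m+1}}])=\sum_{\ell=0}^{i_{2m+1}-1}[x^{i_{2m+1}-\ell-1}a\,\overline{x^{i_1+i_2}}\cdots\overline{x^{i_{2m-1}+i_{2m}}}\,x^\ell]$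 (with $1\le i_j<n$). *)

theory Defs
  imports "HOL-Algebra.QuotRing" "HOL-Algebra.UnivPoly"
begin

section \<open>Modules and algebras over a commutative ring\<close>

text \<open>The library locale \<^locale>\<open>algebra\<close> requires the algebra to be commutative.\<close>

locale assoc_algebra = module k A + ring A for k and A (structure) +
  assumes smult_mult_left:
      "\<lbrakk>c \<in> carrier k; x \<in> carrier A; y \<in> carrier A\<rbrakk> \<Longrightarrow> (c \<odot> x) \<otimes> y = c \<odot> (x \<otimes> y)"
    and smult_mult_right:
      "\<lbrakk>c \<in> carrier k; x \<in> carrier A; y \<in> carrier A\<rbrakk> \<Longrightarrow> x \<otimes> (c \<odot> y) = c \<odot> (x \<otimes> y)"

definition alg_hom ::
  "('k, 'r) ring_scheme \<Rightarrow> ('k, 'a, 'm) module_scheme \<Rightarrow> ('k, 'b, 'n) module_scheme \<Rightarrow> ('a \<Rightarrow> 'b) set"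
  where "alg_hom k A B =
    {h \<in> ring_hom A B. \<forall>c\<in>carrier k. \<forall>x\<in>carrier A. h (c \<odot>\<^bsub>A\<^esub> x) = c \<odot>\<^bsub>B\<^esub> h x}"

definition mod_hom ::
  "('k, 'r) ring_scheme \<Rightarrow> ('k, 'a, 'm) module_scheme \<Rightarrow> ('k, 'b, 'n) module_scheme \<Rightarrow> ('a \<Rightarrow> 'b) set"
  where "mod_hom k M N =
    {h \<in> carrier M \<rightarrow>\<^sub>E carrier N.
       (\<forall>x\<in>carrier M. \<forall>y\<in>carrier M. h (x \<oplus>\<^bsub>M\<^esub> y) = h x \<oplus>\<^bsub>N\<^esub> h y) \<and>
       (\<forall>c\<in>carrier k. \<forall>x\<in>carrier M. h (c \<odot>\<^bsub>M\<^esub> x) = c \<odot>\<^bsub>N\<^esub> h x)}"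

definition mod_isomorphic ::
  "('k, 'r) ring_scheme \<Rightarrow> ('k, 'a, 'm) module_scheme \<Rightarrow> ('k, 'b, 'n) module_scheme \<Rightarrow> bool"
  where "mod_isomorphic k M N \<longleftrightarrow>
    (\<exists>h\<in>mod_hom k M N. bij_betw h (carrier M) (carrier N))"

text \<open>
  Maps that are prescribed on classes generating a quotient module are rendered as \<^emph>\<open>the\<close>
  linear map taking the prescribed values; members of \<^const>\<open>mod_hom\<close> are extensional, so the
  map is unique whenever the classes span.
\<close>

definition the_hom ::
  "('k, 'r) ring_scheme \<Rightarrow> ('k, 'a, 'm) module_scheme \<Rightarrow> ('k, 'b, 'n) module_scheme
     \<Rightarrow> (('a \<Rightarrow> 'b) \<Rightarrow> bool) \<Rightarrow> 'a \<Rightarrow> 'b"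
  where "the_hom k M N P = (THE h. h \<in> mod_hom k M N \<and> P h)"

definition mod_span ::
  "('k, 'r) ring_scheme \<Rightarrow> ('k, 'a, 'm) module_scheme \<Rightarrow> 'a set \<Rightarrow> 'a set"
  where "mod_span k M S = \<Inter>{H. submodule H k M \<and> S \<subseteq> H}"

text \<open>
  The quotient \<^term>\<open>M Quot N\<close> of the library together with the induced scalar action. It serves
  for quotients of modules by submodules (the multiplicative part of the record is then irrelevant)
  and for quotients of algebras by two-sided ideals.
\<close>

definition quot_mod :: "('k, 'a, 'm) module_scheme \<Rightarrow> 'a set \<Rightarrow> ('k, 'a set) module"
  where "quot_mod M N =
    \<lparr>carrier = carrier (M Quot N), mult = mult (M Quot N), one = one (M Quot N),
     zero = zero (M Quot N), add = add (M Quot N),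
     smult = (\<lambda>c X. \<Union>x\<in>X. N +>\<^bsub>M\<^esub> (c \<odot>\<^bsub>M\<^esub> x))\<rparr>"

text \<open>The free module with basis \<open>G\<close>; its elements are the finitely supported functions.\<close>

definition free_mod :: "('k, 'r) ring_scheme \<Rightarrow> 'g set \<Rightarrow> ('k, 'g \<Rightarrow> 'k) module"
  where "free_mod k G =
    \<lparr>carrier = {u. (\<forall>g. u g \<in> carrier k) \<and> finite {g. u g \<noteq> \<zero>\<^bsub>k\<^esub>} \<and> (\<forall>g. g \<notin> G \<longrightarrow> u g = \<zero>\<^bsub>k\<^esub>)},
     mult = undefined, one = undefined,
     zero = (\<lambda>g. \<zero>\<^bsub>k\<^esub>), add = (\<lambda>u v g. u g \<oplus>\<^bsub>k\<^esub> v g),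
     smult = (\<lambda>c u g. c \<otimes>\<^bsub>k\<^esub> u g)\<rparr>"

definition free_gen :: "('k, 'r) ring_scheme \<Rightarrow> 'g \<Rightarrow> 'g \<Rightarrow> 'k"
  where "free_gen k g = (\<lambda>g'. if g' = g then \<one>\<^bsub>k\<^esub> else \<zero>\<^bsub>k\<^esub>)"


section \<open>Mixed complexes and their cyclic homology\<close>

text \<open>
  \<open>b r\<close> is the map from degree \<open>r\<close> to degree \<open>r - 1\<close>, for \<open>r \<ge> 1\<close>, and \<open>B r\<close> the map from
  degree \<open>r\<close> to degree \<open>r + 1\<close>. The module in degree \<open>-1\<close> is zero, so \<open>b 0\<close> is never used.
\<close>

locale mixed_complex =
  fixes k :: "('k, 'r) ring_scheme" and X :: "nat \<Rightarrow> ('k, 'x) module"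
    and b :: "nat \<Rightarrow> 'x \<Rightarrow> 'x" and B :: "nat \<Rightarrow> 'x \<Rightarrow> 'x"
  assumes module_X: "module k (X r)"
    and b_hom: "b (Suc r) \<in> mod_hom k (X (Suc r)) (X r)"
    and B_hom: "B r \<in> mod_hom k (X r) (X (Suc r))"
    and b_b: "x \<in> carrier (X (Suc (Suc r))) \<Longrightarrow> b (Suc r) (b (Suc (Suc r)) x) = \<zero>\<^bsub>X r\<^esub>"
    and B_B: "x \<in> carrier (X r) \<Longrightarrow> B (Suc r) (B r x) = \<zero>\<^bsub>X (Suc (Suc r))\<^esub>"
    and b_B_0: "x \<in> carrier (X 0) \<Longrightarrow> b 1 (B 0 x) = \<zero>\<^bsub>X 0\<^esub>"
    and b_B: "x \<in> carrier (X (Suc r)) \<Longrightarrow>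
      B r (b (Suc r) x) \<oplus>\<^bsub>X (Suc r)\<^esub> b (Suc (Suc r)) (B (Suc r) x) = \<zero>\<^bsub>X (Suc r)\<^esub>"

text \<open>
  An element \<open>u\<close> of the total module \<open>X\<^sub>r \<oplus> X\<^sub>r\<^sub>-\<^sub>2 \<oplus> \<dots>\<close> has components \<open>u j \<in> X\<^sub>r\<^sub>-\<^sub>2\<^sub>j\<close>
  for \<open>j \<le> r div 2\<close>.
\<close>

definition tot_mod :: "(nat \<Rightarrow> ('k, 'x) module) \<Rightarrow> nat \<Rightarrow> ('k, nat \<Rightarrow> 'x) module"
  where "tot_mod X r =
    \<lparr>carrier = (\<Pi>\<^sub>E j\<in>{..r div 2}. carrier (X (r - 2 * j))),
     mult = undefined, one = undefined,
     zero = (\<lambda>j\<in>{..r div 2}. \<zero>\<^bsub>X (r - 2 * j)\<^esub>),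
     add = (\<lambda>u v. \<lambda>j\<in>{..r div 2}. u j \<oplus>\<^bsub>X (r - 2 * j)\<^esub> v j),
     smult = (\<lambda>c u. \<lambda>j\<in>{..r div 2}. c \<odot>\<^bsub>X (r - 2 * j)\<^esub> u j)\<rparr>"

text \<open>
  The component of \<open>(b + B) u\<close> in \<open>X\<^sub>r\<^sub>-\<^sub>1\<^sub>-\<^sub>2\<^sub>j\<close> is \<open>b (u j) + B (u (j + 1))\<close>, where the second term
  is present only if \<open>u\<close> has a component \<open>u (j + 1)\<close>. In particular \<open>B (u 0)\<close> does not occur.
\<close>

definition tot_diff ::
  "(nat \<Rightarrow> ('k, 'x) module) \<Rightarrow> (nat \<Rightarrow> 'x \<Rightarrow> 'x) \<Rightarrow> (nat \<Rightarrow> 'x \<Rightarrow> 'x)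
     \<Rightarrow> nat \<Rightarrow> (nat \<Rightarrow> 'x) \<Rightarrow> nat \<Rightarrow> 'x"
  where "tot_diff X b B r u =
    (\<lambda>j\<in>{..(r - 1) div 2}.
       if j + 1 \<le> r div 2
       then b (r - 2 * j) (u j) \<oplus>\<^bsub>X (r - 1 - 2 * j)\<^esub> B (r - 2 * (j + 1)) (u (j + 1))
       else b (r - 2 * j) (u j))"

text \<open>Homology of a non-negatively graded complex with differentials \<open>D r\<close> from degree \<open>r\<close> to
  degree \<open>r - 1\<close>, for \<open>r \<ge> 1\<close>.\<close>

definition homology ::
  "(nat \<Rightarrow> ('k, 'x) module) \<Rightarrow> (nat \<Rightarrow> 'x \<Rightarrow> 'x) \<Rightarrow> nat \<Rightarrow> ('k, 'x set) module"
  where "homology C D r =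
    quot_mod ((C r)\<lparr>carrier := {u \<in> carrier (C r). r = 0 \<or> D r u = \<zero>\<^bsub>C (r - 1)\<^esub>}\<rparr>)
      (D (r + 1) ` carrier (C (r + 1)))"

definition cyclic_homology ::
  "(nat \<Rightarrow> ('k, 'x) module) \<Rightarrow> (nat \<Rightarrow> 'x \<Rightarrow> 'x) \<Rightarrow> (nat \<Rightarrow> 'x \<Rightarrow> 'x)
     \<Rightarrow> nat \<Rightarrow> ('k, (nat \<Rightarrow> 'x) set) module"
  where "cyclic_homology X b B = homology (tot_mod X) (tot_diff X b B)"


section \<open>The normalized mixed complex of an algebra relative to a ground algebra\<close>

text \<open>
  Here \<open>A\<close> is a \<open>k\<close>-algebra with a \<open>k\<close>-algebra homomorphism \<open>\<iota>\<close> from \<open>K\<close> to \<open>A\<close>, through which \<open>K\<close>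
  acts on \<open>A\<close> from both sides.

  The module \<open>A \<otimes> (A/K)\<^sup>\<otimes>\<^sup>r \<otimes>\<close>, all tensor products being over \<open>K\<close> and the last one cyclic, is
  presented by generators \<open>[a\<^sub>0 \<otimes> \<dots> \<otimes> a\<^sub>r]\<close> indexed by the lists \<open>[a\<^sub>0, \<dots>, a\<^sub>r]\<close> of elements of \<open>A\<close>.
  The relations are: \<open>k\<close>-linearity in every entry; \<open>K\<close>-balancedness between the entries \<open>i\<close> and
  \<open>i + 1\<close>; the same between the last entry and the entry \<open>0\<close>, which divides out the differences
  \<open>m\<lambda> - \<lambda>m\<close>; and the vanishing of generators having an entry from \<open>K\<close> at a position \<open>i \<ge> 1\<close>,
  which replaces \<open>A\<close> by \<open>A/K\<close> there.
\<close>

locale relative_algebra_data =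
  fixes k :: "('k, 'r) ring_scheme" and K :: "('k, 'a, 'm) module_scheme"
    and \<iota> :: "'a \<Rightarrow> 'x" and A :: "('k, 'x) module"
begin

definition tens_gens :: "nat \<Rightarrow> 'x list set"
  where "tens_gens r = {l. length l = r + 1 \<and> set l \<subseteq> carrier A}"

abbreviation tens_free :: "nat \<Rightarrow> ('k, 'x list \<Rightarrow> 'k) module"
  where "tens_free r \<equiv> free_mod k (tens_gens r)"

abbreviation gen :: "'x list \<Rightarrow> 'x list \<Rightarrow> 'k"
  where "gen \<equiv> free_gen k"

definition tens_rels :: "nat \<Rightarrow> ('x list \<Rightarrow> 'k) set"
  where "tens_rels r =
    {gen (l[i := a \<oplus>\<^bsub>A\<^esub> a']) \<ominus>\<^bsub>tens_free r\<^esub> (gen (l[i := a]) \<oplus>\<^bsub>tens_free r\<^esub> gen (l[i := a'])) |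
        l i a a'. l \<in> tens_gens r \<and> i \<le> r \<and> a \<in> carrier A \<and> a' \<in> carrier A}
    \<union> {gen (l[i := c \<odot>\<^bsub>A\<^esub> a]) \<ominus>\<^bsub>tens_free r\<^esub> (c \<odot>\<^bsub>tens_free r\<^esub> gen (l[i := a])) |
        l i c a. l \<in> tens_gens r \<and> i \<le> r \<and> c \<in> carrier k \<and> a \<in> carrier A}
    \<union> {gen (l[i := l ! i \<otimes>\<^bsub>A\<^esub> \<iota> c]) \<ominus>\<^bsub>tens_free r\<^esub> gen (l[i + 1 := \<iota> c \<otimes>\<^bsub>A\<^esub> l ! (i + 1)]) |
        l i c. l \<in> tens_gens r \<and> i < r \<and> c \<in> carrier K}
    \<union> {gen (l[r := l ! r \<otimes>\<^bsub>A\<^esub> \<iota> c]) \<ominus>\<^bsub>tens_free r\<^esub> gen (l[0 := \<iota> c \<otimes>\<^bsub>A\<^esub> l ! 0]) |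
        l c. l \<in> tens_gens r \<and> c \<in> carrier K}
    \<union> {gen l | l i. l \<in> tens_gens r \<and> 1 \<le> i \<and> i \<le> r \<and> l ! i \<in> \<iota> ` carrier K}"

definition tens_ker :: "nat \<Rightarrow> ('x list \<Rightarrow> 'k) set"
  where "tens_ker r = mod_span k (tens_free r) (tens_rels r)"

definition norm_mod :: "nat \<Rightarrow> ('k, ('x list \<Rightarrow> 'k) set) module"
  where "norm_mod r = quot_mod (tens_free r) (tens_ker r)"

text \<open>The class \<open>[a\<^sub>0 \<otimes> \<dots> \<otimes> a\<^sub>r]\<close>.\<close>

definition tens_class :: "nat \<Rightarrow> 'x list \<Rightarrow> ('x list \<Rightarrow> 'k) set"
  where "tens_class r l = tens_ker r +>\<^bsub>tens_free r\<^esub> gen l"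

abbreviation sign :: "nat \<Rightarrow> 'k"
  where "sign i \<equiv> (\<ominus>\<^bsub>k\<^esub> \<one>\<^bsub>k\<^esub>) [^]\<^bsub>k\<^esub> i"

definition norm_b :: "nat \<Rightarrow> ('x list \<Rightarrow> 'k) set \<Rightarrow> ('x list \<Rightarrow> 'k) set"
  where "norm_b r = the_hom k (norm_mod r) (norm_mod (r - 1)) (\<lambda>h. \<forall>l\<in>tens_gens r.
    h (tens_class r l) =
      (\<Oplus>\<^bsub>norm_mod (r - 1)\<^esub> i\<in>{..<r}. sign i \<odot>\<^bsub>norm_mod (r - 1)\<^esub>
         tens_class (r - 1) (take i l @ [l ! i \<otimes>\<^bsub>A\<^esub> l ! (i + 1)] @ drop (i + 2) l))
      \<oplus>\<^bsub>norm_mod (r - 1)\<^esub>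
      (sign r \<odot>\<^bsub>norm_mod (r - 1)\<^esub>
         tens_class (r - 1) ((l ! r \<otimes>\<^bsub>A\<^esub> l ! 0) # take (r - 1) (tl l))))"

definition norm_B :: "nat \<Rightarrow> ('x list \<Rightarrow> 'k) set \<Rightarrow> ('x list \<Rightarrow> 'k) set"
  where "norm_B r = the_hom k (norm_mod r) (norm_mod (r + 1)) (\<lambda>h. \<forall>l\<in>tens_gens r.
    h (tens_class r l) =
      (\<Oplus>\<^bsub>norm_mod (r + 1)\<^esub> i\<in>{..r}. sign (i * r) \<odot>\<^bsub>norm_mod (r + 1)\<^esub>
         tens_class (r + 1) (\<one>\<^bsub>A\<^esub> # drop i l @ take i l)))"

definition HC :: "nat \<Rightarrow> ('k, (nat \<Rightarrow> ('x list \<Rightarrow> 'k) set) set) module"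
  where "HC = cyclic_homology norm_mod norm_b norm_B"

end


section \<open>Monogenic extensions\<close>

text \<open>
  The Ore extension \<open>K[x,\<alpha>]\<close>: the left \<open>K\<close>-module of polynomials \<open>\<Sum> p\<^sub>i x\<^sup>i\<close> with coefficients
  written on the left, multiplied by the rule \<open>x\<lambda> = \<alpha>(\<lambda>)x\<close>, that is
  \<open>(p\<^sub>i x\<^sup>i)(q\<^sub>j x\<^sup>j) = p\<^sub>i \<alpha>\<^sup>i(q\<^sub>j) x\<^sup>i\<^sup>+\<^sup>j\<close>. The scalars are those of \<open>k\<close>.
\<close>

definition ore_ext ::
  "('k, 'a, 'm) module_scheme \<Rightarrow> ('a \<Rightarrow> 'a) \<Rightarrow> ('k, nat \<Rightarrow> 'a) module"
  where "ore_ext K \<alpha> =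
    \<lparr>carrier = up K,
     mult = (\<lambda>p q m. \<Oplus>\<^bsub>K\<^esub> i\<in>{..m}. p i \<otimes>\<^bsub>K\<^esub> (\<alpha> ^^ i) (q (m - i))),
     one = (\<lambda>i. if i = 0 then \<one>\<^bsub>K\<^esub> else \<zero>\<^bsub>K\<^esub>),
     zero = (\<lambda>i. \<zero>\<^bsub>K\<^esub>),
     add = (\<lambda>p q i. p i \<oplus>\<^bsub>K\<^esub> q i),
     smult = (\<lambda>c p i. c \<odot>\<^bsub>K\<^esub> p i)\<rparr>"

definition ore_const :: "('k, 'a, 'm) module_scheme \<Rightarrow> 'a \<Rightarrow> nat \<Rightarrow> 'a"
  where "ore_const K c = (\<lambda>i. if i = 0 then c else \<zero>\<^bsub>K\<^esub>)"

definition ore_var :: "('k, 'a, 'm) module_scheme \<Rightarrow> nat \<Rightarrow> 'a"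
  where "ore_var K = (\<lambda>i. if i = 1 then \<one>\<^bsub>K\<^esub> else \<zero>\<^bsub>K\<^esub>)"

locale monogenic_data =
  fixes k :: "('k, 'r) ring_scheme" and K :: "('k, 'a, 'm) module_scheme"
    and \<alpha> :: "'a \<Rightarrow> 'a" and n :: nat and lam :: "nat \<Rightarrow> 'a"
begin

abbreviation P :: "('k, nat \<Rightarrow> 'a) module"
  where "P \<equiv> ore_ext K \<alpha>"

definition f :: "nat \<Rightarrow> 'a"
  where "f = (\<Oplus>\<^bsub>P\<^esub> i\<in>{..n}. ore_const K (lam i) \<otimes>\<^bsub>P\<^esub> ore_var K [^]\<^bsub>P\<^esub> (n - i))"

definition A :: "('k, (nat \<Rightarrow> 'a) set) module"
  where "A = quot_mod P (Idl\<^bsub>P\<^esub> {f})"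

definition to_A :: "(nat \<Rightarrow> 'a) \<Rightarrow> (nat \<Rightarrow> 'a) set"
  where "to_A p = Idl\<^bsub>P\<^esub> {f} +>\<^bsub>P\<^esub> p"

definition emb :: "'a \<Rightarrow> (nat \<Rightarrow> 'a) set"
  where "emb c = to_A (ore_const K c)"

definition x :: "(nat \<Rightarrow> 'a) set"
  where "x = to_A (ore_var K)"

sublocale rel: relative_algebra_data k K emb A .

text \<open>The \<open>k\<close>-submodule \<open>[A,K]\<close> of \<open>A\<close> twisted by \<open>\<alpha>\<^sup>j\<close>.\<close>

definition comm_sub :: "nat \<Rightarrow> (nat \<Rightarrow> 'a) set set"
  where "comm_sub j = mod_span k A
    {a \<otimes>\<^bsub>A\<^esub> emb ((\<alpha> ^^ j) c) \<ominus>\<^bsub>A\<^esub> emb c \<otimes>\<^bsub>A\<^esub> a | a c. a \<in> carrier A \<and> c \<in> carrier K}"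

definition S_ker :: "nat \<Rightarrow> (nat \<Rightarrow> 'a) set set"
  where "S_ker r = (let m = r div 2 in if even r then comm_sub (m * n) else comm_sub (m * n + 1))"

definition S_mod :: "nat \<Rightarrow> ('k, (nat \<Rightarrow> 'a) set set) module"
  where "S_mod r = quot_mod A (S_ker r)"

definition S_class :: "nat \<Rightarrow> (nat \<Rightarrow> 'a) set \<Rightarrow> (nat \<Rightarrow> 'a) set set"
  where "S_class r a = S_ker r +>\<^bsub>A\<^esub> a"

definition S_d :: "nat \<Rightarrow> (nat \<Rightarrow> 'a) set set \<Rightarrow> (nat \<Rightarrow> 'a) set set"
  where "S_d r = the_hom k (S_mod r) (S_mod (r - 1)) (\<lambda>h. \<forall>a\<in>carrier A.
    h (S_class r a) =
      (if odd r
       then S_class (r - 1) (a \<otimes>\<^bsub>A\<^esub> x \<ominus>\<^bsub>A\<^esub> x \<otimes>\<^bsub>A\<^esub> a)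
       else (\<Oplus>\<^bsub>S_mod (r - 1)\<^esub> i\<in>{1..n}. \<Oplus>\<^bsub>S_mod (r - 1)\<^esub> l\<in>{..<i}.
               S_class (r - 1)
                 (emb (lam (n - i)) \<otimes>\<^bsub>A\<^esub> x [^]\<^bsub>A\<^esub> (i - l - 1) \<otimes>\<^bsub>A\<^esub> a \<otimes>\<^bsub>A\<^esub> x [^]\<^bsub>A\<^esub> l))))"

text \<open>The quotient on right division by \<open>f\<close>.\<close>

definition overline :: "(nat \<Rightarrow> 'a) \<Rightarrow> nat \<Rightarrow> 'a"
  where "overline p = (THE q. q \<in> carrier P \<and>
    (\<exists>s\<in>carrier P. p = q \<otimes>\<^bsub>P\<^esub> f \<oplus>\<^bsub>P\<^esub> s \<and> (s = \<zero>\<^bsub>P\<^esub> \<or> deg K s < n)))"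

text \<open>Multi-indices are lists, with \<open>i\<^sub>1\<close> the entry at position \<open>0\<close>.\<close>

definition II :: "nat \<Rightarrow> nat list set"
  where "II m = {is. length is = m \<and> set is \<subseteq> {1..n}}"

definition JJ :: "nat list \<Rightarrow> nat list set"
  where "JJ is = {ls. length ls = length is \<and> (\<forall>j<length is. 1 \<le> ls ! j \<and> ls ! j < is ! j)}"

definition lam_prod :: "nat list \<Rightarrow> 'a"
  where "lam_prod is = foldr (\<lambda>i c. lam (n - i) \<otimes>\<^bsub>K\<^esub> c) is \<one>\<^bsub>K\<^esub>"

text \<open>The tensor \<open>x \<otimes> x\<^sup>l\<^sup>m \<otimes> \<dots> \<otimes> x \<otimes> x\<^sup>l\<^sup>1\<close> of length \<open>2m\<close>.\<close>

definition x_tilde :: "nat list \<Rightarrow> (nat \<Rightarrow> 'a) set list"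
  where "x_tilde ls = concat (map (\<lambda>l. [x, x [^]\<^bsub>A\<^esub> l]) (rev ls))"

definition phi :: "nat \<Rightarrow> (nat \<Rightarrow> 'a) set set \<Rightarrow> ((nat \<Rightarrow> 'a) set list \<Rightarrow> 'k) set"
  where "phi r = the_hom k (S_mod r) (rel.norm_mod r) (\<lambda>h. \<forall>a\<in>carrier A.
    h (S_class r a) =
      (let m = r div 2 in
       \<Oplus>\<^bsub>rel.norm_mod r\<^esub> is\<in>II m. \<Oplus>\<^bsub>rel.norm_mod r\<^esub> ls\<in>JJ is.
         rel.tens_class r
           ((emb (lam_prod is) \<otimes>\<^bsub>A\<^esub> a \<otimes>\<^bsub>A\<^esub> x [^]\<^bsub>A\<^esub> ((\<Sum>j<m. is ! j - ls ! j) - m))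
             # x_tilde ls @ (if even r then [] else [x]))))"

text \<open>The product of the overlines of \<open>x\<close> to the power \<open>i\<^sub>2\<^sub>j\<^sub>-\<^sub>1 + i\<^sub>2\<^sub>j\<close>, for \<open>j\<close> from 1 to
  \<open>length is div 2\<close>, in this order.\<close>

definition overline_prod :: "nat list \<Rightarrow> (nat \<Rightarrow> 'a) set"
  where "overline_prod is =
    foldr (\<lambda>j y. to_A (overline (ore_var K [^]\<^bsub>P\<^esub> (is ! (2 * j) + is ! (2 * j + 1)))) \<otimes>\<^bsub>A\<^esub> y)
      [0..<length is div 2] \<one>\<^bsub>A\<^esub>"

definition psi :: "nat \<Rightarrow> ((nat \<Rightarrow> 'a) set list \<Rightarrow> 'k) set \<Rightarrow> (nat \<Rightarrow> 'a) set set"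
  where "psi r = the_hom k (rel.norm_mod r) (S_mod r)
    (\<lambda>h. \<forall>a\<in>carrier A. \<forall>is. length is = r \<and> set is \<subseteq> {1..<n} \<longrightarrow>
      h (rel.tens_class r (a # map (\<lambda>i. x [^]\<^bsub>A\<^esub> i) is)) =
        (if even r
         then S_class r (a \<otimes>\<^bsub>A\<^esub> overline_prod is)
         else (\<Oplus>\<^bsub>S_mod r\<^esub> l\<in>{..<last is}.
                S_class r (x [^]\<^bsub>A\<^esub> (last is - l - 1) \<otimes>\<^bsub>A\<^esub> a \<otimes>\<^bsub>A\<^esub> overline_prod is \<otimes>\<^bsub>A\<^esub> x [^]\<^bsub>A\<^esub> l))))"

definition S_D :: "nat \<Rightarrow> (nat \<Rightarrow> 'a) set set \<Rightarrow> (nat \<Rightarrow> 'a) set set"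
  where "S_D r = compose (carrier (S_mod r)) (psi (r + 1)) (compose (carrier (S_mod r)) (rel.norm_B r) (phi r))"

end

end

theory Submission
  imports Defs "HOL-Library.Poly_Mapping" "HOL-Algebra.Free_Abelian_Groups"
begin

text \<open>
  The theorem asserts that the small complex is a deformation retract of the normalized mixed
  complex, in a form that survives the passage to cyclic homology. Three ideas carry the proof.

  \<^emph>\<open>The retraction of Hochschild complexes.\<close> Moving coefficients to the left, every tensor becomes a
  combination of tensors \<open>a \<otimes> x\<^sup>i\<^sup>1 \<otimes> \<dots> \<otimes> x\<^sup>i\<^sup>r\<close> with \<open>1 \<le> i\<^sub>j < n\<close>, which are encoded as pairs \<open>(a, w)\<close> of a
  coefficient and a word. On formal sums of such pairs (\<open>chains\<close>) the boundary \<open>bb\<close>, the map \<open>PP\<close> that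
  removes the first two letters at the cost of the factor \<open>uq (i + j)\<close> (the class of the overline of
  \<open>x\<^sup>i\<^sup>+\<^sup>j\<close>), and the map \<open>QQ\<close> in the other direction are explicit. They satisfy \<open>PP QQ = id\<close>,
  \<open>PP bb = bb PP\<close>, \<open>bb QQ = QQ bb\<close>, and \<open>bb ss + ss bb = QQ PP - id\<close> for an operator \<open>ss\<close> that splits the
  first letter (\<open>PP_Q\<close>, \<open>PP_b\<close>, \<open>Q_b_Suc\<close>, \<open>homotopy_2\<close>). In low degrees \<open>pp\<close> and \<open>dd2\<close> replace
  \<open>PP\<close> and \<open>QQ\<close> (\<open>bb_p0\<close>, \<open>pp_b\<close>, \<open>Q_b_0\<close>). The identities that involve an overlap of \<open>PP\<close> and \<open>QQ\<close>
  rest on a single congruence, \<open>Delta\<close>, which compares the two ways of reducing a sum of the shape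
  \<open>\<Sum>x\<^sup>M\<^sup>-\<^sup>m\<^sup>-\<^sup>1 \<otimes> x\<^sup>m\<close> modulo \<open>f\<close>. Since \<open>\<psi>\<close> and \<open>\<phi>\<close> are the iterates of \<open>PP\<close> and \<open>QQ\<close>, the series
  \<open>- ss - QQ ss PP - QQ\<^sup>2 ss PP\<^sup>2 - \<dots>\<close> is a homotopy between \<open>\<phi>\<psi>\<close> and the identity (\<open>homotopy_chain\<close>), and
  \<open>\<psi>\<phi>\<close> is the identity.

  \<^emph>\<open>The weight filtration.\<close> Give \<open>(a, w)\<close> the weight \<open>deg a + |w|\<close>. All operators above and the Connes
  operator preserve the bound on the weight, \<open>\<phi>\<close> takes values of weight less than \<open>n (m + 1)\<close> in degree
  \<open>2 m\<close>, whereas \<open>\<psi>\<close> kills everything of weight less than \<open>m n\<close> there; odd degrees are similar. Thus \<open>\<psi>\<close>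
  vanishes on every expression that starts with \<open>\<phi>\<close> and raises the degree by at least two
  (\<open>psc_vanish\<close>, \<open>top_wt_step\<close>).

  \<^emph>\<open>Perturbation.\<close> Such a filtered retraction is abstracted in the locale \<open>mixed_retract\<close>. The
  perturbation lemma would transport \<open>b + B\<close> to the differential
  \<open>d + \<psi>B\<phi> - \<psi>BhB\<phi> + \<dots>\<close> on the small complex, and the vanishing leaves only
  \<open>d + \<psi>B\<phi> = d + D\<close>. It also makes \<open>DD = 0\<close>, which is why \<open>(d, D)\<close> is a mixed complex at all.
\<close>

section \<open>Linear algebra\<close>

lemma (in abelian_group) neg_zero: "\<ominus> \<zero> = \<zero>"
 by (rule minus_equality) auto

lemma (in abelian_group) diff_zero_iff:
 assumes "a : carrier G" "b : carrier G"
 shows "a \<ominus> b = \<zero> \<longleftrightarrow> a = b"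
proof
 assume "a \<ominus> b = \<zero>"
 then have "(a \<oplus> \<ominus> b) \<oplus> b = b" using assms by (simp add: a_minus_def)
 then show "a = b" using assms by (simp add: a_assoc l_neg)
qed (use assms in \<open>simp add: a_minus_def r_neg\<close>)

lemma mod_homD:
 assumes "h : mod_hom k M N"
 shows mod_hom_closed: "x : carrier M ==> h x : carrier N"
 and mod_hom_add: "[|x : carrier M; y : carrier M|] ==> h (x \<oplus>\<^bsub>M\<^esub> y) = h x \<oplus>\<^bsub>N\<^esub> h y"
 and mod_hom_smult: "[|c : carrier k; x : carrier M|] ==> h (c \<odot>\<^bsub>M\<^esub> x) = c \<odot>\<^bsub>N\<^esub> h x"
 using assms by (auto simp: mod_hom_def)

lemma mod_homI:
 assumes "!!x. x : carrier M ==> h x : carrier N"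
 and "!!x y. [|x : carrier M; y : carrier M|] ==> h (x \<oplus>\<^bsub>M\<^esub> y) = h x \<oplus>\<^bsub>N\<^esub> h y"
 and "!!c x. [|c : carrier k; x : carrier M|] ==> h (c \<odot>\<^bsub>M\<^esub> x) = c \<odot>\<^bsub>N\<^esub> h x"
 and "h : extensional (carrier M)"
 shows "h : mod_hom k M N"
 using assms by (auto simp: mod_hom_def PiE_def)

lemma mod_hom_restrictI:
 assumes "module k M"
 and "!!x. x : carrier M ==> h x : carrier N"
 and "!!x y. [|x : carrier M; y : carrier M|] ==> h (x \<oplus>\<^bsub>M\<^esub> y) = h x \<oplus>\<^bsub>N\<^esub> h y"
 and "!!c x. [|c : carrier k; x : carrier M|] ==> h (c \<odot>\<^bsub>M\<^esub> x) = c \<odot>\<^bsub>N\<^esub> h x"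
 shows "restrict h (carrier M) : mod_hom k M N"
proof -
 interpret M: module k M by fact
 show ?thesis using assms by (intro mod_homI) auto
qed

context
 fixes k :: "('k, 'r) ring_scheme" and M :: "('k, 'a, 'm) module_scheme"
 and N :: "('k, 'b, 'n) module_scheme" and h
 assumes M: "module k M" and N: "module k N" and h: "h : mod_hom k M N"
begin

interpretation M: module k M by (rule M)
interpretation N: module k N by (rule N)

lemma mod_hom_zero: "h \<zero>\<^bsub>M\<^esub> = \<zero>\<^bsub>N\<^esub>"
proof -
 have "h \<zero>\<^bsub>M\<^esub> = h (\<zero>\<^bsub>M\<^esub> \<oplus>\<^bsub>M\<^esub> \<zero>\<^bsub>M\<^esub>)" by simp
 also have "... = h \<zero>\<^bsub>M\<^esub> \<oplus>\<^bsub>N\<^esub> h \<zero>\<^bsub>M\<^esub>" by (rule mod_hom_add[OF h]) auto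
 finally show ?thesis
 using mod_hom_closed[OF h M.M.zero_closed] by (metis N.M.add.r_cancel_one')
qed

lemma mod_hom_neg: "x : carrier M ==> h (\<ominus>\<^bsub>M\<^esub> x) = \<ominus>\<^bsub>N\<^esub> h x"
 using mod_hom_add[OF h, of "\<ominus>\<^bsub>M\<^esub> x" x] mod_hom_closed[OF h, of x] mod_hom_closed[OF h, of "\<ominus>\<^bsub>M\<^esub> x"]
 by (simp add: M.M.l_neg mod_hom_zero N.M.minus_equality)

lemma mod_hom_minus:
 "[|x : carrier M; y : carrier M|] ==> h (x \<ominus>\<^bsub>M\<^esub> y) = h x \<ominus>\<^bsub>N\<^esub> h y"
 by (simp add: a_minus_def mod_hom_add[OF h] mod_hom_neg)

lemma mod_hom_finsum:
 assumes "f : I \<rightarrow> carrier M"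
 shows "h (finsum M f I) = finsum N (%i. h (f i)) I"
 using assms
proof (induction I rule: infinite_finite_induct)
 case (insert i I)
 then show ?case
 by (simp add: M.M.finsum_insert N.M.finsum_insert Pi_def mod_hom_closed[OF h] mod_hom_add[OF h]
 M.M.finsum_closed)
qed (auto simp: mod_hom_zero N.M.add.finprod_infinite M.M.add.finprod_infinite)

end

lemma mod_hom_compose:
 assumes "module k L" "f : mod_hom k L M" "g : mod_hom k M N"
 shows "compose (carrier L) g f : mod_hom k L N"
proof -
 interpret L: module k L by fact
 note f = mod_homD[OF assms(2)] and g = mod_homD[OF assms(3)]
 show ?thesis by (intro mod_homI) (auto simp: compose_def f g)
qed

lemma mod_hom_eqI:
 assumes "g : mod_hom k M N" "h : mod_hom k M N" "!!x. x : carrier M ==> g x = h x"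
 shows "g = h"
 using assms unfolding mod_hom_def by (metis (no_types, lifting) PiE_ext mem_Collect_eq)

lemma the_homI:
 assumes "h : mod_hom k M N" "Q h"
 and "!!g. [|g : mod_hom k M N; Q g|] ==> g = h"
 shows "the_hom k M N Q = h"
 unfolding the_hom_def by (rule the_equality) (use assms in blast)+

lemma module_surj_image:
 fixes M :: "('k, 'a, 'm) module_scheme" and Q :: "('k, 'b, 'n) module_scheme"
 assumes "module k M" and carr: "carrier Q = q ` carrier M" and zero: "\<zero>\<^bsub>Q\<^esub> = q \<zero>\<^bsub>M\<^esub>"
 and add: "!!x y. [|x : carrier M; y : carrier M|] ==> q x \<oplus>\<^bsub>Q\<^esub> q y = q (x \<oplus>\<^bsub>M\<^esub> y)"
 and smult: "!!c x. [|c : carrier k; x : carrier M|] ==> c \<odot>\<^bsub>Q\<^esub> q x = q (c \<odot>\<^bsub>M\<^esub> x)"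
 shows "module k Q"
proof -
 interpret M: module k M by fact
 have "abelian_group Q"
 proof (rule abelian_groupI)
 fix x assume "x : carrier Q"
 then obtain y where y: "y : carrier M" "x = q y" using carr by auto
 show "EX y:carrier Q. y \<oplus>\<^bsub>Q\<^esub> x = \<zero>\<^bsub>Q\<^esub>"
 by (rule bexI[of _ "q (\<ominus>\<^bsub>M\<^esub> y)"]) (use y in \<open>auto simp: add carr M.M.l_neg zero\<close>)
 qed (auto simp: carr zero add M.M.add.m_ac)
 then show ?thesis
 by (rule moduleI[OF M.R.cring_axioms])
 (auto simp: carr smult add M.smult_l_distr M.smult_r_distr M.smult_assoc1)
qed

lemma submoduleI:
 assumes "module k M" "H <= carrier M" "\<zero>\<^bsub>M\<^esub> : H"
 and add: "!!x y. [|x : H; y : H|] ==> x \<oplus>\<^bsub>M\<^esub> y : H"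
 and smult: "!!c x. [|c : carrier k; x : H|] ==> c \<odot>\<^bsub>M\<^esub> x : H"
 shows "submodule H k M"
proof -
 interpret M: module k M by fact
 have "\<ominus>\<^bsub>M\<^esub> x : H" if "x : H" for x
 proof -
 have "(\<ominus>\<^bsub>k\<^esub> \<one>\<^bsub>k\<^esub>) \<odot>\<^bsub>M\<^esub> x : H" using that by (intro smult) auto
 then show ?thesis using that assms(2) by (auto simp: M.smult_l_minus subset_eq)
 qed
 then show ?thesis
 unfolding submodule_def submodule_axioms_def subgroup_def
 using assms by (auto simp: a_inv_def[symmetric])
qed

lemma submoduleD:
 assumes "submodule H k M"
 shows "H <= carrier M" "\<zero>\<^bsub>M\<^esub> : H"
 "!!x y. [|x : H; y : H|] ==> x \<oplus>\<^bsub>M\<^esub> y : H"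
 "!!x. x : H ==> \<ominus>\<^bsub>M\<^esub> x : H"
 "!!c x. [|c : carrier k; x : H|] ==> c \<odot>\<^bsub>M\<^esub> x : H"
 using assms unfolding submodule_def submodule_axioms_def subgroup_def
 by (auto simp: a_inv_def)

lemma submodule_carrier: "module k M ==> submodule (carrier M) k M"
 by (intro submoduleI) (auto simp: module.smult_closed module_def abelian_group_def abelian_monoid.a_closed abelian_monoid.zero_closed)

lemma mod_span_submodule:
 assumes "module k M" "S <= carrier M"
 shows "submodule (mod_span k M S) k M" "S <= mod_span k M S"
proof -
 have c: "carrier M : {H. submodule H k M & S <= H}"
 using assms submodule_carrier by auto
 show "submodule (mod_span k M S) k M"
 using assms(1) c unfolding mod_span_def
 by (intro submoduleI) (blast dest: submoduleD)+
 show "S <= mod_span k M S" by (auto simp: mod_span_def)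
qed

lemma mod_span_least: "submodule H k M ==> S <= H ==> mod_span k M S <= H"
 by (auto simp: mod_span_def)

lemma mod_span_in_kernel:
 assumes "module k M" "module k N" "S <= carrier M" "h : mod_hom k M N"
 and "!!x. x : S ==> h x = \<zero>\<^bsub>N\<^esub>" "y : mod_span k M S"
 shows "h y = \<zero>\<^bsub>N\<^esub>"
proof -
 interpret M: module k M by fact
 interpret N: module k N by fact
 have "submodule {x : carrier M. h x = \<zero>\<^bsub>N\<^esub>} k M"
 by (intro submoduleI) (auto simp: assms mod_hom_zero[OF assms(1,2,4)] mod_homD[OF assms(4)])
 then show ?thesis using mod_span_least[of "{x : carrier M. h x = \<zero>\<^bsub>N\<^esub>}" k M S] assms by blast
qed

locale mod_quotient =
 fixes k :: "('k, 'r) ring_scheme" and M :: "('k, 'a, 'm) module_scheme" and N :: "'a set"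
 assumes M_module: "module k M" and N_sub: "submodule N k M"
begin

sublocale M: module k M by (rule M_module)

abbreviation q where "q a \<equiv> N +>\<^bsub>M\<^esub> a"

lemma N_subset: "N <= carrier M" and N_add: "subgroup N (add_monoid M)"
 using N_sub submoduleD(1) by (auto simp: submodule_def)

lemma q_self: "a : carrier M ==> a : q a"
 using M.M.a_rcosI[OF submoduleD(2)[OF N_sub] N_subset, of a] by simp

lemma q_eq_iff:
 assumes "a : carrier M" "b : carrier M"
 shows "q a = q b \<longleftrightarrow> a \<ominus>\<^bsub>M\<^esub> b : N"
proof
 assume "q a = q b"
 then have "a : q b" using q_self[OF assms(1)] by simp
 then obtain h where "h : N" "a = h \<oplus>\<^bsub>M\<^esub> b" unfolding a_r_coset_def' by blast
 moreover have "h : carrier M" using N_subset \<open>h : N\<close> by auto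
 ultimately have "a \<ominus>\<^bsub>M\<^esub> b = h" using assms(2)
 by (simp add: a_minus_def M.M.add.m_assoc M.M.r_neg)
 then show "a \<ominus>\<^bsub>M\<^esub> b : N" using \<open>h : N\<close> by simp
next
 assume *: "a \<ominus>\<^bsub>M\<^esub> b : N"
 have "a = (a \<ominus>\<^bsub>M\<^esub> b) \<oplus>\<^bsub>M\<^esub> b" using assms by (simp add: a_minus_def M.M.add.m_assoc M.M.l_neg)
 then have "a : q b" using * unfolding a_r_coset_def' by blast
 then show "q a = q b" using M.M.a_repr_independence[of a N b] assms N_add by simp
qed

lemma carrier_quot: "carrier (quot_mod M N) = q ` carrier M"
 by (auto simp: quot_mod_def FactRing_def A_RCOSETS_def')

lemma q_closed: "a : carrier M ==> q a : carrier (quot_mod M N)"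
 by (simp add: carrier_quot)

lemma add_quot:
 assumes "a : carrier M" "b : carrier M"
 shows "q a \<oplus>\<^bsub>quot_mod M N\<^esub> q b = q (a \<oplus>\<^bsub>M\<^esub> b)"
proof -
 interpret N: abelian_subgroup N M
 by (rule abelian_subgroupI3[OF additive_subgroup.intro[OF N_add] M.M.abelian_group_axioms])
 show ?thesis using N.a_rcos_sum[of a b] assms by (simp add: quot_mod_def FactRing_def)
qed

lemma q_zero: "q \<zero>\<^bsub>M\<^esub> = N"
 using N_subset by (simp add: M.M.a_coset_add_zero)

lemma zero_quot: "\<zero>\<^bsub>quot_mod M N\<^esub> = q \<zero>\<^bsub>M\<^esub>"
 by (simp add: q_zero quot_mod_def FactRing_def)

lemma smult_quot:
 assumes "c : carrier k" "a : carrier M"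
 shows "c \<odot>\<^bsub>quot_mod M N\<^esub> q a = q (c \<odot>\<^bsub>M\<^esub> a)"
proof -
 have "q (c \<odot>\<^bsub>M\<^esub> b) = q (c \<odot>\<^bsub>M\<^esub> a)" if "b : q a" for b
 proof -
 have b: "b : carrier M" using that assms M.M.a_r_coset_subset_G[OF N_subset] by blast
 have "q b = q a" using M.M.a_repr_independence[of b N a] that assms N_add by simp
 then have "b \<ominus>\<^bsub>M\<^esub> a : N" using q_eq_iff b assms by simp
 then have "c \<odot>\<^bsub>M\<^esub> (b \<ominus>\<^bsub>M\<^esub> a) : N" using submoduleD(5)[OF N_sub] assms by simp
 then show ?thesis using b assms
 by (subst q_eq_iff) (auto simp: a_minus_def M.smult_r_distr M.smult_r_minus)
 qed
 then have "(\<Union>b\<in>q a. q (c \<odot>\<^bsub>M\<^esub> b)) = (\<Union>b\<in>q a. q (c \<odot>\<^bsub>M\<^esub> a))"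
 by (rule SUP_cong[OF refl])
 also have "... = q (c \<odot>\<^bsub>M\<^esub> a)" using q_self[OF assms(2)] by blast
 finally show ?thesis by (simp add: quot_mod_def)
qed

lemma quot_module: "module k (quot_mod M N)"
 by (rule module_surj_image[OF M_module carrier_quot zero_quot add_quot smult_quot])

lemma q_hom: "restrict q (carrier M) : mod_hom k M (quot_mod M N)"
 by (rule mod_hom_restrictI[OF M_module q_closed add_quot[symmetric] smult_quot[symmetric]])

lemma q_eq_zero_iff: "a : carrier M ==> q a = \<zero>\<^bsub>quot_mod M N\<^esub> \<longleftrightarrow> a : N"
 unfolding zero_quot by (simp add: q_eq_iff a_minus_def M.M.neg_zero)

lemma ex_quot_hom:
 fixes L :: "('k, 'b, 'n) module_scheme"
 assumes L: "module k L" and g: "g : mod_hom k M L" and z: "!!a. a : N ==> g a = \<zero>\<^bsub>L\<^esub>"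
 shows "EX h:mod_hom k (quot_mod M N) L. ALL a:carrier M. h (q a) = g a"
proof -
 interpret L: module k L by (rule L)
 define h where "h = restrict (%X. g (SOME a. a : carrier M & q a = X)) (carrier (quot_mod M N))"
 have h: "h (q a) = g a" if a: "a : carrier M" for a
 proof -
 define b where "b = (SOME b. b : carrier M & q b = q a)"
 have b: "b : carrier M & q b = q a" unfolding b_def by (rule someI[of _ a]) (simp add: a)
 then have "b \<ominus>\<^bsub>M\<^esub> a : N" using a q_eq_iff by blast
 then have "g b \<ominus>\<^bsub>L\<^esub> g a = \<zero>\<^bsub>L\<^esub>" using z mod_hom_minus[OF M_module L g, of b a] a b by simp
 then have "g b = g a" using mod_hom_closed[OF g] a b L.M.diff_zero_iff by blast
 then show ?thesis using q_closed[OF a] by (simp add: h_def b_def)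
 qed
 have "h : mod_hom k (quot_mod M N) L"
 proof (rule mod_homI)
 show "h : extensional (carrier (quot_mod M N))" by (simp add: h_def)
 qed (auto simp: carrier_quot add_quot smult_quot h mod_homD[OF g])
 then show ?thesis using h by blast
qed

lemma quot_hom_eqI:
 assumes "g : mod_hom k (quot_mod M N) L" "h : mod_hom k (quot_mod M N) L"
 "!!a. a : carrier M ==> g (q a) = h (q a)"
 shows "g = h"
 using assms(1,2) by (rule mod_hom_eqI) (use assms(3) in \<open>auto simp: carrier_quot\<close>)

lemma q_finsum:
 assumes "f : I \<rightarrow> carrier M"
 shows "q (finsum M f I) = finsum (quot_mod M N) (%i. q (f i)) I"
proof -
 interpret Q: module k "quot_mod M N" by (rule quot_module)
 have "finsum M f I : carrier M" using assms M.M.finsum_closed by auto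
 then have "q (finsum M f I) = restrict q (carrier M) (finsum M f I)" by simp
 also have "... = finsum (quot_mod M N) (%i. restrict q (carrier M) (f i)) I"
 by (rule mod_hom_finsum[OF M_module quot_module q_hom assms])
 also have "... = finsum (quot_mod M N) (%i. q (f i)) I"
 using assms by (intro Q.M.finsum_cong') (auto intro: q_closed)
 finally show ?thesis .
qed

end

lemma mod_isomorphic_quot:
 fixes M :: "('k, 'a, 'm) module_scheme" and M' :: "('k, 'b, 'n) module_scheme"
 assumes "mod_quotient k M N" "mod_quotient k M' N'" and f: "f : mod_hom k M M'"
 and iff: "!!a. a : carrier M ==> f a : N' \<longleftrightarrow> a : N"
 and surj: "!!b. b : carrier M' ==> EX a:carrier M. b \<ominus>\<^bsub>M'\<^esub> f a : N'"
 shows "mod_isomorphic k (quot_mod M N) (quot_mod M' N')"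
proof -
 interpret Q: mod_quotient k M N by fact
 interpret Q': mod_quotient k M' N' by fact
 have "compose (carrier M) (restrict Q'.q (carrier M')) f : mod_hom k M (quot_mod M' N')"
 by (rule mod_hom_compose[OF Q.M_module f Q'.q_hom])
 from Q.ex_quot_hom[OF Q'.quot_module this]
 obtain h where h: "h : mod_hom k (quot_mod M N) (quot_mod M' N')"
 and hq: "!!a. a : carrier M ==> h (Q.q a) = Q'.q (f a)"
 using Q.N_subset iff mod_hom_closed[OF f] by (auto simp: compose_def Q'.q_eq_zero_iff subset_eq)
 have "inj_on h (carrier (quot_mod M N))"
 proof (rule inj_onI)
 fix x y assume "x : carrier (quot_mod M N)" "y : carrier (quot_mod M N)" "h x = h y"
 then obtain a b where ab: "a : carrier M" "b : carrier M" "x = Q.q a" "y = Q.q b"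
 by (auto simp: Q.carrier_quot)
 then have "f a \<ominus>\<^bsub>M'\<^esub> f b : N'" using \<open>h x = h y\<close> hq mod_hom_closed[OF f] Q'.q_eq_iff by simp
 then have "f (a \<ominus>\<^bsub>M\<^esub> b) : N'"
 using ab mod_hom_minus[OF Q.M_module Q'.M_module f] by simp
 then show "x = y" using ab iff by (simp add: Q.q_eq_iff)
 qed
 moreover have "h ` carrier (quot_mod M N) = carrier (quot_mod M' N')"
 proof
 show "h ` carrier (quot_mod M N) <= carrier (quot_mod M' N')" using mod_hom_closed[OF h] by auto
 show "carrier (quot_mod M' N') <= h ` carrier (quot_mod M N)"
 proof
 fix y assume "y : carrier (quot_mod M' N')"
 then obtain b where b: "b : carrier M'" "y = Q'.q b" by (auto simp: Q'.carrier_quot)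
 with surj obtain a where a: "a : carrier M" "b \<ominus>\<^bsub>M'\<^esub> f a : N'" by blast
 then have "y = h (Q.q a)" using b hq mod_hom_closed[OF f] Q'.q_eq_iff by auto
 then show "y : h ` carrier (quot_mod M N)" using a Q.q_closed by blast
 qed
 qed
 ultimately show ?thesis unfolding mod_isomorphic_def bij_betw_def using h by blast
qed

subsection \<open>Free modules\<close>

locale free_module =
 fixes k :: "('k, 'r) ring_scheme" and G :: "'g set"
 assumes k_cring: "cring k"
begin

sublocale k: cring k by (rule k_cring)

abbreviation Fr where "Fr \<equiv> free_mod k G"

lemma free_module: "module k Fr"
proof (rule moduleI[OF k_cring])
 have fin: "finite {g. u g \<oplus>\<^bsub>k\<^esub> v g ~= \<zero>\<^bsub>k\<^esub>}"
 if "finite {g. u g ~= \<zero>\<^bsub>k\<^esub>}" "finite {g. v g ~= \<zero>\<^bsub>k\<^esub>}" for u v :: "'g => 'k"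
 proof (rule finite_subset[OF _ finite_UnI[OF that]])
 show "{g. u g \<oplus>\<^bsub>k\<^esub> v g ~= \<zero>\<^bsub>k\<^esub>} <= {g. u g ~= \<zero>\<^bsub>k\<^esub>} \<union> {g. v g ~= \<zero>\<^bsub>k\<^esub>}" by auto
 qed
 show "abelian_group Fr"
 proof (rule abelian_groupI)
 fix x assume x: "x : carrier Fr"
 have "{g. \<ominus>\<^bsub>k\<^esub> x g ~= \<zero>\<^bsub>k\<^esub>} <= {g. x g ~= \<zero>\<^bsub>k\<^esub>}" by auto
 then have "(%g. \<ominus>\<^bsub>k\<^esub> x g) : carrier Fr" using x
 by (auto simp: free_mod_def intro: finite_subset)
 then show "EX y:carrier Fr. y \<oplus>\<^bsub>Fr\<^esub> x = \<zero>\<^bsub>Fr\<^esub>" using x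
 by (intro bexI[of _ "%g. \<ominus>\<^bsub>k\<^esub> x g"]) (auto simp: free_mod_def k.l_neg)
 qed (auto simp: free_mod_def fin k.add.m_ac)
 show "a \<odot>\<^bsub>Fr\<^esub> x : carrier Fr" if "a : carrier k" "x : carrier Fr" for a x
 proof -
 have "{g. a \<otimes>\<^bsub>k\<^esub> x g ~= \<zero>\<^bsub>k\<^esub>} <= {g. x g ~= \<zero>\<^bsub>k\<^esub>}" using that by auto
 then show ?thesis using that by (auto simp: free_mod_def intro: finite_subset)
 qed
qed (auto simp: free_mod_def k.l_distr k.r_distr k.m_assoc)

sublocale F: module k Fr by (rule free_module)

lemma free_gen_closed: "g : G ==> free_gen k g : carrier Fr"
proof -
 assume "g : G"
 have "{g'. g' = g & \<one>\<^bsub>k\<^esub> ~= \<zero>\<^bsub>k\<^esub>} <= {g}" by auto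
 then show ?thesis using \<open>g : G\<close> by (auto simp: free_mod_def free_gen_def finite_subset)
qed

lemma free_expand:
 assumes u: "u : carrier Fr"
 shows "u = (\<Oplus>\<^bsub>Fr\<^esub>g\<in>{g. u g ~= \<zero>\<^bsub>k\<^esub>}. u g \<odot>\<^bsub>Fr\<^esub> free_gen k g)"
proof -
 have *: "(\<Oplus>\<^bsub>Fr\<^esub>g\<in>S. u g \<odot>\<^bsub>Fr\<^esub> free_gen k g) g' = (if g' : S then u g' else \<zero>\<^bsub>k\<^esub>)"
 if "finite S" "S <= G" for S g'
 using that
 proof (induction S arbitrary: g' rule: finite_induct)
 case empty
 show ?case by (subst F.M.finsum_empty) (simp add: free_mod_def)
 next
 case (insert g S)
 have ug: "u g' : carrier k" for g' using u by (auto simp: free_mod_def)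
 have cl: "(%g. u g \<odot>\<^bsub>Fr\<^esub> free_gen k g) : S \<rightarrow> carrier Fr" "u g \<odot>\<^bsub>Fr\<^esub> free_gen k g : carrier Fr"
 using insert.prems by (auto intro!: F.smult_closed free_gen_closed ug)
 have "finsum Fr (%g. u g \<odot>\<^bsub>Fr\<^esub> free_gen k g) (insert g S) g'
 = (u g \<odot>\<^bsub>Fr\<^esub> free_gen k g) g' \<oplus>\<^bsub>k\<^esub> (\<Oplus>\<^bsub>Fr\<^esub>g\<in>S. u g \<odot>\<^bsub>Fr\<^esub> free_gen k g) g'"
 using insert.hyps cl by (subst F.M.finsum_insert) (auto simp: free_mod_def)
 then show ?case using insert ug by (auto simp: free_mod_def free_gen_def)
 qed
 have "finite {g. u g ~= \<zero>\<^bsub>k\<^esub>}" "{g. u g ~= \<zero>\<^bsub>k\<^esub>} <= G" using u by (auto simp: free_mod_def)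
 from *[OF this] show ?thesis by auto
qed

lemma ex_free_hom:
 fixes L :: "('k, 'b, 'n) module_scheme"
 assumes L: "module k L" and c: "!!g. g : G ==> c g : carrier L"
 shows "EX h:mod_hom k Fr L. ALL g:G. h (free_gen k g) = c g"
proof -
 interpret L: module k L by (rule L)
 define e where "e u g = (if g : G then u g \<odot>\<^bsub>L\<^esub> c g else \<zero>\<^bsub>L\<^esub>)" for u g
 define h where "h u = finsum L (e u) {g. u g ~= \<zero>\<^bsub>k\<^esub>}" for u
 have e: "e u g : carrier L" if "u : carrier Fr" for u g
 using that c by (auto simp: free_mod_def e_def)
 have sub: "h u = finsum L (e u) S" if "u : carrier Fr" "finite S" "{g. u g ~= \<zero>\<^bsub>k\<^esub>} <= S" for u S
 unfolding h_def
 proof (rule L.M.add.finprod_mono_neutral_cong_left)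
 show "!!i. i : S - {g. u g ~= \<zero>\<^bsub>k\<^esub>} ==> e u i = \<zero>\<^bsub>L\<^esub>" using c by (auto simp: e_def)
 qed (use that e in auto)
 have fin: "finite {g. u g ~= \<zero>\<^bsub>k\<^esub>}" if "u : carrier Fr" for u
 using that by (auto simp: free_mod_def)
 have "restrict h (carrier Fr) : mod_hom k Fr L"
 proof (rule mod_hom_restrictI[OF free_module])
 show "h u : carrier L" if "u : carrier Fr" for u
 unfolding h_def using e[OF that] by (intro L.M.finsum_closed) auto
 next
 fix u v assume uv: "u : carrier Fr" "v : carrier Fr"
 let ?S = "{g. u g ~= \<zero>\<^bsub>k\<^esub>} \<union> {g. v g ~= \<zero>\<^bsub>k\<^esub>}"
 have "h (u \<oplus>\<^bsub>Fr\<^esub> v) = finsum L (e (u \<oplus>\<^bsub>Fr\<^esub> v)) ?S"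
 proof (rule sub[OF F.M.a_closed[OF uv]])
 show "{g. (u \<oplus>\<^bsub>Fr\<^esub> v) g ~= \<zero>\<^bsub>k\<^esub>} <= ?S" by (auto simp: free_mod_def)
 qed (use fin uv in blast)
 also have "... = finsum L (%g. e u g \<oplus>\<^bsub>L\<^esub> e v g) ?S"
 using uv c e by (intro L.M.finsum_cong') (auto simp: free_mod_def e_def L.smult_l_distr)
 also have "... = finsum L (e u) ?S \<oplus>\<^bsub>L\<^esub> finsum L (e v) ?S"
 using e uv by (intro L.M.finsum_addf) auto
 also have "... = h u \<oplus>\<^bsub>L\<^esub> h v"
 using sub[OF uv(1), of ?S] sub[OF uv(2), of ?S] fin[OF uv(1)] fin[OF uv(2)] by simp
 finally show "h (u \<oplus>\<^bsub>Fr\<^esub> v) = h u \<oplus>\<^bsub>L\<^esub> h v" .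
 next
 fix a u assume au: "a : carrier k" "u : carrier Fr"
 let ?S = "{g. u g ~= \<zero>\<^bsub>k\<^esub>}"
 have "h (a \<odot>\<^bsub>Fr\<^esub> u) = finsum L (e (a \<odot>\<^bsub>Fr\<^esub> u)) ?S"
 proof (rule sub[OF F.smult_closed[OF au] fin[OF au(2)]])
 show "{g. (a \<odot>\<^bsub>Fr\<^esub> u) g ~= \<zero>\<^bsub>k\<^esub>} <= ?S" using au by (auto simp: free_mod_def)
 qed
 also have "... = finsum L (%g. a \<odot>\<^bsub>L\<^esub> e u g) ?S"
 using au c e by (intro L.M.finsum_cong') (auto simp: free_mod_def e_def L.smult_assoc1)
 also have "... = a \<odot>\<^bsub>L\<^esub> finsum L (e u) ?S"
 proof -
 have "restrict (%x. a \<odot>\<^bsub>L\<^esub> x) (carrier L) : mod_hom k L L"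
 using au by (intro mod_hom_restrictI[OF L])
 (auto simp: L.smult_r_distr L.smult_assoc1[symmetric] k.m_comm)
 from mod_hom_finsum[OF L L this, of "e u" ?S] show ?thesis
 using e au by (simp add: Pi_def L.M.finsum_closed cong: L.M.finsum_cong)
 qed
 finally show "h (a \<odot>\<^bsub>Fr\<^esub> u) = a \<odot>\<^bsub>L\<^esub> h u" by (simp add: h_def)
 qed
 moreover have "restrict h (carrier Fr) (free_gen k g) = c g" if "g : G" for g
 proof -
 have "h (free_gen k g) = finsum L (e (free_gen k g)) {g}"
 using that by (intro sub free_gen_closed) (auto simp: free_gen_def)
 also have "... = c g" using c that by (simp add: e_def free_gen_def)
 finally show ?thesis using free_gen_closed that by simp
 qed
 ultimately show ?thesis by blast
qed

lemma free_hom_eqI: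
 assumes L: "module k L" and f: "f : mod_hom k Fr L" and h: "h : mod_hom k Fr L"
 and eq: "!!g. g : G ==> f (free_gen k g) = h (free_gen k g)" and u: "u : carrier Fr"
 shows "f u = h u"
proof -
 interpret L: module k L by (rule L)
 let ?S = "{g. u g ~= \<zero>\<^bsub>k\<^esub>}"
 have S: "?S <= G" "!!g. u g : carrier k" using u by (auto simp: free_mod_def)
 then have cl: "(%g. u g \<odot>\<^bsub>Fr\<^esub> free_gen k g) : ?S \<rightarrow> carrier Fr"
 using free_gen_closed by auto
 have "f (finsum Fr (%g. u g \<odot>\<^bsub>Fr\<^esub> free_gen k g) ?S)
 = h (finsum Fr (%g. u g \<odot>\<^bsub>Fr\<^esub> free_gen k g) ?S)"
 unfolding mod_hom_finsum[OF free_module L f cl] mod_hom_finsum[OF free_module L h cl]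
 proof (rule L.M.finsum_cong')
 fix g assume "g : ?S"
 then have "g : G" using S by auto
 then show "f (u g \<odot>\<^bsub>Fr\<^esub> free_gen k g) = h (u g \<odot>\<^bsub>Fr\<^esub> free_gen k g)"
 using S free_gen_closed eq by (simp add: mod_hom_smult[OF f] mod_hom_smult[OF h])
 qed (use cl mod_hom_closed[OF h] in auto)
 then show ?thesis using free_expand[OF u] by simp
qed

end

section \<open>Perturbation of a deformation retract of mixed complexes\<close>

text \<open>Identities in an abelian group given by its carrier are obtained from a free abelian group, which is a
type of class \<open>ab_group_add\<close>: there the simplifier decides them.\<close>

definition additive_extension :: "('g, 'm) ring_scheme => ('i => 'g) => (('i \<Rightarrow>\<^sub>0 int) => 'g) => bool"
 where "additive_extension G f h \<longleftrightarrow> (ALL u v. h (u + v) = h u \<oplus>\<^bsub>G\<^esub> h v) \<and>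
 (ALL u. h u : carrier G) & (ALL i. h (frag_of i) = f i)"

definition frag_eval :: "('g, 'm) ring_scheme => ('i => 'g) => ('i \<Rightarrow>\<^sub>0 int) => 'g"
 where "frag_eval G f = (SOME h. additive_extension G f h)"

context abelian_group
begin

context
 fixes f :: "'i => 'a"
 assumes f: "!!i. f i : carrier G"
begin

lemma frag_eval_spec: "additive_extension G f (frag_eval G f)"
proof -
 have "f ` UNIV <= carrier (add_monoid G)" using f by auto
 then obtain h where "h : hom (free_Abelian_group UNIV) (add_monoid G)"
 "!!x. x : UNIV ==> h (frag_of x) = f x"
 by (rule comm_group.free_Abelian_group_universal[OF a_comm_group]) blast
 then have "additive_extension G f h" by (auto simp: hom_def additive_extension_def)
 then show ?thesis unfolding frag_eval_def by (rule someI[of "additive_extension G f"])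
qed

lemma frag_eval_closed [simp]: "frag_eval G f u : carrier G"
 and frag_eval_add: "frag_eval G f (u + v) = frag_eval G f u \<oplus> frag_eval G f v"
 and frag_eval_of [simp]: "frag_eval G f (frag_of i) = f i"
 using frag_eval_spec unfolding additive_extension_def by blast+

lemma frag_eval_zero [simp]: "frag_eval G f 0 = \<zero>"
 using frag_eval_add[of 0 0] by (metis add.l_cancel_one' frag_eval_closed add_0)

lemma frag_eval_neg: "frag_eval G f (- u) = \<ominus> frag_eval G f u"
 using frag_eval_add[of "- u" u] by (simp add: minus_equality)

lemma frag_eval_diff: "frag_eval G f (u - v) = frag_eval G f u \<ominus> frag_eval G f v"
 using frag_eval_add[of u "- v"] by (simp add: a_minus_def frag_eval_neg)

lemma frag_eval_sum: "frag_eval G f (sum g I) = (\<Oplus>i\<in>I. frag_eval G f (g i))"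
 by (induction I rule: infinite_finite_induct)
 (auto simp: frag_eval_add finsum_insert finsum_infinite)

end

abbreviation atom where "atom \<equiv> (%x. if x : carrier G then x else \<zero>)"

lemma ex_frag_eval: "x : carrier G ==> EX u. x = frag_eval G atom u"
 using frag_eval_of[of atom x] by (metis (no_types, lifting) zero_closed)

lemma atom_closed: "atom x : carrier G" by simp

lemmas atom_eval = frag_eval_add[OF atom_closed, symmetric] frag_eval_neg[OF atom_closed, symmetric]
 frag_eval_diff[OF atom_closed, symmetric] frag_eval_zero[OF atom_closed, symmetric]

end

lemma (in abelian_group) solve_diff:
 assumes "x : carrier G" "y : carrier G" "a = x \<ominus> y"
 shows "y = x \<ominus> a"
proof -
 obtain x' y' where e: "x = frag_eval G atom x'" "y = frag_eval G atom y'"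
 using assms(1,2)[THEN ex_frag_eval] by blast
 show ?thesis unfolding assms(3) e atom_eval by simp
qed

lemma (in abelian_group) add_solve:
 assumes "x : carrier G" "y : carrier G" "z : carrier G" "x \<oplus> y = z"
 shows "x = z \<ominus> y"
proof -
 obtain x' y' where e: "x = frag_eval G atom x'" "y = frag_eval G atom y'"
 using assms(1,2)[THEN ex_frag_eval] by blast
 show ?thesis unfolding assms(4)[symmetric] e atom_eval by simp
qed

lemma (in abelian_group) diff_diff:
 assumes "x : carrier G" "y : carrier G" "z : carrier G"
 shows "(x \<ominus> y) \<ominus> (x \<ominus> z) = \<ominus> (y \<ominus> z)"
proof -
 obtain x' y' z' where e: "x = frag_eval G atom x'" "y = frag_eval G atom y'" "z = frag_eval G atom z'"
 using assms[THEN ex_frag_eval] by blast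
 show ?thesis unfolding e atom_eval by simp
qed

lemma (in abelian_group) add_diff_add:
 assumes "x : carrier G" "y : carrier G" "z : carrier G" "w : carrier G"
 shows "(x \<ominus> y) \<oplus> (z \<ominus> w) = (x \<oplus> z) \<ominus> (y \<oplus> w)"
proof -
 obtain x' y' z' w' where e: "x = frag_eval G atom x'" "y = frag_eval G atom y'" "z = frag_eval G atom z'"
 "w = frag_eval G atom w'"
 using assms[THEN ex_frag_eval] by blast
 show ?thesis unfolding e atom_eval by (simp add: algebra_simps)
qed

lemma (in abelian_group) chain_map_identity:
 assumes "x : carrier G" "y : carrier G" "z : carrier G" "p : carrier G" "q : carrier G"
 shows "x \<ominus> (y \<ominus> z \<ominus> \<ominus> p) \<oplus> y \<ominus> (x \<oplus> z \<ominus> q) = \<ominus> (p \<ominus> q)"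
proof -
 obtain x' y' z' p' q' where e: "x = frag_eval G atom x'" "y = frag_eval G atom y'" "z = frag_eval G atom z'"
 "p = frag_eval G atom p'" "q = frag_eval G atom q'"
 using assms[THEN ex_frag_eval] by blast
 show ?thesis unfolding e atom_eval by (simp add: algebra_simps)
qed

lemma (in abelian_group) homotopy_identity:
 assumes "x : carrier G" "y : carrier G" "a : carrier G" "a' : carrier G" "m : carrier G"
 "e : carrier G" "p : carrier G" "q : carrier G" "r : carrier G"
 shows "((x \<ominus> a \<ominus> m) \<ominus> (y \<ominus> a' \<ominus> \<ominus> p)) \<oplus> y \<oplus> (m \<oplus> e \<ominus> q) \<oplus> (a \<ominus> a' \<ominus> r) \<ominus> x
 = \<ominus> (p \<oplus> q \<oplus> r \<ominus> e)"
proof -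
 obtain x' y' a1 a2 m' e' p' q' r' where e: "x = frag_eval G atom x'" "y = frag_eval G atom y'"
 "a = frag_eval G atom a1" "a' = frag_eval G atom a2" "m = frag_eval G atom m'"
 "e = frag_eval G atom e'" "p = frag_eval G atom p'" "q = frag_eval G atom q'" "r = frag_eval G atom r'"
 using assms[THEN ex_frag_eval] by blast
 show ?thesis unfolding e atom_eval by (simp add: algebra_simps)
qed

lemma (in abelian_group) add_cancel:
 assumes "x : carrier G" "y : carrier G" "z : carrier G" "x \<oplus> y = x \<oplus> z"
 shows "y = z"
proof -
 have "\<ominus> x \<oplus> (x \<oplus> y) = \<ominus> x \<oplus> (x \<oplus> z)" using assms(4) by simp
 then show ?thesis using assms(1-3) by (simp add: a_assoc[symmetric] l_neg)
qed

text \<open>Families \<open>F s \<in> X s\<close> in all degrees at once. On them \<open>b + B\<close> is a single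
map that does not truncate, so the perturbation formulas need no case distinction on the top degree.\<close>

definition fam :: "(nat => ('k, 'x) module) => ('k, nat => 'x) module"
 where "fam X =
 \<lparr>carrier = {F. ALL s. F s : carrier (X s)}, mult = undefined, one = undefined,
 ring.zero = (%s. \<zero>\<^bsub>X s\<^esub>), ring.add = (%F G s. F s \<oplus>\<^bsub>X s\<^esub> G s),
 smult = (%c F s. c \<odot>\<^bsub>X s\<^esub> F s)\<rparr>"

lemma fam_simps [simp]:
 "F : carrier (fam X) \<longleftrightarrow> (ALL s. F s : carrier (X s))"
 "\<zero>\<^bsub>fam X\<^esub> = (%s. \<zero>\<^bsub>X s\<^esub>)"
 "F \<oplus>\<^bsub>fam X\<^esub> G = (%s. F s \<oplus>\<^bsub>X s\<^esub> G s)"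
 "c \<odot>\<^bsub>fam X\<^esub> F = (%s. c \<odot>\<^bsub>X s\<^esub> F s)"
 by (simp_all add: fam_def)

lemma fam_module:
 assumes "!!s. module k (X s)" shows "module k (fam X)"
proof -
 interpret X: module k "X s" for s by fact
 have "abelian_group (fam X)"
 proof (rule abelian_groupI)
 fix F assume "F : carrier (fam X)"
 then show "EX G:carrier (fam X). G \<oplus>\<^bsub>fam X\<^esub> F = \<zero>\<^bsub>fam X\<^esub>"
 by (intro bexI[of _ "%s. \<ominus>\<^bsub>X s\<^esub> F s"]) (auto simp: X.M.l_neg)
 qed (auto simp: X.M.add.m_ac)
 then show ?thesis
 by (rule moduleI[OF X.R.cring_axioms])
 (auto simp: X.smult_l_distr X.smult_r_distr X.smult_assoc1)
qed

lemma fam_neg: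
 assumes "!!s. module k (X s)" "F : carrier (fam X)"
 shows "(\<ominus>\<^bsub>fam X\<^esub> F) s = \<ominus>\<^bsub>X s\<^esub> F s"
proof -
 interpret X: module k "X s" for s by fact
 interpret XF: module k "fam X" by (rule fam_module) fact
 have "\<ominus>\<^bsub>fam X\<^esub> F = (%s. \<ominus>\<^bsub>X s\<^esub> F s)"
 by (rule XF.M.minus_equality) (use assms(2) in \<open>auto simp: X.M.l_neg\<close>)
 then show ?thesis by simp
qed

lemma fam_minus:
 assumes "!!s. module k (X s)" "F : carrier (fam X)" "G : carrier (fam X)"
 shows "(F \<ominus>\<^bsub>fam X\<^esub> G) s = F s \<ominus>\<^bsub>X s\<^esub> G s"
 unfolding a_minus_def using fam_neg[OF assms(1,3)] by simp

text \<open>Two families agree as far as the total module of degree \<open>m\<close> can see: in the degrees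
\<open>m, m - 2, \<dots>\<close>.\<close>

definition agree :: "nat => (nat => 'z) => (nat => 'z) => bool"
 where "agree m F G \<longleftrightarrow> (ALL j. 2 * j <= m --> F (m - 2 * j) = G (m - 2 * j))"

lemma agree_self: "agree m F G ==> F m = G m"
 by (auto simp: agree_def dest: spec[of _ 0])

lemma agree_down: "agree (Suc (Suc m)) F G ==> agree m F G"
 unfolding agree_def
proof (intro allI impI)
 fix j assume *: "ALL j. 2 * j <= Suc (Suc m) --> F (Suc (Suc m) - 2 * j) = G (Suc (Suc m) - 2 * j)" "2 * j <= m"
 show "F (m - 2 * j) = G (m - 2 * j)" using *(1)[rule_format, of "Suc j"] *(2) by simp
qed

lemma agree_SucSuc:
 "agree (Suc (Suc m)) F G \<longleftrightarrow> F (Suc (Suc m)) = G (Suc (Suc m)) & agree m F G"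
proof
 assume R: "F (Suc (Suc m)) = G (Suc (Suc m)) & agree m F G"
 show "agree (Suc (Suc m)) F G" unfolding agree_def
 proof (intro allI impI)
 fix j assume "2 * j <= Suc (Suc m)"
 then show "F (Suc (Suc m) - 2 * j) = G (Suc (Suc m) - 2 * j)"
 using R by (cases j) (auto simp: agree_def)
 qed
qed (auto dest: agree_self agree_down)

lemma agree_0: "agree 0 F G \<longleftrightarrow> F 0 = G 0" and agree_1: "agree (Suc 0) F G \<longleftrightarrow> F (Suc 0) = G (Suc 0)"
proof -
 have "2 * j <= Suc 0 \<longleftrightarrow> j = 0" for j :: nat by presburger
 then show "agree 0 F G \<longleftrightarrow> F 0 = G 0" "agree (Suc 0) F G \<longleftrightarrow> F (Suc 0) = G (Suc 0)"
 by (simp_all add: agree_def)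
qed

lemma nat_induct2: "[|P 0; P (Suc 0); !!m. P m ==> P (Suc (Suc m))|] ==> P (m::nat)"
 by (rule induct_nat_012)

text \<open>A deformation retract of the Hochschild part of a mixed complex, with subsets \<open>W r j\<close> of
degree \<open>j\<close> that bound what can be reached from \<open>\<phi> r\<close>. They stay bounded
under \<open>B\<close> and \<open>h\<close> while \<open>\<psi>\<close> kills them two degrees higher.\<close>

locale mixed_retract = mixed_complex k X b B
 for k :: "('k, 'r) ring_scheme" and X :: "nat => ('k, 'x) module" and b B +
 fixes C :: "nat => ('k, 'c) module" and d :: "nat => 'c => 'c"
 and \<phi> :: "nat => 'c => 'x" and \<psi> :: "nat => 'x => 'c"
 and h :: "nat => 'x => 'x" and W :: "nat => nat => 'x set"
 assumes module_C: "module k (C r)"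
 and d_hom: "d (Suc r) : mod_hom k (C (Suc r)) (C r)"
 and phi_hom: "\<phi> r : mod_hom k (C r) (X r)"
 and psi_hom: "\<psi> r : mod_hom k (X r) (C r)"
 and h_hom: "h r : mod_hom k (X r) (X (Suc r))"
 and b_phi: "c : carrier (C (Suc r)) ==> b (Suc r) (\<phi> (Suc r) c) = \<phi> r (d (Suc r) c)"
 and psi_b: "x : carrier (X (Suc r)) ==> \<psi> r (b (Suc r) x) = d (Suc r) (\<psi> (Suc r) x)"
 and psi_phi: "c : carrier (C r) ==> \<psi> r (\<phi> r c) = c"
 and homotopy_0: "x : carrier (X 0) ==> b 1 (h 0 x) = x \<ominus>\<^bsub>X 0\<^esub> \<phi> 0 (\<psi> 0 x)"
 and homotopy_Suc: "x : carrier (X (Suc r)) ==>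
 b (Suc (Suc r)) (h (Suc r) x) \<oplus>\<^bsub>X (Suc r)\<^esub> h r (b (Suc r) x) = x \<ominus>\<^bsub>X (Suc r)\<^esub> \<phi> (Suc r) (\<psi> (Suc r) x)"
 and W_carrier: "W r j <= carrier (X j)"
 and W_minus: "[|x : W r j; y : W r j|] ==> x \<ominus>\<^bsub>X j\<^esub> y : W r j"
 and W_mono: "r <= r' ==> W r j <= W r' j"
 and phi_W: "c : carrier (C r) ==> \<phi> r c : W r r"
 and B_W: "x : W r j ==> B j x : W r (Suc j)"
 and h_W: "x : W r j ==> h j x : W r (Suc j)"
 and psi_W: "[|x : W r j; r + 2 <= j|] ==> \<psi> j x = \<zero>\<^bsub>C j\<^esub>"
begin

sublocale X: module k "X r" for r by (rule module_X)
sublocale C: module k "C r" for r by (rule module_C)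

definition D :: "nat => 'c => 'c"
 where "D r = compose (carrier (C r)) (\<psi> (r + 1)) (compose (carrier (C r)) (B r) (\<phi> r))"

lemmas closed [simp] = mod_hom_closed[OF d_hom] mod_hom_closed[OF phi_hom] mod_hom_closed[OF psi_hom]
 mod_hom_closed[OF h_hom] mod_hom_closed[OF b_hom] mod_hom_closed[OF B_hom]

lemmas zeros [simp] = mod_hom_zero[OF module_C module_C d_hom] mod_hom_zero[OF module_C module_X phi_hom]
 mod_hom_zero[OF module_X module_C psi_hom] mod_hom_zero[OF module_X module_X h_hom]
 mod_hom_zero[OF module_X module_X b_hom] mod_hom_zero[OF module_X module_X B_hom]

lemmas adds = mod_hom_add[OF d_hom] mod_hom_add[OF phi_hom] mod_hom_add[OF psi_hom]
 mod_hom_add[OF h_hom] mod_hom_add[OF b_hom] mod_hom_add[OF B_hom]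

lemmas negs = mod_hom_neg[OF module_C module_C d_hom] mod_hom_neg[OF module_C module_X phi_hom]
 mod_hom_neg[OF module_X module_C psi_hom] mod_hom_neg[OF module_X module_X h_hom]
 mod_hom_neg[OF module_X module_X b_hom] mod_hom_neg[OF module_X module_X B_hom]

lemma D_eq: "c : carrier (C r) ==> D r c = \<psi> (Suc r) (B r (\<phi> r c))"
 by (simp add: D_def compose_def)

lemma D_hom: "D r : mod_hom k (C r) (C (Suc r))"
 unfolding D_def Suc_eq_plus1[symmetric]
 by (rule mod_hom_compose[OF module_C mod_hom_compose[OF module_C phi_hom B_hom] psi_hom])

lemmas D_closed [simp] = mod_hom_closed[OF D_hom]

lemma b_B_neg: "x : carrier (X (Suc r)) ==> b (Suc (Suc r)) (B (Suc r) x) = \<ominus>\<^bsub>X (Suc r)\<^esub> B r (b (Suc r) x)"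
 using b_B[of x r] by (metis X.M.minus_equality X.M.a_comm closed(5,6))

lemma B_b_neg: "x : carrier (X (Suc r)) ==> B r (b (Suc r) x) = \<ominus>\<^bsub>X (Suc r)\<^esub> b (Suc (Suc r)) (B (Suc r) x)"
 using b_B[of x r] by (metis X.M.minus_equality closed(5,6))

lemma phi_psi_Suc: "x : carrier (X (Suc r)) ==>
 \<phi> (Suc r) (\<psi> (Suc r) x) = x \<ominus>\<^bsub>X (Suc r)\<^esub> (b (Suc (Suc r)) (h (Suc r) x) \<oplus>\<^bsub>X (Suc r)\<^esub> h r (b (Suc r) x))"
 by (rule X.M.solve_diff) (auto simp: homotopy_Suc)

lemma d_d:
 assumes c: "c : carrier (C (Suc (Suc r)))"
 shows "d (Suc r) (d (Suc (Suc r)) c) = \<zero>\<^bsub>C r\<^esub>"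
proof -
 have "d (Suc r) (d (Suc (Suc r)) c) = \<psi> r (\<phi> r (d (Suc r) (d (Suc (Suc r)) c)))"
 using c by (simp add: psi_phi)
 also have "... = \<psi> r (b (Suc r) (b (Suc (Suc r)) (\<phi> (Suc (Suc r)) c)))" using c by (simp add: b_phi)
 finally show ?thesis using c by (simp add: b_b)
qed

lemma B_phi_W: "c : carrier (C r) ==> B r (\<phi> r c) : W r (Suc r)"
 by (intro B_W phi_W)

text \<open>Inserting \<open>\<phi>\<psi> = 1 - bh - hb\<close> between the two factors of \<open>DD =
\<psi>B\<phi>\<psi>B\<phi>\<close> leaves terms that \<open>\<psi>\<close> kills, because they start with
\<open>\<phi>\<close> and have raised the degree by two.\<close>

lemma D_D:
 assumes c: "c : carrier (C r)"
 shows "D (Suc r) (D r c) = \<zero>\<^bsub>C (Suc (Suc r))\<^esub>"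
proof -
 define y where "y = B r (\<phi> r c)"
 have y: "y : carrier (X (Suc r))" "y : W r (Suc r)" using c B_phi_W by (auto simp: y_def)
 have "B (Suc (Suc r)) (h (Suc r) y) : W r (Suc (Suc (Suc r)))" using y by (intro B_W h_W)
 then have 1: "\<psi> (Suc (Suc r)) (B (Suc r) (b (Suc (Suc r)) (h (Suc r) y))) = \<zero>\<^bsub>C (Suc (Suc r))\<^esub>"
 using y psi_W[of _ r "Suc (Suc (Suc r))"] by (simp add: B_b_neg negs psi_b C.M.neg_zero)
 have 2: "\<psi> (Suc (Suc r)) (B (Suc r) (h r (b (Suc r) y))) = \<zero>\<^bsub>C (Suc (Suc r))\<^esub>"
 proof (cases r)
 case 0
 then show ?thesis using c b_B_0[of "\<phi> 0 c"] by (simp add: y_def)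
 next
 case (Suc t)
 have "B (Suc r) (h r (B t (\<phi> t (d (Suc t) c)))) : W t (Suc (Suc r))"
 using B_phi_W[of "d (Suc t) c" t] c Suc by (auto intro!: B_W h_W)
 then have "\<psi> (Suc (Suc r)) (B (Suc r) (h r (B t (\<phi> t (d (Suc t) c))))) = \<zero>\<^bsub>C (Suc (Suc r))\<^esub>"
 by (rule psi_W) (simp add: Suc)
 then show ?thesis using c Suc by (simp add: y_def b_B_neg b_phi negs C.M.neg_zero)
 qed
 have "D (Suc r) (D r c) = \<psi> (Suc (Suc r)) (B (Suc r) (\<phi> (Suc r) (\<psi> (Suc r) y)))"
 using c y by (simp add: D_eq y_def[symmetric])
 also have "... = \<zero>\<^bsub>C (Suc (Suc r))\<^esub>"
 using c y B_B[of "\<phi> r c" r]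
 by (simp add: phi_psi_Suc adds negs 1 2 C.M.neg_zero y_def[symmetric]
 a_minus_def)
 finally show ?thesis .
qed

lemma d_D_0: "c : carrier (C 0) ==> d 1 (D 0 c) = \<zero>\<^bsub>C 0\<^esub>"
 using psi_b[of "B 0 (\<phi> 0 c)" 0] b_B_0[of "\<phi> 0 c"] by (simp add: D_eq)

lemma d_D: 
 assumes "c : carrier (C (Suc r))"
 shows "D r (d (Suc r) c) \<oplus>\<^bsub>C (Suc r)\<^esub> d (Suc (Suc r)) (D (Suc r) c) = \<zero>\<^bsub>C (Suc r)\<^esub>"
proof -
 define y where "y = \<phi> (Suc r) c"
 have y: "y : carrier (X (Suc r))" using assms by (simp add: y_def)
 have "D r (d (Suc r) c) \<oplus>\<^bsub>C (Suc r)\<^esub> d (Suc (Suc r)) (D (Suc r) c)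
 = \<psi> (Suc r) (B r (b (Suc r) y)) \<oplus>\<^bsub>C (Suc r)\<^esub> \<psi> (Suc r) (b (Suc (Suc r)) (B (Suc r) y))"
 using assms y by (simp add: D_eq psi_b b_phi[symmetric] y_def)
 also have "... = \<psi> (Suc r) (B r (b (Suc r) y) \<oplus>\<^bsub>X (Suc r)\<^esub> b (Suc (Suc r)) (B (Suc r) y))"
 using y by (simp add: mod_hom_add[OF psi_hom])
 finally show ?thesis using y by (simp add: b_B)
qed

theorem mixed_complex_retract: "mixed_complex k C d D"
 by unfold_locales (auto simp: module_C d_hom D_hom d_d D_D d_D_0[simplified] d_D)

subsection \<open>Families\<close>

abbreviation XF where "XF \<equiv> fam X"
abbreviation CF where "CF \<equiv> fam C"

abbreviation carrX ("\<X>") where "\<X> \<equiv> carrier (fam X)"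
abbreviation carrC ("\<C>") where "\<C> \<equiv> carrier (fam C)"
abbreviation plusX (infixl "+\<^sub>X" 65) where "u +\<^sub>X v \<equiv> u \<oplus>\<^bsub>XF\<^esub> v"
abbreviation minusX (infixl "-\<^sub>X" 65) where "u -\<^sub>X v \<equiv> u \<ominus>\<^bsub>XF\<^esub> v"
abbreviation zeroX ("0\<^sub>X") where "0\<^sub>X \<equiv> \<zero>\<^bsub>XF\<^esub>"
abbreviation plusC (infixl "+\<^sub>C" 65) where "u +\<^sub>C v \<equiv> u \<oplus>\<^bsub>CF\<^esub> v"
abbreviation minusC (infixl "-\<^sub>C" 65) where "u -\<^sub>C v \<equiv> u \<ominus>\<^bsub>CF\<^esub> v"
abbreviation zeroC ("0\<^sub>C") where "0\<^sub>C \<equiv> \<zero>\<^bsub>CF\<^esub>"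

sublocale XF: module k XF by (rule fam_module) (rule module_X)
sublocale CF: module k CF by (rule fam_module) (rule module_C)

definition "Fb F = (%s. b (Suc s) (F (Suc s)))"
definition "FB F = (%s. case s of 0 => \<zero>\<^bsub>X 0\<^esub> | Suc t => B t (F t))"
definition "Fh F = (%s. case s of 0 => \<zero>\<^bsub>X 0\<^esub> | Suc t => h t (F t))"
definition "Fd F = (%s. d (Suc s) (F (Suc s)))"
definition "FD F = (%s. case s of 0 => \<zero>\<^bsub>C 0\<^esub> | Suc t => D t (F t))"
definition "Fphi F = (%s. \<phi> s (F s))"
definition "Fpsi F = (%s. \<psi> s (F s))"

lemma F_closed [simp]:
 "F : \<X> ==> Fb F : \<X>" "F : \<X> ==> FB F : \<X>"
 "F : \<X> ==> Fh F : \<X>" "F : \<X> ==> Fpsi F : \<C>"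
 "E : \<C> ==> Fphi E : \<X>" "E : \<C> ==> Fd E : \<C>"
 "E : \<C> ==> FD E : \<C>"
 unfolding Fb_def FB_def Fh_def Fpsi_def Fphi_def Fd_def FD_def by (auto split: nat.split)

lemma F_add:
 assumes "F : \<X>" "G : \<X>"
 shows "Fb (F +\<^sub>X G) = Fb F +\<^sub>X Fb G" "FB (F +\<^sub>X G) = FB F +\<^sub>X FB G"
 "Fh (F +\<^sub>X G) = Fh F +\<^sub>X Fh G" "Fpsi (F +\<^sub>X G) = Fpsi F +\<^sub>C Fpsi G"
 using assms unfolding Fb_def FB_def Fh_def Fpsi_def
 by (auto simp: fun_eq_iff mod_hom_add[OF b_hom] mod_hom_add[OF B_hom] mod_hom_add[OF h_hom]
 mod_hom_add[OF psi_hom] split: nat.split)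

lemma F_add_C:
 assumes "F : \<C>" "G : \<C>"
 shows "Fphi (F +\<^sub>C G) = Fphi F +\<^sub>X Fphi G" "Fd (F +\<^sub>C G) = Fd F +\<^sub>C Fd G"
 "FD (F +\<^sub>C G) = FD F +\<^sub>C FD G"
 using assms unfolding Fphi_def Fd_def FD_def
 by (auto simp: fun_eq_iff mod_hom_add[OF phi_hom] mod_hom_add[OF d_hom] mod_hom_add[OF D_hom]
 split: nat.split)

lemma F_smult:
 assumes "F : \<X>" "c : carrier k"
 shows "FB (c \<odot>\<^bsub>XF\<^esub> F) = c \<odot>\<^bsub>XF\<^esub> FB F" "Fh (c \<odot>\<^bsub>XF\<^esub> F) = c \<odot>\<^bsub>XF\<^esub> Fh F"
 using assms unfolding FB_def Fh_def
 by (auto simp: fun_eq_iff mod_hom_smult[OF B_hom] mod_hom_smult[OF h_hom] split: nat.split)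

lemma F_smult_C:
 assumes "F : \<C>" "c : carrier k"
 shows "Fphi (c \<odot>\<^bsub>CF\<^esub> F) = c \<odot>\<^bsub>XF\<^esub> Fphi F"
 using assms unfolding Fphi_def by (auto simp: mod_hom_smult[OF phi_hom])

lemma F_zero: "Fb 0\<^sub>X = 0\<^sub>X" "FB 0\<^sub>X = 0\<^sub>X" "Fh 0\<^sub>X = 0\<^sub>X" "Fpsi 0\<^sub>X = 0\<^sub>C"
 unfolding Fb_def FB_def Fh_def Fpsi_def by (auto simp: fun_eq_iff split: nat.split)

lemma additive_neg:
 assumes "abelian_group M" "abelian_group N"
 and f: "!!x. x : carrier M ==> f x : carrier N"
 "!!x y. [|x : carrier M; y : carrier M|] ==> f (x \<oplus>\<^bsub>M\<^esub> y) = f x \<oplus>\<^bsub>N\<^esub> f y"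
 and x: "x : carrier M"
 shows "f (\<ominus>\<^bsub>M\<^esub> x) = \<ominus>\<^bsub>N\<^esub> f x"
proof -
 interpret M: abelian_group M by fact
 interpret N: abelian_group N by fact
 have "f \<zero>\<^bsub>M\<^esub> \<oplus>\<^bsub>N\<^esub> f \<zero>\<^bsub>M\<^esub> = f \<zero>\<^bsub>M\<^esub>" using f(2)[of "\<zero>\<^bsub>M\<^esub>" "\<zero>\<^bsub>M\<^esub>"] by simp
 then have "f \<zero>\<^bsub>M\<^esub> = \<zero>\<^bsub>N\<^esub>" using f(1)[of "\<zero>\<^bsub>M\<^esub>"] by (metis M.zero_closed N.add.r_cancel_one')
 then have "f (\<ominus>\<^bsub>M\<^esub> x) \<oplus>\<^bsub>N\<^esub> f x = \<zero>\<^bsub>N\<^esub>" using f(2)[of "\<ominus>\<^bsub>M\<^esub> x" x] x by (simp add: M.l_neg)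
 then show ?thesis using N.minus_equality f(1) x M.a_inv_closed by metis
qed

lemma F_neg:
 assumes "F : \<X>"
 shows "Fb (\<ominus>\<^bsub>XF\<^esub> F) = \<ominus>\<^bsub>XF\<^esub> Fb F" "FB (\<ominus>\<^bsub>XF\<^esub> F) = \<ominus>\<^bsub>XF\<^esub> FB F"
 "Fh (\<ominus>\<^bsub>XF\<^esub> F) = \<ominus>\<^bsub>XF\<^esub> Fh F" "Fpsi (\<ominus>\<^bsub>XF\<^esub> F) = \<ominus>\<^bsub>CF\<^esub> Fpsi F"
 by (rule additive_neg[OF XF.M.abelian_group_axioms XF.M.abelian_group_axioms F_closed(1) F_add(1) assms], assumption+,
 rule additive_neg[OF XF.M.abelian_group_axioms XF.M.abelian_group_axioms F_closed(2) F_add(2) assms], assumption+,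
 rule additive_neg[OF XF.M.abelian_group_axioms XF.M.abelian_group_axioms F_closed(3) F_add(3) assms], assumption+,
 rule additive_neg[OF XF.M.abelian_group_axioms CF.M.abelian_group_axioms F_closed(4) F_add(4) assms], assumption+)

lemma Fphi_neg: "F : \<C> ==> Fphi (\<ominus>\<^bsub>CF\<^esub> F) = \<ominus>\<^bsub>XF\<^esub> Fphi F"
 by (rule additive_neg[where f = Fphi, OF CF.M.abelian_group_axioms XF.M.abelian_group_axioms F_closed(5) F_add_C(1)])

lemma F_diff:
 assumes "F : \<X>" "G : \<X>"
 shows "Fb (F \<ominus>\<^bsub>XF\<^esub> G) = Fb F \<ominus>\<^bsub>XF\<^esub> Fb G" "FB (F \<ominus>\<^bsub>XF\<^esub> G) = FB F \<ominus>\<^bsub>XF\<^esub> FB G"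
 "Fh (F \<ominus>\<^bsub>XF\<^esub> G) = Fh F \<ominus>\<^bsub>XF\<^esub> Fh G" "Fpsi (F \<ominus>\<^bsub>XF\<^esub> G) = Fpsi F \<ominus>\<^bsub>CF\<^esub> Fpsi G"
 unfolding a_minus_def using assms
 by (simp_all only: F_add F_neg F_closed XF.M.a_inv_closed)

lemma Fphi_diff:
 "[|F : \<C>; G : \<C>|] ==> Fphi (F \<ominus>\<^bsub>CF\<^esub> G) = Fphi F \<ominus>\<^bsub>XF\<^esub> Fphi G"
 unfolding a_minus_def by (simp only: F_add_C Fphi_neg F_closed CF.M.a_inv_closed)

lemma Fb_Fb: "F : \<X> ==> Fb (Fb F) = 0\<^sub>X"
 unfolding Fb_def by (simp add: b_b)

lemma FB_FB: "F : \<X> ==> FB (FB F) = 0\<^sub>X"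
 unfolding FB_def by (auto simp: B_B fun_eq_iff split: nat.split)

lemma Fb_FB: "F : \<X> ==> Fb (FB F) = \<ominus>\<^bsub>XF\<^esub> FB (Fb F)"
proof -
 assume F: "F : \<X>"
 have "Fb (FB F) +\<^sub>X FB (Fb F) = 0\<^sub>X"
 unfolding Fb_def FB_def using F b_B b_B_0
 by (auto simp: fun_eq_iff X.M.a_comm split: nat.split)
 then show ?thesis using F F_closed by (metis XF.M.minus_equality)
qed

lemma Fb_Fh: "F : \<X> ==> Fb (Fh F) = F \<ominus>\<^bsub>XF\<^esub> Fphi (Fpsi F) \<ominus>\<^bsub>XF\<^esub> Fh (Fb F)"
proof -
 assume F: "F : \<X>"
 have m: "(F \<ominus>\<^bsub>XF\<^esub> G) s = F s \<ominus>\<^bsub>X s\<^esub> G s" if "F : \<X>" "G : \<X>" for F G s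
 using that by (rule fam_minus[OF module_X])
 have "Fb (Fh F) +\<^sub>X Fh (Fb F) = F \<ominus>\<^bsub>XF\<^esub> Fphi (Fpsi F)"
 proof
 fix s show "(Fb (Fh F) +\<^sub>X Fh (Fb F)) s = (F \<ominus>\<^bsub>XF\<^esub> Fphi (Fpsi F)) s"
 using F homotopy_0[of "F 0"] homotopy_Suc[of "F s" "s - 1"]
 by (cases s) (simp_all add: m F_closed del: fam_simps(1), simp_all add: Fb_def Fh_def Fphi_def Fpsi_def)
 qed
 then show ?thesis using F by (rule_tac XF.M.add_solve) (simp_all del: fam_simps)
qed

lemma Fb_Fphi: "F : \<C> ==> Fb (Fphi F) = Fphi (Fd F)"
 unfolding Fb_def Fphi_def Fd_def by (simp add: b_phi)

subsection \<open>The perturbed maps\<close>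

text \<open>The solution \<open>F\<close> of \<open>F = c - h B F\<close>. As \<open>h B\<close> raises the degree by
two, it is found by recursion on the degree.\<close>

fun fixp :: "(nat => 'x) => nat => 'x" where
 "fixp c s = (if s < 2 then c s else c s \<ominus>\<^bsub>X s\<^esub> h (s - 1) (B (s - 2) (fixp c (s - 2))))"

declare fixp.simps [simp del]

lemma fixp_cases:
 "fixp c 0 = c 0" "fixp c (Suc 0) = c (Suc 0)"
 "fixp c (Suc (Suc t)) = c (Suc (Suc t)) \<ominus>\<^bsub>X (Suc (Suc t))\<^esub> h (Suc t) (B t (fixp c t))"
 by (simp_all add: fixp.simps[of c])

lemma Fh_FB: "Fh (FB F) s = (if s < 2 then \<zero>\<^bsub>X s\<^esub> else h (s - 1) (B (s - 2) (F (s - 2))))"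
proof -
 consider "s = 0" | "s = Suc 0" | t where "s = Suc (Suc t)" by (metis nat.exhaust)
 then show ?thesis by cases (auto simp: Fh_def FB_def)
qed

lemma fixp_closed:
 assumes "c : \<X>" shows "fixp c : \<X>"
proof -
 have "fixp c s : carrier (X s)" for s
 proof (induction s rule: less_induct)
 case (less s)
 consider "s = 0" | "s = Suc 0" | t where "s = Suc (Suc t)" by (metis nat.exhaust)
 then show ?case using assms less by cases (auto simp: fixp_cases)
 qed
 then show ?thesis by simp
qed

lemma fixp_eq:
 assumes "c : \<X>" shows "fixp c = c \<ominus>\<^bsub>XF\<^esub> Fh (FB (fixp c))"
proof
 fix s
 have "(c \<ominus>\<^bsub>XF\<^esub> Fh (FB (fixp c))) s = c s \<ominus>\<^bsub>X s\<^esub> Fh (FB (fixp c)) s"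
 using assms by (intro fam_minus[OF module_X]) (simp_all add: fixp_closed del: fam_simps)
 then show "fixp c s = (c \<ominus>\<^bsub>XF\<^esub> Fh (FB (fixp c))) s"
 using assms by (auto simp: Fh_FB fixp.simps[of c s] a_minus_def X.M.neg_zero)
qed

lemma nilpotent:
 assumes G: "G : \<X>" and eq: "G = \<ominus>\<^bsub>XF\<^esub> Fh (FB G)"
 shows "G = 0\<^sub>X"
proof -
 have n: "(\<ominus>\<^bsub>XF\<^esub> F) s = \<ominus>\<^bsub>X s\<^esub> F s" if "F : \<X>" for F s
 using that by (rule fam_neg[OF module_X])
 have "G s = \<zero>\<^bsub>X s\<^esub>" for s
 proof (induction s rule: less_induct)
 case (less s)
 consider "s = 0" | "s = Suc 0" | t where "s = Suc (Suc t)" by (metis nat.exhaust)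
 moreover have "G s = \<ominus>\<^bsub>X s\<^esub> Fh (FB G) s"
 by (subst eq) (rule n, use G in \<open>simp del: fam_simps\<close>)
 ultimately show ?case using less
 by cases (simp_all add: Fh_FB X.M.neg_zero)
 qed
 then show ?thesis by auto
qed

lemma fixp_unique:
 assumes "c : \<X>" "F : \<X>" "F = c \<ominus>\<^bsub>XF\<^esub> Fh (FB F)"
 shows "F = fixp c"
proof -
 have cl: "fixp c : \<X>" "Fh (FB F) : \<X>" "Fh (FB (fixp c)) : \<X>"
 using assms(1,2) fixp_closed by (auto simp del: fam_simps)
 have "F \<ominus>\<^bsub>XF\<^esub> fixp c = (c \<ominus>\<^bsub>XF\<^esub> Fh (FB F)) \<ominus>\<^bsub>XF\<^esub> (c \<ominus>\<^bsub>XF\<^esub> Fh (FB (fixp c)))"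
 using assms(3) fixp_eq[OF assms(1)] by simp
 also have "... = \<ominus>\<^bsub>XF\<^esub> (Fh (FB F) \<ominus>\<^bsub>XF\<^esub> Fh (FB (fixp c)))"
 using assms(1) cl by (intro XF.M.diff_diff)
 also have "... = \<ominus>\<^bsub>XF\<^esub> Fh (FB (F \<ominus>\<^bsub>XF\<^esub> fixp c))"
 using assms cl by (simp add: F_diff F_closed del: fam_simps)
 finally have "F \<ominus>\<^bsub>XF\<^esub> fixp c = 0\<^sub>X"
 using assms(2) cl by (intro nilpotent) (auto simp del: fam_simps)
 then show ?thesis using assms(2) cl by (simp add: XF.M.diff_zero_iff del: fam_simps)
qed

text \<open>The perturbed inclusion \<open>(1 + hB)\<^sup>-\<^sup>1 \<phi>\<close>, the perturbed homotopy \<open>(1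
+ hB)\<^sup>-\<^sup>1 h\<close> and the perturbed projection \<open>\<psi> (1 +
Bh)\<^sup>-\<^sup>1\<close>.\<close>

definition "T F = fixp (Fphi F)"
definition "H F = fixp (Fh F)"
definition "S F = Fpsi (F \<ominus>\<^bsub>XF\<^esub> FB (H F))"

lemma T_closed [simp]: "F : \<C> ==> T F : \<X>"
 and H_closed [simp]: "G : \<X> ==> H G : \<X>"
 and S_closed [simp]: "G : \<X> ==> S G : \<C>"
 unfolding T_def H_def S_def by (auto simp: fixp_closed simp del: fam_simps)

lemma T_eq: "F : \<C> ==> T F = Fphi F \<ominus>\<^bsub>XF\<^esub> Fh (FB (T F))"
 unfolding T_def by (rule fixp_eq) (simp del: fam_simps)

lemma H_eq: "F : \<X> ==> H F = Fh F \<ominus>\<^bsub>XF\<^esub> Fh (FB (H F))"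
 unfolding H_def by (rule fixp_eq) (simp del: fam_simps)

lemma T_add:
 assumes "F : \<C>" "G : \<C>"
 shows "T (F +\<^sub>C G) = T F +\<^sub>X T G"
proof -
 have "T F +\<^sub>X T G = (Fphi F \<ominus>\<^bsub>XF\<^esub> Fh (FB (T F))) +\<^sub>X (Fphi G \<ominus>\<^bsub>XF\<^esub> Fh (FB (T G)))"
 using assms T_eq by simp
 also have "... = (Fphi F +\<^sub>X Fphi G) \<ominus>\<^bsub>XF\<^esub> (Fh (FB (T F)) +\<^sub>X Fh (FB (T G)))"
 using assms by (intro XF.M.add_diff_add) (simp_all del: fam_simps)
 also have "... = Fphi (F +\<^sub>C G) \<ominus>\<^bsub>XF\<^esub> Fh (FB (T F +\<^sub>X T G))"
 using assms by (simp add: F_add F_add_C F_closed del: fam_simps)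
 finally show ?thesis
 unfolding T_def[of "F +\<^sub>C G"] using assms
 by (intro fixp_unique[symmetric]) (simp_all del: fam_simps)
qed

lemma T_smult:
 assumes "F : \<C>" "c : carrier k"
 shows "T (c \<odot>\<^bsub>CF\<^esub> F) = c \<odot>\<^bsub>XF\<^esub> T F"
proof -
 have "c \<odot>\<^bsub>XF\<^esub> T F = c \<odot>\<^bsub>XF\<^esub> (Fphi F \<ominus>\<^bsub>XF\<^esub> Fh (FB (T F)))"
 using assms T_eq by simp
 also have "... = (c \<odot>\<^bsub>XF\<^esub> Fphi F) \<ominus>\<^bsub>XF\<^esub> (c \<odot>\<^bsub>XF\<^esub> Fh (FB (T F)))"
 using assms unfolding a_minus_def
 by (simp add: XF.smult_r_distr XF.smult_r_minus del: fam_simps)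
 also have "... = Fphi (c \<odot>\<^bsub>CF\<^esub> F) \<ominus>\<^bsub>XF\<^esub> Fh (FB (c \<odot>\<^bsub>XF\<^esub> T F))"
 using assms by (simp add: F_smult F_smult_C F_closed del: fam_simps)
 finally show ?thesis
 unfolding T_def[of "c \<odot>\<^bsub>CF\<^esub> F"] using assms
 by (intro fixp_unique[symmetric]) (simp_all del: fam_simps)
qed

subsection \<open>Vanishing of the higher terms\<close>

lemma T_W:
 assumes "F : \<C>" shows "T F s : W s s"
proof (induction s rule: less_induct)
 case (less s)
 have F: "F s : carrier (C s)" using assms by simp
 consider "s = 0" | "s = Suc 0" | t where "s = Suc (Suc t)" by (metis nat.exhaust)
 then show ?case
 proof cases
 case (3 t)
 have "h (Suc t) (B t (T F t)) : W t s" using less[of t] 3 by (auto intro: h_W B_W)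
 then have "h (Suc t) (B t (T F t)) : W s s" using W_mono[of t s s] 3 by auto
 then show ?thesis using 3 W_minus[OF phi_W[OF F]] by (simp add: T_def fixp_cases Fphi_def)
 qed (use phi_W[OF F] in \<open>simp_all add: T_def fixp_cases Fphi_def\<close>)
qed

lemma H_T_W:
 assumes "F : \<C>" shows "H (T F) (Suc s) : W s (Suc s)"
proof (induction s rule: less_induct)
 case (less s)
 have hT: "h s (T F s) : W s (Suc s)" using T_W[OF assms] by (rule h_W)
 consider "s = 0" | "s = Suc 0" | t where "s = Suc (Suc t)" by (metis nat.exhaust)
 then show ?case
 proof cases
 case 2
 have "H (T F) 0 = \<zero>\<^bsub>X 0\<^esub>" by (simp add: H_def fixp_cases Fh_def)
 then show ?thesis using 2 hT assms W_carrier
 by (auto simp: H_def fixp_cases Fh_def a_minus_def X.M.neg_zero subset_eq)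
 next
 case (3 t)
 have "h s (B (Suc t) (H (T F) (Suc t))) : W t (Suc s)" using less[of t] 3 by (auto intro: h_W B_W)
 then have "h s (B (Suc t) (H (T F) (Suc t))) : W s (Suc s)" using W_mono[of t s "Suc s"] 3 by auto
 then show ?thesis using 3 W_minus[OF hT] by (simp add: H_def fixp_cases Fh_def)
 qed (use hT in \<open>simp_all add: H_def fixp_cases Fh_def\<close>)
qed

lemma psi_hB_T:
 assumes "F : \<C>" shows "Fpsi (Fh (FB (T F))) = 0\<^sub>C"
proof
 fix s
 consider "s = 0" | "s = Suc 0" | t where "s = Suc (Suc t)" by (metis nat.exhaust)
 then show "Fpsi (Fh (FB (T F))) s = 0\<^sub>C s"
 proof cases
 case (3 t)
 have "h (Suc t) (B t (T F t)) : W t s" using T_W[OF assms] 3 by (auto intro: h_W B_W)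
 then show ?thesis using psi_W[of _ t s] 3 by (simp add: Fpsi_def Fh_FB)
 qed (simp_all add: Fpsi_def Fh_FB)
qed

lemma psi_BhB_T:
 assumes "F : \<C>" shows "Fpsi (FB (Fh (FB (T F)))) = 0\<^sub>C"
proof
 fix s
 consider "s = 0" | "s = Suc 0" | "s = Suc (Suc 0)" | t where "s = Suc (Suc (Suc t))" by (metis nat.exhaust)
 then show "Fpsi (FB (Fh (FB (T F)))) s = 0\<^sub>C s"
 proof cases
 case (4 t)
 have "B (Suc (Suc t)) (h (Suc t) (B t (T F t))) : W t s" using T_W[OF assms] 4 by (auto intro: h_W B_W)
 then show ?thesis using psi_W[of _ t s] 4 by (simp add: Fpsi_def FB_def Fh_FB[unfolded FB_def])
 qed (simp_all add: Fpsi_def FB_def Fh_FB[unfolded FB_def])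
qed

lemma psi_BH_T:
 assumes "F : \<C>" shows "Fpsi (FB (H (T F))) = 0\<^sub>C"
proof
 fix s
 consider "s = 0" | "s = Suc 0" | t where "s = Suc (Suc t)" by (metis nat.exhaust)
 then show "Fpsi (FB (H (T F))) s = 0\<^sub>C s"
 proof cases
 case 2
 have "H (T F) 0 = \<zero>\<^bsub>X 0\<^esub>" by (simp add: H_def fixp_cases Fh_def)
 then show ?thesis using 2 by (simp add: Fpsi_def FB_def)
 next
 case (3 t)
 have "B (Suc t) (H (T F) (Suc t)) : W t s" using H_T_W[OF assms] 3 by (auto intro: B_W)
 then show ?thesis using psi_W[of _ t s] 3 by (simp add: Fpsi_def FB_def)
 qed (simp_all add: Fpsi_def FB_def)
qed

lemma Fpsi_Fphi: "F : \<C> ==> Fpsi (Fphi F) = F"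
 by (simp add: Fpsi_def Fphi_def psi_phi)

text \<open>The correction \<open>\<psi>BHT\<close> lives at least two degrees above its argument, hence vanishes by
the bounds \<open>W\<close>.\<close>

lemma S_T:
 assumes "F : \<C>" shows "S (T F) = F"
proof -
 have "Fpsi (T F) = Fpsi (Fphi F) \<ominus>\<^bsub>CF\<^esub> Fpsi (Fh (FB (T F)))"
 by (subst T_eq[OF assms], rule F_diff(4)) (use assms in \<open>simp_all del: fam_simps\<close>)
 then have "Fpsi (T F) = F" using assms
 by (simp add: psi_hB_T Fpsi_Fphi a_minus_def CF.M.neg_zero del: fam_simps)
 moreover have "S (T F) = Fpsi (T F) \<ominus>\<^bsub>CF\<^esub> Fpsi (FB (H (T F)))"
 unfolding S_def by (rule F_diff(4)) (use assms in \<open>simp_all del: fam_simps\<close>)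
 ultimately show ?thesis using assms
 by (simp add: psi_BH_T a_minus_def CF.M.neg_zero del: fam_simps)
qed

lemma psi_B_T:
 assumes "F : \<C>" shows "Fpsi (FB (T F)) = FD F"
proof -
 have "Fpsi (FB (T F)) = Fpsi (FB (Fphi F)) \<ominus>\<^bsub>CF\<^esub> Fpsi (FB (Fh (FB (T F))))"
 by (subst T_eq[OF assms]) (use assms in \<open>simp add: F_diff del: fam_simps\<close>)
 also have "... = Fpsi (FB (Fphi F))"
 using assms by (simp add: psi_BhB_T a_minus_def CF.M.neg_zero del: fam_simps)
 also have "... = FD F"
 using assms by (auto simp: Fpsi_def FB_def Fphi_def FD_def D_eq fun_eq_iff split: nat.split)
 finally show ?thesis .
qed

subsection \<open>Chain map and homotopy\<close>

definition "dX F = Fb F +\<^sub>X FB F"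
definition "dC F = Fd F +\<^sub>C FD F"

lemma dX_closed [simp]: "F : \<X> ==> dX F : \<X>"
 and dC_closed [simp]: "G : \<C> ==> dC G : \<C>"
 unfolding dX_def dC_def by (auto simp del: fam_simps)

text \<open>The difference of the two sides solves the homogeneous equation \<open>G = - h B G\<close>, whose only
solution is zero.\<close>

lemma dX_T:
 assumes F: "F : \<C>"
 shows "dX (T F) = T (dC F)"
proof -
 note [simp] = F
 note [simp del] = fam_simps
 define y where "y = FB (T F)"
 have y [simp]: "y : \<X>" by (simp add: y_def)
 have by': "Fb y = \<ominus>\<^bsub>XF\<^esub> FB (Fb (T F))" by (simp add: y_def Fb_FB)
 define p where "p = Fh (FB (Fb (T F)))"
 define q where "q = Fh (FB (T (dC F)))"
 have pq [simp]: "p : \<X>" "q : \<X>" by (simp_all add: p_def q_def)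
 have 1: "Fb (T F) = Fphi (Fd F) \<ominus>\<^bsub>XF\<^esub> (y \<ominus>\<^bsub>XF\<^esub> Fphi (FD F) \<ominus>\<^bsub>XF\<^esub> \<ominus>\<^bsub>XF\<^esub> p)"
 proof -
 have "Fb (T F) = Fb (Fphi F) \<ominus>\<^bsub>XF\<^esub> Fb (Fh y)"
 by (subst T_eq[OF F]) (simp add: F_diff y_def)
 then show ?thesis
 by (simp add: Fb_Fphi Fb_Fh by' F_neg p_def) (simp add: y_def psi_B_T)
 qed
 have 2: "T (dC F) = Fphi (Fd F) +\<^sub>X Fphi (FD F) \<ominus>\<^bsub>XF\<^esub> q"
 by (subst T_eq) (simp_all add: q_def dC_def F_add_C)
 define E where "E = dX (T F) \<ominus>\<^bsub>XF\<^esub> T (dC F)"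
 have "FB (dX (T F)) = FB (Fb (T F))" by (simp add: dX_def F_add FB_FB)
 then have 3: "Fh (FB E) = p \<ominus>\<^bsub>XF\<^esub> q" by (simp add: E_def F_diff p_def q_def)
 have "E = \<ominus>\<^bsub>XF\<^esub> (p \<ominus>\<^bsub>XF\<^esub> q)"
 unfolding E_def dX_def y_def[symmetric] 1 2 by (rule XF.M.chain_map_identity) simp_all
 then have "E = 0\<^sub>X" using 3 by (intro nilpotent) (simp_all add: E_def)
 then show ?thesis by (simp add: E_def XF.M.diff_zero_iff)
qed

lemma homotopy:
 assumes F: "F : \<X>"
 shows "dX (H F) +\<^sub>X H (dX F) +\<^sub>X T (S F) = F"
proof -
 note [simp] = F
 note [simp del] = fam_simps
 define y where "y = FB (H F)"
 have y [simp]: "y : \<X>" by (simp add: y_def)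
 have by': "Fb y = \<ominus>\<^bsub>XF\<^esub> FB (Fb (H F))" by (simp add: y_def Fb_FB)
 define p where "p = Fh (FB (Fb (H F)))"
 define q where "q = Fh (FB (H (dX F)))"
 define r where "r = Fh (FB (T (S F)))"
 define a where "a = Fphi (Fpsi F)"
 define a' where "a' = Fphi (Fpsi y)"
 define m where "m = Fh (Fb F)"
 define e where "e = Fh (FB F)"
 have cl [simp]: "p : \<X>" "q : \<X>" "r : \<X>" "a : \<X>" "a' : \<X>"
 "m : \<X>" "e : \<X>" by (simp_all add: p_def q_def r_def a_def a'_def m_def e_def)
 have 1: "Fb (H F) = (F \<ominus>\<^bsub>XF\<^esub> a \<ominus>\<^bsub>XF\<^esub> m) \<ominus>\<^bsub>XF\<^esub> (y \<ominus>\<^bsub>XF\<^esub> a' \<ominus>\<^bsub>XF\<^esub> \<ominus>\<^bsub>XF\<^esub> p)"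
 proof -
 have "Fb (H F) = Fb (Fh F) \<ominus>\<^bsub>XF\<^esub> Fb (Fh y)"
 by (subst H_eq[OF F]) (simp add: F_diff y_def)
 then show ?thesis
 by (simp add: Fb_Fh by' F_neg p_def a_def a'_def m_def)
 qed
 have 2: "H (dX F) = m +\<^sub>X e \<ominus>\<^bsub>XF\<^esub> q"
 by (subst H_eq) (simp_all add: q_def dX_def F_add m_def e_def)
 have 3: "T (S F) = a \<ominus>\<^bsub>XF\<^esub> a' \<ominus>\<^bsub>XF\<^esub> r"
 by (subst T_eq) (simp_all add: r_def a_def a'_def, simp add: S_def F_diff Fphi_diff y_def)
 define E where "E = dX (H F) +\<^sub>X H (dX F) +\<^sub>X T (S F) \<ominus>\<^bsub>XF\<^esub> F"
 have "FB (dX (H F)) = FB (Fb (H F))" by (simp add: dX_def F_add FB_FB)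
 then have 4: "Fh (FB E) = p +\<^sub>X q +\<^sub>X r \<ominus>\<^bsub>XF\<^esub> e"
 by (simp add: E_def F_diff F_add p_def q_def r_def e_def)
 have "E = \<ominus>\<^bsub>XF\<^esub> (p +\<^sub>X q +\<^sub>X r \<ominus>\<^bsub>XF\<^esub> e)"
 unfolding E_def dX_def[of "H F"] y_def[symmetric] 1 2 3 by (rule XF.M.homotopy_identity) simp_all
 then have "E = 0\<^sub>X" using 4 by (intro nilpotent) (simp_all add: E_def)
 then show ?thesis by (simp add: E_def XF.M.diff_zero_iff)
qed


subsection \<open>The total complexes\<close>

lemma agree_dX:
 assumes "agree (Suc m) F G" shows "agree m (dX F) (dX G)"
 using assms by (induction m rule: nat_induct2)
 (auto simp: agree_SucSuc agree_0 agree_1 dX_def Fb_def FB_def dest: agree_self)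

lemma agree_dC:
 assumes "agree (Suc m) F G" shows "agree m (dC F) (dC G)"
 using assms by (induction m rule: nat_induct2)
 (auto simp: agree_SucSuc agree_0 agree_1 dC_def Fd_def FD_def dest: agree_self)

lemma agree_fixp:
 assumes "agree m F G" shows "agree m (fixp F) (fixp G)"
 using assms by (induction m rule: nat_induct2)
 (auto simp: agree_SucSuc agree_0 agree_1 fixp_cases dest: agree_self)

lemma agree_T:
 assumes "agree m F G" shows "agree m (T F) (T G)"
 unfolding T_def by (rule agree_fixp) (use assms in \<open>auto simp: agree_def Fphi_def\<close>)

lemma agree_Fh:
 assumes "agree m F G" shows "agree (Suc m) (Fh F) (Fh G)"
 using assms by (induction m rule: nat_induct2) (auto simp: agree_SucSuc agree_0 agree_1 Fh_def dest: agree_self)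

lemma agree_H:
 assumes "agree m F G" shows "agree (Suc m) (H F) (H G)"
 unfolding H_def by (intro agree_fixp agree_Fh assms)

lemma agree_FB:
 assumes "agree m F G" shows "agree (Suc m) (FB F) (FB G)"
 using assms by (induction m rule: nat_induct2) (auto simp: agree_SucSuc agree_0 agree_1 FB_def dest: agree_self)

lemma agree_S:
 assumes "agree m F G" "F : \<X>" "G : \<X>" shows "agree m (S F) (S G)"
proof -
 have "agree m (FB (H F)) (FB (H G))"
 by (rule agree_down, rule agree_FB, rule agree_H) fact
 moreover have "(F \<ominus>\<^bsub>XF\<^esub> FB (H F)) s = F s \<ominus>\<^bsub>X s\<^esub> FB (H F) s"
 "(G \<ominus>\<^bsub>XF\<^esub> FB (H G)) s = G s \<ominus>\<^bsub>X s\<^esub> FB (H G) s" for s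
 using assms(2,3) by (auto intro!: fam_minus[OF module_X] simp del: fam_simps)
 ultimately show ?thesis using assms(1) by (simp add: agree_def S_def Fpsi_def)
qed

lemma T_zero: "T 0\<^sub>C = 0\<^sub>X"
proof -
 have "T 0\<^sub>C +\<^sub>X T 0\<^sub>C = T 0\<^sub>C" using T_add[of "0\<^sub>C" "0\<^sub>C"] CF.M.l_zero[of "0\<^sub>C"] by (metis CF.M.zero_closed)
 then show ?thesis using T_closed[of "0\<^sub>C"] by (metis XF.M.add.r_cancel_one' CF.M.zero_closed)
qed

lemma H_zero: "H 0\<^sub>X = 0\<^sub>X"
 unfolding H_def
 by (rule fixp_unique[symmetric])
 (simp_all only: F_zero XF.M.zero_closed a_minus_def XF.M.neg_zero XF.M.l_zero)

lemma S_zero: "S 0\<^sub>X = 0\<^sub>C"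
 unfolding S_def by (simp only: H_zero F_zero XF.M.zero_closed a_minus_def XF.M.neg_zero XF.M.l_zero)

lemma dX_dX: "F : \<X> ==> dX (dX F) = 0\<^sub>X"
 unfolding dX_def
 by (simp add: F_add Fb_Fb FB_FB Fb_FB XF.M.l_neg del: fam_simps)

lemma S_dX:
 assumes F: "F : \<X>" shows "S (dX F) = dC (S F)"
proof -
 note [simp] = F
 note [simp del] = fam_simps
 have dX_add: "dX (F +\<^sub>X G) = dX F +\<^sub>X dX G" if "F : \<X>" "G : \<X>" for F G
 using that unfolding dX_def by (simp add: F_add XF.M.add.m_ac)
 have "dX F = dX (dX (H F)) +\<^sub>X dX (H (dX F)) +\<^sub>X dX (T (S F))"
 by (subst homotopy[OF F, symmetric]) (simp add: dX_add)
 then have 1: "dX F = dX (H (dX F)) +\<^sub>X T (dC (S F))" by (simp add: dX_dX dX_T)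
 have "dX F = dX (H (dX F)) +\<^sub>X H (dX (dX F)) +\<^sub>X T (S (dX F))"
 by (simp add: homotopy)
 then have 2: "dX F = dX (H (dX F)) +\<^sub>X T (S (dX F))" by (simp add: dX_dX H_zero)
 have "T (dC (S F)) = T (S (dX F))"
 using 1 2 XF.M.add_cancel[of "dX (H (dX F))" "T (dC (S F))" "T (S (dX F))"] by simp
 then have "S (T (dC (S F))) = S (T (S (dX F)))" by simp
 then show ?thesis by (simp add: S_T)
qed

end

subsection \<open>Total modules as truncated families\<close>

text \<open>Elements of the total modules are truncated families; \<open>tot_hat\<close> extends by zero and
\<open>tot_cut\<close> truncates, so that statements on families descend.\<close>

definition tot_hat :: "(nat => ('k, 'x) module) => nat => (nat => 'x) => nat => 'x"
 where "tot_hat X r u = (%s. if s <= r & even (r - s) then u ((r - s) div 2) else \<zero>\<^bsub>X s\<^esub>)"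

definition tot_cut :: "nat => (nat => 'x) => nat => 'x"
 where "tot_cut r F = (\<lambda>j\<in>{..r div 2}. F (r - 2 * j))"

lemma tot_hat_cut: "agree r (tot_hat X r (tot_cut r F)) F"
 unfolding agree_def tot_hat_def tot_cut_def by auto

lemma tot_cut_eq_iff: "tot_cut r F = tot_cut r G \<longleftrightarrow> agree r F G"
proof -
 have e: "2 * j <= r \<longleftrightarrow> j <= r div 2" for j by auto
 show ?thesis unfolding tot_cut_def agree_def e
 by (auto simp: fun_eq_iff restrict_def dest: spec)
qed

context
 fixes k :: "('k, 'r) ring_scheme" and X :: "nat => ('k, 'x) module"
 assumes X: "!!s. module k (X s)"
begin

interpretation X: module k "X s" for s by (rule X)

lemma tot_hat_closed: "u : carrier (tot_mod X r) ==> tot_hat X r u : carrier (fam X)"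
proof -
 assume u: "u : carrier (tot_mod X r)"
 have "tot_hat X r u s : carrier (X s)" for s
 proof (cases "s <= r & even (r - s)")
 case True
 then have "r - 2 * ((r - s) div 2) = s" "(r - s) div 2 <= r div 2" by auto
 then show ?thesis using u True by (auto simp: tot_hat_def tot_mod_def PiE_def Pi_def dest!: spec[of _ "(r - s) div 2"])
 qed (auto simp: tot_hat_def)
 then show ?thesis by simp
qed

lemma tot_cut_closed: "F : carrier (fam X) ==> tot_cut r F : carrier (tot_mod X r)"
 unfolding tot_cut_def tot_mod_def by auto

lemma tot_cut_hat: "u : carrier (tot_mod X r) ==> tot_cut r (tot_hat X r u) = u"
 unfolding tot_cut_def tot_hat_def tot_mod_def by (fastforce simp: PiE_def extensional_def)

lemma tot_cut_add: "tot_cut r (F \<oplus>\<^bsub>fam X\<^esub> G) = tot_cut r F \<oplus>\<^bsub>tot_mod X r\<^esub> tot_cut r G"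
 unfolding tot_cut_def tot_mod_def by auto

lemma tot_cut_smult: "tot_cut r (c \<odot>\<^bsub>fam X\<^esub> F) = c \<odot>\<^bsub>tot_mod X r\<^esub> tot_cut r F"
 unfolding tot_cut_def tot_mod_def by auto

lemma tot_cut_zero: "tot_cut r \<zero>\<^bsub>fam X\<^esub> = \<zero>\<^bsub>tot_mod X r\<^esub>"
 unfolding tot_cut_def tot_mod_def by auto

lemma carrier_tot: "carrier (tot_mod X r) = tot_cut r ` carrier (fam X)"
proof
 show "carrier (tot_mod X r) <= tot_cut r ` carrier (fam X)"
 using tot_cut_hat tot_hat_closed by (metis image_eqI subsetI)
qed (use tot_cut_closed in auto)

lemma tot_module: "module k (tot_mod X r)"
 by (rule module_surj_image[where M = "fam X" and q = "tot_cut r"])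
 (simp_all only: tot_cut_add tot_cut_smult fam_module[OF X] carrier_tot tot_cut_zero)

end


lemma tot_diff_hat:
 fixes b :: "nat => 'x => 'x"
 assumes X: "!!s. module k (X s)" and b: "!!s. b (Suc s) : mod_hom k (X (Suc s)) (X s)"
 and B: "!!s. B s : mod_hom k (X s) (X (Suc s))" and u: "u : carrier (tot_mod X (Suc r))"
 shows "tot_diff X b B (Suc r) u = tot_cut r (%s. b (Suc s) (tot_hat X (Suc r) u (Suc s))
 \<oplus>\<^bsub>X s\<^esub> (case s of 0 => \<zero>\<^bsub>X 0\<^esub> | Suc t => B t (tot_hat X (Suc r) u t)))"
proof
 fix j
 interpret X: module k "X s" for s by (rule X)
 have U: "!!s. tot_hat X (Suc r) u s : carrier (X s)" using tot_hat_closed[OF X u] by simp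
 show "tot_diff X b B (Suc r) u j = tot_cut r (%s. b (Suc s) (tot_hat X (Suc r) u (Suc s))
 \<oplus>\<^bsub>X s\<^esub> (case s of 0 => \<zero>\<^bsub>X 0\<^esub> | Suc t => B t (tot_hat X (Suc r) u t))) j"
 proof (cases "j <= r div 2")
 case True
 then have j: "2 * j <= r" by auto
 then have S: "Suc r - 2 * j = Suc (r - 2 * j)" by simp
 have 1: "tot_hat X (Suc r) u (Suc (r - 2 * j)) = u j"
 using j by (auto simp: tot_hat_def)
 show ?thesis
 proof (cases "r - 2 * j")
 case 0
 then have "~ Suc j <= Suc r div 2" using j by auto
 then show ?thesis using True 1 S 0 U[of "Suc 0"] mod_hom_closed[OF b, of "u j" 0]
 by (simp add: tot_diff_def tot_cut_def)
 next
 case (Suc t)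
 then have "Suc j <= Suc r div 2" "Suc r - 2 * Suc j = t" using j by auto
 moreover have "tot_hat X (Suc r) u t = u (Suc j)"
 proof -
 have "Suc r - t = 2 * Suc j" "t <= Suc r" using j Suc by auto
 then have "(Suc r - t) div 2 = Suc j" "even (Suc r - t)" by (simp_all only: nonzero_mult_div_cancel_left) auto
 then show ?thesis using \<open>t <= Suc r\<close> unfolding tot_hat_def by simp
 qed
 ultimately show ?thesis using True 1 S Suc by (simp add: tot_diff_def tot_cut_def)
 qed
 qed (simp add: tot_diff_def tot_cut_def)
qed

context mixed_retract
begin

lemma tot_diff_X: "u : carrier (tot_mod X (Suc r)) ==>
 tot_diff X b B (Suc r) u = tot_cut r (dX (tot_hat X (Suc r) u))"
 using tot_diff_hat[of k X b B, OF module_X b_hom B_hom] by (simp add: dX_def Fb_def FB_def)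

lemma tot_diff_C: "u : carrier (tot_mod C (Suc r)) ==>
 tot_diff C d D (Suc r) u = tot_cut r (dC (tot_hat C (Suc r) u))"
 using tot_diff_hat[of k C d D, OF module_C d_hom D_hom] by (simp add: dC_def Fd_def FD_def)

lemma tot_diff_X_cut:
 assumes "F : \<X>" shows "tot_diff X b B (Suc r) (tot_cut (Suc r) F) = tot_cut r (dX F)"
 using tot_diff_X[OF tot_cut_closed[of k X, OF module_X assms]]
 by (simp add: tot_cut_eq_iff agree_dX tot_hat_cut)

lemma tot_diff_C_cut:
 assumes "F : \<C>" shows "tot_diff C d D (Suc r) (tot_cut (Suc r) F) = tot_cut r (dC F)"
 using tot_diff_C[OF tot_cut_closed[of k C, OF module_C assms]]
 by (simp add: tot_cut_eq_iff agree_dC tot_hat_cut)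

end

text \<open>Homology of a sequence of modules with a degree lowering map.\<close>

lemma homology_quotient:
 fixes M :: "nat => ('k, 'x) module" and r :: nat
 assumes M: "!!s. module k (M s)"
 and cl: "!!s u. u : carrier (M (Suc s)) ==> D (Suc s) u : carrier (M s)"
 and add: "!!s u v. [|u : carrier (M (Suc s)); v : carrier (M (Suc s))|] ==>
 D (Suc s) (u \<oplus>\<^bsub>M (Suc s)\<^esub> v) = D (Suc s) u \<oplus>\<^bsub>M s\<^esub> D (Suc s) v"
 and smult: "!!s c u. [|c : carrier k; u : carrier (M (Suc s))|] ==>
 D (Suc s) (c \<odot>\<^bsub>M (Suc s)\<^esub> u) = c \<odot>\<^bsub>M s\<^esub> D (Suc s) u"
 and DD: "!!s u. u : carrier (M (Suc (Suc s))) ==> D (Suc s) (D (Suc (Suc s)) u) = \<zero>\<^bsub>M s\<^esub>"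
 shows "mod_quotient k (M r\<lparr>carrier := {u : carrier (M r). r = 0 \<or> D r u = \<zero>\<^bsub>M (r - 1)\<^esub>}\<rparr>)
 (D (r + 1) ` carrier (M (r + 1)))"
proof -
 define Z where "Z = {u : carrier (M r). r = 0 \<or> D r u = \<zero>\<^bsub>M (r - 1)\<^esub>}"
 interpret M: module k "M s" for s by (rule M)
 have hom: "restrict (D (Suc s)) (carrier (M (Suc s))) : mod_hom k (M (Suc s)) (M s)" for s
 by (rule mod_hom_restrictI[OF M cl add smult])
 have zero: "D (Suc s) \<zero>\<^bsub>M (Suc s)\<^esub> = \<zero>\<^bsub>M s\<^esub>" for s
 using mod_hom_zero[OF M M hom[of s]] by simp
 have Z: "submodule Z k (M r)"
 proof (cases r)
 case 0
 then have "Z = carrier (M r)" by (simp add: Z_def)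
 then show ?thesis using submodule_carrier[OF M, of r] by simp
 next
 case (Suc t)
 show ?thesis unfolding Z_def by (intro submoduleI[OF M]) (auto simp: Suc zero add smult)
 qed
 have mZ: "module k (M r\<lparr>carrier := Z\<rparr>)"
 by (rule submodule.submodule_is_module[OF Z M])
 have im: "u : carrier (M (Suc r)) ==> D (Suc r) u : Z" for u
 by (cases r) (auto simp: Z_def cl DD)
 have "submodule (D (Suc r) ` carrier (M (Suc r))) k (M r\<lparr>carrier := Z\<rparr>)"
 proof (intro submoduleI[OF mZ])
 show "\<zero>\<^bsub>M r\<lparr>carrier := Z\<rparr>\<^esub> : D (Suc r) ` carrier (M (Suc r))"
 using zero[of r, symmetric] by (simp add: image_eqI)
 next
 fix x y assume "x : D (Suc r) ` carrier (M (Suc r))" "y : D (Suc r) ` carrier (M (Suc r))"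
 then show "x \<oplus>\<^bsub>M r\<lparr>carrier := Z\<rparr>\<^esub> y : D (Suc r) ` carrier (M (Suc r))"
 by (auto simp: add[symmetric])
 next
 fix c x assume "c : carrier k" "x : D (Suc r) ` carrier (M (Suc r))"
 then show "c \<odot>\<^bsub>M r\<lparr>carrier := Z\<rparr>\<^esub> x : D (Suc r) ` carrier (M (Suc r))"
 by (auto simp: smult[symmetric])
 qed (use im in auto)
 with mZ show ?thesis unfolding mod_quotient_def Z_def[symmetric] Suc_eq_plus1 by blast
qed

context mixed_retract
begin

lemma F_minus_X:
 assumes "F : \<X>" "G : \<X>"
 shows "tot_cut r (F \<ominus>\<^bsub>XF\<^esub> G) = tot_cut r F \<ominus>\<^bsub>tot_mod X r\<^esub> tot_cut r G"
proof -
 have h: "restrict (tot_cut r) (\<X>) : mod_hom k XF (tot_mod X r)"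
 by (rule mod_hom_restrictI[OF XF.module_axioms])
 (simp_all only: tot_cut_add[of k X, OF module_X] tot_cut_smult[of k X, OF module_X] tot_cut_closed[of k X, OF module_X])
 have "F \<ominus>\<^bsub>XF\<^esub> G : \<X>" using assms by (simp del: fam_simps)
 then show ?thesis
 using mod_hom_minus[OF XF.module_axioms tot_module[of k X, OF module_X] h assms] assms
 by (simp del: fam_simps)
qed

lemma dX_add: "[|F : \<X>; G : \<X>|] ==> dX (F +\<^sub>X G) = dX F +\<^sub>X dX G"
 unfolding dX_def by (simp add: F_add XF.M.add.m_ac del: fam_simps)

lemma dC_add: "[|F : \<C>; G : \<C>|] ==> dC (F +\<^sub>C G) = dC F +\<^sub>C dC G"
 unfolding dC_def by (simp add: F_add_C CF.M.add.m_ac del: fam_simps)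

lemma dX_smult: "[|F : \<X>; c : carrier k|] ==> dX (c \<odot>\<^bsub>XF\<^esub> F) = c \<odot>\<^bsub>XF\<^esub> dX F"
 unfolding dX_def Fb_def FB_def
 by (auto simp: fun_eq_iff mod_hom_smult[OF B_hom] mod_hom_smult[OF b_hom] X.smult_r_distr split: nat.split)

lemma dC_smult: "[|F : \<C>; c : carrier k|] ==> dC (c \<odot>\<^bsub>CF\<^esub> F) = c \<odot>\<^bsub>CF\<^esub> dC F"
 unfolding dC_def Fd_def FD_def
 by (auto simp: fun_eq_iff mod_hom_smult[OF D_hom] mod_hom_smult[OF d_hom] C.smult_r_distr split: nat.split)

lemma dC_dC: "F : \<C> ==> dC (dC F) = 0\<^sub>C"
proof -
 assume F: "F : \<C>"
 have "T (dC (dC F)) = 0\<^sub>X" using F by (simp add: dX_T[symmetric] dX_dX del: fam_simps)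
 then have "S (T (dC (dC F))) = 0\<^sub>C" using S_zero by metis
 then show ?thesis using F by (simp add: S_T del: fam_simps)
qed

lemma tot_quotient_X:
 "mod_quotient k (tot_mod X r\<lparr>carrier := {u : carrier (tot_mod X r). r = 0 \<or> tot_diff X b B r u = \<zero>\<^bsub>tot_mod X (r - 1)\<^esub>}\<rparr>)
 (tot_diff X b B (r + 1) ` carrier (tot_mod X (r + 1)))"
proof (rule homology_quotient)
 note tX = carrier_tot[of k X, OF module_X]
 show "module k (tot_mod X r)" for r by (rule tot_module[of k X, OF module_X])
 show "tot_diff X b B (Suc r) u : carrier (tot_mod X r)" if "u : carrier (tot_mod X (Suc r))" for r u
 using that by (auto simp: tX tot_diff_X_cut simp del: fam_simps)
 show "tot_diff X b B (Suc r) (u \<oplus>\<^bsub>tot_mod X (Suc r)\<^esub> v) = tot_diff X b B (Suc r) u \<oplus>\<^bsub>tot_mod X r\<^esub> tot_diff X b B (Suc r) v"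
 if "u : carrier (tot_mod X (Suc r))" "v : carrier (tot_mod X (Suc r))" for r u v
 using that by (auto simp: tX tot_diff_X_cut dX_add tot_cut_add[of k X, OF module_X, symmetric] simp del: fam_simps)
 show "tot_diff X b B (Suc r) (c \<odot>\<^bsub>tot_mod X (Suc r)\<^esub> u) = c \<odot>\<^bsub>tot_mod X r\<^esub> tot_diff X b B (Suc r) u"
 if "c : carrier k" "u : carrier (tot_mod X (Suc r))" for r c u
 using that by (auto simp: tX tot_diff_X_cut dX_smult tot_cut_smult[of k X, OF module_X, symmetric] simp del: fam_simps)
 show "tot_diff X b B (Suc r) (tot_diff X b B (Suc (Suc r)) u) = \<zero>\<^bsub>tot_mod X r\<^esub>"
 if "u : carrier (tot_mod X (Suc (Suc r)))" for r u
 using that by (auto simp: tX tot_diff_X_cut dX_dX tot_cut_zero[of k X, OF module_X, symmetric] simp del: fam_simps)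
qed

lemma tot_quotient_C:
 "mod_quotient k (tot_mod C r\<lparr>carrier := {u : carrier (tot_mod C r). r = 0 \<or> tot_diff C d D r u = \<zero>\<^bsub>tot_mod C (r - 1)\<^esub>}\<rparr>)
 (tot_diff C d D (r + 1) ` carrier (tot_mod C (r + 1)))"
proof (rule homology_quotient)
 note tX = carrier_tot[of k C, OF module_C]
 show "module k (tot_mod C r)" for r by (rule tot_module[of k C, OF module_C])
 show "tot_diff C d D (Suc r) u : carrier (tot_mod C r)" if "u : carrier (tot_mod C (Suc r))" for r u
 using that by (auto simp: tX tot_diff_C_cut simp del: fam_simps)
 show "tot_diff C d D (Suc r) (u \<oplus>\<^bsub>tot_mod C (Suc r)\<^esub> v) = tot_diff C d D (Suc r) u \<oplus>\<^bsub>tot_mod C r\<^esub> tot_diff C d D (Suc r) v"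
 if "u : carrier (tot_mod C (Suc r))" "v : carrier (tot_mod C (Suc r))" for r u v
 using that by (auto simp: tX tot_diff_C_cut dC_add tot_cut_add[of k C, OF module_C, symmetric] simp del: fam_simps)
 show "tot_diff C d D (Suc r) (c \<odot>\<^bsub>tot_mod C (Suc r)\<^esub> u) = c \<odot>\<^bsub>tot_mod C r\<^esub> tot_diff C d D (Suc r) u"
 if "c : carrier k" "u : carrier (tot_mod C (Suc r))" for r c u
 using that by (auto simp: tX tot_diff_C_cut dC_smult tot_cut_smult[of k C, OF module_C, symmetric] simp del: fam_simps)
 show "tot_diff C d D (Suc r) (tot_diff C d D (Suc (Suc r)) u) = \<zero>\<^bsub>tot_mod C r\<^esub>"
 if "u : carrier (tot_mod C (Suc (Suc r)))" for r u
 using that by (auto simp: tX tot_diff_C_cut dC_dC tot_cut_zero[of k C, OF module_C, symmetric] simp del: fam_simps)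
qed

text \<open>The map \<open>T\<close> induces the isomorphism: \<open>S T\<close> is the identity, and \<open>1 - T
S\<close> is the boundary of \<open>H\<close> on cycles.\<close>

theorem cyclic_homology_retract:
 "mod_isomorphic k (cyclic_homology C d D r) (cyclic_homology X b B r)"
proof -
 define ZC where "ZC = {u : carrier (tot_mod C r). r = 0 \<or> tot_diff C d D r u = \<zero>\<^bsub>tot_mod C (r - 1)\<^esub>}"
 define ZX where "ZX = {u : carrier (tot_mod X r). r = 0 \<or> tot_diff X b B r u = \<zero>\<^bsub>tot_mod X (r - 1)\<^esub>}"
 note carrC = carrier_tot[of k C, OF module_C] and carrX = carrier_tot[of k X, OF module_X]
 interpret QC: mod_quotient k "tot_mod C r\<lparr>carrier := ZC\<rparr>" "tot_diff C d D (r + 1) ` carrier (tot_mod C (r + 1))"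
 by (rule tot_quotient_C[of r, folded ZC_def])
 define f where "f = restrict (%v. tot_cut r (T (tot_hat C r v))) ZC"
 have cycC: "tot_cut r F : ZC \<longleftrightarrow> (ALL m. r = Suc m --> agree m (dC F) 0\<^sub>C)" if "F : \<C>" for F
 using that by (cases r) (auto simp: ZC_def ZX_def tot_cut_closed[of k C, OF module_C] tot_diff_C_cut
 tot_cut_zero[of k C, OF module_C, symmetric] tot_cut_eq_iff simp del: fam_simps)
 have cycX: "tot_cut r F : ZX \<longleftrightarrow> (ALL m. r = Suc m --> agree m (dX F) 0\<^sub>X)" if "F : \<X>" for F
 using that by (cases r) (auto simp: ZC_def ZX_def tot_cut_closed[of k X, OF module_X] tot_diff_X_cut
 tot_cut_zero[of k X, OF module_X, symmetric] tot_cut_eq_iff simp del: fam_simps)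
 have f_cut: "f (tot_cut r F) = tot_cut r (T F)" if "F : \<C>" "tot_cut r F : ZC" for F
 using that by (simp add: f_def tot_cut_eq_iff agree_T tot_hat_cut del: fam_simps)
 have f_Z: "tot_cut r (T F) : ZX" if F: "F : \<C>" "tot_cut r F : ZC" for F
 proof -
 have "agree m (dX (T F)) 0\<^sub>X" if "r = Suc m" for m
 proof -
 have "agree m (dC F) 0\<^sub>C" using cycC[OF F(1)] F(2) that by blast
 then have "agree m (T (dC F)) (T 0\<^sub>C)" by (rule agree_T)
 then show ?thesis using F(1) by (simp only: dX_T T_zero)
 qed
 then show ?thesis using F(1) by (subst cycX) (auto simp del: fam_simps)
 qed
 have rep: "EX F : \<C>. u = tot_cut r F" if "u : ZC" for u
 using that by (auto simp: ZC_def carrC simp del: fam_simps)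
 show ?thesis unfolding cyclic_homology_def homology_def ZC_def[symmetric] ZX_def[symmetric]
 proof (rule mod_isomorphic_quot[OF tot_quotient_C[of r, folded ZC_def] tot_quotient_X[of r, folded ZX_def]])
 have ZC: "tot_cut r (F +\<^sub>C G) : ZC" if "tot_cut r F : ZC" "tot_cut r G : ZC" for F G
 using QC.M.M.a_closed[of "tot_cut r F" "tot_cut r G"] that by (simp add: tot_cut_add[of k C, OF module_C] del: fam_simps)
 have ZC': "tot_cut r (c \<odot>\<^bsub>CF\<^esub> F) : ZC" if "tot_cut r F : ZC" "c : carrier k" for c F
 using QC.M.smult_closed[of c "tot_cut r F"] that by (simp add: tot_cut_smult[of k C, OF module_C] del: fam_simps)
 show "f : mod_hom k (tot_mod C r\<lparr>carrier := ZC\<rparr>) (tot_mod X r\<lparr>carrier := ZX\<rparr>)"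
 proof (rule mod_homI)
 fix u assume "u : carrier (tot_mod C r\<lparr>carrier := ZC\<rparr>)"
 then show "f u : carrier (tot_mod X r\<lparr>carrier := ZX\<rparr>)"
 using rep[of u] f_cut f_Z by (auto simp del: fam_simps)
 next
 fix u v assume "u : carrier (tot_mod C r\<lparr>carrier := ZC\<rparr>)" "v : carrier (tot_mod C r\<lparr>carrier := ZC\<rparr>)"
 then have Z: "u : ZC" "v : ZC" by simp_all
 from rep[OF Z(1)] obtain F where F: "F : \<C>" "u = tot_cut r F" by blast
 from rep[OF Z(2)] obtain G where G: "G : \<C>" "v = tot_cut r G" by blast
 note FG = F G
 have "f (tot_cut r (F +\<^sub>C G)) = tot_cut r (T (F +\<^sub>C G))"
 using FG Z by (intro f_cut ZC CF.M.a_closed) simp_all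
 then show "f (u \<oplus>\<^bsub>tot_mod C r\<lparr>carrier := ZC\<rparr>\<^esub> v) = f u \<oplus>\<^bsub>tot_mod X r\<lparr>carrier := ZX\<rparr>\<^esub> f v"
 using f_cut[of F] f_cut[of G] Z FG by (simp add: tot_cut_add[of k C, OF module_C] tot_cut_add[of k X, OF module_X] T_add del: fam_simps)
 next
 fix c u assume "c : carrier k" "u : carrier (tot_mod C r\<lparr>carrier := ZC\<rparr>)"
 then have Z: "c : carrier k" "u : ZC" by simp_all
 from rep[OF Z(2)] obtain F where FG: "F : \<C>" "u = tot_cut r F" by blast
 have "f (tot_cut r (c \<odot>\<^bsub>CF\<^esub> F)) = tot_cut r (T (c \<odot>\<^bsub>CF\<^esub> F))"
 using FG Z by (intro f_cut ZC' CF.smult_closed) simp_all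
 then show "f (c \<odot>\<^bsub>tot_mod C r\<lparr>carrier := ZC\<rparr>\<^esub> u) = c \<odot>\<^bsub>tot_mod X r\<lparr>carrier := ZX\<rparr>\<^esub> f u"
 using f_cut[of F] Z FG by (simp add: tot_cut_smult[of k C, OF module_C] tot_cut_smult[of k X, OF module_X] T_smult del: fam_simps)
 qed (simp add: f_def)
 next
 fix u assume "u : carrier (tot_mod C r\<lparr>carrier := ZC\<rparr>)"
 then obtain F where F: "F : \<C>" "u = tot_cut r F" "tot_cut r F : ZC"
 using rep[of u] by auto
 show "f u : tot_diff X b B (r + 1) ` carrier (tot_mod X (r + 1)) \<longleftrightarrow>
 u : tot_diff C d D (r + 1) ` carrier (tot_mod C (r + 1))"
 proof
 assume "f u : tot_diff X b B (r + 1) ` carrier (tot_mod X (r + 1))"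
 then obtain G where G: "G : \<X>" "tot_cut r (T F) = tot_cut r (dX G)"
 using F f_cut by (auto simp: carrX tot_diff_X_cut simp del: fam_simps)
 then have "agree r (S (T F)) (S (dX G))"
 using F by (intro agree_S) (auto simp: tot_cut_eq_iff simp del: fam_simps)
 then have "u = tot_diff C d D (Suc r) (tot_cut (Suc r) (S G))"
 using F G by (simp add: S_T S_dX tot_diff_C_cut tot_cut_eq_iff del: fam_simps)
 then show "u : tot_diff C d D (r + 1) ` carrier (tot_mod C (r + 1))"
 using G by (auto intro!: imageI tot_cut_closed[of k C, OF module_C] simp del: fam_simps)
 next
 assume "u : tot_diff C d D (r + 1) ` carrier (tot_mod C (r + 1))"
 then obtain G where G: "G : \<C>" "tot_cut r F = tot_cut r (dC G)"
 using F by (auto simp: carrC tot_diff_C_cut simp del: fam_simps)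
 then have "agree r (T F) (T (dC G))" by (intro agree_T) (auto simp: tot_cut_eq_iff)
 then have "f u = tot_diff X b B (Suc r) (tot_cut (Suc r) (T G))"
 using F G f_cut by (simp add: dX_T tot_diff_X_cut tot_cut_eq_iff del: fam_simps)
 then show "f u : tot_diff X b B (r + 1) ` carrier (tot_mod X (r + 1))"
 using G by (auto intro!: imageI tot_cut_closed[of k X, OF module_X] simp del: fam_simps)
 qed
 next
 fix z assume "z : carrier (tot_mod X r\<lparr>carrier := ZX\<rparr>)"
 then obtain F where F: "F : \<X>" "z = tot_cut r F" "tot_cut r F : ZX"
 by (auto simp: ZX_def carrX simp del: fam_simps)
 have cyc: "agree m (dX F) 0\<^sub>X" if "r = Suc m" for m
 using cycX[OF F(1)] F(3) that by blast
 have 1: "tot_cut r (S F) : ZC"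
 proof -
 have "agree m (dC (S F)) 0\<^sub>C" if "r = Suc m" for m
 proof -
 have "agree m (S (dX F)) (S 0\<^sub>X)"
 by (rule agree_S[OF cyc[OF that]]) (use F in \<open>auto simp del: fam_simps\<close>)
 then show ?thesis using F(1) by (simp only: S_dX S_zero)
 qed
 then show ?thesis using F(1) by (subst cycC) (auto simp del: fam_simps)
 qed
 have 2: "agree r (H (dX F)) 0\<^sub>X"
 proof (cases r)
 case 0
 then show ?thesis by (simp add: agree_0 H_def fixp_cases Fh_def)
 next
 case (Suc m)
 then show ?thesis using agree_H[OF cyc[OF Suc]] by (simp only: H_zero)
 qed
 have "F = dX (H F) +\<^sub>X H (dX F) +\<^sub>X T (S F)" using homotopy[OF F(1)] by simp
 then have "F \<ominus>\<^bsub>XF\<^esub> T (S F) = dX (H F) +\<^sub>X H (dX F)"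
 using F(1) by (intro XF.M.add_solve[symmetric]) (simp_all del: fam_simps)
 moreover have "agree r (dX (H F) +\<^sub>X H (dX F)) (dX (H F))"
 proof -
 have "dX (H F) : \<X>" using F(1) by (simp del: fam_simps)
 then show ?thesis using 2 by (simp add: agree_def)
 qed
 ultimately have "tot_cut r F \<ominus>\<^bsub>tot_mod X r\<^esub> tot_cut r (T (S F)) = tot_diff X b B (Suc r) (tot_cut (Suc r) (H F))"
 using F(1) by (simp add: F_minus_X[symmetric] tot_diff_X_cut tot_cut_eq_iff del: fam_simps)
 moreover have "a \<ominus>\<^bsub>tot_mod X r\<lparr>carrier := ZX\<rparr>\<^esub> c = a \<ominus>\<^bsub>tot_mod X r\<^esub> c" if "a : ZX" "c : ZX" for a c
 proof -
 interpret Q: mod_quotient k "tot_mod X r\<lparr>carrier := ZX\<rparr>" "tot_diff X b B (r + 1) ` carrier (tot_mod X (r + 1))"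
 by (rule tot_quotient_X[of r, folded ZX_def])
 interpret tX: module k "tot_mod X r" by (rule tot_module[of k X, OF module_X])
 have n: "\<ominus>\<^bsub>tot_mod X r\<lparr>carrier := ZX\<rparr>\<^esub> c : ZX" using Q.M.M.a_inv_closed[of c] that by simp
 have "\<ominus>\<^bsub>tot_mod X r\<^esub> c = \<ominus>\<^bsub>tot_mod X r\<lparr>carrier := ZX\<rparr>\<^esub> c"
 proof (rule tX.M.minus_equality)
 show "\<ominus>\<^bsub>tot_mod X r\<lparr>carrier := ZX\<rparr>\<^esub> c \<oplus>\<^bsub>tot_mod X r\<^esub> c = \<zero>\<^bsub>tot_mod X r\<^esub>"
 using Q.M.M.l_neg[of c] that by simp
 qed (use that n in \<open>auto simp: ZX_def\<close>)
 then show ?thesis by (simp add: a_minus_def)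
 qed
 ultimately have "z \<ominus>\<^bsub>tot_mod X r\<lparr>carrier := ZX\<rparr>\<^esub> f (tot_cut r (S F)) : tot_diff X b B (r + 1) ` carrier (tot_mod X (r + 1))"
 using F f_cut[OF S_closed[OF F(1)] 1] f_Z[OF S_closed[OF F(1)] 1]
 by (auto intro!: imageI tot_cut_closed[of k X, OF module_X] simp del: fam_simps)
 then show "EX a:carrier (tot_mod C r\<lparr>carrier := ZC\<rparr>). z \<ominus>\<^bsub>tot_mod X r\<lparr>carrier := ZX\<rparr>\<^esub> f a
 : tot_diff X b B (r + 1) ` carrier (tot_mod X (r + 1))"
 using 1 by auto
 qed
qed

end

section \<open>The normalized mixed complex\<close>

locale relative_algebra = relative_algebra_data k K \<iota> A
 for k :: "('k, 'r) ring_scheme" and K :: "('k, 'a, 'm) module_scheme"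
 and \<iota> :: "'a => 'x" and A :: "('k, 'x) module" (structure) +
 assumes k_cring: "cring k" and A_algebra: "assoc_algebra k A"
 and K_algebra: "assoc_algebra k K" and iota_hom: "\<iota> : alg_hom k K A"
begin

abbreviation carr_A ("\<A>") where "\<A> \<equiv> carrier A"
abbreviation carr_K ("\<K>") where "\<K> \<equiv> carrier K"
abbreviation "\<N> \<equiv> norm_mod"
abbreviation mult_A (infixl "**" 70) where "a ** b \<equiv> a \<otimes> b"

sublocale k: cring k by (rule k_cring)
sublocale A: assoc_algebra k A by (rule A_algebra)
sublocale K: assoc_algebra k K by (rule K_algebra)
sublocale Fr: free_module k "tens_gens r" for r by (rule free_module.intro[OF k_cring])

lemma iota_closed [simp]: "c : \<K> ==> \<iota> c : \<A>"
 and iota_mult: "[|c : \<K>; c' : \<K>|] ==> \<iota> (c \<otimes>\<^bsub>K\<^esub> c') = \<iota> c ** \<iota> c'"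
 and iota_add: "[|c : \<K>; c' : \<K>|] ==> \<iota> (c \<oplus>\<^bsub>K\<^esub> c') = \<iota> c \<oplus> \<iota> c'"
 and iota_one [simp]: "\<iota> \<one>\<^bsub>K\<^esub> = \<one>"
 and iota_smult: "[|e : carrier k; c : \<K>|] ==> \<iota> (e \<odot>\<^bsub>K\<^esub> c) = e \<odot> \<iota> c"
 using iota_hom by (auto simp: alg_hom_def ring_hom_def)

lemma tens_gens_update: "[|l : tens_gens r; a : \<A>|] ==> l[i := a] : tens_gens r"
 by (auto simp: tens_gens_def dest!: set_update_subset_insert[THEN subsetD])

lemma tens_gens_nth: "[|l : tens_gens r; i <= r|] ==> l ! i : \<A>"
 by (auto simp: tens_gens_def subset_eq)

lemma tens_gens_length: "l : tens_gens r ==> length l = Suc r"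
 by (auto simp: tens_gens_def)

lemma tens_gensI: "[|length l = Suc r; !!i. i <= r ==> l ! i : \<A>|] ==> l : tens_gens r"
 by (auto simp: tens_gens_def in_set_conv_nth)

lemma tens_rels_carrier: "tens_rels r <= carrier (tens_free r)"
 unfolding tens_rels_def
 by (auto intro!: Fr.F.M.minus_closed Fr.F.M.a_closed Fr.F.smult_closed Fr.free_gen_closed tens_gens_update
 A.M.a_closed A.smult_closed A.m_closed tens_gens_nth)

sublocale N: mod_quotient k "tens_free r" "tens_ker r" for r
 unfolding tens_ker_def
 by (intro mod_quotient.intro Fr.free_module mod_span_submodule tens_rels_carrier)

lemma norm_module: "module k (\<N> r)"
 unfolding norm_mod_def by (rule N.quot_module)

sublocale NM: module k "\<N> r" for r by (rule norm_module)

abbreviation cl where "cl \<equiv> tens_class"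

lemma cl_closed [simp]: "l : tens_gens r ==> cl r l : carrier (\<N> r)"
 unfolding tens_class_def norm_mod_def by (intro N.q_closed Fr.free_gen_closed)

text \<open>Position of the right neighbour in the cyclic order; it merges the two balancing relations into one.\<close>

definition nx :: "nat => nat => nat" where "nx r i = (if i = r then 0 else Suc i)"

definition multilinear :: "nat => ('x list => 'y) => ('k, 'y, 'q) module_scheme => bool"
 where "multilinear r F L \<longleftrightarrow>
 (ALL l:tens_gens r. F l : carrier L) \<and>
 (ALL l:tens_gens r. ALL i<=r. ALL a:\<A>. ALL a':\<A>.
 F (l[i := a \<oplus> a']) = F (l[i := a]) \<oplus>\<^bsub>L\<^esub> F (l[i := a'])) \<and>
 (ALL l:tens_gens r. ALL i<=r. ALL c:carrier k. ALL a:\<A>.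
 F (l[i := c \<odot> a]) = c \<odot>\<^bsub>L\<^esub> F (l[i := a])) \<and>
 (ALL l:tens_gens r. ALL i<=r. ALL c:\<K>.
 F (l[i := l ! i ** \<iota> c]) = F (l[nx r i := \<iota> c ** l ! nx r i]))"

definition normalized :: "nat => ('x list => 'y) => ('k, 'y, 'q) module_scheme => bool"
 where "normalized r F L \<longleftrightarrow>
 (ALL l:tens_gens r. ALL i. 1 <= i --> i <= r --> l ! i : \<iota> ` \<K> --> F l = \<zero>\<^bsub>L\<^esub>)"

lemma multilinearD:
 assumes "multilinear r F L" "l : tens_gens r"
 shows "F l : carrier L"
 "[|i <= r; a : \<A>; a' : \<A>|] ==> F (l[i := a \<oplus> a']) = F (l[i := a]) \<oplus>\<^bsub>L\<^esub> F (l[i := a'])"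
 "[|i <= r; c : carrier k; a : \<A>|] ==> F (l[i := c \<odot> a]) = c \<odot>\<^bsub>L\<^esub> F (l[i := a])"
 "[|i <= r; d : \<K>|] ==> F (l[i := l ! i ** \<iota> d]) = F (l[nx r i := \<iota> d ** l ! nx r i])"
 using assms unfolding multilinear_def by blast+

lemma rel_eq:
 assumes "u : carrier (tens_free r)" "v : carrier (tens_free r)" "u \<ominus>\<^bsub>tens_free r\<^esub> v : tens_rels r"
 shows "N.q r u = N.q r v"
 using assms N.q_eq_iff mod_span_submodule(2)[OF Fr.free_module tens_rels_carrier]
 unfolding tens_ker_def by blast

lemma tens_relsI:
 assumes l: "l : tens_gens r"
 shows "[|i <= r; a : \<A>; a' : \<A>|] ==>
 gen (l[i := a \<oplus> a']) \<ominus>\<^bsub>tens_free r\<^esub> (gen (l[i := a]) \<oplus>\<^bsub>tens_free r\<^esub> gen (l[i := a'])) : tens_rels r"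
 and "[|i <= r; c : carrier k; a : \<A>|] ==>
 gen (l[i := c \<odot> a]) \<ominus>\<^bsub>tens_free r\<^esub> (c \<odot>\<^bsub>tens_free r\<^esub> gen (l[i := a])) : tens_rels r"
 and "[|i < r; d : \<K>|] ==>
 gen (l[i := l ! i ** \<iota> d]) \<ominus>\<^bsub>tens_free r\<^esub> gen (l[i + 1 := \<iota> d ** l ! (i + 1)]) : tens_rels r"
 and "d : \<K> ==>
 gen (l[r := l ! r ** \<iota> d]) \<ominus>\<^bsub>tens_free r\<^esub> gen (l[0 := \<iota> d ** l ! 0]) : tens_rels r"
 and "[|1 <= i; i <= r; l ! i : \<iota> ` \<K>|] ==> gen l : tens_rels r"
 unfolding tens_rels_def
 subgoal by (rule UnI1, rule UnI1, rule UnI1, rule UnI1, intro CollectI exI[of _ l] exI[of _ i] exI[of _ a] exI[of _ a'] conjI refl l)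
 subgoal by (rule UnI1, rule UnI1, rule UnI1, rule UnI2, intro CollectI exI[of _ l] exI[of _ i] exI[of _ c] exI[of _ a] conjI refl l)
 subgoal by (rule UnI1, rule UnI1, rule UnI2, intro CollectI exI[of _ l] exI[of _ i] exI[of _ d] conjI refl l)
 subgoal by (rule UnI1, rule UnI2, intro CollectI exI[of _ l] exI[of _ d] conjI refl l)
 subgoal by (rule UnI2, intro CollectI exI[of _ l] exI[of _ i] conjI refl l)
 done

lemma multilinear_cl: "multilinear r (cl r) (\<N> r)"
 unfolding multilinear_def
proof (intro conjI ballI allI impI)
 note [simp] = Fr.free_gen_closed tens_gens_update tens_gens_nth Fr.F.M.a_closed
 show "cl r l : carrier (\<N> r)" if "l : tens_gens r" for l using that by simp
 fix l i assume l: "l : tens_gens r" and i: "i <= r"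
 {
 fix a a' assume a: "a : \<A>" "a' : \<A>"
 have "N.q r (gen (l[i := a \<oplus> a'])) = N.q r (gen (l[i := a]) \<oplus>\<^bsub>tens_free r\<^esub> gen (l[i := a']))"
 proof (rule rel_eq)
 show "gen (l[i := a \<oplus> a']) \<ominus>\<^bsub>tens_free r\<^esub> (gen (l[i := a]) \<oplus>\<^bsub>tens_free r\<^esub> gen (l[i := a'])) : tens_rels r"
 by (rule tens_relsI(1)[OF l i a])
 qed (use l a in simp_all)
 then show "cl r (l[i := a \<oplus> a']) = cl r (l[i := a]) \<oplus>\<^bsub>\<N> r\<^esub> cl r (l[i := a'])"
 using l a unfolding tens_class_def norm_mod_def by (simp add: N.add_quot)
 next
 fix c a assume a: "c : carrier k" "a : \<A>"
 have "N.q r (gen (l[i := c \<odot> a])) = N.q r (c \<odot>\<^bsub>tens_free r\<^esub> gen (l[i := a]))"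
 proof (rule rel_eq)
 show "gen (l[i := c \<odot> a]) \<ominus>\<^bsub>tens_free r\<^esub> (c \<odot>\<^bsub>tens_free r\<^esub> gen (l[i := a])) : tens_rels r"
 by (rule tens_relsI(2)[OF l i a])
 qed (use l a in simp_all)
 then show "cl r (l[i := c \<odot> a]) = c \<odot>\<^bsub>\<N> r\<^esub> cl r (l[i := a])"
 using l a unfolding tens_class_def norm_mod_def by (simp add: N.smult_quot)
 next
 fix c assume c: "c : \<K>"
 have "nx r i <= r" using i by (auto simp: nx_def)
 have "N.q r (gen (l[i := l ! i ** \<iota> c])) = N.q r (gen (l[nx r i := \<iota> c ** l ! nx r i]))"
 proof (rule rel_eq)
 show "gen (l[i := l ! i ** \<iota> c]) \<ominus>\<^bsub>tens_free r\<^esub> gen (l[nx r i := \<iota> c ** l ! nx r i]) : tens_rels r"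
 proof (cases "i = r")
 case True
 then show ?thesis using tens_relsI(4)[OF l c] by (simp add: nx_def)
 next
 case False
 then have "gen (l[i := l ! i ** \<iota> c]) \<ominus>\<^bsub>tens_free r\<^esub> gen (l[i + 1 := \<iota> c ** l ! (i + 1)]) : tens_rels r"
 by (intro tens_relsI(3)[OF l]) (use c i in auto)
 then show ?thesis using False by (simp add: nx_def)
 qed
 qed (use l c i \<open>nx r i <= r\<close> in simp_all)
 then show "cl r (l[i := l ! i ** \<iota> c]) = cl r (l[nx r i := \<iota> c ** l ! nx r i])"
 by (simp add: tens_class_def)
 }
qed

lemmas cl_add = multilinearD(2)[OF multilinear_cl]
lemmas cl_smult = multilinearD(3)[OF multilinear_cl]
lemmas cl_balance = multilinearD(4)[OF multilinear_cl]

lemma normalized_cl: "normalized r (cl r) (\<N> r)"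
 unfolding normalized_def
proof (intro ballI allI impI)
 fix l i assume *: "l : tens_gens r" "1 <= i" "i <= r" "l ! i : \<iota> ` \<K>"
 then have "gen l : tens_rels r" by (intro tens_relsI(5))
 then have "gen l : tens_ker r"
 using mod_span_submodule(2)[OF Fr.free_module tens_rels_carrier] by (auto simp: tens_ker_def)
 then show "cl r l = \<zero>\<^bsub>\<N> r\<^esub>"
 using * by (simp add: tens_class_def norm_mod_def N.q_eq_zero_iff Fr.free_gen_closed)
qed

lemma cl_zero: "[|l : tens_gens r; 1 <= i; i <= r; l ! i : \<iota> ` \<K>|] ==> cl r l = \<zero>\<^bsub>\<N> r\<^esub>"
 using normalized_cl unfolding normalized_def by blast

text \<open>Universal property of the normalized cyclic tensor product.\<close>

lemma ex_norm_hom: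
 fixes L :: "('k, 'y, 'q) module_scheme"
 assumes L: "module k L" and ml: "multilinear r F L" and nz: "normalized r F L"
 shows "EX h:mod_hom k (\<N> r) L. ALL l:tens_gens r. h (cl r l) = F l"
proof -
 interpret L: module k L by fact
 note F = multilinearD[OF ml]
 note [simp] = Fr.free_gen_closed tens_gens_update tens_gens_nth F(1)
 obtain g where g: "g : mod_hom k (tens_free r) L" "!!l. l : tens_gens r ==> g (gen l) = F l"
 using Fr.ex_free_hom[of L r F] L F(1) by blast
 have gm: "g (u \<ominus>\<^bsub>tens_free r\<^esub> v) = g u \<ominus>\<^bsub>L\<^esub> g v" if "u : carrier (tens_free r)" "v : carrier (tens_free r)" for u v
 by (rule mod_hom_minus[OF Fr.free_module L g(1) that])
 have "g x = \<zero>\<^bsub>L\<^esub>" if "x : tens_rels r" for x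
 using that unfolding tens_rels_def
 proof (elim UnE CollectE exE conjE)
 fix l i a a' assume *: "x = gen (l[i := a \<oplus> a']) \<ominus>\<^bsub>tens_free r\<^esub> (gen (l[i := a]) \<oplus>\<^bsub>tens_free r\<^esub> gen (l[i := a']))"
 "l : tens_gens r" "i <= r" "a : \<A>" "a' : \<A>"
 then show ?thesis by (simp add: gm g(2) mod_hom_add[OF g(1)] F(2) L.M.diff_zero_iff)
 next
 fix l i c a assume *: "x = gen (l[i := c \<odot> a]) \<ominus>\<^bsub>tens_free r\<^esub> (c \<odot>\<^bsub>tens_free r\<^esub> gen (l[i := a]))"
 "l : tens_gens r" "i <= r" "c : carrier k" "a : \<A>"
 then show ?thesis by (simp add: gm g(2) mod_hom_smult[OF g(1)] F(3) L.M.diff_zero_iff)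
 next
 fix l i c assume *: "x = gen (l[i := l ! i ** \<iota> c]) \<ominus>\<^bsub>tens_free r\<^esub> gen (l[i + 1 := \<iota> c ** l ! (i + 1)])"
 "l : tens_gens r" "i < r" "c : \<K>"
 then show ?thesis using F(4)[of l i c] by (simp add: gm g(2) nx_def L.M.diff_zero_iff)
 next
 fix l c assume *: "x = gen (l[r := l ! r ** \<iota> c]) \<ominus>\<^bsub>tens_free r\<^esub> gen (l[0 := \<iota> c ** l ! 0])"
 "l : tens_gens r" "c : \<K>"
 then show ?thesis using F(4)[of l r c] by (simp add: gm g(2) nx_def L.M.diff_zero_iff)
 next
 fix l i assume *: "x = gen l" "l : tens_gens r" "1 <= i" "i <= r" "l ! i : \<iota> ` \<K>"
 then have "F l = \<zero>\<^bsub>L\<^esub>" using nz unfolding normalized_def by blast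
 then show ?thesis using * g(2) by simp
 qed
 then have "g x = \<zero>\<^bsub>L\<^esub>" if "x : tens_ker r" for x
 using mod_span_in_kernel[OF Fr.free_module L tens_rels_carrier g(1)] that unfolding tens_ker_def by blast
 from N.ex_quot_hom[OF L g(1) this]
 obtain h where "h : mod_hom k (\<N> r) L" "!!a. a : carrier (tens_free r) ==> h (N.q r a) = g a"
 unfolding norm_mod_def by blast
 then show ?thesis using g(2) by (intro bexI[of _ h]) (auto simp: tens_class_def)
qed

lemma norm_hom_eqI:
 fixes L :: "('k, 'y, 'q) module_scheme"
 assumes L: "module k L" and g: "g : mod_hom k (\<N> r) L" and h: "h : mod_hom k (\<N> r) L"
 and eq: "!!l. l : tens_gens r ==> g (cl r l) = h (cl r l)"
 shows "g = h"
proof (rule N.quot_hom_eqI[OF g[unfolded norm_mod_def] h[unfolded norm_mod_def]])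
 fix a assume a: "a : carrier (tens_free r)"
 let ?c = "%f. compose (carrier (tens_free r)) f (restrict (N.q r) (carrier (tens_free r)))"
 have "?c g a = ?c h a"
 proof (rule Fr.free_hom_eqI[OF L _ _ _ a])
 show "?c g : mod_hom k (tens_free r) L" "?c h : mod_hom k (tens_free r) L"
 using g h unfolding norm_mod_def by (auto intro: mod_hom_compose[OF Fr.free_module N.q_hom])
 show "?c g (gen l) = ?c h (gen l)" if "l : tens_gens r" for l
 using eq[OF that] Fr.free_gen_closed[OF that] by (simp add: compose_def tens_class_def)
 qed
 then show "g (N.q r a) = h (N.q r a)" using a by (simp add: compose_def)
qed

lemma sign_smult:
 fixes L :: "('k, 'y, 'q) module_scheme"
 assumes "module k L" "y : carrier L"
 shows "sign i \<odot>\<^bsub>L\<^esub> y = (if even i then y else \<ominus>\<^bsub>L\<^esub> y)"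
proof -
 interpret L: module k L by fact
 have "sign i = (if even i then \<one>\<^bsub>k\<^esub> else \<ominus>\<^bsub>k\<^esub> \<one>\<^bsub>k\<^esub>)"
 by (induction i) (auto simp: k.l_minus k.minus_minus)
 then show ?thesis using assms(2) by (simp add: L.smult_l_minus)
qed

subsection \<open>Formal chains of lists\<close>

text \<open>Alternating sums of tensors are evaluated from formal sums of lists, where signs and cancellations are
those of an ordinary abelian group.\<close>

definition val :: "nat => ('x list \<Rightarrow>\<^sub>0 int) => ('x list => 'k) set"
 where "val r = frag_eval (\<N> r) (%l. if l : tens_gens r then cl r l else \<zero>\<^bsub>\<N> r\<^esub>)"

lemma val_closed [simp]: "val r u : carrier (\<N> r)"
 and val_add: "val r (u + v) = val r u \<oplus>\<^bsub>\<N> r\<^esub> val r v"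
 and val_neg: "val r (- u) = \<ominus>\<^bsub>\<N> r\<^esub> val r u"
 and val_diff: "val r (u - v) = val r u \<ominus>\<^bsub>\<N> r\<^esub> val r v"
 and val_zero [simp]: "val r 0 = \<zero>\<^bsub>\<N> r\<^esub>"
 and val_sum: "val r (sum g I) = (\<Oplus>\<^bsub>\<N> r\<^esub>i\<in>I. val r (g i))"
 unfolding val_def
 by (rule NM.M.frag_eval_closed NM.M.frag_eval_add NM.M.frag_eval_neg NM.M.frag_eval_diff
 NM.M.frag_eval_zero NM.M.frag_eval_sum; simp)+

lemma val_of: "l : tens_gens r ==> val r (frag_of l) = cl r l"
 unfolding val_def by (subst NM.M.frag_eval_of) auto

lemma val_sign: "val r (frag_cmul ((- 1) ^ i) u) = sign i \<odot>\<^bsub>\<N> r\<^esub> val r u"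
 by (cases "even i") (simp_all add: sign_smult[OF norm_module] val_neg)

lemma norm_hom_val:
 assumes h: "h : mod_hom k (\<N> r) (\<N> s)"
 and eq: "!!l. l : tens_gens r ==> h (cl r l) = val s (F l)" and u: "Poly_Mapping.keys u <= tens_gens r"
 shows "h (val r u) = val s (frag_extend F u)"
 using u
proof (induction u rule: frag_induction)
 case zero
 then show ?case by (simp add: mod_hom_zero[OF norm_module norm_module h])
next
 case (one l)
 then show ?case by (simp add: val_of eq)
next
 case (diff a b)
 then show ?case by (simp add: val_diff mod_hom_minus[OF norm_module norm_module h] frag_extend_diff)
qed

lemma multilinear_signed_sum:
 assumes I: "finite I" and F: "!!i. i : I ==> multilinear r (F i) (\<N> s)"
 shows "multilinear r (%l. \<Oplus>\<^bsub>\<N> s\<^esub>i\<in>I. sign (e i) \<odot>\<^bsub>\<N> s\<^esub> F i l) (\<N> s)"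
proof -
 note FD = multilinearD[OF F]
 have sg: "sign j : carrier k" for j by simp
 have cl: "l : tens_gens r ==> (%i. sign (e i) \<odot>\<^bsub>\<N> s\<^esub> F i l) : I \<rightarrow> carrier (\<N> s)" for l
 using FD(1) by auto
 show ?thesis unfolding multilinear_def
 proof (intro conjI ballI allI impI)
 show "(\<Oplus>\<^bsub>\<N> s\<^esub>i\<in>I. sign (e i) \<odot>\<^bsub>\<N> s\<^esub> F i l) : carrier (\<N> s)" if "l : tens_gens r" for l
 using cl[OF that] by (rule NM.M.finsum_closed)
 fix l j assume l: "l : tens_gens r" and j: "j <= r"
 {
 fix a a' assume a: "a : \<A>" "a' : \<A>"
 have "(\<Oplus>\<^bsub>\<N> s\<^esub>i\<in>I. sign (e i) \<odot>\<^bsub>\<N> s\<^esub> F i (l[j := a \<oplus> a']))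
 = (\<Oplus>\<^bsub>\<N> s\<^esub>i\<in>I. sign (e i) \<odot>\<^bsub>\<N> s\<^esub> F i (l[j := a]) \<oplus>\<^bsub>\<N> s\<^esub> sign (e i) \<odot>\<^bsub>\<N> s\<^esub> F i (l[j := a']))"
 using l a j by (intro NM.M.finsum_cong') (auto simp: FD tens_gens_update NM.smult_r_distr)
 also have "... = (\<Oplus>\<^bsub>\<N> s\<^esub>i\<in>I. sign (e i) \<odot>\<^bsub>\<N> s\<^esub> F i (l[j := a])) \<oplus>\<^bsub>\<N> s\<^esub> (\<Oplus>\<^bsub>\<N> s\<^esub>i\<in>I. sign (e i) \<odot>\<^bsub>\<N> s\<^esub> F i (l[j := a']))"
 using l a by (intro NM.M.finsum_addf cl tens_gens_update)
 finally show "(\<Oplus>\<^bsub>\<N> s\<^esub>i\<in>I. sign (e i) \<odot>\<^bsub>\<N> s\<^esub> F i (l[j := a \<oplus> a'])) = ..." .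
 next
 fix c a assume a: "c : carrier k" "a : \<A>"
 have h: "restrict (%y. c \<odot>\<^bsub>\<N> s\<^esub> y) (carrier (\<N> s)) : mod_hom k (\<N> s) (\<N> s)"
 using a by (intro mod_hom_restrictI[OF norm_module])
 (auto simp: NM.smult_r_distr NM.smult_assoc1[symmetric] k.m_comm)
 have "(\<Oplus>\<^bsub>\<N> s\<^esub>i\<in>I. sign (e i) \<odot>\<^bsub>\<N> s\<^esub> F i (l[j := c \<odot> a]))
 = (\<Oplus>\<^bsub>\<N> s\<^esub>i\<in>I. restrict (%y. c \<odot>\<^bsub>\<N> s\<^esub> y) (carrier (\<N> s)) (sign (e i) \<odot>\<^bsub>\<N> s\<^esub> F i (l[j := a])))"
 using l a j FD(1) by (intro NM.M.finsum_cong') (auto simp: FD(3) tens_gens_update NM.smult_assoc1[symmetric] k.m_comm)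
 also have "... = restrict (%y. c \<odot>\<^bsub>\<N> s\<^esub> y) (carrier (\<N> s)) (\<Oplus>\<^bsub>\<N> s\<^esub>i\<in>I. sign (e i) \<odot>\<^bsub>\<N> s\<^esub> F i (l[j := a]))"
 using l a by (intro mod_hom_finsum[OF norm_module norm_module h, symmetric] cl tens_gens_update)
 also have "... = c \<odot>\<^bsub>\<N> s\<^esub> (\<Oplus>\<^bsub>\<N> s\<^esub>i\<in>I. sign (e i) \<odot>\<^bsub>\<N> s\<^esub> F i (l[j := a]))"
 using NM.M.finsum_closed[OF cl[OF tens_gens_update[OF l a(2)]]] by simp
 finally show "(\<Oplus>\<^bsub>\<N> s\<^esub>i\<in>I. sign (e i) \<odot>\<^bsub>\<N> s\<^esub> F i (l[j := c \<odot> a])) = ..." .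
 next
 fix c assume c: "c : \<K>"
 have "nx r j <= r" using j by (auto simp: nx_def)
 then show "(\<Oplus>\<^bsub>\<N> s\<^esub>i\<in>I. sign (e i) \<odot>\<^bsub>\<N> s\<^esub> F i (l[j := l ! j ** \<iota> c]))
 = (\<Oplus>\<^bsub>\<N> s\<^esub>i\<in>I. sign (e i) \<odot>\<^bsub>\<N> s\<^esub> F i (l[nx r j := \<iota> c ** l ! nx r j]))"
 using l c j FD(1) by (intro NM.M.finsum_cong') (auto simp: FD(4) tens_gens_update tens_gens_nth)
 }
 qed
qed

subsection \<open>The Hochschild boundary\<close>

definition dd :: "nat => nat => 'x list => 'x list"
 where "dd r q l = (if q < r then take q l @ [l ! q ** l ! (q + 1)] @ drop (q + 2) l
 else (l ! r ** l ! 0) # take (r - 1) (tl l))"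

definition ps :: "nat => nat => nat" where "ps r q = (if q = r then 0 else q)"

lemma dd_length: "[|length l = Suc r; 1 <= r; q <= r|] ==> length (dd r q l) = r"
 by (auto simp: dd_def)

lemma dd_nth:
 assumes "length l = Suc r" "1 <= r" "q <= r" "p < r"
 shows "dd r q l ! p = (if p = ps r q then l ! q ** l ! nx r q
 else if p < q then l ! p else l ! Suc p)"
proof (cases "q < r")
 case True
 then show ?thesis using assms by (auto simp: dd_def ps_def nx_def nth_append nth_Cons')
next
 case False
 then show ?thesis using assms by (auto simp: dd_def ps_def nx_def nth_Cons' nth_tl)
qed

text \<open>Entry \<open>i\<close> of a list contributes to entry \<open>tau r q i\<close> of its face
\<open>q\<close>.\<close>

definition tau :: "nat => nat => nat => nat"
 where "tau r q i = (if i = q then ps r q else if i < q then i else i - 1)"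

lemma tau_less: "[|1 <= r; q <= r; i <= r|] ==> tau r q i < r"
 by (auto simp: tau_def ps_def)

lemma tau_nx: "[|1 <= r; q <= r; i <= r; i ~= q|] ==> tau r q (nx r i) = nx (r - 1) (tau r q i)"
 by (auto simp: tau_def ps_def nx_def)

lemma tau_nx_self: "[|1 <= r; q <= r|] ==> tau r q (nx r q) = tau r q q"
 by (auto simp: tau_def ps_def nx_def)

lemma dd_update:
 assumes "length l = Suc r" "1 <= r" "q <= r" "i <= r"
 shows "dd r q (l[i := a]) = (dd r q l)[tau r q i := (if i = q then a ** l ! nx r q
 else if i = nx r q then l ! q ** a else a)]"
proof (rule nth_equalityI)
 show "length (dd r q (l[i := a])) = length ((dd r q l)[tau r q i := (if i = q then a ** l ! nx r q
 else if i = nx r q then l ! q ** a else a)])" using assms by (simp add: dd_length)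
next
 fix p assume "p < length (dd r q (l[i := a]))"
 then have p: "p < r" using assms by (simp add: dd_length)
 have "nx r q ~= q" "nx r q <= r" "q = r \<or> q < r" using assms by (auto simp: nx_def)
 then show "dd r q (l[i := a]) ! p = (dd r q l)[tau r q i := (if i = q then a ** l ! nx r q
 else if i = nx r q then l ! q ** a else a)] ! p"
 using assms p by (auto simp: dd_nth dd_length nth_list_update tau_def ps_def nx_def)
qed

lemma dd_tau:
 assumes "length l = Suc r" "1 <= r" "q <= r" "i <= r"
 shows "dd r q l ! tau r q i = (if i = q \<or> i = nx r q then l ! q ** l ! nx r q else l ! i)"
 using assms tau_less[OF assms(2-4)] by (auto simp: dd_nth tau_def ps_def nx_def)

lemma dd_gens:
 assumes "l : tens_gens (Suc r)" "q <= Suc r" shows "dd (Suc r) q l : tens_gens r"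
proof (rule tens_gensI)
 have L: "length l = Suc (Suc r)" using assms tens_gens_length by blast
 then show "length (dd (Suc r) q l) = Suc r" using assms by (simp add: dd_length)
 fix i assume "i <= r"
 moreover have "nx (Suc r) q <= Suc r" using assms by (auto simp: nx_def)
 ultimately show "dd (Suc r) q l ! i : \<A>"
 using assms L by (auto simp: dd_nth intro!: A.m_closed tens_gens_nth)
qed

lemma multilinear_dd:
 assumes q: "q <= Suc r"
 shows "multilinear (Suc r) (%l. cl r (dd (Suc r) q l)) (\<N> r)"
 unfolding multilinear_def
proof (intro conjI ballI allI impI)
 show "cl r (dd (Suc r) q l) : carrier (\<N> r)" if "l : tens_gens (Suc r)" for l
 using dd_gens[OF that q] by simp
 fix l i assume l: "l : tens_gens (Suc r)" and i: "i <= Suc r"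
 let ?R = "Suc r" let ?t = "tau ?R q i"
 have L: "length l = Suc ?R" using l tens_gens_length by blast
 have t: "?t <= r" using tau_less[of ?R q i] q i by simp
 have nxq: "nx ?R q <= ?R" and nxi: "nx ?R i <= ?R" using q i by (auto simp: nx_def)
 note D = dd_gens[OF l q] and up = dd_update[OF L _ q]
 note [simp] = tens_gens_nth[OF l] nxq nxi q i A.M.a_closed
 {
 fix a a' assume a: "a : \<A>" "a' : \<A>"
 then show "cl r (dd ?R q (l[i := a \<oplus> a'])) = cl r (dd ?R q (l[i := a])) \<oplus>\<^bsub>\<N> r\<^esub> cl r (dd ?R q (l[i := a']))"
 using D t by (cases "i = q"; cases "i = nx ?R q") (simp_all add: up A.l_distr A.r_distr cl_add)
 next
 fix c a assume a: "c : carrier k" "a : \<A>"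
 then show "cl r (dd ?R q (l[i := c \<odot> a])) = c \<odot>\<^bsub>\<N> r\<^esub> cl r (dd ?R q (l[i := a]))"
 using D t by (cases "i = q"; cases "i = nx ?R q")
 (simp_all add: up A.smult_mult_left A.smult_mult_right cl_smult)
 next
 fix c assume c: "c : \<K>"
 let ?n = "nx ?R i"
 show "cl r (dd ?R q (l[i := l ! i ** \<iota> c])) = cl r (dd ?R q (l[?n := \<iota> c ** l ! ?n]))"
 proof (cases "i = q")
 case True
 have "nx ?R q ~= q" by (auto simp: nx_def)
 then show ?thesis using c True by (simp add: up A.m_assoc tau_nx_self)
 next
 case False
 have 1: "dd ?R q (l[i := l ! i ** \<iota> c]) = (dd ?R q l)[?t := dd ?R q l ! ?t ** \<iota> c]"
 using False c by (simp add: up dd_tau[OF L _ q] A.m_assoc)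
 have n: "?n ~= nx ?R q" using False i q by (auto simp: nx_def split: if_splits)
 have 2: "dd ?R q (l[?n := \<iota> c ** l ! ?n]) = (dd ?R q l)[nx r ?t := \<iota> c ** dd ?R q l ! nx r ?t]"
 using False c n tau_nx[of ?R q i] dd_tau[OF L _ q, of ?n]
 by (simp add: up A.m_assoc)
 show ?thesis unfolding 1 2 by (rule cl_balance[OF D t c])
 qed
 }
qed

definition fd :: "nat => 'x list => ('x list \<Rightarrow>\<^sub>0 int)"
 where "fd r l = (\<Sum>q\<le>r. frag_cmul ((- 1) ^ q) (frag_of (dd r q l)))"

lemma val_fd:
 assumes "l : tens_gens (Suc r)"
 shows "val r (fd (Suc r) l) = (\<Oplus>\<^bsub>\<N> r\<^esub>q\<in>{..Suc r}. sign q \<odot>\<^bsub>\<N> r\<^esub> cl r (dd (Suc r) q l))"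
 unfolding fd_def val_sum
 by (rule NM.M.finsum_cong') (use assms in \<open>auto simp: val_sign val_of dd_gens\<close>)

lemma normalized_fd: "normalized (Suc r) (%l. val r (fd (Suc r) l)) (\<N> r)"
 unfolding normalized_def
proof (intro ballI allI impI)
 let ?R = "Suc r"
 fix l i assume l: "l : tens_gens ?R" and i: "1 <= i" "i <= ?R" and "l ! i : \<iota> ` \<K>"
 then obtain c where c: "c : \<K>" "l ! i = \<iota> c" by auto
 have L: "length l = Suc ?R" using l tens_gens_length by blast
 let ?f = "%q. sign q \<odot>\<^bsub>\<N> r\<^esub> cl r (dd ?R q l)"
 have f: "?f q : carrier (\<N> r)" if "q <= ?R" for q using dd_gens[OF l that] by simp
 obtain j where j: "i = Suc j" "j <= r" using i by (cases i) auto
 have z: "?f q = \<zero>\<^bsub>\<N> r\<^esub>" if q: "q <= ?R" "q ~= i" "q ~= j" for q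
 proof -
 have t: "tau ?R q i <= r" "1 <= tau ?R q i" using tau_less[of ?R q i] q i j by (auto simp: tau_def ps_def)
 have "nx ?R q ~= i" using q j i by (auto simp: nx_def)
 then have "dd ?R q l ! tau ?R q i = \<iota> c" using dd_tau[OF L _ q(1) i(2)] q c by simp
 then have "cl r (dd ?R q l) = \<zero>\<^bsub>\<N> r\<^esub>" using c by (intro cl_zero[OF dd_gens[OF l q(1)] t(2,1)]) auto
 then show ?thesis by simp
 qed
 have e: "cl r (dd ?R i l) = cl r (dd ?R j l)"
 proof -
 have "multilinear ?R (%l. cl r (dd ?R i l)) (\<N> r)" by (rule multilinear_dd[OF i(2)])
 let ?l = "l[i := \<one>]"
 have l1: "?l : tens_gens ?R" using l by (simp add: tens_gens_update)
 have ln: "l ! j : \<A>" "l ! nx ?R i : \<A>" using l j i by (auto intro!: tens_gens_nth simp: nx_def)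
 have u: "dd ?R i l = dd ?R i (l[i := \<iota> c])" "dd ?R j l = dd ?R j (l[i := \<iota> c])"
 using c(2) by (metis list_update_id)+
 have 1: "dd ?R i l = (dd ?R i l)[tau ?R i i := \<iota> c ** l ! nx ?R i]"
 unfolding u(1) using dd_update[OF L _ i(2) i(2), of "\<iota> c"] by simp
 have nj: "nx ?R j = i" using j by (simp add: nx_def)
 have 2: "dd ?R j l = (dd ?R j l)[tau ?R j i := l ! j ** \<iota> c]"
 unfolding u(2) using dd_update[OF L _ _ i(2), of j "\<iota> c"] j nj by simp
 define m where "m = (dd ?R j l)[j := l ! j]"
 have m: "m : tens_gens r" unfolding m_def using ln j by (intro tens_gens_update dd_gens[OF l]) auto
 have Lm: "length m = Suc r" using m tens_gens_length by blast
 have ps: "tau ?R j i = j" using j by (simp add: tau_def)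
 have 3: "dd ?R j l = m[j := m ! j ** \<iota> c]"
 using 2 ps Lm j unfolding m_def by (simp add: nth_list_update)
 have 4: "dd ?R i l = m[nx r j := \<iota> c ** m ! nx r j]"
 proof (rule nth_equalityI)
 show "length (dd ?R i l) = length (m[nx r j := \<iota> c ** m ! nx r j])"
 using L Lm i by (simp add: dd_length)
 fix p assume "p < length (dd ?R i l)"
 then have p: "p < ?R" using L i by (simp add: dd_length)
 have "m ! p = (if p = j then l ! j else dd ?R j l ! p)" using p Lm unfolding m_def
 by (simp add: nth_list_update)
 moreover have "m ! nx r j = l ! nx ?R i"
 proof -
 have "nx r j < ?R" using j by (auto simp: nx_def)
 then show ?thesis using j L Lm unfolding m_def by (auto simp: nth_list_update dd_nth nx_def ps_def)
 qed
 ultimately show "dd ?R i l ! p = m[nx r j := \<iota> c ** m ! nx r j] ! p"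
 using p L Lm i j c by (auto simp: nth_list_update dd_nth nx_def ps_def)
 qed
 show ?thesis unfolding 3 4 using cl_balance[OF m j(2) c(1)] by simp
 qed
 have "val r (fd ?R l) = (\<Oplus>\<^bsub>\<N> r\<^esub>q\<in>{..?R}. ?f q)" by (rule val_fd[OF l])
 also have "... = (\<Oplus>\<^bsub>\<N> r\<^esub>q\<in>{i, j}. ?f q)"
 by (rule NM.M.add.finprod_mono_neutral_cong_right) (use i j z f in auto)
 also have "... = ?f i \<oplus>\<^bsub>\<N> r\<^esub> ?f j"
 using f[OF i(2)] f[of j] i j by (subst NM.M.finsum_insert) simp_all
 also have "... = \<zero>\<^bsub>\<N> r\<^esub>"
 proof -
 define y where "y = cl r (dd ?R j l)"
 have y: "y : carrier (\<N> r)" using dd_gens[OF l, of j] j by (simp add: y_def)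
 have "sign i \<odot>\<^bsub>\<N> r\<^esub> y = (if even i then y else \<ominus>\<^bsub>\<N> r\<^esub> y)"
 "sign j \<odot>\<^bsub>\<N> r\<^esub> y = (if even j then y else \<ominus>\<^bsub>\<N> r\<^esub> y)"
 by (rule sign_smult[OF norm_module y])+
 moreover have "even i \<longleftrightarrow> odd j" using j by simp
 ultimately show ?thesis unfolding e y_def[symmetric] using y
 by (cases "even j") (simp_all only: if_True if_False NM.M.l_neg NM.M.r_neg not_not simp_thms)
 qed
 finally show "val r (fd ?R l) = \<zero>\<^bsub>\<N> r\<^esub>" .
qed

lemma norm_b_spec:
 "norm_b (Suc r) : mod_hom k (\<N> (Suc r)) (\<N> r)"
 "l : tens_gens (Suc r) ==> norm_b (Suc r) (cl (Suc r) l) = val r (fd (Suc r) l)"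
proof -
 let ?R = "Suc r"
 have ml: "multilinear ?R (%l. \<Oplus>\<^bsub>\<N> r\<^esub>q\<in>{..?R}. sign q \<odot>\<^bsub>\<N> r\<^esub> cl r (dd ?R q l)) (\<N> r)"
 by (rule multilinear_signed_sum) (auto intro: multilinear_dd)
 have nz: "normalized ?R (%l. \<Oplus>\<^bsub>\<N> r\<^esub>q\<in>{..?R}. sign q \<odot>\<^bsub>\<N> r\<^esub> cl r (dd ?R q l)) (\<N> r)"
 unfolding normalized_def
 proof (intro ballI allI impI)
 fix l i assume *: "l : tens_gens ?R" "1 <= i" "i <= ?R" "l ! i : \<iota> ` \<K>"
 then have "val r (fd ?R l) = \<zero>\<^bsub>\<N> r\<^esub>" using normalized_fd[of r] unfolding normalized_def by blast
 then show "(\<Oplus>\<^bsub>\<N> r\<^esub>q\<in>{..?R}. sign q \<odot>\<^bsub>\<N> r\<^esub> cl r (dd ?R q l)) = \<zero>\<^bsub>\<N> r\<^esub>"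
 using val_fd[OF *(1)] by simp
 qed
 from ex_norm_hom[OF norm_module ml nz] obtain h where h: "h : mod_hom k (\<N> ?R) (\<N> r)"
 "!!l. l : tens_gens ?R ==> h (cl ?R l) = (\<Oplus>\<^bsub>\<N> r\<^esub>q\<in>{..?R}. sign q \<odot>\<^bsub>\<N> r\<^esub> cl r (dd ?R q l))"
 by blast
 have split: "(\<Oplus>\<^bsub>\<N> r\<^esub>q\<in>{..?R}. sign q \<odot>\<^bsub>\<N> r\<^esub> cl r (dd ?R q l))
 = (\<Oplus>\<^bsub>\<N> (?R - 1)\<^esub> i\<in>{..<?R}. sign i \<odot>\<^bsub>\<N> (?R - 1)\<^esub>
 cl (?R - 1) (take i l @ [l ! i ** l ! (i + 1)] @ drop (i + 2) l))
 \<oplus>\<^bsub>\<N> (?R - 1)\<^esub> (sign ?R \<odot>\<^bsub>\<N> (?R - 1)\<^esub>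
 cl (?R - 1) ((l ! ?R ** l ! 0) # take (?R - 1) (tl l)))" if l: "l : tens_gens ?R" for l
 proof -
 have f: "sign q \<odot>\<^bsub>\<N> r\<^esub> cl r (dd ?R q l) : carrier (\<N> r)" if "q <= ?R" for q
 using dd_gens[OF l that] by simp
 define F where "F = (%q. sign q \<odot>\<^bsub>\<N> r\<^esub> cl r (dd ?R q l))"
 have F: "F q : carrier (\<N> r)" if "q <= ?R" for q using f[OF that] by (simp add: F_def)
 have "{..?R} = insert ?R {..<?R}" by auto
 then have "finsum (\<N> r) F {..?R} = F ?R \<oplus>\<^bsub>\<N> r\<^esub> finsum (\<N> r) F {..<?R}"
 using F by (simp only:) (subst NM.M.finsum_insert, auto)
 also have "... = finsum (\<N> r) F {..<?R} \<oplus>\<^bsub>\<N> r\<^esub> F ?R"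
 using F by (intro NM.M.a_comm NM.M.finsum_closed) auto
 finally have "(\<Oplus>\<^bsub>\<N> r\<^esub>q\<in>{..?R}. sign q \<odot>\<^bsub>\<N> r\<^esub> cl r (dd ?R q l))
 = (\<Oplus>\<^bsub>\<N> r\<^esub>q\<in>{..<?R}. sign q \<odot>\<^bsub>\<N> r\<^esub> cl r (dd ?R q l)) \<oplus>\<^bsub>\<N> r\<^esub> sign ?R \<odot>\<^bsub>\<N> r\<^esub> cl r (dd ?R ?R l)"
 unfolding F_def .
 also have "(\<Oplus>\<^bsub>\<N> r\<^esub>q\<in>{..<?R}. sign q \<odot>\<^bsub>\<N> r\<^esub> cl r (dd ?R q l))
 = (\<Oplus>\<^bsub>\<N> r\<^esub>i\<in>{..<?R}. sign i \<odot>\<^bsub>\<N> r\<^esub> cl r (take i l @ [l ! i ** l ! (i + 1)] @ drop (i + 2) l))"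
 proof (rule NM.M.finsum_cong'[OF refl])
 show "(%i. sign i \<odot>\<^bsub>\<N> r\<^esub> cl r (take i l @ [l ! i ** l ! (i + 1)] @ drop (i + 2) l)) : {..<?R} \<rightarrow> carrier (\<N> r)"
 proof (rule Pi_I)
 fix i assume "i : {..<?R}"
 then show "sign i \<odot>\<^bsub>\<N> r\<^esub> cl r (take i l @ [l ! i ** l ! (i + 1)] @ drop (i + 2) l) : carrier (\<N> r)"
 using f[of i] by (simp add: dd_def)
 qed
 qed (simp add: dd_def)
 finally show ?thesis by (simp add: dd_def)
 qed
 have "norm_b ?R = h"
 unfolding norm_b_def
 proof (rule the_homI)
 show "h : mod_hom k (\<N> ?R) (\<N> (?R - 1))" using h(1) by simp
 show "ALL l:tens_gens ?R. h (cl ?R l) =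
 (\<Oplus>\<^bsub>\<N> (?R - 1)\<^esub> i\<in>{..<?R}. sign i \<odot>\<^bsub>\<N> (?R - 1)\<^esub>
 cl (?R - 1) (take i l @ [l ! i ** l ! (i + 1)] @ drop (i + 2) l))
 \<oplus>\<^bsub>\<N> (?R - 1)\<^esub> (sign ?R \<odot>\<^bsub>\<N> (?R - 1)\<^esub>
 cl (?R - 1) ((l ! ?R ** l ! 0) # take (?R - 1) (tl l)))"
 by (intro ballI, subst split[symmetric], assumption, rule h(2))
 fix g assume g: "g : mod_hom k (\<N> ?R) (\<N> (?R - 1))"
 and gl: "ALL l:tens_gens ?R. g (cl ?R l) =
 (\<Oplus>\<^bsub>\<N> (?R - 1)\<^esub> i\<in>{..<?R}. sign i \<odot>\<^bsub>\<N> (?R - 1)\<^esub>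
 cl (?R - 1) (take i l @ [l ! i ** l ! (i + 1)] @ drop (i + 2) l))
 \<oplus>\<^bsub>\<N> (?R - 1)\<^esub> (sign ?R \<odot>\<^bsub>\<N> (?R - 1)\<^esub>
 cl (?R - 1) ((l ! ?R ** l ! 0) # take (?R - 1) (tl l)))"
 show "g = h"
 proof (rule norm_hom_eqI[OF norm_module _ h(1)])
 show "g : mod_hom k (\<N> ?R) (\<N> r)" using g by simp
 fix l assume l: "l : tens_gens ?R"
 show "g (cl ?R l) = h (cl ?R l)" using bspec[OF gl l] split[OF l] h(2)[OF l] by simp
 qed
 qed
 then show "norm_b (Suc r) : mod_hom k (\<N> (Suc r)) (\<N> r)"
 "l : tens_gens (Suc r) ==> norm_b (Suc r) (cl (Suc r) l) = val r (fd (Suc r) l)"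
 using h val_fd by auto
qed


end

context relative_algebra
begin

subsection \<open>The Connes operator\<close>

definition rot :: "nat => 'x list => 'x list"
 where "rot i l = drop i l @ take i l"

abbreviation rl :: "nat => 'x list => 'x list"
 where "rl i l \<equiv> \<one> # rot i l"

definition sg :: "nat => nat => nat => nat"
 where "sg r i j = (if j < i then j + Suc r - i else j - i)"

lemma rot_length: "length l = Suc r ==> i <= r ==> length (rot i l) = Suc r"
 by (simp add: rot_def)

lemma rot_nth:
 "[|length l = Suc r; i <= r; p <= r|] ==> rot i l ! p = l ! (if i + p <= r then i + p else i + p - Suc r)"
 by (auto simp: rot_def nth_append intro!: arg_cong[where f = "(!) l"])

lemma rot_update:
 assumes "length l = Suc r" "i <= r" "j <= r"
 shows "rot i (l[j := a]) = (rot i l)[sg r i j := a]"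
proof (rule nth_equalityI)
 fix p assume "p < length (rot i (l[j := a]))"
 then have "p <= r" using assms by (simp add: rot_length)
 then show "rot i (l[j := a]) ! p = (rot i l)[sg r i j := a] ! p"
 using assms by (auto simp: rot_nth rot_length sg_def nth_list_update)
qed (use assms in \<open>simp add: rot_length\<close>)

lemma rot_sg: "[|length l = Suc r; i <= r; j <= r|] ==> rot i l ! sg r i j = l ! j"
 by (auto simp: rot_nth sg_def)

lemma sg_le: "[|i <= r; j <= r|] ==> sg r i j <= r"
 by (auto simp: sg_def)

lemma sg_nx: "[|i <= r; j <= r|] ==> sg r i (nx r j) = nx r (sg r i j)"
 by (auto simp: sg_def nx_def)

lemma rot_gens: "[|l : tens_gens r; i <= r|] ==> rot i l : tens_gens r"
 by (auto simp: tens_gens_def rot_def dest: in_set_takeD in_set_dropD)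

lemma one_gens: "l : tens_gens r ==> \<one> # l : tens_gens (Suc r)"
 by (auto simp: tens_gens_def)

lemma rl_gens: "[|l : tens_gens r; i <= r|] ==> rl i l : tens_gens (Suc r)"
 by (intro one_gens rot_gens)

lemma multilinear_rl:
 assumes i: "i <= r"
 shows "multilinear r (%l. cl (Suc r) (rl i l)) (\<N> (Suc r))"
 unfolding multilinear_def
proof (intro conjI ballI allI impI)
 show "cl (Suc r) (rl i l) : carrier (\<N> (Suc r))" if "l : tens_gens r" for l
 using rl_gens[OF that i] by simp
 fix l j assume l: "l : tens_gens r" and j: "j <= r"
 have L: "length l = Suc r" using l tens_gens_length by blast
 have nxj: "nx r j <= r" using j by (auto simp: nx_def)
 have up: "rl i (l[j := a]) = (rl i l)[Suc (sg r i j) := a]" if "j <= r" for a j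
 using rot_update[OF L i that] by simp
 have s: "Suc (sg r i j) <= Suc r" using sg_le[OF i j] by simp
 note G = rl_gens[OF l i]
 {
 fix a a' assume a: "a : \<A>" "a' : \<A>"
 show "cl (Suc r) (rl i (l[j := a \<oplus> a'])) = cl (Suc r) (rl i (l[j := a])) \<oplus>\<^bsub>\<N> (Suc r)\<^esub> cl (Suc r) (rl i (l[j := a']))"
 unfolding up[OF j] by (rule cl_add[OF G s a])
 next
 fix c a assume a: "c : carrier k" "a : \<A>"
 show "cl (Suc r) (rl i (l[j := c \<odot> a])) = c \<odot>\<^bsub>\<N> (Suc r)\<^esub> cl (Suc r) (rl i (l[j := a]))"
 unfolding up[OF j] by (rule cl_smult[OF G s a])
 next
 fix c assume c: "c : \<K>"
 have 1: "cl (Suc r) (rl i (l[j := l ! j ** \<iota> c]))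
 = cl (Suc r) ((rl i l)[nx (Suc r) (Suc (sg r i j)) := \<iota> c ** rl i l ! nx (Suc r) (Suc (sg r i j))])"
 unfolding up[OF j] using cl_balance[OF G s c] rot_sg[OF L i j] by simp
 have 2: "rl i (l[nx r j := \<iota> c ** l ! nx r j]) = (rl i l)[Suc (nx r (sg r i j)) := \<iota> c ** rl i l ! Suc (nx r (sg r i j))]"
 unfolding up[OF nxj] sg_nx[OF i j] using rot_sg[OF L i nxj] by (simp add: sg_nx[OF i j])
 show "cl (Suc r) (rl i (l[j := l ! j ** \<iota> c])) = cl (Suc r) (rl i (l[nx r j := \<iota> c ** l ! nx r j]))"
 proof (cases "sg r i j = r")
 case True
 then show ?thesis unfolding 1 2
 using cl_balance[OF G, of 0 c] c by (simp add: nx_def)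
 next
 case False
 then show ?thesis unfolding 1 2 by (simp add: nx_def)
 qed
 }
qed

lemma cl_rl_zero:
 assumes "l : tens_gens r" "i <= r" "j <= r" "l ! j : \<iota> ` \<K>"
 shows "cl (Suc r) (rl i l) = \<zero>\<^bsub>\<N> (Suc r)\<^esub>"
proof (rule cl_zero[OF rl_gens[OF assms(1,2)]])
 have L: "length l = Suc r" using assms(1) tens_gens_length by blast
 show "rl i l ! Suc (sg r i j) : \<iota> ` \<K>" using assms rot_sg[OF L assms(2,3)] by simp
qed (use sg_le[OF assms(2,3)] in auto)

definition fB :: "nat => 'x list => ('x list \<Rightarrow>\<^sub>0 int)"
 where "fB r l = (\<Sum>i\<le>r. frag_cmul ((- 1) ^ (i * r)) (frag_of (rl i l)))"

lemma val_fB: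
 assumes "l : tens_gens r"
 shows "val (Suc r) (fB r l) = (\<Oplus>\<^bsub>\<N> (Suc r)\<^esub>i\<in>{..r}. sign (i * r) \<odot>\<^bsub>\<N> (Suc r)\<^esub> cl (Suc r) (rl i l))"
 unfolding fB_def val_sum
 by (rule NM.M.finsum_cong') (use assms in \<open>auto simp: val_sign val_of rl_gens\<close>)

lemma norm_B_spec:
 "norm_B r : mod_hom k (\<N> r) (\<N> (Suc r))"
 "l : tens_gens r ==> norm_B r (cl r l) = val (Suc r) (fB r l)"
proof -
 let ?F = "%l. \<Oplus>\<^bsub>\<N> (Suc r)\<^esub>i\<in>{..r}. sign (i * r) \<odot>\<^bsub>\<N> (Suc r)\<^esub> cl (Suc r) (rl i l)"
 have ml: "multilinear r ?F (\<N> (Suc r))"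
 by (rule multilinear_signed_sum) (auto intro: multilinear_rl)
 have nz: "normalized r ?F (\<N> (Suc r))"
 unfolding normalized_def
 proof (intro ballI allI impI)
 fix l j assume *: "l : tens_gens r" "1 <= j" "j <= r" "l ! j : \<iota> ` \<K>"
 have "?F l = (\<Oplus>\<^bsub>\<N> (Suc r)\<^esub>i\<in>{..r}. \<zero>\<^bsub>\<N> (Suc r)\<^esub>)"
 by (rule NM.M.finsum_cong') (use cl_rl_zero[OF *(1) _ *(3,4)] in auto)
 then show "?F l = \<zero>\<^bsub>\<N> (Suc r)\<^esub>" by simp
 qed
 from ex_norm_hom[OF norm_module ml nz] obtain h where h: "h : mod_hom k (\<N> r) (\<N> (Suc r))"
 "!!l. l : tens_gens r ==> h (cl r l) = ?F l" by blast
 have "norm_B r = h"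
 unfolding norm_B_def
 proof (rule the_homI)
 show "h : mod_hom k (\<N> r) (\<N> (r + 1))" using h(1) by simp
 show "ALL l:tens_gens r. h (cl r l) = (\<Oplus>\<^bsub>\<N> (r + 1)\<^esub> i\<in>{..r}. sign (i * r) \<odot>\<^bsub>\<N> (r + 1)\<^esub>
 cl (r + 1) (\<one> # drop i l @ take i l))"
 using h(2) by (simp add: rot_def)
 fix g assume g: "g : mod_hom k (\<N> r) (\<N> (r + 1))"
 and gl: "ALL l:tens_gens r. g (cl r l) = (\<Oplus>\<^bsub>\<N> (r + 1)\<^esub> i\<in>{..r}. sign (i * r) \<odot>\<^bsub>\<N> (r + 1)\<^esub>
 cl (r + 1) (\<one> # drop i l @ take i l))"
 show "g = h"
 proof (rule norm_hom_eqI[OF norm_module _ h(1)])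
 show "g : mod_hom k (\<N> r) (\<N> (Suc r))" using g by simp
 fix l assume l: "l : tens_gens r"
 show "g (cl r l) = h (cl r l)" using bspec[OF gl l] h(2)[OF l] by (simp add: rot_def)
 qed
 qed
 then show "norm_B r : mod_hom k (\<N> r) (\<N> (Suc r))"
 "l : tens_gens r ==> norm_B r (cl r l) = val (Suc r) (fB r l)"
 using h val_fB by auto
qed

subsection \<open>The identities of a mixed complex\<close>

lemma keys_signed_sum:
 assumes "!!i. i : I ==> F i : S"
 shows "Poly_Mapping.keys (\<Sum>i\<in>I. frag_cmul (e i) (frag_of (F i))) <= S"
proof -
 have "Poly_Mapping.keys (\<Sum>i\<in>I. frag_cmul (e i) (frag_of (F i))) <= (\<Union>i\<in>I. Poly_Mapping.keys (frag_cmul (e i) (frag_of (F i))))"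
 by (rule keys_sum)
 also have "... <= S"
 proof (rule UN_least)
 fix i assume "i : I"
 then show "Poly_Mapping.keys (frag_cmul (e i) (frag_of (F i))) <= S"
 using assms keys_cmul[of "e i" "frag_of (F i)"] by auto
 qed
 finally show ?thesis .
qed

lemma keys_fd: "l : tens_gens (Suc r) ==> Poly_Mapping.keys (fd (Suc r) l) <= tens_gens r"
 unfolding fd_def by (rule keys_signed_sum) (auto intro: dd_gens)

lemma keys_fB: "l : tens_gens r ==> Poly_Mapping.keys (fB r l) <= {m : tens_gens (Suc r). m ! 0 = \<one>}"
 unfolding fB_def by (rule keys_signed_sum) (auto intro: rl_gens)

lemma dd_dd:
 assumes l: "l : tens_gens (Suc (Suc r))" and pq: "p < q" "q <= Suc (Suc r)"
 shows "dd (Suc r) p (dd (Suc (Suc r)) q l) = dd (Suc r) (q - 1) (dd (Suc (Suc r)) p l)"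
proof (rule nth_equalityI)
 have L: "length l = Suc (Suc (Suc r))" using l tens_gens_length by blast
 show "length (dd (Suc r) p (dd (Suc (Suc r)) q l)) = length (dd (Suc r) (q - 1) (dd (Suc (Suc r)) p l))"
 using L pq by (simp add: dd_length)
 fix t assume "t < length (dd (Suc r) p (dd (Suc (Suc r)) q l))"
 then have t: "t < Suc r" using L pq by (simp add: dd_length)
 have c: "i <= Suc (Suc r) ==> l ! i : \<A>" for i using tens_gens_nth[OF l] .
 obtain q' where q': "q = Suc q'" using pq by (cases q) auto
 have a: "[|i <= Suc (Suc r); j <= Suc (Suc r); m <= Suc (Suc r)|] ==>
 (l ! i ** l ! j) ** l ! m = l ! i ** (l ! j ** l ! m)" for i j m
 using c by (intro A.m_assoc)
 show "dd (Suc r) p (dd (Suc (Suc r)) q l) ! t = dd (Suc r) (q - 1) (dd (Suc (Suc r)) p l) ! t"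
 proof (cases "q' = Suc r")
 case True
 then have q: "q = Suc (Suc r)" using q' by simp
 show ?thesis using L t pq(1) unfolding q
 by (cases "p = Suc r") (auto simp: dd_nth dd_length ps_def nx_def a)
 next
 case False
 then have "q' <= r" "p <= r" "q' ~= Suc r" "p ~= Suc r" "q ~= Suc (Suc r)" using pq q' by auto
 moreover have "p = q' \<or> p < q'" using pq(1) q' by auto
 ultimately show ?thesis using L t q'
 by (elim disjE) (simp_all add: dd_nth dd_length ps_def nx_def a)
 qed
qed

lemma fd_fd:
 assumes l: "l : tens_gens (Suc (Suc r))"
 shows "frag_extend (fd (Suc r)) (fd (Suc (Suc r)) l) = 0"
proof -
 define g where "g = (%(p, q). frag_cmul ((- 1) ^ (p + q)) (frag_of (dd (Suc r) p (dd (Suc (Suc r)) q l))))"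
 let ?S = "{..Suc r} \<times> {..Suc (Suc r)}"
 let ?U = "{(p, q) : ?S. p < q}" and ?V = "{(p, q) : ?S. q <= p}"
 have "frag_extend (fd (Suc r)) (fd (Suc (Suc r)) l) = (\<Sum>q\<le>Suc (Suc r). \<Sum>p\<le>Suc r. g (p, q))"
 unfolding fd_def[of "Suc (Suc r)"]
 by (simp only: frag_extend_sum finite_atMost o_def frag_extend_cmul frag_extend_of)
 (simp only: fd_def frag_cmul_sum frag_cmul_cmul g_def prod.case power_add mult.commute)
 also have "... = (\<Sum>p\<le>Suc r. \<Sum>q\<le>Suc (Suc r). g (p, q))" by (rule sum.swap)
 also have "... = sum g ?S" by (simp only: sum.cartesian_product case_prod_eta)
 also have "... = sum g ?U + sum g ?V"
 proof -
 have "finite ?U" "finite ?V" by (rule finite_subset[of _ ?S]; auto)+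
 then have "sum g (?U \<union> ?V) = sum g ?U + sum g ?V" by (rule sum.union_disjoint) auto
 moreover have "?U \<union> ?V = ?S" by auto
 ultimately show ?thesis by (simp only:)
 qed
 also have "sum g ?U = (\<Sum>x\<in>?V. - g x)"
 proof (rule sum.reindex_bij_witness[where i = "%(p, q). (q, Suc p)" and j = "%(p, q). (q - 1, p)"])
 fix x assume "x : ?U"
 then obtain p q where x: "x = (p, q)" "p < q" "q <= Suc (Suc r)" by auto
 then obtain q' where q': "q = Suc q'" by (cases q) auto
 have "dd (Suc r) p (dd (Suc (Suc r)) q l) = dd (Suc r) (q - 1) (dd (Suc (Suc r)) p l)"
 by (rule dd_dd[OF l x(2,3)])
 then show "- g ((%(p, q). (q - 1, p)) x) = g x" using x q' by (simp add: g_def add.commute)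
 qed auto
 finally show ?thesis by (simp add: sum_negf)
qed

lemma norm_b_b:
 assumes x: "x : carrier (\<N> (Suc (Suc r)))"
 shows "norm_b (Suc r) (norm_b (Suc (Suc r)) x) = \<zero>\<^bsub>\<N> r\<^esub>"
proof -
 let ?z = "\<lambda>x\<in>carrier (\<N> (Suc (Suc r))). \<zero>\<^bsub>\<N> r\<^esub>"
 have "compose (carrier (\<N> (Suc (Suc r)))) (norm_b (Suc r)) (norm_b (Suc (Suc r))) = ?z"
 proof (rule norm_hom_eqI[OF norm_module mod_hom_compose[OF norm_module norm_b_spec(1) norm_b_spec(1)]])
 show "?z : mod_hom k (\<N> (Suc (Suc r))) (\<N> r)"
 by (rule mod_hom_restrictI[OF norm_module]) auto
 fix l assume l: "l : tens_gens (Suc (Suc r))"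
 have "norm_b (Suc r) (norm_b (Suc (Suc r)) (cl (Suc (Suc r)) l)) = val r (frag_extend (fd (Suc r)) (fd (Suc (Suc r)) l))"
 unfolding norm_b_spec(2)[OF l] by (rule norm_hom_val[OF norm_b_spec keys_fd[OF l]])
 then show "compose (carrier (\<N> (Suc (Suc r)))) (norm_b (Suc r)) (norm_b (Suc (Suc r))) (cl (Suc (Suc r)) l) = ?z (cl (Suc (Suc r)) l)"
 using l by (simp add: compose_def fd_fd)
 qed
 from fun_cong[OF this, of x] show ?thesis using x by (simp add: compose_def)
qed

lemma norm_B_B:
 assumes x: "x : carrier (\<N> r)"
 shows "norm_B (Suc r) (norm_B r x) = \<zero>\<^bsub>\<N> (Suc (Suc r))\<^esub>"
proof -
 let ?z = "\<lambda>x\<in>carrier (\<N> r). \<zero>\<^bsub>\<N> (Suc (Suc r))\<^esub>"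
 have "compose (carrier (\<N> r)) (norm_B (Suc r)) (norm_B r) = ?z"
 proof (rule norm_hom_eqI[OF norm_module mod_hom_compose[OF norm_module norm_B_spec(1) norm_B_spec(1)]])
 show "?z : mod_hom k (\<N> r) (\<N> (Suc (Suc r)))"
 by (rule mod_hom_restrictI[OF norm_module]) auto
 fix l assume l: "l : tens_gens r"
 have one: "norm_B (Suc r) (cl (Suc r) m) = \<zero>\<^bsub>\<N> (Suc (Suc r))\<^esub>"
 if m: "m : tens_gens (Suc r)" "m ! 0 = \<one>" for m
 proof -
 have "m ! 0 : \<iota> ` \<K>" using m iota_one by (metis K.one_closed imageI)
 then have "val (Suc (Suc r)) (fB (Suc r) m) = (\<Oplus>\<^bsub>\<N> (Suc (Suc r))\<^esub>i\<in>{..Suc r}. \<zero>\<^bsub>\<N> (Suc (Suc r))\<^esub>)"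
 unfolding val_fB[OF m(1)]
 by (intro NM.M.finsum_cong') (use cl_rl_zero[OF m(1), of _ 0] in auto)
 then show ?thesis using norm_B_spec(2)[OF m(1)] by simp
 qed
 have "norm_B (Suc r) (val (Suc r) u) = \<zero>\<^bsub>\<N> (Suc (Suc r))\<^esub>"
 if "Poly_Mapping.keys u <= {m : tens_gens (Suc r). m ! 0 = \<one>}" for u
 using that
 proof (induction u rule: frag_induction)
 case zero
 then show ?case by (simp add: mod_hom_zero[OF norm_module norm_module norm_B_spec(1)])
 next
 case (one l)
 then show ?case by (auto simp: val_of \<open>!!m. [|m : tens_gens (Suc r); m ! 0 = \<one>|] ==> norm_B (Suc r) (cl (Suc r) m) = \<zero>\<^bsub>\<N> (Suc (Suc r))\<^esub>\<close>)
 next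
 case (diff a b)
 then show ?case
 by (simp add: val_diff mod_hom_minus[OF norm_module norm_module norm_B_spec(1)] NM.M.diff_zero_iff)
 qed
 from this[OF keys_fB[OF l]] show "compose (carrier (\<N> r)) (norm_B (Suc r)) (norm_B r) (cl r l) = ?z (cl r l)"
 using l by (simp add: compose_def norm_B_spec(2))
 qed
 from fun_cong[OF this, of x] show ?thesis using x by (simp add: compose_def)
qed

lemma dd_one:
 assumes m: "m : tens_gens r"
 shows "dd (Suc r) 0 (\<one> # m) = m" "j < r ==> dd (Suc r) (Suc j) (\<one> # m) = \<one> # dd r j m"
 "dd (Suc r) (Suc r) (\<one> # m) = rot r m"
proof -
 have L: "length m = Suc r" using m tens_gens_length by blast
 have c: "m ! 0 : \<A>" "m ! r : \<A>" using m by (auto intro: tens_gens_nth)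
 obtain y ys where y: "m = y # ys" using L by (cases m) auto
 show "dd (Suc r) 0 (\<one> # m) = m" using c(1) by (simp add: dd_def y)
 show "j < r ==> dd (Suc r) (Suc j) (\<one> # m) = \<one> # dd r j m" by (simp add: dd_def)
 have "drop r m = [m ! r]" using L by (metis Cons_nth_drop_Suc drop_all le_refl lessI)
 then show "dd (Suc r) (Suc r) (\<one> # m) = rot r m" using c(2) by (simp add: dd_def rot_def)
qed

lemma fd_one:
 assumes m: "m : tens_gens r"
 shows "fd (Suc r) (\<one> # m) = frag_of m - (\<Sum>j<r. frag_cmul ((- 1) ^ j) (frag_of (\<one> # dd r j m)))
 + frag_cmul ((- 1) ^ Suc r) (frag_of (rot r m))"
proof -
 have s: "(\<Sum>q\<le>Suc r. G q) = G 0 + (\<Sum>j<r. G (Suc j)) + G (Suc r)" for G :: "nat => 'x list \<Rightarrow>\<^sub>0 int"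
 by (simp add: sum.atMost_shift sum.lessThan_Suc add.assoc del: sum.atMost_Suc)
 have "(\<Sum>j<r. frag_cmul ((- 1) ^ Suc j) (frag_of (dd (Suc r) (Suc j) (\<one> # m))))
 = - (\<Sum>j<r. frag_cmul ((- 1) ^ j) (frag_of (\<one> # dd r j m)))"
 unfolding sum_negf[symmetric] using dd_one(2)[OF m] by (intro sum.cong) auto
 then show ?thesis unfolding fd_def s dd_one(1,3)[OF m] by simp
qed

lemma rot_rot:
 assumes L: "length l = Suc r"
 shows "rot r (rot 0 l) = rot r l" "i < r ==> rot r (rot (Suc i) l) = rot i l"
proof -
 show "rot r (rot 0 l) = rot r l" by (simp add: rot_def)
 assume i: "i < r"
 show "rot r (rot (Suc i) l) = rot i l"
 proof (rule nth_equalityI)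
 show "length (rot r (rot (Suc i) l)) = length (rot i l)" using L i by (simp add: rot_length[OF rot_length] rot_length)
 fix p assume "p < length (rot r (rot (Suc i) l))"
 then have p: "p <= r" using L i by (simp add: rot_length[OF rot_length])
 have L': "length (rot (Suc i) l) = Suc r" using rot_length[OF L] i by simp
 show "rot r (rot (Suc i) l) ! p = rot i l ! p"
 using L L' i p by (cases p) (auto simp: rot_nth)
 qed
qed

lemma minus_one_cong: "(even a \<longleftrightarrow> even b) ==> (- 1 :: int) ^ a = (- 1) ^ b"
 by (simp add: minus_one_power_iff)

lemma telescope:
 assumes l: "l : tens_gens r"
 shows "(\<Sum>i\<le>r. frag_cmul ((- 1) ^ (i * r)) (frag_cmul ((- 1) ^ Suc r) (frag_of (rot r (rot i l)))))
 = - (\<Sum>i\<le>r. frag_cmul ((- 1) ^ (i * r)) (frag_of (rot i l)))"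
proof -
 have L: "length l = Suc r" using l tens_gens_length by blast
 have "(\<Sum>i\<le>r. frag_cmul ((- 1) ^ (i * r)) (frag_cmul ((- 1) ^ Suc r) (frag_of (rot r (rot i l)))))
 = frag_cmul ((- 1) ^ Suc r) (frag_of (rot r l))
 + (\<Sum>i<r. frag_cmul ((- 1) ^ (Suc i * r)) (frag_cmul ((- 1) ^ Suc r) (frag_of (rot r (rot (Suc i) l)))))"
 by (subst sum.atMost_shift) (simp add: rot_rot(1)[OF L])
 also have "(\<Sum>i<r. frag_cmul ((- 1) ^ (Suc i * r)) (frag_cmul ((- 1) ^ Suc r) (frag_of (rot r (rot (Suc i) l)))))
 = (\<Sum>i<r. - frag_cmul ((- 1) ^ (i * r)) (frag_of (rot i l)))"
 proof (rule sum.cong[OF refl])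
 fix i assume "i : {..<r}"
 moreover have "(- 1 :: int) ^ (Suc i * r) * (- 1) ^ Suc r = - ((- 1) ^ (i * r))"
 by (simp add: power_add minus_one_power_iff)
 ultimately show "frag_cmul ((- 1) ^ (Suc i * r)) (frag_cmul ((- 1) ^ Suc r) (frag_of (rot r (rot (Suc i) l))))
 = - frag_cmul ((- 1) ^ (i * r)) (frag_of (rot i l))"
 using rot_rot(2)[OF L, of i] by (simp only: frag_cmul_cmul minus_frag_cmul) auto
 qed
 also have "frag_cmul ((- 1) ^ Suc r) (frag_of (rot r l)) = - frag_cmul ((- 1) ^ (r * r)) (frag_of (rot r l))"
 by (simp add: minus_one_power_iff)
 also have "- frag_cmul ((- 1) ^ (r * r)) (frag_of (rot r l)) + (\<Sum>i<r. - frag_cmul ((- 1) ^ (i * r)) (frag_of (rot i l)))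
 = - (\<Sum>i\<le>r. frag_cmul ((- 1) ^ (i * r)) (frag_of (rot i l)))"
 by (simp only: sum_negf lessThan_Suc_atMost[symmetric] sum.lessThan_Suc minus_add_distrib add.commute)
 finally show ?thesis .
qed

lemma dd_rot:
 assumes L: "length l = Suc (Suc r)"
 shows "[|i + j <= Suc r; i <= r; j <= r|] ==> dd (Suc r) j (rot i l) = rot i (dd (Suc r) (i + j) l)"
 "dd (Suc r) 0 (rot (Suc r) l) = rot 0 (dd (Suc r) (Suc r) l)"
 "[|Suc q + Suc r = i + j; i <= Suc r; j <= r|] ==> dd (Suc r) j (rot i l) = rot (i - 1) (dd (Suc r) q l)"
proof -
 show "dd (Suc r) j (rot i l) = rot i (dd (Suc r) (i + j) l)" if "i + j <= Suc r" "i <= r" "j <= r"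
 proof (rule nth_equalityI)
 have L1: "length (rot i l) = Suc (Suc r)" "length (dd (Suc r) (i + j) l) = Suc r" using L that by (simp_all add: rot_length dd_length)
 then show "length (dd (Suc r) j (rot i l)) = length (rot i (dd (Suc r) (i + j) l))" using that by (simp add: rot_length dd_length)
 fix p assume "p < length (dd (Suc r) j (rot i l))"
 then have "p <= r" using L1 that by (simp add: dd_length)
 then show "dd (Suc r) j (rot i l) ! p = rot i (dd (Suc r) (i + j) l) ! p"
 using that L L1 by (auto simp: dd_nth rot_nth ps_def nx_def)
 qed
 show "dd (Suc r) 0 (rot (Suc r) l) = rot 0 (dd (Suc r) (Suc r) l)"
 proof (rule nth_equalityI)
 have L1: "length (rot (Suc r) l) = Suc (Suc r)" "length (dd (Suc r) (Suc r) l) = Suc r" using L by (simp_all add: rot_length dd_length)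
 then show "length (dd (Suc r) 0 (rot (Suc r) l)) = length (rot 0 (dd (Suc r) (Suc r) l))" by (simp add: rot_length dd_length)
 fix p assume "p < length (dd (Suc r) 0 (rot (Suc r) l))"
 then have "p <= r" using L1 by (simp add: dd_length)
 then show "dd (Suc r) 0 (rot (Suc r) l) ! p = rot 0 (dd (Suc r) (Suc r) l) ! p"
 using L L1 by (auto simp: dd_nth rot_nth ps_def nx_def)
 qed
 show "dd (Suc r) j (rot i l) = rot (i - 1) (dd (Suc r) q l)" if *: "Suc q + Suc r = i + j" "i <= Suc r" "j <= r"
 proof -
 obtain e where e: "j = Suc q + e" using * by (metis add_le_mono1 le_Suc_ex le_add_diff_inverse2 nat_add_left_cancel_le add.commute)
 obtain d where r: "r = d + j" using *(3) by (metis le_add_diff_inverse2)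
 have i: "i = Suc (Suc (q + d))" using * r by simp
 show ?thesis
 proof (rule nth_equalityI)
 have L1: "length (rot i l) = Suc (Suc r)" "length (dd (Suc r) q l) = Suc r" using L * by (simp_all add: rot_length dd_length)
 then show "length (dd (Suc r) j (rot i l)) = length (rot (i - 1) (dd (Suc r) q l))" using * by (simp add: rot_length dd_length)
 fix p assume "p < length (dd (Suc r) j (rot i l))"
 then have p: "p <= r" using L1 * by (simp add: dd_length)
 consider "p <= e" | p' where "p = Suc e + p'" "p' < q" | "p = Suc e + q" | p' where "p = Suc (Suc (e + q)) + p'"
 by (metis add.assoc add_Suc_right add_Suc_shift le_Suc_ex less_iff_Suc_add linorder_neqE_nat not_less_eq_eq)
 then show "dd (Suc r) j (rot i l) ! p = rot (i - 1) (dd (Suc r) q l) ! p"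
 using L L1 p unfolding e i r by cases (simp_all add: dd_nth rot_nth ps_def nx_def)
 qed
 qed
qed

lemma fd_fB_0:
 assumes l: "l : tens_gens 0" shows "frag_extend (fd (Suc 0)) (fB 0 l) = 0"
proof -
 have "rot 0 l = l" by (simp add: rot_def)
 then show ?thesis by (simp add: fB_def fd_one[OF l])
qed

lemma fd_fB:
 assumes l: "l : tens_gens (Suc r)"
 shows "frag_extend (fB r) (fd (Suc r) l) + frag_extend (fd (Suc (Suc r))) (fB (Suc r) l) = 0"
proof -
 let ?R = "Suc r"
 have L: "length l = Suc ?R" using l tens_gens_length by blast
 define g where "g = (%(i, j). frag_cmul ((- 1) ^ (i * ?R + j)) (frag_of (\<one> # dd ?R j (rot i l))))"
 define g' where "g' = (%(q, i). frag_cmul ((- 1) ^ (q + i * r)) (frag_of (\<one> # rot i (dd ?R q l))))"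
 have 1: "frag_extend (fB r) (fd ?R l) = sum g' ({..?R} \<times> {..r})"
 unfolding fd_def
 by (simp only: frag_extend_sum finite_atMost o_def frag_extend_cmul frag_extend_of)
 (simp only: fB_def frag_cmul_sum frag_cmul_cmul g'_def prod.case power_add sum.cartesian_product)
 have "frag_extend (fd (Suc ?R)) (fB ?R l) = (\<Sum>i\<le>?R. frag_cmul ((- 1) ^ (i * ?R)) (fd (Suc ?R) (rl i l)))"
 unfolding fB_def by (simp only: frag_extend_sum finite_atMost o_def frag_extend_cmul frag_extend_of)
 also have "... = (\<Sum>i\<le>?R. frag_cmul ((- 1) ^ (i * ?R)) (frag_of (rot i l))
 - (\<Sum>j\<le>r. g (i, j)) + frag_cmul ((- 1) ^ (i * ?R)) (frag_cmul ((- 1) ^ Suc ?R) (frag_of (rot ?R (rot i l)))))"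
 proof (rule sum.cong[OF refl])
 fix i assume "i : {..?R}"
 then have m: "rot i l : tens_gens ?R" using l by (intro rot_gens) auto
 have d: "frag_cmul e (a - b + c) = frag_cmul e a - frag_cmul e b + frag_cmul e c" for e and a b c :: "'x list \<Rightarrow>\<^sub>0 int"
 by (rule poly_mapping_eqI) (simp add: lookup_add lookup_minus algebra_simps)
 show "frag_cmul ((- 1) ^ (i * ?R)) (fd (Suc ?R) (rl i l)) = frag_cmul ((- 1) ^ (i * ?R)) (frag_of (rot i l))
 - (\<Sum>j\<le>r. g (i, j)) + frag_cmul ((- 1) ^ (i * ?R)) (frag_cmul ((- 1) ^ Suc ?R) (frag_of (rot ?R (rot i l))))"
 unfolding fd_one[OF m] d lessThan_Suc_atMost by (simp only: frag_cmul_sum frag_cmul_cmul g_def prod.case power_add)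
 qed
 also have "... = - (\<Sum>i\<le>?R. \<Sum>j\<le>r. g (i, j))"
 proof -
 have "X - Y + - X = - Y" for X Y :: "'x list \<Rightarrow>\<^sub>0 int" by simp
 then show ?thesis unfolding sum.distrib sum_subtractf telescope[OF l] .
 qed
 also have "(\<Sum>i\<le>?R. \<Sum>j\<le>r. g (i, j)) = sum g ({..?R} \<times> {..r})"
 by (simp only: sum.cartesian_product case_prod_eta)
 also have "... = sum g' ({..?R} \<times> {..r})"
 proof (rule sum.reindex_bij_witness[where
 j = "%(i, j). if i = ?R & j = 0 then (?R, 0) else if i + j <= ?R then (i + j, i) else (i + j - ?R - 1, i - 1)"
 and i = "%(q, i). if q = ?R & i = 0 then (?R, 0) else if i <= q then (i, q - i) else (Suc i, q + ?R - i)"])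
 fix x assume "x : {..?R} \<times> {..r}"
 then obtain i j where x: "x = (i, j)" "i <= ?R" "j <= r" by auto
 consider "i = ?R" "j = 0" | "i + j <= ?R" "i <= r" | q where "Suc q + ?R = i + j"
 proof (cases "i + j <= ?R")
 case False
 then have "Suc (i + j - ?R - 1) + ?R = i + j" by simp
 then show ?thesis using that(3) by blast
 qed (use that x in \<open>cases "i = ?R"; auto\<close>)
 then show "g' ((%(i, j). if i = ?R & j = 0 then (?R, 0) else if i + j <= ?R then (i + j, i) else (i + j - ?R - 1, i - 1)) x) = g x"
 proof cases
 case 1
 have e: "(- 1 :: int) ^ ?R = (- 1) ^ (?R * ?R)" by (rule minus_one_cong) auto
 show ?thesis using 1 x dd_rot(2)[OF L] by (simp add: g_def g'_def e del: power_Suc)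
 next
 case 2
 have e: "(- 1 :: int) ^ (i + j + i * r) = (- 1) ^ (i * ?R + j)" by (rule arg_cong[where f = "(^) _"]) simp
 show ?thesis using 2 x dd_rot(1)[OF L 2 x(3)] e by (simp add: g_def g'_def del: power_Suc)
 next
 case (3 q)
 then obtain i' where i': "i = Suc i'" using x by (cases i) auto
 have q: "i + j - ?R - 1 = q" "~ i + j <= ?R" "~ (i = ?R & j = 0)" using 3 by auto
 have "even (q + i' * r) \<longleftrightarrow> even (i * ?R + j)"
 proof -
 have "q + i' * r + (2 * Suc r) = i * ?R + j" using 3 i' by (simp add: algebra_simps)
 then show ?thesis by (metis dvd_triv_left even_add)
 qed
 then have e: "(- 1 :: int) ^ (q + i' * r) = (- 1) ^ (i * ?R + j)" by (rule minus_one_cong)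
 show ?thesis unfolding x(1) prod.case if_not_P[OF q(3)] if_not_P[OF q(2)] q(1)
 using dd_rot(3)[OF L 3 x(2,3)] e i' by (simp add: g_def g'_def del: power_Suc mult_Suc_right)
 qed
 qed (auto split: if_splits)
 finally show ?thesis unfolding 1 by simp
qed

theorem norm_mixed_complex: "mixed_complex k \<N> norm_b norm_B"
proof (rule mixed_complex.intro)
 show "module k (\<N> r)" for r by (rule norm_module)
 show b: "norm_b (Suc r) : mod_hom k (\<N> (Suc r)) (\<N> r)" for r by (rule norm_b_spec)
 show B: "norm_B r : mod_hom k (\<N> r) (\<N> (Suc r))" for r by (rule norm_B_spec)
 show "norm_b (Suc r) (norm_b (Suc (Suc r)) x) = \<zero>\<^bsub>\<N> r\<^esub>" if "x : carrier (\<N> (Suc (Suc r)))" for x r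
 by (rule norm_b_b[OF that])
 show "norm_B (Suc r) (norm_B r x) = \<zero>\<^bsub>\<N> (Suc (Suc r))\<^esub>" if "x : carrier (\<N> r)" for x r
 by (rule norm_B_B[OF that])
 show "norm_b 1 (norm_B 0 x) = \<zero>\<^bsub>\<N> 0\<^esub>" if x: "x : carrier (\<N> 0)" for x
 proof -
 let ?z = "\<lambda>x\<in>carrier (\<N> 0). \<zero>\<^bsub>\<N> 0\<^esub>"
 have "compose (carrier (\<N> 0)) (norm_b (Suc 0)) (norm_B 0) = ?z"
 proof (rule norm_hom_eqI[OF norm_module mod_hom_compose[OF norm_module B b]])
 show "?z : mod_hom k (\<N> 0) (\<N> 0)"
 by (rule mod_hom_restrictI[OF norm_module]) auto
 fix l assume l: "l : tens_gens 0"
 have "norm_b (Suc 0) (norm_B 0 (cl 0 l)) = val 0 (frag_extend (fd (Suc 0)) (fB 0 l))"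
 unfolding norm_B_spec(2)[OF l] by (rule norm_hom_val[OF norm_b_spec]) (use keys_fB[OF l] in auto)
 then show "compose (carrier (\<N> 0)) (norm_b (Suc 0)) (norm_B 0) (cl 0 l) = ?z (cl 0 l)"
 using l by (simp add: compose_def fd_fB_0)
 qed
 from fun_cong[OF this, of x] show ?thesis using x by (simp add: compose_def)
 qed
 show "norm_B r (norm_b (Suc r) x) \<oplus>\<^bsub>\<N> (Suc r)\<^esub> norm_b (Suc (Suc r)) (norm_B (Suc r) x) = \<zero>\<^bsub>\<N> (Suc r)\<^esub>"
 if x: "x : carrier (\<N> (Suc r))" for x r
 proof -
 let ?X = "\<N> (Suc r)"
 let ?z = "\<lambda>x\<in>carrier ?X. \<zero>\<^bsub>?X\<^esub>"
 have "(\<lambda>x\<in>carrier ?X. norm_B r (norm_b (Suc r) x) \<oplus>\<^bsub>?X\<^esub> norm_b (Suc (Suc r)) (norm_B (Suc r) x)) = ?z"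
 proof (rule norm_hom_eqI[OF norm_module])
 show "?z : mod_hom k ?X ?X"
 by (rule mod_hom_restrictI[OF norm_module]) auto
 show "(\<lambda>x\<in>carrier ?X. norm_B r (norm_b (Suc r) x) \<oplus>\<^bsub>?X\<^esub> norm_b (Suc (Suc r)) (norm_B (Suc r) x)) : mod_hom k ?X ?X"
 by (rule mod_hom_restrictI[OF norm_module])
 (auto simp: mod_hom_closed[OF b] mod_hom_closed[OF B] mod_hom_add[OF b] mod_hom_add[OF B]
 mod_hom_smult[OF b] mod_hom_smult[OF B] NM.smult_r_distr NM.M.add.m_ac)
 fix l assume l: "l : tens_gens (Suc r)"
 have 1: "norm_b (Suc (Suc r)) (norm_B (Suc r) (cl (Suc r) l)) = val (Suc r) (frag_extend (fd (Suc (Suc r))) (fB (Suc r) l))"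
 unfolding norm_B_spec(2)[OF l] by (rule norm_hom_val[OF norm_b_spec]) (use keys_fB[OF l] in auto)
 have 2: "norm_B r (norm_b (Suc r) (cl (Suc r) l)) = val (Suc r) (frag_extend (fB r) (fd (Suc r) l))"
 unfolding norm_b_spec(2)[OF l] by (rule norm_hom_val[OF norm_B_spec keys_fd[OF l]])
 show "(\<lambda>x\<in>carrier ?X. norm_B r (norm_b (Suc r) x) \<oplus>\<^bsub>?X\<^esub> norm_b (Suc (Suc r)) (norm_B (Suc r) x)) (cl (Suc r) l) = ?z (cl (Suc r) l)"
 using l by (simp add: 1 2 val_add[symmetric] fd_fB)
 qed
 from fun_cong[OF this, of x] show ?thesis using x by simp
 qed
qed

end

section \<open>Arithmetic in a monogenic algebra\<close>

lemma (in abelian_group) c_u_identity: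
 assumes "p : carrier G" "g : carrier G" "v : carrier G" "w : carrier G" "q : carrier G"
 and "p \<oplus> g = v \<ominus> w"
 shows "g \<ominus> q = v \<ominus> (w \<oplus> (p \<oplus> q))"
proof -
 obtain p' g' v' w' q' where e: "p = frag_eval G atom p'" "g = frag_eval G atom g'"
 "v = frag_eval G atom v'" "w = frag_eval G atom w'" "q = frag_eval G atom q'"
 using assms(1-5)[THEN ex_frag_eval] by blast
 have "g = (v \<ominus> w) \<ominus> p" unfolding assms(6)[symmetric] unfolding e atom_eval by simp
 then have "g \<ominus> q = ((v \<ominus> w) \<ominus> p) \<ominus> q" by (rule arg_cong)
 also have "... = v \<ominus> (w \<oplus> (p \<oplus> q))" unfolding e atom_eval by (simp add: algebra_simps)
 finally show ?thesis .
qed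

locale monogenic_algebra = relative_algebra k K \<iota> A
 for k :: "('k, 'r) ring_scheme" and K :: "('k, 'a, 'm) module_scheme"
 and \<iota> :: "'a => 'x" and A :: "('k, 'x) module" (structure) +
 fixes \<alpha> :: "'a => 'a" and n :: nat and lam :: "nat => 'a" and x :: 'x and co :: "'x => nat => 'a"
 assumes alpha_hom: "\<alpha> : alg_hom k K K" and n_ge_2: "2 <= n"
 and lam_0: "lam 0 = \<one>\<^bsub>K\<^esub>"
 and lam_closed: "i <= n ==> lam i : carrier K"
 and alpha_lam: "i <= n ==> \<alpha> (lam i) = lam i"
 and lam_comm: "[|i <= n; c : carrier K|] ==> lam i \<otimes>\<^bsub>K\<^esub> c = (\<alpha> ^^ i) c \<otimes>\<^bsub>K\<^esub> lam i"
 and x_closed [simp]: "x : carrier A"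
 and x_iota: "c : carrier K ==> x \<otimes> \<iota> c = \<iota> (\<alpha> c) \<otimes> x"
 and f_zero: "(\<Oplus>i\<in>{..n}. \<iota> (lam (n - i)) \<otimes> x [^] i) = \<zero>"
 and co_closed [simp]: "[|a : carrier A; i < n|] ==> co a i : carrier K"
 and expand: "a : carrier A ==> a = (\<Oplus>i\<in>{..<n}. \<iota> (co a i) \<otimes> x [^] i)"
 and co_unique: "[|!!i. i < n ==> cs i : carrier K; j < n|] ==>
 co (\<Oplus>i\<in>{..<n}. \<iota> (cs i) \<otimes> x [^] i) j = cs j"
begin

abbreviation X :: "nat => 'x" where "X i \<equiv> x [^] i"

abbreviation tw :: "nat => 'a => 'a" where "tw i \<equiv> \<alpha> ^^ i"

lemma alpha_closed [simp]: "c : \<K> ==> \<alpha> c : \<K>"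
 and alpha_mult: "[|c : \<K>; d : \<K>|] ==> \<alpha> (c \<otimes>\<^bsub>K\<^esub> d) = \<alpha> c \<otimes>\<^bsub>K\<^esub> \<alpha> d"
 and alpha_add: "[|c : \<K>; d : \<K>|] ==> \<alpha> (c \<oplus>\<^bsub>K\<^esub> d) = \<alpha> c \<oplus>\<^bsub>K\<^esub> \<alpha> d"
 and alpha_one [simp]: "\<alpha> \<one>\<^bsub>K\<^esub> = \<one>\<^bsub>K\<^esub>"
 and alpha_smult: "[|e : carrier k; c : \<K>|] ==> \<alpha> (e \<odot>\<^bsub>K\<^esub> c) = e \<odot>\<^bsub>K\<^esub> \<alpha> c"
 using alpha_hom by (auto simp: alg_hom_def ring_hom_def)

lemma alpha_zero [simp]: "\<alpha> \<zero>\<^bsub>K\<^esub> = \<zero>\<^bsub>K\<^esub>"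
 using alpha_add[of "\<zero>\<^bsub>K\<^esub>" "\<zero>\<^bsub>K\<^esub>"] by (metis K.M.add.r_cancel_one' K.M.l_zero K.M.zero_closed alpha_closed)

lemma alpha_neg: "c : \<K> ==> \<alpha> (\<ominus>\<^bsub>K\<^esub> c) = \<ominus>\<^bsub>K\<^esub> \<alpha> c"
 using alpha_add[of "\<ominus>\<^bsub>K\<^esub> c" c] by (simp add: K.M.l_neg K.M.minus_equality)

lemma iota_zero [simp]: "\<iota> \<zero>\<^bsub>K\<^esub> = \<zero>"
 using iota_add[of "\<zero>\<^bsub>K\<^esub>" "\<zero>\<^bsub>K\<^esub>"] by (metis A.M.add.r_cancel_one' K.M.l_zero K.M.zero_closed iota_closed)

lemma iota_neg: "c : \<K> ==> \<iota> (\<ominus>\<^bsub>K\<^esub> c) = \<ominus> \<iota> c"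
 using iota_add[of "\<ominus>\<^bsub>K\<^esub> c" c] by (simp add: K.M.l_neg A.M.minus_equality)

lemma iota_minus: "[|c : \<K>; d : \<K>|] ==> \<iota> (c \<ominus>\<^bsub>K\<^esub> d) = \<iota> c \<ominus> \<iota> d"
 by (simp add: a_minus_def iota_add iota_neg)

lemma tw_closed [simp]: "c : \<K> ==> tw i c : \<K>"
 by (induction i) auto

lemma tw_mult: "[|c : \<K>; d : \<K>|] ==> tw i (c \<otimes>\<^bsub>K\<^esub> d) = tw i c \<otimes>\<^bsub>K\<^esub> tw i d"
 and tw_add: "[|c : \<K>; d : \<K>|] ==> tw i (c \<oplus>\<^bsub>K\<^esub> d) = tw i c \<oplus>\<^bsub>K\<^esub> tw i d"
 and tw_smult: "[|e : carrier k; c : \<K>|] ==> tw i (e \<odot>\<^bsub>K\<^esub> c) = e \<odot>\<^bsub>K\<^esub> tw i c"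
 and tw_zero [simp]: "tw i \<zero>\<^bsub>K\<^esub> = \<zero>\<^bsub>K\<^esub>"
 and tw_one [simp]: "tw i \<one>\<^bsub>K\<^esub> = \<one>\<^bsub>K\<^esub>"
 by (induction i) (auto simp: alpha_mult alpha_add alpha_smult)

lemma tw_tw: "tw i (tw j c) = tw (i + j) c"
 by (simp add: funpow_add)

lemma tw_fixed: "\<alpha> c = c ==> tw i c = c"
 by (induction i) auto

lemma X_add: "X (i + j) = X i ** X j"
 by (simp add: A.nat_pow_mult)

lemma X_Suc_left: "X (Suc i) = x ** X i"
 using X_add[of 1 i] by simp

lemma X_iota: "c : \<K> ==> X i ** \<iota> c = \<iota> (tw i c) ** X i"
proof (induction i)
 case (Suc i)
 then have "X (Suc i) ** \<iota> c = x ** (\<iota> (tw i c) ** X i)"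
 by (simp only: X_Suc_left) (simp add: A.m_assoc)
 also have "... = (x ** \<iota> (tw i c)) ** X i" using Suc by (simp add: A.m_assoc)
 also have "... = \<iota> (tw (Suc i) c) ** X (Suc i)"
 using Suc by (simp only: X_Suc_left x_iota tw_closed) (simp add: A.m_assoc)
 finally show ?case .
qed (simp add: A.l_one A.r_one)

subsection \<open>Homogeneous elements commuting with the variable\<close>

text \<open>Homogeneous elements of degree \<open>e\<close> that commute with the variable. Multiplication by them is
compatible with the twisted relations, which is what makes the operators below well defined.\<close>

definition Hm :: "nat => 'x set"
 where "Hm e = {q : \<A>. x ** q = q ** x & (ALL c:\<K>. q ** \<iota> c = \<iota> (tw e c) ** q)}"

lemma Hm_closed: "q : Hm e ==> q : \<A>"
 and Hm_x: "q : Hm e ==> x ** q = q ** x"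
 and Hm_iota: "[|q : Hm e; c : \<K>|] ==> q ** \<iota> c = \<iota> (tw e c) ** q"
 by (auto simp: Hm_def)

lemma Hm_mult:
 assumes "p : Hm d" "q : Hm e" shows "p ** q : Hm (d + e)"
proof -
 note [simp] = Hm_closed[OF assms(1)] Hm_closed[OF assms(2)]
 have "x ** (p ** q) = (x ** p) ** q" by (simp add: A.m_assoc)
 also have "... = p ** (x ** q)" by (simp add: Hm_x[OF assms(1)] A.m_assoc)
 also have "... = p ** q ** x" by (simp add: Hm_x[OF assms(2)] A.m_assoc)
 finally have 1: "x ** (p ** q) = p ** q ** x" .
 have "p ** q ** \<iota> c = \<iota> (tw (d + e) c) ** (p ** q)" if c: "c : \<K>" for c
 proof -
 have "p ** q ** \<iota> c = p ** (\<iota> (tw e c) ** q)" using c by (simp add: A.m_assoc Hm_iota[OF assms(2)])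
 also have "... = (p ** \<iota> (tw e c)) ** q" using c by (simp add: A.m_assoc)
 also have "... = \<iota> (tw (d + e) c) ** (p ** q)"
 using c by (simp add: Hm_iota[OF assms(1)] tw_tw A.m_assoc)
 finally show ?thesis .
 qed
 then show ?thesis using 1 by (simp add: Hm_def)
qed

lemma Hm_zero [simp]: "\<zero> : Hm e"
 by (simp add: Hm_def)

lemma Hm_one [simp]: "\<one> : Hm 0"
 by (simp add: Hm_def)

lemma Hm_add: "[|p : Hm e; q : Hm e|] ==> p \<oplus> q : Hm e"
 by (auto simp: Hm_def A.l_distr A.r_distr)

lemma Hm_neg: "q : Hm e ==> \<ominus> q : Hm e"
 by (auto simp: Hm_def A.l_minus A.r_minus)

lemma Hm_x_mem: "x : Hm (Suc 0)"
 by (simp add: Hm_def x_iota)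

lemma Hm_X [simp]: "X i : Hm i"
proof (induction i)
 case (Suc i)
 then show ?case using Hm_mult[OF Suc Hm_x_mem] by simp
qed simp

abbreviation L :: "nat => 'x" where "L i \<equiv> \<iota> (lam i)"

lemma iota_fixed_Hm:
 assumes "c : \<K>" "\<alpha> c = c" "!!d. d : \<K> ==> c \<otimes>\<^bsub>K\<^esub> d = tw e d \<otimes>\<^bsub>K\<^esub> c"
 shows "\<iota> c : Hm e"
 using assms by (auto simp: Hm_def x_iota iota_mult[symmetric])

abbreviation Z :: "nat => nat => 'x" where "Z i l \<equiv> L (n - i) ** X (i - l - 1)"

lemma L_Hm: "i <= n ==> L i : Hm i"
 by (intro iota_fixed_Hm lam_closed alpha_lam lam_comm)

lemma L_0 [simp]: "L 0 = \<one>"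
 by (simp add: lam_0)

lemma L_closed [simp]: "i <= n ==> L i : \<A>"
 using L_Hm Hm_closed by blast

text \<open>The weaker commutation that all coefficients produced by reduction modulo \<open>f\<close> share,
whatever their degree. It allows the factors to be reordered freely.\<close>

definition Com :: "'x set"
 where "Com = {y : \<A>. x ** y = y ** x & (ALL c:\<K>. \<alpha> c = c --> \<iota> c ** y = y ** \<iota> c)}"

lemma Com_closed: "y : Com ==> y : \<A>"
 by (simp add: Com_def)

lemma Com_x: "y : Com ==> x ** y = y ** x"
 and Com_iota: "[|y : Com; c : \<K>; \<alpha> c = c|] ==> \<iota> c ** y = y ** \<iota> c"
 by (auto simp: Com_def)

lemma Hm_Com: "q : Hm e ==> q : Com"
 by (auto simp: Com_def Hm_def tw_fixed)

lemma Com_mult: "[|p : Com; q : Com|] ==> p ** q : Com"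
proof -
 assume pq: "p : Com" "q : Com"
 note [simp] = Com_closed[OF pq(1)] Com_closed[OF pq(2)]
 have "z ** (p ** q) = p ** q ** z"
 if z: "z : \<A>" "z ** p = p ** z" "z ** q = q ** z" for z
 proof -
 have "z ** (p ** q) = (z ** p) ** q" using z(1) by (simp add: A.m_assoc)
 also have "... = p ** (z ** q)" unfolding z(2) using z(1) by (simp add: A.m_assoc)
 also have "... = p ** q ** z" unfolding z(3) using z(1) by (simp add: A.m_assoc)
 finally show ?thesis .
 qed
 then show ?thesis using pq by (auto simp: Com_def)
qed

lemma Com_add: "[|p : Com; q : Com|] ==> p \<oplus> q : Com"
 by (auto simp: Com_def A.l_distr A.r_distr)

lemma Com_neg: "q : Com ==> \<ominus> q : Com"
 by (auto simp: Com_def A.l_minus A.r_minus)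

lemma Com_X [simp]: "X i : Com"
 using Hm_X Hm_Com by blast

lemma Com_L [simp]: "i <= n ==> L i : Com"
 using L_Hm Hm_Com by blast

lemma Com_X_comm: "y : Com ==> X i ** y = y ** X i"
proof (induction i)
 case (Suc i)
 note [simp] = Com_closed[OF Suc.prems]
 have "X (Suc i) ** y = X i ** (x ** y)" by (simp add: A.m_assoc)
 also have "... = (X i ** y) ** x" by (simp add: Com_x[OF Suc.prems] A.m_assoc)
 finally show ?case using Suc by (simp add: A.m_assoc)
qed (simp add: Com_closed)

subsection \<open>Reduction of powers of the variable\<close>

text \<open>The remainder of \<open>x\<^sup>m\<close> modulo \<open>f\<close> is \<open>\<Sum>cK m l
x\<^sup>l\<close> over \<open>l < n\<close>; the recursion multiplies by \<open>x\<close> and eliminates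
\<open>x\<^sup>n\<close>.\<close>

fun cK :: "nat => nat => 'a" where
 "cK 0 l = (if l = 0 then \<one>\<^bsub>K\<^esub> else \<zero>\<^bsub>K\<^esub>)"
| "cK (Suc m) l = (if l = 0 then \<zero>\<^bsub>K\<^esub> else cK m (l - 1)) \<ominus>\<^bsub>K\<^esub> cK m (n - 1) \<otimes>\<^bsub>K\<^esub> lam (n - l)"

abbreviation cf :: "nat => nat => 'x" where "cf m l \<equiv> \<iota> (cK m l)"

lemma cK_closed [simp]: "cK m l : \<K>"
 by (induction m arbitrary: l) (auto intro!: K.M.minus_closed simp: lam_closed)

lemma alpha_cK: "\<alpha> (cK m l) = cK m l"
proof (induction m arbitrary: l)
 case (Suc m)
 have "cK m (n - 1) \<otimes>\<^bsub>K\<^esub> lam (n - l) : \<K>" by (simp add: lam_closed)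
 then show ?case using Suc
 by (simp add: a_minus_def alpha_add alpha_neg alpha_mult alpha_lam lam_closed)
qed auto

lemma cK_small: "[|m < n; l < n|] ==> cK m l = (if l = m then \<one>\<^bsub>K\<^esub> else \<zero>\<^bsub>K\<^esub>)"
 by (induction m arbitrary: l) (auto simp: lam_closed a_minus_def K.M.neg_zero)

lemma c_rec: "cf (Suc m) l = (if l = 0 then \<zero> else cf m (l - 1)) \<ominus> cf m (n - 1) ** L (n - l)"
 by (simp add: iota_minus iota_mult lam_closed)

lemma c_small: "[|m < n; l < n|] ==> cf m l = (if l = m then \<one> else \<zero>)"
 by (simp add: cK_small)

lemma c_Hm: "[|l <= m; l < n|] ==> cf m l : Hm (m - l)" and c_gt: "[|m < l; l < n|] ==> cf m l = \<zero>"
proof (induction m arbitrary: l)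
 case (Suc m)
 { case 1
 show ?case
 proof (cases "n - 1 <= m")
 case True
 have "cf m (n - 1) ** L (n - l) : Hm ((m - (n - 1)) + (n - l))"
 by (rule Hm_mult[OF Suc(1)[OF True] L_Hm]) (use n_ge_2 in auto)
 moreover have "(m - (n - 1)) + (n - l) = Suc m - l" using True 1 by auto
 moreover have "(if l = 0 then \<zero> else cf m (l - 1)) : Hm (Suc m - l)"
 using Suc(1)[of "l - 1"] 1 by (cases l) auto
 ultimately show ?thesis unfolding c_rec a_minus_def by (auto intro!: Hm_add Hm_neg)
 next
 case False
 then have "cf m (n - 1) = \<zero>" by (subst c_small) auto
 moreover have "(if l = 0 then \<zero> else cf m (l - 1)) : Hm (Suc m - l)"
 using Suc(1)[of "l - 1"] 1 by (cases l) auto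
 ultimately show ?thesis unfolding c_rec by (auto simp: a_minus_def A.M.neg_zero Hm_closed)
 qed
 next
 case 2
 then show ?case by (subst c_small) auto
 }
qed auto

lemma c_Com [simp]: "l < n ==> cf m l : Com"
 using c_Hm[of l m] c_gt[of m l] Hm_Com Hm_zero by (metis not_le)

text \<open>The class of the quotient of \<open>x\<^sup>m\<close> by \<open>f\<close>, obtained by the recursion that
accompanies the one for the remainder.\<close>

fun uq :: "nat => 'x" where
 "uq 0 = \<zero>"
| "uq (Suc m) = uq m ** x \<oplus> cf m (n - 1)"

lemma u_closed [simp]: "uq m : \<A>"
 by (induction m) auto

lemma u_small: "m < n ==> uq m = \<zero>"
proof (induction m)
 case (Suc m)
 then have "cf m (n - 1) = \<zero>" by (subst c_small) auto
 then show ?case using Suc by simp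
qed simp

lemma u_n: "uq n = \<one>"
proof -
 have 1: "Suc (n - 1) = n" "n - 1 < n" using n_ge_2 by auto
 have "uq (Suc (n - 1)) = \<one>"
 using u_small[OF 1(2)] c_small[OF 1(2) 1(2)] by simp
 then show ?thesis by (simp only: 1(1))
qed

lemma u_Hm: "uq m : Hm (m - n)"
proof (induction m)
 case (Suc m)
 show ?case
 proof (cases "Suc m < n")
 case True
 then show ?thesis by (simp only: u_small Hm_zero)
 next
 case False
 have "uq m ** x : Hm (Suc m - n)"
 proof (cases "m < n")
 case True
 then show ?thesis by (simp add: u_small)
 next
 case False
 then show ?thesis using Hm_mult[OF Suc Hm_x_mem] by (simp add: Suc_diff_le)
 qed
 moreover have "cf m (n - 1) : Hm (Suc m - n)"
 using c_Hm[of "n - 1" m] False n_ge_2 by (simp add: Suc_diff_le)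
 ultimately show ?thesis by (auto intro: Hm_add)
 qed
qed simp

lemma u_Com [simp]: "uq m : Com"
 using u_Hm Hm_Com by blast

lemma finsum_delta:
 assumes "j < n" "!!i. i < n ==> F i : \<A>" "!!i. [|i < n; i ~= j|] ==> F i = \<zero>"
 shows "(\<Oplus>i\<in>{..<n}. F i) = F j"
proof -
 have "(\<Oplus>i\<in>{..<n}. F i) = (\<Oplus>i\<in>{j}. F i)"
 by (rule A.M.add.finprod_mono_neutral_cong_right) (use assms in auto)
 then show ?thesis using assms by simp
qed

lemma finsum_top:
 assumes "!!i. i <= n ==> F i : \<A>"
 shows "(\<Oplus>i\<in>{..n}. F i) = F n \<oplus> (\<Oplus>i\<in>{..<n}. F i)"
proof -
 have "{..n} = insert n {..<n}" by auto
 then show ?thesis using assms by (simp only:) (subst A.M.finsum_insert, auto)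
qed

lemma finsum_shift:
 assumes "!!i. i < n ==> F i : \<A>" "!!i. i <= n ==> G i : \<A>"
 and "G 0 = \<zero>" "!!i. i < n ==> G (Suc i) = F i"
 shows "(\<Oplus>i\<in>{..<n}. F i) = F (n - 1) \<oplus> (\<Oplus>i\<in>{..<n}. G i)"
proof -
 obtain m where m: "n = Suc (Suc m)" using n_ge_2 by (metis Suc_le_D numeral_2_eq_2 le_Suc_ex add_Suc)
 have "(\<Oplus>i\<in>{..<n}. F i) = (\<Oplus>i\<in>{..Suc m}. F i)" by (simp add: m lessThan_Suc_atMost)
 also have "... = F (Suc m) \<oplus> (\<Oplus>i\<in>{..m}. F i)"
 using assms m by (subst A.M.finsum_Suc) auto
 also have "(\<Oplus>i\<in>{..m}. F i) = (\<Oplus>i\<in>{..m}. G (Suc i))"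
 using assms m by (intro A.M.finsum_cong') auto
 also have "... = (\<Oplus>i\<in>{..Suc m}. G i)"
 using assms m by (subst A.M.finsum_Suc2) (auto intro!: A.M.finsum_closed)
 finally show ?thesis by (simp add: m lessThan_Suc_atMost)
qed

lemma X_n: "X n = \<ominus> (\<Oplus>i\<in>{..<n}. L (n - i) ** X i)"
proof -
 have cl: "L (n - i) ** X i : \<A>" for i by simp
 have "X n \<oplus> (\<Oplus>i\<in>{..<n}. L (n - i) ** X i) = \<zero>"
 using f_zero finsum_top[of "%i. L (n - i) ** X i"] cl by simp
 then show ?thesis using A.M.finsum_closed[of "%i. L (n - i) ** X i" "{..<n}"]
 by (simp add: A.M.minus_equality)
qed

lemma finsum_rec:
 assumes F: "!!i. F i : \<A>" "!!i. F' i : \<A>" and z: "z : \<A>"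
 shows "(\<Oplus>i\<in>I. F i \<ominus> z ** F' i) = (\<Oplus>i\<in>I. F i) \<ominus> z ** (\<Oplus>i\<in>I. F' i)"
proof (induction I rule: infinite_finite_induct)
 case (insert i I)
 have cl: "(\<Oplus>i\<in>I. F i) : \<A>" "(\<Oplus>i\<in>I. F' i) : \<A>"
 using F by (auto intro: A.M.finsum_closed)
 have "(\<Oplus>i\<in>insert i I. F i \<ominus> z ** F' i) = (F i \<ominus> z ** F' i) \<oplus> ((\<Oplus>i\<in>I. F i) \<ominus> z ** (\<Oplus>i\<in>I. F' i))"
 using insert F z by (subst A.M.finsum_insert) auto
 also have "... = (F i \<oplus> (\<Oplus>i\<in>I. F i)) \<ominus> (z ** F' i \<oplus> z ** (\<Oplus>i\<in>I. F' i))"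
 using F z cl by (intro A.M.add_diff_add) auto
 finally show ?case using insert F z cl by (simp add: A.M.finsum_insert A.r_distr)
qed (use z in \<open>auto simp: a_minus_def A.M.neg_zero\<close>)

lemma X_reduce: "X m = (\<Oplus>l\<in>{..<n}. cf m l ** X l)"
proof (induction m)
 case 0
 show ?case using n_ge_2 by (subst finsum_delta[of 0]) auto
next
 case (Suc m)
 let ?z = "cf m (n - 1)"
 let ?G = "%l. (if l = 0 then \<zero> else cf m (l - 1)) ** X l"
 have z: "?z : \<A>" by simp
 have G: "?G l : \<A>" for l by simp
 have "X (Suc m) = (\<Oplus>l\<in>{..<n}. cf m l ** X l) ** x" using Suc by simp
 also have "... = (\<Oplus>l\<in>{..<n}. cf m l ** X (Suc l))"
 by (subst A.finsum_ldistr) (auto simp: A.m_assoc)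
 also have "... = ?z ** X n \<oplus> (\<Oplus>l\<in>{..<n}. ?G l)"
 using n_ge_2 by (subst finsum_shift[where G = ?G]) auto
 also have "... = (\<Oplus>l\<in>{..<n}. ?G l) \<ominus> ?z ** (\<Oplus>i\<in>{..<n}. L (n - i) ** X i)"
 using A.M.finsum_closed[of ?G "{..<n}"] A.M.finsum_closed[of "%i. L (n - i) ** X i" "{..<n}"]
 unfolding X_n by (simp add: A.r_minus a_minus_def A.M.a_comm)
 also have "... = (\<Oplus>l\<in>{..<n}. ?G l \<ominus> ?z ** (L (n - l) ** X l))"
 by (rule finsum_rec[symmetric]) auto
 also have "... = (\<Oplus>l\<in>{..<n}. cf (Suc m) l ** X l)"
 by (rule A.M.finsum_cong') (auto simp: c_rec a_minus_def A.l_distr A.l_minus A.m_assoc simp del: cK.simps)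
 finally show ?case .
qed

lemma co_X: "l < n ==> co (X m) l = cK m l"
 using co_unique[of "cK m" l] X_reduce[of m] by simp

text \<open>The sequences \<open>cf _ l\<close> satisfy the recurrence given by \<open>f\<close>.\<close>

lemma finsum_L_rec:
 assumes "!!i. F i : \<A>" "!!i. F' i : \<A>" "z : Com"
 shows "(\<Oplus>i\<in>{..n}. L (n - i) ** (F i \<ominus> F' i ** z))
 = (\<Oplus>i\<in>{..n}. L (n - i) ** F i) \<ominus> (\<Oplus>i\<in>{..n}. L (n - i) ** F' i) ** z"
proof -
 have z: "z : \<A>" by (rule Com_closed[OF assms(3)])
 have "(\<Oplus>i\<in>I. L (n - i) ** (F i \<ominus> F' i ** z))
 = (\<Oplus>i\<in>I. L (n - i) ** F i) \<ominus> (\<Oplus>i\<in>I. L (n - i) ** F' i) ** z" for I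
 proof (induction I rule: infinite_finite_induct)
 case (insert i I)
 have cl: "(\<Oplus>i\<in>I. L (n - i) ** F i) : \<A>" "(\<Oplus>i\<in>I. L (n - i) ** F' i) : \<A>"
 using assms by (auto intro: A.M.finsum_closed)
 have "(\<Oplus>i\<in>insert i I. L (n - i) ** (F i \<ominus> F' i ** z))
 = (L (n - i) ** F i \<ominus> L (n - i) ** F' i ** z) \<oplus> ((\<Oplus>i\<in>I. L (n - i) ** F i) \<ominus> (\<Oplus>i\<in>I. L (n - i) ** F' i) ** z)"
 using insert assms z by (subst A.M.finsum_insert) (auto simp: a_minus_def A.r_distr A.r_minus A.m_assoc)
 also have "... = (L (n - i) ** F i \<oplus> (\<Oplus>i\<in>I. L (n - i) ** F i)) \<ominus> (L (n - i) ** F' i ** z \<oplus> (\<Oplus>i\<in>I. L (n - i) ** F' i) ** z)"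
 using assms z cl by (intro A.M.add_diff_add) auto
 finally show ?case using insert assms z cl by (simp add: A.M.finsum_insert A.l_distr)
 qed (use z in \<open>auto simp: a_minus_def A.M.neg_zero\<close>)
 then show ?thesis .
qed

text \<open>Applying the recurrence of \<open>f\<close> to the remainders gives the remainder of \<open>x\<^sup>j
f\<close>, which is zero.\<close>

lemma L_c: "l < n ==> (\<Oplus>i\<in>{..n}. L (n - i) ** cf (i + j) l) = \<zero>"
proof (induction j arbitrary: l)
 case 0
 have 1: "Suc (n - 1) = n" "n - 1 < n" using n_ge_2 by auto
 have cn: "cf n l = \<ominus> L (n - l)"
 proof -
 have "(if l = 0 then \<zero> else cf (n - 1) (l - 1)) = \<zero>"
 using 0 c_small[OF 1(2), of "l - 1"] by (cases l) auto
 moreover have "cf (Suc (n - 1)) l = (if l = 0 then \<zero> else cf (n - 1) (l - 1)) \<ominus> cf (n - 1) (n - 1) ** L (n - l)"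
 by (rule c_rec)
 ultimately have "cf (Suc (n - 1)) l = \<ominus> L (n - l)"
 using c_small[OF 1(2) 1(2)] by (simp add: a_minus_def del: cK.simps)
 then show ?thesis by (simp only: 1(1))
 qed
 have "(\<Oplus>i\<in>{..n}. L (n - i) ** cf (i + 0) l) = cf n l \<oplus> (\<Oplus>i\<in>{..<n}. L (n - i) ** cf i l)"
 by (subst finsum_top) auto
 also have "(\<Oplus>i\<in>{..<n}. L (n - i) ** cf i l) = L (n - l)"
 using 0 by (subst finsum_delta[of l]) (auto simp: c_small)
 finally show ?case by (simp add: cn A.M.l_neg)
next
 case (Suc j)
 let ?z = "L (n - l)"
 have "(\<Oplus>i\<in>{..n}. L (n - i) ** cf (i + Suc j) l)
 = (\<Oplus>i\<in>{..n}. L (n - i) ** ((if l = 0 then \<zero> else cf (i + j) (l - 1)) \<ominus> cf (i + j) (n - 1) ** ?z))"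
 by (simp only: add_Suc_right c_rec)
 also have "... = (\<Oplus>i\<in>{..n}. L (n - i) ** (if l = 0 then \<zero> else cf (i + j) (l - 1)))
 \<ominus> (\<Oplus>i\<in>{..n}. L (n - i) ** cf (i + j) (n - 1)) ** ?z"
 by (rule finsum_L_rec) auto
 also have "(\<Oplus>i\<in>{..n}. L (n - i) ** (if l = 0 then \<zero> else cf (i + j) (l - 1))) = \<zero>"
 proof (cases "l = 0")
 case True
 have "(\<Oplus>i\<in>{..n}. L (n - i) ** \<zero>) = (\<Oplus>i\<in>{..n}. \<zero>)"
 by (rule A.M.finsum_cong') auto
 then show ?thesis using True by simp
 next
 case False
 then show ?thesis using Suc(1)[of "l - 1"] Suc(2) by simp
 qed
 also have "(\<Oplus>i\<in>{..n}. L (n - i) ** cf (i + j) (n - 1)) = \<zero>"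
 using n_ge_2 by (intro Suc(1)) auto
 finally show ?case by (simp add: a_minus_def A.M.neg_zero)
qed

lemma L_X: "(\<Oplus>i\<in>{..n}. L (n - i) ** X (i + j)) = \<zero>"
proof -
 have "(\<Oplus>i\<in>{..n}. L (n - i) ** X (i + j)) = (\<Oplus>i\<in>{..n}. (L (n - i) ** X i) ** X j)"
 by (rule A.M.finsum_cong') (auto simp: X_add A.m_assoc)
 also have "... = (\<Oplus>i\<in>{..n}. L (n - i) ** X i) ** X j"
 by (rule A.finsum_ldistr[symmetric]) auto
 finally show ?thesis by (simp add: f_zero)
qed

text \<open>The quotient of \<open>x\<^sup>j f\<close> by \<open>f\<close>.\<close>

lemma L_u: "(\<Oplus>i\<in>{..n}. L (n - i) ** uq (i + j)) = X j"
proof (induction j)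
 case 0
 have "(\<Oplus>i\<in>{..n}. L (n - i) ** uq (i + 0)) = uq n \<oplus> (\<Oplus>i\<in>{..<n}. L (n - i) ** uq i)"
 by (subst finsum_top) auto
 also have "(\<Oplus>i\<in>{..<n}. L (n - i) ** uq i) = (\<Oplus>i\<in>{..<n}. \<zero>)"
 by (rule A.M.finsum_cong') (auto simp: u_small)
 finally show ?case by (simp add: u_n)
next
 case (Suc j)
 have "(\<Oplus>i\<in>{..n}. L (n - i) ** uq (i + Suc j))
 = (\<Oplus>i\<in>{..n}. L (n - i) ** uq (i + j) ** x \<oplus> L (n - i) ** cf (i + j) (n - 1))"
 by (rule A.M.finsum_cong') (auto simp: A.r_distr A.m_assoc)
 also have "... = (\<Oplus>i\<in>{..n}. L (n - i) ** uq (i + j) ** x) \<oplus> (\<Oplus>i\<in>{..n}. L (n - i) ** cf (i + j) (n - 1))"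
 by (rule A.M.finsum_addf) auto
 also have "(\<Oplus>i\<in>{..n}. L (n - i) ** cf (i + j) (n - 1)) = \<zero>"
 using n_ge_2 by (intro L_c) auto
 also have "(\<Oplus>i\<in>{..n}. L (n - i) ** uq (i + j) ** x) = (\<Oplus>i\<in>{..n}. L (n - i) ** uq (i + j)) ** x"
 by (rule A.finsum_ldistr[symmetric]) auto
 finally show ?case using Suc by simp
qed

text \<open>Multiply \<open>x\<^sup>m = uq m f + \<Sum>cf m l x\<^sup>l\<close> by \<open>x\<^sup>j\<close> and
compare quotients. Associativity of the reduction enters the boundary identities only in this form.\<close>

lemma c_u: "(\<Oplus>l\<in>{..<n}. cf m l ** uq (l + j)) = uq (m + j) \<ominus> X j ** uq m"
proof (induction m arbitrary: j)
 case 0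
 show ?case using n_ge_2 by (subst finsum_delta[of 0]) (auto simp: a_minus_def A.M.neg_zero)
next
 case (Suc m)
 let ?z = "cf m (n - 1)"
 let ?G = "%l. (if l = 0 then \<zero> else cf m (l - 1)) ** uq (l + j)"
 let ?L = "\<Oplus>i\<in>{..<n}. L (n - i) ** uq (i + j)"
 have cl: "?L : \<A>" "(\<Oplus>l\<in>{..<n}. ?G l) : \<A>" by (auto intro: A.M.finsum_closed)
 have "(\<Oplus>l\<in>{..<n}. cf (Suc m) l ** uq (l + j)) = (\<Oplus>l\<in>{..<n}. ?G l \<ominus> ?z ** (L (n - l) ** uq (l + j)))"
 by (rule A.M.finsum_cong') (auto simp: c_rec a_minus_def A.l_distr A.l_minus A.m_assoc simp del: cK.simps)
 also have "... = (\<Oplus>l\<in>{..<n}. ?G l) \<ominus> ?z ** ?L"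
 by (rule finsum_rec) auto
 finally have 1: "(\<Oplus>l\<in>{..<n}. cf (Suc m) l ** uq (l + j)) = (\<Oplus>l\<in>{..<n}. ?G l) \<ominus> ?z ** ?L" .
 have "(\<Oplus>l\<in>{..<n}. cf m l ** uq (l + Suc j)) = ?z ** uq (n + j) \<oplus> (\<Oplus>l\<in>{..<n}. ?G l)"
 using n_ge_2 by (subst finsum_shift[where G = ?G]) auto
 then have 2: "?z ** uq (n + j) \<oplus> (\<Oplus>l\<in>{..<n}. ?G l) = uq (m + Suc j) \<ominus> X (Suc j) ** uq m"
 using Suc[of "Suc j"] by simp
 have 3: "uq (n + j) \<oplus> ?L = X j"
 using L_u[of j] finsum_top[of "%i. L (n - i) ** uq (i + j)"] by simp
 have 4: "X j ** uq (Suc m) = X (Suc j) ** uq m \<oplus> (?z ** uq (n + j) \<oplus> ?z ** ?L)"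
 proof -
 have "X j ** uq (Suc m) = X j ** (x ** uq m) \<oplus> X j ** ?z"
 using Com_x[OF u_Com, of m] by (simp add: A.r_distr)
 also have "X j ** ?z = ?z ** X j" using n_ge_2 by (intro Com_X_comm c_Com) auto
 also have "?z ** X j = ?z ** uq (n + j) \<oplus> ?z ** ?L"
 unfolding 3[symmetric] using cl by (simp add: A.r_distr)
 finally show ?thesis by (simp add: A.m_assoc)
 qed
 show ?case unfolding 1 4
 using A.M.c_u_identity[OF _ _ _ _ _ 2, of "?z ** ?L"] cl by simp
qed

end

section \<open>Formal chains on monomial words\<close>

context monogenic_algebra
begin

text \<open>A pair \<open>(a, w)\<close> stands for \<open>a \<otimes> x\<^sup>i\<^sup>1 \<otimes> \<dots> \<otimes>
x\<^sup>i\<^sup>r\<close> with \<open>w = [i\<^sub>1, \<dots>, i\<^sub>r]\<close>.\<close>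

type_synonym 'y chain = "('y \<times> nat list) \<Rightarrow>\<^sub>0 int"

abbreviation g :: "'x => nat list => 'x chain" where "g a w \<equiv> frag_of (a, w)"

definition lift :: "('x => nat list => 'x chain) => 'x chain => 'x chain"
 where "lift G = frag_extend (%p. G (fst p) (snd p))"

lemma lift_g [simp]: "lift G (g a w) = G a w"
 and lift_zero [simp]: "lift G 0 = 0"
 and lift_add: "lift G (v + v') = lift G v + lift G v'"
 and lift_diff: "lift G (v - v') = lift G v - lift G v'"
 and lift_neg: "lift G (- v) = - lift G v"
 by (simp_all add: lift_def frag_extend_add frag_extend_diff frag_extend_minus)

lemma lift_sum: "lift G (sum f I) = (\<Sum>i\<in>I. lift G (f i))"
 by (cases "finite I") (simp_all add: lift_def frag_extend_sum o_def)

lemma chain_ext: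
 assumes "!!a w. F (g a w) = F' (g a w)" "F 0 = F' 0"
 "!!v v'. F (v - v') = F v - F v'" "!!v v'. F' (v - v') = F' v - (F' v' :: 'x chain)"
 shows "F v = F' v"
proof -
 have "Poly_Mapping.keys v <= UNIV" by simp
 then show ?thesis
 proof (induction v rule: frag_induction)
 case (one p)
 then show ?case using assms(1)[of "fst p" "snd p"] by simp
 qed (simp_all add: assms)
qed

text \<open>The relations between chains. Carrying a scalar once around the cyclic tensor twists it by
\<open>\<alpha>\<close> to the length of the word; the additional twist \<open>t\<close> accounts for
powers of \<open>f\<close> that have been split off, and is \<open>m n\<close> for the small complex in
degrees \<open>2 m\<close> and \<open>2 m + 1\<close>.\<close>

inductive_set N :: "nat => 'x chain set" for t where
 N_zero: "0 : N t"
| N_diff: "[|v : N t; v' : N t|] ==> v - v' : N t"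
| N_add: "[|a : \<A>; b : \<A>|] ==> g (a \<oplus> b) w - g a w - g b w : N t"
| N_twist: "[|a : \<A>; d : \<K>|] ==>
 g (\<iota> d ** a) w - g (a ** \<iota> (tw (t + sum_list w) d)) w : N t"

lemma N_neg: "v : N t ==> - v : N t"
 using N_diff[OF N_zero, of v] by simp

lemma N_plus: "[|v : N t; v' : N t|] ==> v + v' : N t"
 using N_diff[OF _ N_neg, of v t v'] by simp

definition eqv :: "nat => 'x chain => 'x chain => bool"
 where "eqv t v v' \<longleftrightarrow> v - v' : N t"

lemma eqv_refl [simp]: "eqv t v v"
 by (simp add: eqv_def N_zero)

lemma eqv_sym: "eqv t v v' ==> eqv t v' v"
 unfolding eqv_def using N_neg[of "v - v'" t] by simp

lemma eqv_trans [trans]: "[|eqv t v v'; eqv t v' v''|] ==> eqv t v v''"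
 unfolding eqv_def using N_plus[of "v - v'" t "v' - v''"] by simp

lemma eqv_add: "[|eqv t v v'; eqv t y y'|] ==> eqv t (v + y) (v' + y')"
 unfolding eqv_def using N_plus[of "v - v'" t "y - y'"] by (simp add: algebra_simps)

lemma eqv_neg: "eqv t v v' ==> eqv t (- v) (- v')"
 unfolding eqv_def using N_neg[of "v - v'" t] by simp

lemma eqv_diff: "[|eqv t v v'; eqv t y y'|] ==> eqv t (v - y) (v' - y')"
 using eqv_add[OF _ eqv_neg] by fastforce

lemma eqv_sum: "(!!i. i : I ==> eqv t (f i) (f' i)) ==> eqv t (sum f I) (sum f' I)"
 by (induction I rule: infinite_finite_induct) (auto intro: eqv_add)

lemma eqv_g_add: "[|a : \<A>; b : \<A>|] ==> eqv t (g (a \<oplus> b) w) (g a w + g b w)"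
 using N_add[of a b w t] by (simp add: eqv_def diff_diff_eq)

lemma eqv_g_twist:
 "[|a : \<A>; d : \<K>|] ==> eqv t (g (\<iota> d ** a) w) (g (a ** \<iota> (tw (t + sum_list w) d)) w)"
 using N_twist[of a d w t] by (simp add: eqv_def)

lemma eqv_g_fixed:
 "[|a : \<A>; d : \<K>; \<alpha> d = d|] ==> eqv t (g (\<iota> d ** a) w) (g (a ** \<iota> d) w)"
 using eqv_g_twist[of a d t w] by (simp add: tw_fixed)

definition ad :: "'x set => nat => ('x => 'x chain) => bool"
 where "ad S t F \<longleftrightarrow> (ALL a:S. ALL b:S. eqv t (F (a \<oplus> b)) (F a + F b))"

definition sgp :: "'x set => bool"
 where "sgp S \<longleftrightarrow> S <= \<A> & \<zero> : S & (ALL a:S. ALL b:S. a \<oplus> b : S) & (ALL a:S. \<ominus> a : S)"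

lemma sgp_carrier [simp]: "sgp (\<A>)" and sgp_Com [simp]: "sgp Com"
 by (auto simp: sgp_def Com_add Com_neg Com_closed intro: Hm_Com[OF Hm_zero])

lemma ad_zero: "[|ad S t F; sgp S|] ==> eqv t (F \<zero>) 0"
proof -
 assume "ad S t F" "sgp S"
 then have "eqv t (F (\<zero> \<oplus> \<zero>)) (F \<zero> + F \<zero>)" unfolding ad_def sgp_def by blast
 then have "eqv t (F \<zero>) (F \<zero> + F \<zero>)" by simp
 from eqv_diff[OF this eqv_refl[of t "F \<zero>"]] show ?thesis by (auto intro: eqv_sym)
qed

lemma ad_neg: "[|ad S t F; sgp S; a : S|] ==> eqv t (F (\<ominus> a)) (- F a)"
proof -
 assume *: "ad S t F" "sgp S" "a : S"
 then have "eqv t (F (\<ominus> a \<oplus> a)) (F (\<ominus> a) + F a)" unfolding ad_def sgp_def by blast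
 moreover have "\<ominus> a \<oplus> a = \<zero>" using * by (auto simp: sgp_def A.M.l_neg)
 ultimately have "eqv t (F (\<ominus> a) + F a) 0" using ad_zero[OF *(1,2)] by (auto intro: eqv_sym eqv_trans)
 from eqv_diff[OF this eqv_refl[of t "F a"]] show ?thesis by simp
qed

lemma ad_plus: "[|ad S t F; a : S; b : S|] ==> eqv t (F (a \<oplus> b)) (F a + F b)"
 by (auto simp: ad_def)

lemma ad_minus: "[|ad S t F; sgp S; a : S; b : S|] ==> eqv t (F (a \<ominus> b)) (F a - F b)"
proof -
 assume *: "ad S t F" "sgp S" "a : S" "b : S"
 then have "eqv t (F (a \<ominus> b)) (F a + F (\<ominus> b))" unfolding a_minus_def ad_def sgp_def by blast
 also have "eqv t (F a + F (\<ominus> b)) (F a + - F b)" by (intro eqv_add eqv_refl ad_neg[OF *(1,2,4)])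
 finally show ?thesis by simp
qed

lemma sgp_finsum: "[|sgp S; !!i. i : I ==> f i : S|] ==> (\<Oplus>i\<in>I. f i) : S"
proof (induction I rule: infinite_finite_induct)
 case (insert i I)
 then show ?case by (subst A.M.finsum_insert) (auto simp: sgp_def)
qed (auto simp: sgp_def)

lemma ad_finsum: "[|ad S t F; sgp S; !!i. i : I ==> f i : S|] ==> eqv t (F (\<Oplus>i\<in>I. f i)) (\<Sum>i\<in>I. F (f i))"
proof (induction I rule: infinite_finite_induct)
 case (insert i I)
 have "(\<Oplus>i\<in>I. f i) : S" using insert by (intro sgp_finsum) auto
 then have "eqv t (F (f i \<oplus> (\<Oplus>i\<in>I. f i))) (F (f i) + F (\<Oplus>i\<in>I. f i))"
 using insert by (auto simp: ad_def)
 also have "eqv t (F (f i) + F (\<Oplus>i\<in>I. f i)) (F (f i) + (\<Sum>i\<in>I. F (f i)))"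
 using insert by (intro eqv_add) auto
 finally show ?case using insert by (subst A.M.finsum_insert) (auto simp: sgp_def)
qed (auto simp: ad_zero)

lemma ad_add: "[|ad S t F; ad S t F'|] ==> ad S t (%a. F a + F' a)"
 unfolding ad_def
proof (intro ballI)
 fix a b assume *: "ALL a:S. ALL b:S. eqv t (F (a \<oplus> b)) (F a + F b)" "ALL a:S. ALL b:S. eqv t (F' (a \<oplus> b)) (F' a + F' b)" "a : S" "b : S"
 then have "eqv t (F (a \<oplus> b) + F' (a \<oplus> b)) ((F a + F b) + (F' a + F' b))" by (intro eqv_add) auto
 then show "eqv t (F (a \<oplus> b) + F' (a \<oplus> b)) (F a + F' a + (F b + F' b))" by (simp add: algebra_simps)
qed

lemma ad_uminus: "ad S t F ==> ad S t (%a. - F a)"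
 unfolding ad_def using eqv_neg by (metis minus_add_distrib)

lemma ad_const_zero [simp]: "ad S t (%a. 0)"
 by (simp add: ad_def)

lemma ad_subset: "ad S t F ==> S' <= S ==> ad S' t F"
 by (auto simp: ad_def)

lemma ad_g: "[|p : \<A>; q : \<A>|] ==> ad (\<A>) t (%a. g (p ** a ** q) w)"
 unfolding ad_def by (auto simp: A.l_distr A.r_distr intro!: eqv_g_add)

lemma ad_g': "ad (\<A>) t (%a. g a w)"
 unfolding ad_def by (auto intro!: eqv_g_add)

subsection \<open>Well-defined operators\<close>

definition sm :: "'k => 'x chain => 'x chain" where "sm e = lift (%a w. g (e \<odot> a) w)"

lemmas sm_simps = sm_def[THEN fun_cong, THEN trans, OF lift_g] lift_zero[of "%a w. g (e \<odot> a) w" for e, folded sm_def]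
 lift_add[of "%a w. g (e \<odot> a) w" for e, folded sm_def] lift_diff[of "%a w. g (e \<odot> a) w" for e, folded sm_def]
 lift_neg[of "%a w. g (e \<odot> a) w" for e, folded sm_def] lift_sum[of "%a w. g (e \<odot> a) w" for e, folded sm_def]

text \<open>The conditions on the values at \<open>(a, w)\<close>, as functions of \<open>a\<close>, under which an
operator respects the relations and the scalars.\<close>

definition wd :: "nat => nat => ('x => 'x chain) => bool"
 where "wd s t F \<longleftrightarrow> ad (\<A>) t F
 & (ALL a:\<A>. ALL d:\<K>. eqv t (F (\<iota> d ** a)) (F (a ** \<iota> (tw s d))))
 & (ALL a:\<A>. ALL e:carrier k. eqv t (F (e \<odot> a)) (sm e (F a)))"

lemma wdD:
 assumes "wd s t F"
 shows "ad (\<A>) t F"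
 "[|a : \<A>; d : \<K>|] ==> eqv t (F (\<iota> d ** a)) (F (a ** \<iota> (tw s d)))"
 "[|a : \<A>; e : carrier k|] ==> eqv t (F (e \<odot> a)) (sm e (F a))"
 using assms by (auto simp: wd_def)

lemma wd_zero [simp]: "wd s t (%a. 0)"
 by (simp add: wd_def sm_simps)

lemma wd_add: "[|wd s t F; wd s t F'|] ==> wd s t (%a. F a + F' a)"
 unfolding wd_def by (auto intro!: ad_add eqv_add simp: sm_simps)

lemma wd_neg: "wd s t F ==> wd s t (%a. - F a)"
 unfolding wd_def by (auto intro!: ad_uminus eqv_neg simp: sm_simps)

lemma wd_diff: "[|wd s t F; wd s t F'|] ==> wd s t (%a. F a - F' a)"
 using wd_add[OF _ wd_neg] by fastforce

lemma wd_sum: "(!!i. i : I ==> wd s t (F i)) ==> wd s t (%a. \<Sum>i\<in>I. F i a)"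
 by (induction I rule: infinite_finite_induct) (auto intro: wd_add)

lemma wd_g:
 assumes p: "p : Hm d" and q: "q : Hm e" and s: "s = d + e + t + sum_list w"
 shows "wd s t (%a. g (p ** a ** q) w)"
 unfolding wd_def
proof (intro conjI ballI)
 note [simp] = Hm_closed[OF p] Hm_closed[OF q]
 show "ad (\<A>) t (%a. g (p ** a ** q) w)" by (rule ad_g) simp_all
 fix a assume a: "a : \<A>"
 {
 fix y assume y: "y : \<K>"
 have "p ** (\<iota> y ** a) ** q = (p ** \<iota> y) ** a ** q" using a y by (simp add: A.m_assoc)
 also have "... = \<iota> (tw d y) ** (p ** a ** q)" using a y by (simp add: Hm_iota[OF p] A.m_assoc)
 finally have "eqv t (g (p ** (\<iota> y ** a) ** q) w) (g (p ** a ** q ** \<iota> (tw (t + sum_list w) (tw d y))) w)"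
 using a y by (simp only:) (intro eqv_g_twist, simp_all)
 also have "p ** a ** q ** \<iota> (tw (t + sum_list w) (tw d y)) = p ** (a ** \<iota> (tw s y)) ** q"
 proof -
 have "q ** \<iota> (tw (t + sum_list w) (tw d y)) = \<iota> (tw s y) ** q"
 using y s by (simp add: Hm_iota[OF q] tw_tw add.commute add.left_commute)
 then show ?thesis using a y by (simp add: A.m_assoc)
 qed
 finally show "eqv t (g (p ** (\<iota> y ** a) ** q) w) (g (p ** (a ** \<iota> (tw s y)) ** q) w)" .
 next
 fix e assume "e : carrier k"
 then show "eqv t (g (p ** (e \<odot> a) ** q) w) (sm e (g (p ** a ** q) w))"
 using a by (simp add: sm_simps A.smult_mult_left A.smult_mult_right)
 }
qed

lemma wd_cong:
 assumes "wd s t F'" "!!a. a : \<A> ==> F a = F' a"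
 shows "wd s t F"
 using assms by (auto simp: wd_def ad_def)

lemma wd_g_left: "[|p : Hm d; s = d + t + sum_list w|] ==> wd s t (%a. g (p ** a) w)"
 by (rule wd_cong[OF wd_g[of p d "\<one>" 0]]) (auto simp: Hm_closed)

lemma wd_g_right: "[|q : Hm e; s = e + t + sum_list w|] ==> wd s t (%a. g (a ** q) w)"
 by (rule wd_cong[OF wd_g[of "\<one>" 0 q e]]) (auto simp: Hm_closed)

lemma wd_g_id: "s = t + sum_list w ==> wd s t (%a. g a w)"
 by (rule wd_cong[OF wd_g[of "\<one>" 0 "\<one>" 0]]) auto

lemma lift_N:
 assumes "!!w. wd (t + sum_list w) t' (%a. G a w)" and "v : N t"
 shows "lift G v : N t'"
 using assms(2)
proof (induction rule: N.induct)
 case (N_add a b w)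
 then show ?case using ad_plus[OF wdD(1)[OF assms(1)], of a b w] by (simp add: lift_diff lift_add eqv_def diff_diff_eq)
next
 case (N_twist a d w)
 then show ?case using wdD(2)[OF assms(1), of a d w] by (simp add: lift_diff eqv_def)
qed (auto simp: lift_diff intro: N.intros)

lemma lift_eqv:
 assumes "!!w. wd (t + sum_list w) t' (%a. G a w)" and "eqv t v v'"
 shows "eqv t' (lift G v) (lift G v')"
 using lift_N[OF assms(1), of "v - v'"] assms(2) by (simp add: eqv_def lift_diff)

definition Ca :: "'x chain set" where "Ca = {v. Poly_Mapping.keys v <= \<A> \<times> UNIV}"

lemma lift_sm:
 assumes "!!w. wd (t + sum_list w) t' (%a. G a w)" and "v : Ca" and e: "e : carrier k"
 shows "eqv t' (lift G (sm e v)) (sm e (lift G v))"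
proof -
 have "Poly_Mapping.keys v <= \<A> \<times> UNIV" using assms(2) by (simp add: Ca_def)
 then show ?thesis
 proof (induction v rule: frag_induction)
 case (one p)
 then show ?case using wdD(3)[OF assms(1), of "fst p" e "snd p"] e by (auto simp: sm_simps)
 next
 case (diff a b)
 then show ?case by (auto simp: sm_simps lift_diff intro: eqv_diff)
 qed (simp add: sm_simps)
qed

subsection \<open>Elementary operators\<close>

definition pre :: "nat => 'x chain => 'x chain" where "pre i = lift (%a w. g a (i # w))"

definition rm :: "'x => 'x chain => 'x chain" where "rm q = lift (%a w. g (a ** q) w)"

lemma pre_simps: "pre i (g a w) = g a (i # w)" "pre i 0 = 0" "pre i (v + v') = pre i v + pre i v'"
 "pre i (v - v') = pre i v - pre i v'" "pre i (- v) = - pre i v" "pre i (sum f I) = (\<Sum>j\<in>I. pre i (f j))"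
 by (simp_all add: pre_def lift_add lift_diff lift_neg lift_sum)

lemma rm_simps: "rm q (g a w) = g (a ** q) w" "rm q 0 = 0" "rm q (v + v') = rm q v + rm q v'"
 "rm q (v - v') = rm q v - rm q v'" "rm q (- v) = - rm q v" "rm q (sum f I) = (\<Sum>j\<in>I. rm q (f j))"
 by (simp_all add: rm_def lift_add lift_diff lift_neg lift_sum)

lemma rm_pre: "rm q (pre i v) = pre i (rm q v)"
 by (rule chain_ext) (auto simp: rm_simps pre_simps)

lemma sm_pre: "sm e (pre i v) = pre i (sm e v)"
 by (rule chain_ext) (auto simp: sm_simps pre_simps)

lemma pre_eqv: "eqv (t + i) v v' ==> eqv t (pre i v) (pre i v')"
 unfolding pre_def by (rule lift_eqv[where t = "t + i"]) (auto intro!: wd_g_id)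

lemma wd_pre: "wd s (t + i) F ==> wd s t (%a. pre i (F a))"
 unfolding wd_def ad_def
 by (auto simp: sm_pre pre_simps(3)[symmetric] intro!: pre_eqv)

text \<open>The word starting with \<open>x\<^sup>m\<close>, with \<open>x\<^sup>m\<close> reduced modulo
\<open>f\<close>. The constant term drops out by normalization.\<close>

definition R :: "nat => 'x => nat list => 'x chain"
 where "R m a w = (if m = 0 then 0 else if m < n then g a (m # w) else \<Sum>l\<in>{1..<n}. g (a ** cf m l) (l # w))"

lemma wd_R: "s = t + m + sum_list w ==> wd s t (%a. R m a w)"
 unfolding R_def
 by (cases "m = 0"; cases "m < n") (auto intro!: wd_g_id wd_sum wd_g_right[OF c_Hm])

lemma R_eqv:
 assumes a: "a : \<A>"
 shows "eqv t (R m a w) (\<Sum>l\<in>{1..<n}. g (a ** cf m l) (l # w))"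
proof (cases "m < n")
 case True
 have "(\<Sum>l\<in>{1..<n}. g (a ** cf m l) (l # w)) = (\<Sum>l\<in>{1..<n}. if l = m then g a (m # w) else g \<zero> (l # w))"
 using True a by (intro sum.cong) (auto simp: c_small)
 moreover have "eqv t (\<Sum>l\<in>{1..<n}. if l = m then g a (m # w) else g \<zero> (l # w)) (\<Sum>l\<in>{1..<n}. if l = m then g a (m # w) else 0)"
 by (rule eqv_sum) (auto intro: ad_zero[OF ad_g' sgp_carrier])
 moreover have "(\<Sum>l\<in>{1..<n}. if l = m then g a (m # w) else 0) = R m a w"
 using True by (simp add: R_def)
 ultimately show ?thesis by (auto intro: eqv_sym)
next
 case False
 then show ?thesis using n_ge_2 by (simp add: R_def)
qed

lemma R_small: "m < n ==> m ~= 0 ==> R m a w = g a (m # w)" and R_0 [simp]: "R 0 a w = 0"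
 by (auto simp: R_def)

lemma lessThan_shift_1: "(\<Sum>l<(j::nat). G l) = (if j = 0 then 0 else G 0) + (\<Sum>l\<in>{1..<j}. (G l :: 'x chain))"
 by (cases j) (simp_all add: lessThan_atLeast0 sum.atLeast_Suc_lessThan)

lemma R_reduce:
 assumes a: "a : \<A>"
 shows "eqv t (R m a w) (\<Sum>l<n. R l (a ** cf m l) w)"
proof -
 have "(\<Sum>l<n. R l (a ** cf m l) w) = (\<Sum>l\<in>{1..<n}. g (a ** cf m l) (l # w))"
 unfolding lessThan_shift_1 by (simp add: R_small)
 then show ?thesis using R_eqv[OF a] by simp
qed

lemma rm_R: "[|a : \<A>; q : Com|] ==> R m (a ** q) w = rm q (R m a w)"
proof -
 assume a: "a : \<A>" and q: "q : Com"
 have "a ** q ** cf m l = a ** cf m l ** q" for l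
 using a q Com_closed[OF q] Com_iota[OF q cK_closed alpha_cK, of m l] by (simp add: A.m_assoc)
 then show ?thesis by (auto simp: R_def rm_simps intro: sum.cong)
qed

lemma word_cases:
 fixes w :: "nat list"
 obtains "w = []" | i where "w = [i]" | i j w' where "w = i # j # w'"
 by (metis list.exhaust)

text \<open>All faces of the Hochschild boundary except the first. The recursion peels off the first letter, and the
coefficient \<open>a\<close> meets only the last one.\<close>

fun bt :: "'x => nat list => 'x chain" where
 "bt a [] = 0"
| "bt a [i] = - g (X i ** a) []"
| "bt a (i # j # w) = - R (i + j) a w - pre i (bt a (j # w))"

lemma wd_bt: "wd (t + sum_list w) t (%a. bt a w)"
proof (induction w arbitrary: t rule: induct_list012)
 case (2 i)
 then show ?case by (auto intro!: wd_neg wd_g_left)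
next
 case (3 i j w)
 have "wd (t + sum_list (i # j # w)) t (%a. pre i (bt a (j # w)))"
 using 3(2)[of "t + i"] by (intro wd_pre) (simp add: add.assoc)
 moreover have "wd (t + sum_list (i # j # w)) t (%a. - R (i + j) a w)"
 by (intro wd_neg wd_R) simp
 ultimately show ?case using wd_diff by auto
qed simp

lemma bt_rm: "[|a : \<A>; q : Com|] ==> bt (a ** q) w = rm q (bt a w)"
 by (induction w rule: induct_list012) (auto simp: rm_simps rm_R rm_pre A.m_assoc Com_closed)

fun b0 :: "'x => nat list => 'x chain" where
 "b0 a [] = 0"
| "b0 a (i # w) = g (a ** X i) w + bt a (i # w)"

abbreviation bb :: "'x chain => 'x chain" where "bb \<equiv> lift b0"

lemma wd_b0: "wd (t + sum_list w) t (%a. b0 a w)"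
proof (cases w)
 case (Cons i w')
 have "wd (t + sum_list w) t (%a. g (a ** X i) w')" using Cons by (intro wd_g_right[of _ i]) auto
 from wd_add[OF this wd_bt[of t w]] show ?thesis using Cons by simp
qed simp

text \<open>The splitting of \<open>x\<^sup>i\<close> into \<open>x \<otimes> x\<^sup>l\<close>: the contracting
homotopy of the tensor algebra on \<open>x\<close>.\<close>

fun s0 :: "'x => nat list => 'x chain" where
 "s0 a [] = 0"
| "s0 a (i # w) = (\<Sum>l\<in>{1..<i}. g (a ** X (i - l - 1)) (1 # l # w))"

abbreviation ss :: "'x chain => 'x chain" where "ss \<equiv> lift s0"

lemma wd_s0: "wd (t + sum_list w) t (%a. s0 a w)"
 by (cases w) (auto intro!: wd_sum wd_g_right[OF Hm_X])

fun P0 :: "'x => nat list => 'x chain" where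
 "P0 a (i # j # w) = (if i + j < n then 0 else g (a ** uq (i + j)) w)"
| "P0 a w = 0"

abbreviation PP :: "'x chain => 'x chain" where "PP \<equiv> lift P0"

lemma wd_P0: "wd (t + sum_list w) (t + n) (%a. P0 a w)"
proof (cases w rule: word_cases)
 case (3 i j w')
 have "wd (t + sum_list w) (t + n) (%a. g (a ** uq (i + j)) w')" if "~ i + j < n"
 using that 3 by (intro wd_g_right[OF u_Hm]) simp
 then show ?thesis using 3 by (cases "i + j < n") simp_all
qed simp_all

lemma P0_eqv: "a : \<A> ==> eqv t (P0 a (i # j # w)) (g (a ** uq (i + j)) w)"
 by (auto simp: u_small intro!: eqv_sym[OF ad_zero[OF ad_g' sgp_carrier]])

text \<open>Splitting \<open>f\<close> instead of a power of \<open>x\<close>: the element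
\<open>\<Sum>\<lambda>\<^sub>n\<^sub>-\<^sub>i x\<^sup>i\<^sup>-\<^sup>l\<^sup>-\<^sup>1 \<otimes> x
\<otimes> x\<^sup>l\<close>.\<close>

definition Q0 :: "'x => nat list => 'x chain"
 where "Q0 a w = (\<Sum>i\<le>n. \<Sum>l\<in>{1..<i}. g (a ** Z i l) (1 # l # w))"

abbreviation QQ :: "'x chain => 'x chain" where "QQ \<equiv> lift Q0"

lemma LX_Hm: "i <= n ==> L (n - i) ** X j : Hm (n - i + j)"
 by (intro Hm_mult L_Hm Hm_X) simp

lemma wd_Q0: "wd (t + n + sum_list w) t (%a. Q0 a w)"
 unfolding Q0_def by (intro wd_sum wd_g_right[OF LX_Hm]) auto

fun p0 :: "'x => nat list => 'x chain" where
 "p0 a [i] = (\<Sum>l<i. g (X (i - l - 1) ** a ** X l) [1])"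
| "p0 a w = 0"

abbreviation pp :: "'x chain => 'x chain" where "pp \<equiv> lift p0"

lemma wd_p0: "wd (t + sum_list w) t (%a. p0 a w)"
 by (cases w rule: word_cases) (auto intro!: wd_sum wd_g[OF Hm_X Hm_X])

fun d0 :: "'x => nat list => 'x chain" where
 "d0 a [] = (\<Sum>i\<le>n. \<Sum>l<i. g (L (n - i) ** X (i - l - 1) ** a ** X l) [1])"
| "d0 a w = 0"

abbreviation dd2 :: "'x chain => 'x chain" where "dd2 \<equiv> lift d0"

lemma wd_d0: "wd (t + n + sum_list w) t (%a. d0 a w)"
 by (cases w) (auto intro!: wd_sum wd_g[OF LX_Hm Hm_X])

lemma ss_pre: "ss (pre i v) = (\<Sum>l\<in>{1..<i}. pre 1 (pre l (rm (X (i - l - 1)) v)))"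
 by (rule chain_ext) (auto simp: pre_simps rm_simps lift_diff sum_subtractf)

lemma PP_pre: "PP (pre i (pre j v)) = (if i + j < n then 0 else rm (uq (i + j)) v)"
 by (rule chain_ext) (auto simp: pre_simps rm_simps lift_diff)

lemma QQ_eq: "QQ v = (\<Sum>i\<le>n. \<Sum>l\<in>{1..<i}. pre 1 (pre l (rm (Z i l) v)))"
 by (rule chain_ext) (auto simp: Q0_def pre_simps rm_simps lift_diff sum_subtractf)

subsection \<open>The key congruence\<close>

text \<open>For \<open>G y l = y \<otimes> x\<^sup>l\<close> the left side is the noncommutative difference quotient
of \<open>x\<^sup>M\<close>. Differentiating \<open>x\<^sup>M = \<Sum>cf M k x\<^sup>k + uq M f\<close>
gives the right side, as the second factor of the product \<open>uq M f\<close> vanishes in the algebra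
when the derivative falls on \<open>uq M\<close>. The induction on \<open>M\<close> follows the
recursions of \<open>cf\<close> and \<open>uq\<close>.\<close>

lemma Delta:
 assumes "!!l. ad Com t (%y. G y l)"
 and "!!y l. y : Com ==> eqv t (G y l) (\<Sum>k<n. G (y ** cf l k) k)"
 shows "eqv t (\<Sum>m<M. G (X (M - m - 1)) m)
 ((\<Sum>k<n. \<Sum>l<k. G (cf M k ** X (k - l - 1)) l)
 + (\<Sum>i\<le>n. \<Sum>l<i. G (uq M ** Z i l) l))"
 using assms
proof (induction M arbitrary: G)
 case 0
 have Z: "eqv t (G \<zero> l) 0" for l by (rule ad_zero[OF 0(1) sgp_Com])
 have "eqv t (\<Sum>k<n. \<Sum>l<k. G (cf 0 k ** X (k - l - 1)) l) (\<Sum>k<n. \<Sum>l<k. 0)"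
 by (intro eqv_sum) (use Z in auto)
 moreover have "eqv t (\<Sum>i\<le>n. \<Sum>l<i. G (uq 0 ** Z i l) l) (\<Sum>i\<le>n. \<Sum>l<i. 0)"
 by (intro eqv_sum) (use Z in auto)
 ultimately have "eqv t ((\<Sum>k<n. \<Sum>l<k. G (cf 0 k ** X (k - l - 1)) l)
 + (\<Sum>i\<le>n. \<Sum>l<i. G (uq 0 ** Z i l) l)) 0"
 using eqv_add[of t _ "\<Sum>k<n. \<Sum>l<k. 0" _ "\<Sum>i\<le>n. \<Sum>l<i. 0"] by simp
 then show ?case using eqv_sym[of t _ 0] by simp
next
 case (Suc M)
 have Cm: "y : Com ==> y : \<A>" for y by (rule Com_closed)
 have xC: "x : Com" using Com_X[of 1] by simp
 define z where "z = cf M (n - 1)"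
 have z: "z : Com" using n_ge_2 by (simp add: z_def)
 define B where "B k = (\<Sum>l<Suc k. G (cf M k ** X (k - l)) l)" for k
 define U where "U = (\<Sum>i\<le>n. \<Sum>l<i. G (uq M ** x ** Z i l) l)"
 define V where "V i = (\<Sum>l<i. G (z ** Z i l) l)" for i
 have IH: "eqv t (\<Sum>m<M. G (x ** X (M - m - 1)) m)
 ((\<Sum>k<n. \<Sum>l<k. G (x ** (cf M k ** X (k - l - 1))) l)
 + (\<Sum>i\<le>n. \<Sum>l<i. G (x ** (uq M ** Z i l)) l))"
 proof (rule Suc.IH[of "%y l. G (x ** y) l"])
 show "ad Com t (%y. G (x ** y) l)" for l
 using Suc.prems(1)[of l] Com_mult[OF xC] Cm by (simp add: ad_def A.r_distr)
 show "eqv t (G (x ** y) l) (\<Sum>k<n. G (x ** (y ** cf l k)) k)" if "y : Com" for y l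
 using Suc.prems(2)[OF Com_mult[OF xC that], of l] Cm[OF that] by (simp add: A.m_assoc)
 qed
 have 1: "(\<Sum>m<Suc M. G (X (Suc M - m - 1)) m) = (\<Sum>m<M. G (x ** X (M - m - 1)) m) + G \<one> M"
 proof -
 have "X (Suc M - m - 1) = x ** X (M - m - 1)" if "m < M" for m
 using X_Suc_left[of "M - m - 1"] that by (simp add: Suc_diff_Suc)
 then show ?thesis by simp
 qed
 have 2: "eqv t (G \<one> M) (\<Sum>k<n. G (cf M k) k)"
 using Suc.prems(2)[of "\<one>" M] Hm_Com[OF Hm_one] by simp
 have 3: "(\<Sum>k<n. \<Sum>l<k. G (x ** (cf M k ** X (k - l - 1))) l) + (\<Sum>k<n. G (cf M k) k) = (\<Sum>k<n. B k)"
 proof -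
 have "x ** (cf M k ** X (k - l - 1)) = cf M k ** X (k - l)" if "l < k" "k < n" for k l
 proof -
 have "x ** (cf M k ** X (k - l - 1)) = (cf M k ** x) ** X (k - l - 1)"
 using Com_x[OF c_Com[OF that(2)], of M] by (simp add: A.m_assoc[symmetric])
 also have "... = cf M k ** X (k - l)"
 using X_Suc_left[of "k - l - 1"] that by (simp add: A.m_assoc Suc_diff_Suc)
 finally show ?thesis .
 qed
 then show ?thesis unfolding B_def sum.distrib[symmetric] by (intro sum.cong) auto
 qed
 have 4: "(\<Sum>i\<le>n. \<Sum>l<i. G (x ** (uq M ** Z i l)) l) = U"
 unfolding U_def using Com_x[OF u_Com, of M] by (intro sum.cong) (auto simp: A.m_assoc[symmetric])
 have lhs: "eqv t (\<Sum>m<Suc M. G (X (Suc M - m - 1)) m) ((\<Sum>k<n. B k) + U)"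
 using eqv_add[OF IH 2] unfolding 1 3[symmetric] 4 by (simp add: algebra_simps)
 have 5: "eqv t (\<Sum>k<n. \<Sum>l<k. G (cf (Suc M) k ** X (k - l - 1)) l) ((\<Sum>k<n - 1. B k) - (\<Sum>k<n. V k))"
 proof -
 let ?p = "%k. if k = 0 then \<zero> else cf M (k - 1)"
 have "eqv t (\<Sum>k<n. \<Sum>l<k. G (cf (Suc M) k ** X (k - l - 1)) l)
 (\<Sum>k<n. \<Sum>l<k. G (?p k ** X (k - l - 1)) l - G (z ** Z k l) l)"
 proof (intro eqv_sum)
 fix k l assume k: "k : {..<n}" "l : {..<k}"
 have p: "?p k : Com" using k by (auto intro: c_Com Hm_Com[OF Hm_zero])
 have "cf (Suc M) k ** X (k - l - 1) = ?p k ** X (k - l - 1) \<ominus> z ** Z k l"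
 unfolding c_rec using Cm[OF p] Cm[OF z] by (simp add: z_def a_minus_def A.l_distr A.l_minus A.m_assoc)
 then show "eqv t (G (cf (Suc M) k ** X (k - l - 1)) l) (G (?p k ** X (k - l - 1)) l - G (z ** Z k l) l)"
 by (simp only:) (intro ad_minus[OF Suc.prems(1)] sgp_Com Com_mult p z Com_L Com_X, simp)
 qed
 also have "... = (\<Sum>k<n. \<Sum>l<k. G (?p k ** X (k - l - 1)) l) - (\<Sum>k<n. V k)"
 by (simp only: sum_subtractf V_def)
 also have "(\<Sum>k<n. \<Sum>l<k. G (?p k ** X (k - l - 1)) l) = (\<Sum>k<n - 1. B k)"
 proof -
 obtain n' where n': "n = Suc n'" using n_ge_2 by (cases n) auto
 have "(\<Sum>k<n. Fk k) = Fk 0 + (\<Sum>k<n - 1. Fk (Suc k))" for Fk :: "nat => 'x chain"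
 using sum.lessThan_Suc_shift[of Fk "n - 1"] n_ge_2 by simp
 then show ?thesis by (simp add: B_def)
 qed
 finally show ?thesis .
 qed
 have 6: "eqv t (\<Sum>i\<le>n. \<Sum>l<i. G (uq (Suc M) ** Z i l) l) (U + (\<Sum>i\<le>n. V i))"
 proof -
 have "eqv t (\<Sum>i\<le>n. \<Sum>l<i. G (uq (Suc M) ** Z i l) l)
 (\<Sum>i\<le>n. \<Sum>l<i. G (uq M ** x ** Z i l) l + G (z ** Z i l) l)"
 proof (intro eqv_sum)
 fix i l assume "i : {..n}" "l : {..<i}"
 have "uq (Suc M) ** Z i l = uq M ** x ** Z i l \<oplus> z ** Z i l"
 using Cm[OF z] by (simp add: z_def A.l_distr)
 then show "eqv t (G (uq (Suc M) ** Z i l) l)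
 (G (uq M ** x ** Z i l) l + G (z ** Z i l) l)"
 by (simp only:) (intro ad_plus[OF Suc.prems(1)] Com_mult z Com_L Com_X u_Com xC, simp_all)
 qed
 then show ?thesis by (simp only: sum.distrib U_def V_def)
 qed
 have 7: "V n = B (n - 1)"
 proof -
 obtain n' where n': "n = Suc n'" using n_ge_2 by (cases n) auto
 have "Suc (n - 1) = n" using n_ge_2 by simp
 then show ?thesis unfolding V_def B_def
 by (simp only: diff_self_eq_0 L_0) (simp add: z_def diff_right_commute)
 qed
 have 8: "(\<Sum>i\<le>n. V i) = (\<Sum>k<n. V k) + V n"
 by (simp add: lessThan_Suc_atMost[symmetric])
 have 9: "(\<Sum>k<n. B k) = (\<Sum>k<n - 1. B k) + B (n - 1)"
 using sum.lessThan_Suc[of B "n - 1"] n_ge_2 by simp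
 have "eqv t ((\<Sum>k<n. \<Sum>l<k. G (cf (Suc M) k ** X (k - l - 1)) l)
 + (\<Sum>i\<le>n. \<Sum>l<i. G (uq (Suc M) ** Z i l) l)) ((\<Sum>k<n. B k) + U)"
 using eqv_add[OF 5 6] unfolding 7[symmetric] 8 9 by (simp add: algebra_simps)
 then show ?case using lhs by (blast intro: eqv_trans eqv_sym)
qed

end

section \<open>Relations between the operators\<close>

lemma chain_cancel: "p - (q - r) + (q - p) + s = r + (s :: 'g :: ab_group_add)"
 by (simp add: algebra_simps)

lemma chain_cancel2: "(G - g - (- S - p)) + (m - r - p) = m + (G + S) - r - (g :: 'g :: ab_group_add)"
 by (simp add: algebra_simps)

context monogenic_algebra
begin

abbreviation redw :: "nat list => bool" where "redw w \<equiv> set w <= {1..<n}"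

lemma PP_eqv: "eqv t v v' ==> eqv (t + n) (PP v) (PP v')"
 by (rule lift_eqv[OF wd_P0])

lemma QQ_eqv: "eqv (t + n) v v' ==> eqv t (QQ v) (QQ v')"
 by (rule lift_eqv[OF wd_Q0])

lemma bb_eqv: "eqv t v v' ==> eqv t (bb v) (bb v')"
 by (rule lift_eqv[OF wd_b0])

lemma ss_eqv: "eqv t v v' ==> eqv t (ss v) (ss v')"
 by (rule lift_eqv[OF wd_s0])

lemma pp_eqv: "eqv t v v' ==> eqv t (pp v) (pp v')"
 by (rule lift_eqv[OF wd_p0])

lemma dd2_eqv: "eqv (t + n) v v' ==> eqv t (dd2 v) (dd2 v')"
 by (rule lift_eqv[OF wd_d0])

lemmas chain_simps = lift_add lift_diff lift_neg lift_sum

lemma ad_l: "a : \<A> ==> ad (\<A>) t (%y. g (a ** y) w)"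
 using ad_g[of a "\<one>" t w] by (simp add: ad_def)

lemma sum_c_u:
 assumes a: "a : \<A>" and j: "j < n"
 shows "eqv t (\<Sum>l\<in>{1..<n}. g (a ** cf m l ** uq (l + j)) v)
 (g (a ** uq (m + j)) v - g (a ** X j ** uq m) v)"
proof -
 have "eqv t (g (a ** (\<Oplus>l\<in>{..<n}. cf m l ** uq (l + j))) v) (\<Sum>l<n. g (a ** (cf m l ** uq (l + j))) v)"
 using ad_finsum[OF ad_l[OF a] sgp_carrier, where I = "{..<n}" and f = "%l. cf m l ** uq (l + j)"] by simp
 also have "eqv t ... (\<Sum>l\<in>{1..<n}. g (a ** cf m l ** uq (l + j)) v)"
 proof -
 have "eqv t (g (a ** (cf m 0 ** uq (0 + j))) v) 0"
 using a j by (simp add: u_small ad_zero[OF ad_g' sgp_carrier])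
 from eqv_add[OF this eqv_refl] show ?thesis unfolding lessThan_shift_1
 using n_ge_2 a by (simp add: A.m_assoc)
 qed
 finally have 1: "eqv t (g (a ** (uq (m + j) \<ominus> X j ** uq m)) v) (\<Sum>l\<in>{1..<n}. g (a ** cf m l ** uq (l + j)) v)"
 unfolding c_u .
 have "eqv t (g (a ** (uq (m + j) \<ominus> X j ** uq m)) v) (g (a ** uq (m + j)) v - g (a ** (X j ** uq m)) v)"
 by (intro ad_minus[OF ad_l[OF a] sgp_carrier]) simp_all
 from eqv_trans[OF eqv_sym[OF 1] this] show ?thesis using a by (simp add: A.m_assoc)
qed

lemma PP_R:
 assumes a: "a : \<A>" and j: "j < n"
 shows "eqv (t + n) (PP (R m a (j # v))) (g (a ** uq (m + j)) v - g (a ** X j ** uq m) v)"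
proof -
 have "eqv (t + n) (PP (R m a (j # v))) (PP (\<Sum>l\<in>{1..<n}. g (a ** cf m l) (l # j # v)))"
 by (intro PP_eqv R_eqv a)
 also have "eqv (t + n) ... (\<Sum>l\<in>{1..<n}. g (a ** cf m l ** uq (l + j)) v)"
 unfolding lift_sum lift_g using a by (intro eqv_sum P0_eqv) simp
 finally show ?thesis using sum_c_u[OF a j] eqv_trans by blast
qed

lemma PP_pre_R:
 assumes a: "a : \<A>" and j: "j < n"
 shows "eqv (t + n) (PP (pre j (R m a v))) (g (a ** uq (m + j)) v - g (a ** X j ** uq m) v)"
proof -
 have "eqv (t + n) (PP (pre j (R m a v))) (PP (pre j (\<Sum>l\<in>{1..<n}. g (a ** cf m l) (l # v))))"
 by (intro PP_eqv pre_eqv R_eqv a)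
 also have "eqv (t + n) ... (\<Sum>l\<in>{1..<n}. g (a ** cf m l ** uq (j + l)) v)"
 unfolding lift_sum lift_g pre_simps using a by (intro eqv_sum P0_eqv) simp
 finally show ?thesis using sum_c_u[OF a j] eqv_trans unfolding add.commute[of j] by blast
qed

text \<open>The products \<open>uq (i + j + k)\<close> that arise from the two neighbouring contractions cancel, by
\<open>c_u\<close>.\<close>

lemma PP_b:
 assumes a: "a : \<A>" and w: "redw w"
 shows "eqv (t + n) (PP (b0 a w)) (bb (P0 a w))"
proof (cases w rule: word_cases)
 case 1
 then show ?thesis by simp
next
 case (2 i)
 then show ?thesis by (simp add: chain_simps)
next
 case (3 i j w')
 show ?thesis
 proof (cases w')
 case Nil
 have "PP (R m a []) = 0" for m by (simp add: R_def chain_simps)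
 then show ?thesis using 3 Nil by (simp add: chain_simps pre_simps)
 next
 case (Cons k v)
 then have ijk: "i < n" "j < n" "k < n" using w 3 by auto
 let ?u = "uq (i + j)"
 have 1: "eqv (t + n) (PP (g (a ** X i) (j # k # v))) (g (a ** X i ** uq (j + k)) v)"
 unfolding lift_g using a by (intro P0_eqv) simp
 have 2: "eqv (t + n) (PP (R (i + j) a (k # v))) (g (a ** uq (i + j + k)) v - g (a ** X k ** ?u) v)"
 by (rule PP_R[OF a ijk(3)])
 have 3: "eqv (t + n) (PP (pre i (R (j + k) a v))) (g (a ** uq (j + k + i)) v - g (a ** X i ** uq (j + k)) v)"
 by (rule PP_pre_R[OF a ijk(1)])
 have btz: "eqv (t + n) (bt \<zero> (k # v)) 0"
 by (rule ad_zero[OF wdD(1)[OF wd_bt] sgp_carrier])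
 have 4: "eqv (t + n) (PP (pre i (pre j (bt a (k # v))))) (bt (a ** ?u) (k # v))"
 proof (cases "i + j < n")
 case True
 then show ?thesis using eqv_sym[OF btz] a by (simp add: PP_pre u_small)
 next
 case False
 then show ?thesis using a by (simp add: PP_pre bt_rm)
 qed
 have 5: "PP (b0 a w) = PP (g (a ** X i) (j # k # v)) - PP (R (i + j) a (k # v)) + PP (pre i (R (j + k) a v)) + PP (pre i (pre j (bt a (k # v))))"
 using \<open>w = i # j # w'\<close> Cons by (simp add: chain_simps pre_simps)
 have e: "j + k + i = i + j + k" by simp
 have 6: "eqv (t + n) (PP (b0 a w)) (g (a ** X k ** ?u) v + bt (a ** ?u) (k # v))"
 using eqv_add[OF eqv_add[OF eqv_diff[OF 1 2] 3] 4] unfolding 5 e chain_cancel .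
 have 7: "g (a ** X k ** ?u) v + bt (a ** ?u) (k # v) = bb (g (a ** ?u) (k # v))"
 using a Com_X_comm[OF u_Com, of k "i + j"] by (simp add: A.m_assoc)
 have "eqv (t + n) (bb (g (a ** ?u) (k # v))) (bb (P0 a w))"
 unfolding \<open>w = i # j # w'\<close> Cons by (intro bb_eqv eqv_sym[OF P0_eqv] a)
 from eqv_trans[OF 6[unfolded 7] this] show ?thesis .
 qed
qed

text \<open>Only the leading term \<open>x\<^sup>n\<close> of \<open>f\<close>, split as \<open>x \<otimes>
x\<^sup>n\<^sup>-\<^sup>1\<close>, has a nonzero overline.\<close>

lemma PP_Q:
 assumes a: "a : \<A>"
 shows "PP (Q0 a w) = g a w"
proof -
 have "PP (Q0 a w) = (\<Sum>i\<le>n. \<Sum>l\<in>{1..<i}. if 1 + l < n then 0 else g (a ** Z i l ** uq (1 + l)) w)"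
 by (simp only: Q0_def lift_sum lift_g P0.simps)
 also have "... = (\<Sum>i\<le>n. \<Sum>l\<in>{1..<i}. if i = n then (if l = n - 1 then g a w else 0) else 0)"
 proof (intro sum.cong refl)
 fix i l assume il: "i : {..n}" "l : {1..<i}"
 have "l = n - 1" "i = n" if "~ 1 + l < n" using il that by auto
 then show "(if 1 + l < n then 0 else g (a ** Z i l ** uq (1 + l)) w) = (if i = n then (if l = n - 1 then g a w else 0) else 0)"
 using a n_ge_2 u_n by (cases "1 + l < n") (auto simp: Suc_diff_Suc simp del: uq.simps)
 qed
 also have "... = (\<Sum>i\<le>n. if i = n then (\<Sum>l\<in>{1..<i}. if l = n - 1 then g a w else 0) else 0)"
 by (intro sum.cong) auto
 also have "... = g a w" using n_ge_2 by simp
 finally show ?thesis .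
qed

subsection \<open>The homotopy identity\<close>

lemma telescope_up:
 fixes F :: "nat => 'x chain"
 assumes "1 <= i"
 shows "(\<Sum>l\<in>{1..<i}. F l - F (l + 1)) = F 1 - F i"
 using assms by (induction i rule: dec_induct) auto

text \<open>The first two faces of the split words telescope.\<close>

lemma telescope_b:
 assumes a: "a : \<A>" and y: "y : Com" and i: "1 <= i" "i <= n"
 shows "(\<Sum>l\<in>{1..<i}. bb (g (a ** (y ** X (i - l - 1))) (1 # l # w)))
 = g (a ** (y ** X (i - 1))) (1 # w) - R i (a ** y) w
 - (\<Sum>l\<in>{1..<i}. pre 1 (bt (a ** (y ** X (i - l - 1))) (l # w)))"
proof -
 note [simp] = Com_closed[OF y]
 let ?F = "%l. R l (a ** (y ** X (i - l))) w"
 have "bb (g (a ** (y ** X (i - l - 1))) (1 # l # w)) = ?F l - ?F (l + 1) - pre 1 (bt (a ** (y ** X (i - l - 1))) (l # w))"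
 if "l : {1..<i}" for l
 proof -
 have "a ** (y ** X (i - l - 1)) ** x = a ** (y ** X (i - l))"
 using that a A.nat_pow_Suc[of x "i - l - 1"] by (simp add: A.m_assoc Suc_diff_Suc del: A.nat_pow_Suc)
 moreover have "R l y' w = g y' (l # w)" for y' using that i by (intro R_small) auto
 ultimately show ?thesis by (simp add: R_def)
 qed
 then have "(\<Sum>l\<in>{1..<i}. bb (g (a ** (y ** X (i - l - 1))) (1 # l # w)))
 = (\<Sum>l\<in>{1..<i}. ?F l - ?F (l + 1)) - (\<Sum>l\<in>{1..<i}. pre 1 (bt (a ** (y ** X (i - l - 1))) (l # w)))"
 unfolding sum_subtractf[symmetric] by (rule sum.cong[OF refl])
 moreover have "?F 1 = g (a ** (y ** X (i - 1))) (1 # w)" using n_ge_2 by (intro R_small) auto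
 ultimately show ?thesis using telescope_up[OF i(1), of ?F] a by simp
qed

lemma bb_s0:
 assumes a: "a : \<A>" and i: "1 <= i" "i < n"
 shows "bb (s0 a (i # w)) = g (a ** X (i - 1)) (1 # w) - g a (i # w)
 - (\<Sum>l\<in>{1..<i}. pre 1 (bt (a ** X (i - l - 1)) (l # w)))"
 using telescope_b[OF a Hm_Com[OF Hm_one], of i w] a i by (simp add: chain_simps R_small)

lemma homotopy_1:
 assumes a: "a : \<A>" and i: "1 <= i" "i < n"
 shows "bb (s0 a [i]) = p0 a [i] - g a [i]"
proof -
 have "p0 a [i] = (\<Sum>l<i. g (X l ** a ** X (i - l - 1)) [1])"
 by (simp, subst sum.nat_diff_reindex[symmetric]) (intro sum.cong, auto)
 also have "... = g (a ** X (i - 1)) [1] + (\<Sum>l\<in>{1..<i}. g (X l ** a ** X (i - l - 1)) [1])"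
 unfolding lessThan_shift_1 using i a by simp
 finally have p: "p0 a [i] = g (a ** X (i - 1)) [1] + (\<Sum>l\<in>{1..<i}. g (X l ** a ** X (i - l - 1)) [1])" .
 show ?thesis unfolding p bb_s0[OF a i] using a by (simp add: pre_simps sum_negf A.m_assoc)
qed

text \<open>The family to which the key congruence is applied.\<close>

definition GR :: "'x => nat list => 'x => nat => 'x chain"
 where "GR a v y l = pre 1 (R l (a ** y) v)"

lemma GR_ad: "a : \<A> ==> ad (\<A>) t (%y. GR a v y l)"
proof -
 assume a: "a : \<A>"
 have "ad (\<A>) (t + 1) (%a. R l a v)" by (rule wdD(1)[OF wd_R[OF refl]])
 then show ?thesis using a unfolding ad_def GR_def pre_simps(3)[symmetric]
 by (auto simp: A.r_distr intro!: pre_eqv)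
qed

lemma GR_small: "l < n ==> GR a v y l = (if l = 0 then 0 else g (a ** y) (1 # l # v))"
 by (simp add: GR_def R_small pre_simps)

lemma GR_Delta:
 assumes a: "a : \<A>"
 shows "eqv t (\<Sum>m<M. GR a v (X (M - m - 1)) m)
 ((\<Sum>k<n. \<Sum>l<k. GR a v (cf M k ** X (k - l - 1)) l)
 + (\<Sum>i\<le>n. \<Sum>l<i. GR a v (uq M ** Z i l) l))"
proof (rule Delta)
 show "ad Com t (%y. GR a v y l)" for l
 by (rule ad_subset[OF GR_ad[OF a]]) (auto simp: Com_closed)
 fix y l assume "y : Com"
 then have y: "y : \<A>" by (rule Com_closed)
 have "eqv t (pre 1 (R l (a ** y) v)) (pre 1 (\<Sum>k<n. R k (a ** y ** cf l k) v))"
 using a y by (intro pre_eqv R_reduce) simp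
 then show "eqv t (GR a v y l) (\<Sum>k<n. GR a v (y ** cf l k) k)"
 using a y by (simp add: GR_def pre_simps A.m_assoc)
qed

lemma sum_GR:
 assumes "i <= n"
 shows "(\<Sum>l<i. GR a v (Y l) l) = (\<Sum>l\<in>{1..<i}. g (a ** Y l) (1 # l # v))"
 unfolding lessThan_shift_1 using assms n_ge_2 by (auto simp: GR_small intro!: sum.cong)

lemma sum_split:
 fixes F :: "nat => 'x chain"
 shows "(\<Sum>m<i + j. F m) = (\<Sum>m<j. F m) + (\<Sum>l<i. F (l + j))"
 by (simp add: lessThan_atLeast0 sum.atLeastLessThan_concat[of 0 j "i + j", symmetric] sum.shift_bounds_nat_ivl[of F 0 j i, simplified])

text \<open>What remains after telescoping is the difference quotient of \<open>x\<^sup>i\<^sup>+\<^sup>j\<close>;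
\<open>Delta\<close> identifies its two parts with \<open>ss\<close> of the contracted word and with
\<open>QQ PP\<close>.\<close>

lemma homotopy_2:
 assumes a: "a : \<A>" and w: "redw (i # j # v)"
 shows "eqv t (bb (s0 a (i # j # v)) + ss (b0 a (i # j # v))) (QQ (P0 a (i # j # v)) - g a (i # j # v))"
proof -
 have ij: "1 <= i" "i < n" "1 <= j" "j < n" using w by auto
 let ?M = "i + j"
 let ?T = "\<Sum>m<?M. GR a v (X (?M - m - 1)) m"
 have 1: "(\<Sum>l\<in>{1..<i}. pre 1 (bt (a ** X (i - l - 1)) (l # j # v)))
 = - (\<Sum>l\<in>{1..<i}. GR a v (X (i - l - 1)) (l + j)) - ss (pre i (bt a (j # v)))"
 unfolding ss_pre using a by (simp add: pre_simps bt_rm GR_def sum_subtractf sum_negf)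
 have 2: "g (a ** X (i - 1)) (1 # j # v) = GR a v (X (i - 1)) j"
 using ij by (simp add: GR_small)
 have 3: "s0 (a ** X i) (j # v) = (\<Sum>m<j. GR a v (X (?M - m - 1)) m)"
 proof -
 have "X i ** X (j - l - 1) = X (?M - l - 1)" if "l : {1..<j}" for l
 using that by (simp add: X_add[symmetric])
 then show ?thesis unfolding sum_GR[OF less_imp_le[OF ij(4)]] using a by (simp add: A.m_assoc)
 qed
 have 4: "?T = (\<Sum>m<j. GR a v (X (?M - m - 1)) m) + (GR a v (X (i - 1)) j + (\<Sum>l\<in>{1..<i}. GR a v (X (i - l - 1)) (l + j)))"
 unfolding sum_split[of _ i j] lessThan_shift_1[of _ i] using ij by simp
 have 5: "bb (s0 a (i # j # v)) + ss (b0 a (i # j # v)) = ?T - ss (R ?M a v) - g a (i # j # v)"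
 proof -
 have "b0 a (i # j # v) = g (a ** X i) (j # v) - R ?M a v - pre i (bt a (j # v))" by simp
 then have "ss (b0 a (i # j # v)) = s0 (a ** X i) (j # v) - ss (R ?M a v) - ss (pre i (bt a (j # v)))"
 by (simp only: lift_diff lift_g)
 then show ?thesis unfolding bb_s0[OF a ij(1,2)] 1 2 3 4 by (simp only: chain_cancel2)
 qed
 have 6: "eqv t (ss (R ?M a v)) (\<Sum>k<n. \<Sum>l<k. GR a v (cf ?M k ** X (k - l - 1)) l)"
 proof -
 have "eqv t (ss (R ?M a v)) (ss (\<Sum>l\<in>{1..<n}. g (a ** cf ?M l) (l # v)))"
 by (intro ss_eqv R_eqv a)
 also have "... = (\<Sum>k<n. \<Sum>l<k. GR a v (cf ?M k ** X (k - l - 1)) l)"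
 unfolding lessThan_shift_1[of _ n] using n_ge_2 a by (simp add: chain_simps sum_GR A.m_assoc)
 finally show ?thesis .
 qed
 have 7: "eqv t (\<Sum>i\<le>n. \<Sum>l<i. GR a v (uq ?M ** Z i l) l) (QQ (P0 a (i # j # v)))"
 proof -
 have "(\<Sum>i\<le>n. \<Sum>l<i. GR a v (uq ?M ** Z i l) l) = QQ (g (a ** uq ?M) v)"
 using a by (simp add: Q0_def sum_GR A.m_assoc)
 moreover have "eqv t ... (QQ (P0 a (i # j # v)))" by (intro QQ_eqv eqv_sym[OF P0_eqv] a)
 ultimately show ?thesis by simp
 qed
 have "eqv t (?T - ss (R ?M a v)) (QQ (P0 a (i # j # v)))"
 using eqv_diff[OF eqv_trans[OF GR_Delta[OF a, where t = t and M = "i + j" and v = v] eqv_add[OF eqv_sym[OF 6] 7]] eqv_refl[of t "ss (R ?M a v)"]] by simp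
 from eqv_diff[OF this eqv_refl[of t "g a (i # j # v)"]] show ?thesis unfolding 5 .
qed

subsection \<open>Degrees one and two\<close>

lemma bb_p0:
 assumes a: "a : \<A>"
 shows "bb (p0 a [i]) = b0 a [i]"
proof -
 let ?F = "%l. g (X (i - l) ** a ** X l) []"
 have "bb (g (X (i - l - 1) ** a ** X l) [1]) = ?F (Suc l) - ?F l" if "l < i" for l
 proof -
 have "x ** (X (i - l - 1) ** a ** X l) = X (i - l) ** a ** X l"
 using that a X_Suc_left[of "i - l - 1"] by (simp add: A.m_assoc[symmetric] Suc_diff_Suc del: A.nat_pow_Suc)
 then show ?thesis using a by (simp add: A.m_assoc)
 qed
 then have "bb (p0 a [i]) = (\<Sum>l<i. ?F (Suc l) - ?F l)" by (simp add: chain_simps)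
 also have "... = ?F i - ?F 0" by (rule sum_lessThan_telescope)
 finally show ?thesis using a by simp
qed

text \<open>The fixed scalars \<open>\<lambda>\<^sub>i\<close> travel around the cyclic tensor.\<close>

lemma d0_eqv:
 assumes a: "a : \<A>"
 shows "eqv t (d0 a []) (\<Sum>i\<le>n. \<Sum>l<i. g (X l ** a ** Z i l) [1])"
proof -
 have "d0 a [] = (\<Sum>i\<le>n. \<Sum>l<i. g (L (n - i) ** (X l ** a ** X (i - l - 1))) [1])"
 unfolding d0.simps
 proof (rule sum.cong[OF refl], goal_cases)
 case (1 i)
 show ?case by (subst sum.nat_diff_reindex[symmetric], intro sum.cong) (use a 1 in \<open>auto simp: A.m_assoc\<close>)
 qed
 also have "eqv t ... (\<Sum>i\<le>n. \<Sum>l<i. g (X l ** a ** Z i l) [1])"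
 proof (intro eqv_sum)
 fix i l assume i: "i : {..n}"
 have "eqv t (g (L (n - i) ** (X l ** a ** X (i - l - 1))) [1]) (g (X l ** a ** X (i - l - 1) ** L (n - i)) [1])"
 using a by (intro eqv_g_fixed lam_closed alpha_lam) auto
 also have "X l ** a ** X (i - l - 1) ** L (n - i) = X l ** a ** Z i l"
 using a Com_X_comm[OF Com_L, of "n - i" "i - l - 1"] by (simp add: A.m_assoc)
 finally show "eqv t (g (L (n - i) ** (X l ** a ** X (i - l - 1))) [1]) (g (X l ** a ** Z i l) [1])" .
 qed
 finally show ?thesis .
qed

lemma pp_eq: "pp (g a [i]) = (\<Sum>l<i. g (X l ** a ** X (i - l - 1)) [1])"
 by (simp, subst sum.nat_diff_reindex[symmetric]) (intro sum.cong, auto)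

text \<open>The congruence \<open>Delta\<close> once more, now with the powers of \<open>x\<close> on both sides of
\<open>a\<close>.\<close>

lemma pp_b:
 assumes a: "a : \<A>"
 shows "eqv t (pp (b0 a [i, j])) (dd2 (P0 a [i, j]))"
proof -
 let ?M = "i + j" and ?G = "%y l. g (X l ** a ** y) [1]"
 have D: "eqv t (\<Sum>m<?M. ?G (X (?M - m - 1)) m)
 ((\<Sum>k<n. \<Sum>l<k. ?G (cf ?M k ** X (k - l - 1)) l)
 + (\<Sum>i\<le>n. \<Sum>l<i. ?G (uq ?M ** Z i l) l))"
 proof (rule Delta)
 show "ad Com t (%y. ?G y l)" for l
 using a by (intro ad_subset[OF ad_l]) (auto simp: Com_closed)
 fix y l assume "y : Com"
 then have y: "y : \<A>" by (rule Com_closed)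
 have "X l ** a ** y = (\<Oplus>k\<in>{..<n}. cf l k ** X k) ** (a ** y)"
 using a y X_reduce[of l] by (simp add: A.m_assoc)
 also have "... = (\<Oplus>k\<in>{..<n}. cf l k ** X k ** (a ** y))"
 using a y by (intro A.finsum_ldistr) auto
 finally have "eqv t (?G y l) (\<Sum>k<n. g (cf l k ** X k ** (a ** y)) [1])"
 using ad_finsum[OF ad_g'[of t "[1]"] sgp_carrier, where I = "{..<n}" and f = "%k. cf l k ** X k ** (a ** y)"] a y by simp
 also have "eqv t ... (\<Sum>k<n. ?G (y ** cf l k) k)"
 proof (intro eqv_sum)
 fix k
 show "eqv t (g (cf l k ** X k ** (a ** y)) [1]) (?G (y ** cf l k) k)"
 using eqv_g_fixed[OF _ cK_closed alpha_cK, of "X k ** (a ** y)" t l k "[1]"] a y by (simp add: A.m_assoc)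
 qed
 finally show "eqv t (?G y l) (\<Sum>k<n. ?G (y ** cf l k) k)" .
 qed
 have 1: "pp (b0 a [i, j]) = (\<Sum>m<?M. ?G (X (?M - m - 1)) m) - pp (R ?M a [])"
 proof -
 have "pp (b0 a [i, j]) = pp (g (a ** X i) [j]) - pp (R ?M a []) + pp (g (X j ** a) [i])"
 by (simp add: chain_simps pre_simps del: p0.simps)
 moreover have "pp (g (a ** X i) [j]) = (\<Sum>m<j. ?G (X (?M - m - 1)) m)"
 unfolding pp_eq
 proof (rule sum.cong[OF refl])
 fix l assume "l : {..<j}"
 then have "X i ** X (j - l - 1) = X (?M - l - 1)" by (simp add: X_add[symmetric])
 then show "g (X l ** (a ** X i) ** X (j - l - 1)) [1] = ?G (X (?M - l - 1)) l" using a by (simp add: A.m_assoc)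
 qed
 moreover have "pp (g (X j ** a) [i]) = (\<Sum>l<i. ?G (X (?M - (l + j) - 1)) (l + j))"
 unfolding pp_eq using a by (intro sum.cong) (auto simp: X_add A.m_assoc)
 ultimately show ?thesis unfolding sum_split[of _ i j] by simp
 qed
 have 2: "eqv t (pp (R ?M a [])) (\<Sum>k<n. \<Sum>l<k. ?G (cf ?M k ** X (k - l - 1)) l)"
 proof -
 have "eqv t (pp (R ?M a [])) (pp (\<Sum>l\<in>{1..<n}. g (a ** cf ?M l) [l]))"
 by (intro pp_eqv R_eqv a)
 also have "... = (\<Sum>k<n. \<Sum>l<k. ?G (cf ?M k ** X (k - l - 1)) l)"
 unfolding lift_sum pp_eq lessThan_shift_1[of _ n] using n_ge_2 a by (simp add: A.m_assoc)
 finally show ?thesis .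
 qed
 have 3: "eqv t (dd2 (P0 a [i, j])) (\<Sum>i\<le>n. \<Sum>l<i. ?G (uq ?M ** Z i l) l)"
 proof -
 have "eqv t (dd2 (P0 a [i, j])) (dd2 (g (a ** uq ?M) []))" by (intro dd2_eqv P0_eqv a)
 also have "eqv t ... (\<Sum>i\<le>n. \<Sum>l<i. g (X l ** (a ** uq ?M) ** Z i l) [1])"
 unfolding lift_g using a by (intro d0_eqv) simp
 finally show ?thesis using a by (simp add: A.m_assoc)
 qed
 have "eqv t ((\<Sum>m<?M. ?G (X (?M - m - 1)) m) - pp (R ?M a [])) (dd2 (P0 a [i, j]))"
 using eqv_diff[OF eqv_trans[OF D eqv_add[OF eqv_sym[OF 2] eqv_sym[OF 3]]] eqv_refl[of t "pp (R ?M a [])"]] by simp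
 then show ?thesis unfolding 1 .
qed

subsection \<open>Compatibility of \<open>QQ\<close> with the boundary\<close>

lemma sum_zero:
 assumes F: "ad Com t F" and I: "!!i. i : I ==> y i : Com" and z: "(\<Oplus>i\<in>I. y i) = \<zero>"
 shows "eqv t (\<Sum>i\<in>I. F (y i)) 0"
 using ad_finsum[OF F sgp_Com, of I y] ad_zero[OF F sgp_Com] I unfolding z by (blast intro: eqv_sym eqv_trans)

text \<open>The coefficients add up to a multiple of \<open>f\<close>.\<close>

lemma sum_R_L:
 assumes a: "a : \<A>"
 shows "eqv t (\<Sum>i\<in>{1..n}. R i (a ** L (n - i)) w) 0"
proof -
 have "(\<Sum>i\<in>{1..n}. R i (a ** L (n - i)) w) = (\<Sum>i\<le>n. R i (a ** L (n - i)) w)"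
 by (rule sum.mono_neutral_left) (auto simp: R_def)
 also have "eqv t ... (\<Sum>i\<le>n. \<Sum>l\<in>{1..<n}. g (a ** L (n - i) ** cf i l) (l # w))"
 using a by (intro eqv_sum R_eqv) simp
 also have "... = (\<Sum>l\<in>{1..<n}. \<Sum>i\<le>n. g (a ** (L (n - i) ** cf (i + 0) l)) (l # w))"
 using a by (subst sum.swap) (simp add: A.m_assoc)
 also have "eqv t ... (\<Sum>l\<in>{1..<n}. 0)"
 proof (intro eqv_sum)
 fix l assume l: "l : {1..<n}"
 show "eqv t (\<Sum>i\<le>n. g (a ** (L (n - i) ** cf (i + 0) l)) (l # w)) 0"
 using a l by (intro sum_zero[where F = "%y. g (a ** y) (l # w)"] L_c ad_subset[OF ad_l] Com_mult Com_L) (auto simp: Com_closed)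
 qed
 finally show ?thesis by simp
qed

lemma bb_Q:
 assumes a: "a : \<A>"
 shows "eqv t (bb (Q0 a w)) (\<Sum>i\<in>{1..n}. g (a ** (L (n - i) ** X (i - 1))) (1 # w)
 - (\<Sum>l\<in>{1..<i}. pre 1 (bt (a ** Z i l) (l # w))))" (is "eqv t _ ?S")
proof -
 have "bb (Q0 a w) = (\<Sum>i\<le>n. \<Sum>l\<in>{1..<i}. bb (g (a ** Z i l) (1 # l # w)))"
 by (simp only: Q0_def lift_sum)
 also have "... = (\<Sum>i\<in>{1..n}. \<Sum>l\<in>{1..<i}. bb (g (a ** Z i l) (1 # l # w)))"
 by (rule sum.mono_neutral_right) (auto simp: Suc_le_eq)
 also have "... = (\<Sum>i\<in>{1..n}. g (a ** (L (n - i) ** X (i - 1))) (1 # w) - R i (a ** L (n - i)) w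
 - (\<Sum>l\<in>{1..<i}. pre 1 (bt (a ** Z i l) (l # w))))"
 using a by (intro sum.cong telescope_b Com_L) auto
 also have "... = ?S - (\<Sum>i\<in>{1..n}. R i (a ** L (n - i)) w)"
 unfolding sum_subtractf by (rule diff_right_commute)
 finally have E: "bb (Q0 a w) = ?S - (\<Sum>i\<in>{1..n}. R i (a ** L (n - i)) w)" .
 show ?thesis using eqv_diff[OF eqv_refl[of t ?S] sum_R_L[OF a, of t w]] unfolding E diff_zero .
qed

lemma Q_b_0:
 assumes a: "a : \<A>"
 shows "eqv t (bb (Q0 a [])) (d0 a [])"
proof -
 have 1: "(\<Sum>i\<in>{1..n}. g (a ** (L (n - i) ** X (i - 1))) [1]
 - (\<Sum>l\<in>{1..<i}. pre 1 (bt (a ** Z i l) [l])))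
 = (\<Sum>i\<in>{1..n}. \<Sum>l<i. g (X l ** a ** Z i l) [1])"
 unfolding lessThan_shift_1 using a by (intro sum.cong) (auto simp: pre_simps sum_negf A.m_assoc)
 have 2: "(\<Sum>i\<in>{1..n}. \<Sum>l<i. g (X l ** a ** Z i l) [1])
 = (\<Sum>i\<le>n. \<Sum>l<i. g (X l ** a ** Z i l) [1])"
 by (rule sum.mono_neutral_left) (auto simp: Suc_le_eq)
 show ?thesis using eqv_trans[OF bb_Q[OF a, of t "[]", unfolded 1 2] eqv_sym[OF d0_eqv[OF a]]] .
qed

text \<open>The sum over \<open>i\<close> turns every occurrence of \<open>x\<^sup>i\<close> into \<open>f\<close>.
By \<open>Delta\<close> for \<open>x\<^sup>i\<^sup>+\<^sup>j\<close> only the part with \<open>uq (i +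
j)\<close> survives, and \<open>L_u\<close> collects it to \<open>x\<^sup>j\<close>.\<close>

lemma Q_b_Suc:
 assumes a: "a : \<A>" and w: "redw (j # v)"
 shows "eqv t (bb (Q0 a (j # v))) (QQ (b0 a (j # v)))"
proof -
 have j: "1 <= j" "j < n" using w by auto
 let ?G = "GR a v"
 have adG: "ad Com t (%y. ?G y l)" for l
 by (rule ad_subset[OF GR_ad[OF a]]) (auto simp: Com_closed)
 have adG': "ad Com t (%y. ?G (y ** q) l)" if "q : Com" for q l
 using adG[of l] Com_mult[OF _ that] Com_closed Com_closed[OF that] unfolding ad_def by (simp add: A.l_distr)
 have Q: "QQ (bt a (j # v)) = (\<Sum>i\<in>{1..n}. \<Sum>l\<in>{1..<i}. pre 1 (pre l (rm (Z i l) (bt a (j # v)))))"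
 unfolding QQ_eq by (rule sum.mono_neutral_right) auto
 have 1: "(\<Sum>i\<in>{1..n}. g (a ** (L (n - i) ** X (i - 1))) (1 # j # v)
 - (\<Sum>l\<in>{1..<i}. pre 1 (bt (a ** Z i l) (l # j # v))))
 = (\<Sum>i\<in>{1..n}. \<Sum>l<i. ?G (Z i l) (l + j)) + QQ (bt a (j # v))"
 unfolding Q sum.distrib[symmetric]
 proof (rule sum.cong[OF refl])
 fix i assume i: "i : {1..n}"
 have "bt (a ** Z i l) (j # v) = rm (Z i l) (bt a (j # v))" for l
 by (intro bt_rm a Com_mult Com_L Com_X) simp
 then show "g (a ** (L (n - i) ** X (i - 1))) (1 # j # v)
 - (\<Sum>l\<in>{1..<i}. pre 1 (bt (a ** Z i l) (l # j # v)))
 = (\<Sum>l<i. ?G (Z i l) (l + j)) + (\<Sum>l\<in>{1..<i}. pre 1 (pre l (rm (Z i l) (bt a (j # v)))))"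
 unfolding lessThan_shift_1 using i j
 by (simp add: GR_small[of j]) (simp add: pre_simps GR_def sum_subtractf sum_negf)
 qed
 have 2: "(\<Sum>i\<in>{1..n}. \<Sum>l<i. ?G (Z i l) (l + j)) = (\<Sum>i\<le>n. \<Sum>l<i. ?G (Z i l) (l + j))"
 by (rule sum.mono_neutral_left) (auto simp: Suc_le_eq)
 have 3: "(\<Sum>l<i. ?G (Z i l) (l + j)) =
 (\<Sum>m<i + j. GR (a ** L (n - i)) v (X (i + j - m - 1)) m) - (\<Sum>m<j. ?G (L (n - i) ** X (i + (j - m - 1))) m)" for i
 proof -
 have "(\<Sum>m<i + j. GR (a ** L (n - i)) v (X (i + j - m - 1)) m) = (\<Sum>m<i + j. ?G (L (n - i) ** X (i + j - m - 1)) m)"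
 using a by (simp add: GR_def A.m_assoc)
 moreover have "(\<Sum>m<j. ?G (L (n - i) ** X (i + j - m - 1)) m) = (\<Sum>m<j. ?G (L (n - i) ** X (i + (j - m - 1))) m)"
 by (rule sum.cong) auto
 ultimately show ?thesis unfolding sum_split[of _ i j] by simp
 qed
 have 4: "eqv t (\<Sum>i\<le>n. \<Sum>m<j. ?G (L (n - i) ** X (i + (j - m - 1))) m) 0"
 proof -
 have "eqv t (\<Sum>m<j. \<Sum>i\<le>n. ?G (L (n - i) ** X (i + (j - m - 1))) m) (\<Sum>m<j. 0)"
 by (intro eqv_sum sum_zero[OF adG _ L_X] Com_mult Com_L Com_X) simp
 then show ?thesis by (subst sum.swap) simp
 qed
 have 5: "eqv t (\<Sum>i\<le>n. \<Sum>m<i + j. GR (a ** L (n - i)) v (X (i + j - m - 1)) m) (Q0 (a ** X j) v)"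
 proof -
 let ?Z = "%k l. (Z k l)"
 have "eqv t (\<Sum>i\<le>n. \<Sum>m<i + j. GR (a ** L (n - i)) v (X (i + j - m - 1)) m)
 (\<Sum>i\<le>n. (\<Sum>k<n. \<Sum>l<k. GR (a ** L (n - i)) v (cf (i + j) k ** X (k - l - 1)) l)
 + (\<Sum>k\<le>n. \<Sum>l<k. GR (a ** L (n - i)) v (uq (i + j) ** ?Z k l) l))"
 using a by (intro eqv_sum GR_Delta) simp
 also have "... = (\<Sum>i\<le>n. \<Sum>k<n. \<Sum>l<k. ?G (L (n - i) ** cf (i + j) k ** X (k - l - 1)) l)
 + (\<Sum>i\<le>n. \<Sum>k\<le>n. \<Sum>l<k. ?G (L (n - i) ** uq (i + j) ** ?Z k l) l)"
 using a by (simp add: GR_def A.m_assoc sum.distrib)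
 also have "... = (\<Sum>k<n. \<Sum>l<k. \<Sum>i\<le>n. ?G (L (n - i) ** cf (i + j) k ** X (k - l - 1)) l)
 + (\<Sum>k\<le>n. \<Sum>l<k. \<Sum>i\<le>n. ?G (L (n - i) ** uq (i + j) ** ?Z k l) l)"
 by (simp only: sum.swap[where A = "{..n}" and B = "{..<n}"] sum.swap[where A = "{..n}" and B = "{..<k}" for k] sum.swap[where A = "{..n}" and B = "{..n}"])
 also have "eqv t ... ((\<Sum>k<n. \<Sum>l<k. 0) + (\<Sum>k\<le>n. \<Sum>l<k. ?G (X j ** ?Z k l) l))"
 proof (intro eqv_add eqv_sum)
 fix k l assume k: "k : {..<n}"
 then show "eqv t (\<Sum>i\<le>n. ?G (L (n - i) ** cf (i + j) k ** X (k - l - 1)) l) 0"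
 by (intro sum_zero[OF adG'[OF Com_X]] L_c Com_mult Com_L c_Com) auto
 next
 fix k l assume k: "k : {..n}"
 have "eqv t (?G ((\<Oplus>i\<in>{..n}. L (n - i) ** uq (i + j)) ** ?Z k l) l) (\<Sum>i\<le>n. ?G (L (n - i) ** uq (i + j) ** ?Z k l) l)"
 by (rule ad_finsum[OF adG' sgp_Com]) (auto intro!: Com_mult)
 then show "eqv t (\<Sum>i\<le>n. ?G (L (n - i) ** uq (i + j) ** ?Z k l) l) (?G (X j ** ?Z k l) l)"
 unfolding L_u by (rule eqv_sym)
 qed
 also have "(\<Sum>k<n. \<Sum>l<k. 0) + (\<Sum>k\<le>n. \<Sum>l<k. ?G (X j ** ?Z k l) l) = Q0 (a ** X j) v"
 using a by (simp add: Q0_def sum_GR A.m_assoc)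
 finally show ?thesis .
 qed
 have "eqv t (\<Sum>i\<le>n. \<Sum>l<i. ?G (Z i l) (l + j)) (Q0 (a ** X j) v)"
 using eqv_diff[OF 5 4] unfolding 3 by (simp add: sum_subtractf)
 from eqv_add[OF this eqv_refl[of t "QQ (bt a (j # v))"]]
 have "eqv t ((\<Sum>i\<le>n. \<Sum>l<i. ?G (Z i l) (l + j)) + QQ (bt a (j # v))) (QQ (b0 a (j # v)))"
 by (simp add: chain_simps)
 then show ?thesis using eqv_trans[OF bb_Q[OF a, of t "j # v"]] unfolding 1 2 by blast
qed

end

section \<open>Expansion of tensors into monomial words\<close>

context monogenic_algebra
begin

lemma co_eqI:
 assumes "!!i. i < n ==> cs i : \<K>" "a = (\<Oplus>i\<in>{..<n}. \<iota> (cs i) ** X i)" "j < n"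
 shows "co a j = cs j"
 using co_unique[of cs j] assms by simp

lemma co_add: "[|a : \<A>; b : \<A>; j < n|] ==> co (a \<oplus> b) j = co a j \<oplus>\<^bsub>K\<^esub> co b j"
proof (rule co_eqI[of "%j. co a j \<oplus>\<^bsub>K\<^esub> co b j"])
 assume a: "a : \<A>" and b: "b : \<A>"
 have "a \<oplus> b = (\<Oplus>i\<in>{..<n}. \<iota> (co a i) ** X i) \<oplus> (\<Oplus>i\<in>{..<n}. \<iota> (co b i) ** X i)"
 using expand[OF a] expand[OF b] by simp
 also have "... = (\<Oplus>i\<in>{..<n}. \<iota> (co a i) ** X i \<oplus> \<iota> (co b i) ** X i)"
 using a b by (intro A.M.finsum_addf[symmetric]) auto
 also have "... = (\<Oplus>i\<in>{..<n}. \<iota> (co a i \<oplus>\<^bsub>K\<^esub> co b i) ** X i)"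
 using a b by (intro A.M.finsum_cong') (auto simp: iota_add A.l_distr)
 finally show "a \<oplus> b = (\<Oplus>i\<in>{..<n}. \<iota> (co a i \<oplus>\<^bsub>K\<^esub> co b i) ** X i)" .
qed auto

lemma co_iota_mult: "[|a : \<A>; c : \<K>; j < n|] ==> co (\<iota> c ** a) j = c \<otimes>\<^bsub>K\<^esub> co a j"
proof (rule co_eqI[of "%j. c \<otimes>\<^bsub>K\<^esub> co a j"])
 assume a: "a : \<A>" and c: "c : \<K>"
 have "\<iota> c ** a = \<iota> c ** (\<Oplus>i\<in>{..<n}. \<iota> (co a i) ** X i)"
 using expand[OF a] by simp
 also have "... = (\<Oplus>i\<in>{..<n}. \<iota> c ** (\<iota> (co a i) ** X i))"
 using a c by (intro A.finsum_rdistr) auto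
 also have "... = (\<Oplus>i\<in>{..<n}. \<iota> (c \<otimes>\<^bsub>K\<^esub> co a i) ** X i)"
 using a c by (intro A.M.finsum_cong') (auto simp: iota_mult A.m_assoc)
 finally show "\<iota> c ** a = (\<Oplus>i\<in>{..<n}. \<iota> (c \<otimes>\<^bsub>K\<^esub> co a i) ** X i)" .
qed auto

lemma co_mult_iota: "[|a : \<A>; c : \<K>; j < n|] ==> co (a ** \<iota> c) j = co a j \<otimes>\<^bsub>K\<^esub> tw j c"
proof (rule co_eqI[of "%j. co a j \<otimes>\<^bsub>K\<^esub> tw j c"])
 assume a: "a : \<A>" and c: "c : \<K>"
 have "a ** \<iota> c = (\<Oplus>i\<in>{..<n}. \<iota> (co a i) ** X i) ** \<iota> c"
 using expand[OF a] by simp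
 also have "... = (\<Oplus>i\<in>{..<n}. \<iota> (co a i) ** X i ** \<iota> c)"
 using a c by (intro A.finsum_ldistr) auto
 also have "... = (\<Oplus>i\<in>{..<n}. \<iota> (co a i \<otimes>\<^bsub>K\<^esub> tw i c) ** X i)"
 using a c by (intro A.M.finsum_cong') (auto simp: iota_mult A.m_assoc X_iota)
 finally show "a ** \<iota> c = (\<Oplus>i\<in>{..<n}. \<iota> (co a i \<otimes>\<^bsub>K\<^esub> tw i c) ** X i)" .
qed auto

lemma smult_iota: "[|e : carrier k; a : \<A>|] ==> e \<odot> a = \<iota> (e \<odot>\<^bsub>K\<^esub> \<one>\<^bsub>K\<^esub>) ** a"
 by (simp add: iota_smult A.smult_mult_left)

lemma co_smult: "[|a : \<A>; e : carrier k; j < n|] ==> co (e \<odot> a) j = e \<odot>\<^bsub>K\<^esub> co a j"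
 by (simp add: smult_iota co_iota_mult K.smult_mult_left)

lemma co_iota: "[|c : \<K>; j < n|] ==> co (\<iota> c) j = (if j = 0 then c else \<zero>\<^bsub>K\<^esub>)"
 using n_ge_2 by (intro co_eqI[of "%j. if j = 0 then c else \<zero>\<^bsub>K\<^esub>"]) (auto simp: finsum_delta[of 0])

lemma co_X_small: "[|i < n; j < n|] ==> co (X i) j = (if j = i then \<one>\<^bsub>K\<^esub> else \<zero>\<^bsub>K\<^esub>)"
 by (simp add: co_X cK_small)

lemma X_image [simp]: "X ` S <= \<A>"
 by auto

text \<open>The normal form of a tensor with arbitrary entries: each entry is written in the basis of powers of
\<open>x\<close> and its coefficient is carried to the far left, collecting the twist of the powers
passed on the way.\<close>

fun ex :: "nat => 'x => 'x list => 'x chain" where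
 "ex t a [] = g a []"
| "ex t a (b # w) = (\<Sum>j\<in>{1..<n}. pre j (ex (t + j) (a ** \<iota> (tw t (co b j))) w))"

lemma ex_add: "set w <= \<A> ==> ad (\<A>) t (%a. ex t a w)"
proof (induction w arbitrary: t)
 case Nil
 then show ?case using ad_g' by simp
next
 case (Cons b w)
 have "eqv t (pre j (ex (t + j) ((a \<oplus> a') ** \<iota> (tw t (co b j))) w))
 (pre j (ex (t + j) (a ** \<iota> (tw t (co b j))) w) + pre j (ex (t + j) (a' ** \<iota> (tw t (co b j))) w))"
 if "a : \<A>" "a' : \<A>" "j : {1..<n}" for a a' j
 using that Cons ad_plus[OF Cons.IH[of "t + j"], of "a ** \<iota> (tw t (co b j))" "a' ** \<iota> (tw t (co b j))"]
 unfolding pre_simps(3)[symmetric] by (intro pre_eqv) (simp add: A.l_distr)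
 then show ?case unfolding ad_def ex.simps sum.distrib[symmetric] by (intro ballI eqv_sum)
qed

lemma ex_smult: "[|a : \<A>; e : carrier k; set w <= \<A>|] ==> ex t (e \<odot> a) w = sm e (ex t a w)"
proof (induction w arbitrary: t a)
 case (Cons b w)
 then show ?case by (simp add: sm_simps sm_pre A.smult_mult_left)
qed (simp add: sm_simps)

lemma ex_zero: "set w <= \<A> ==> eqv t (ex t \<zero> w) 0"
 by (intro ad_zero[OF ex_add sgp_carrier])

lemma ex_Cons_eqv:
 assumes "!!j. j : {1..<n} ==> eqv (t + j) (F j) (F' j)"
 shows "eqv t (\<Sum>j\<in>{1..<n}. pre j (F j)) (\<Sum>j\<in>{1..<n}. pre j (F' j))"
 by (intro eqv_sum pre_eqv assms)

lemma ex_add_at: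
 assumes "a : \<A>" "set w <= \<A>" "b : \<A>" "b' : \<A>" "i < length w"
 shows "eqv t (ex t a (w[i := b \<oplus> b'])) (ex t a (w[i := b]) + ex t a (w[i := b']))"
 using assms
proof (induction w arbitrary: t a i)
 case (Cons y w)
 show ?case
 proof (cases i)
 case 0
 have "eqv (t + j) (ex (t + j) (a ** \<iota> (tw t (co (b \<oplus> b') j))) w)
 (ex (t + j) (a ** \<iota> (tw t (co b j))) w + ex (t + j) (a ** \<iota> (tw t (co b' j))) w)" if j: "j : {1..<n}" for j
 using Cons.prems j ad_plus[OF ex_add[of w "t + j"], of "a ** \<iota> (tw t (co b j))" "a ** \<iota> (tw t (co b' j))"]
 by (simp add: co_add tw_add iota_add A.r_distr)
 from ex_Cons_eqv[OF this] show ?thesis using 0 by (simp add: pre_simps sum.distrib)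
 next
 case (Suc i')
 have "eqv (t + j) (ex (t + j) (a ** \<iota> (tw t (co y j))) (w[i' := b \<oplus> b']))
 (ex (t + j) (a ** \<iota> (tw t (co y j))) (w[i' := b]) + ex (t + j) (a ** \<iota> (tw t (co y j))) (w[i' := b']))"
 if j: "j : {1..<n}" for j
 using Cons.prems j Suc by (intro Cons.IH) auto
 from ex_Cons_eqv[OF this] show ?thesis using Suc by (simp add: pre_simps sum.distrib)
 qed
qed simp

lemma ex_smult_at:
 assumes "a : \<A>" "set w <= \<A>" "b : \<A>" "e : carrier k" "i < length w"
 shows "ex t a (w[i := e \<odot> b]) = sm e (ex t a (w[i := b]))"
 using assms
proof (induction w arbitrary: t a i)
 case (Cons y w)
 show ?case
 proof (cases i)
 case 0
 then show ?thesis using Cons.prems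
 by (auto simp: sm_simps sm_pre co_smult tw_smult iota_smult A.smult_mult_right ex_smult intro!: sum.cong)
 next
 case (Suc i')
 then show ?thesis using Cons by (auto simp: sm_simps sm_pre intro!: sum.cong)
 qed
qed simp

lemma ex_balance_0:
 assumes "a : \<A>" "b : \<A>" "c : \<K>"
 shows "ex t (a ** \<iota> (tw t c)) (b # w) = ex t a ((\<iota> c ** b) # w)"
 using assms by (auto simp: co_iota_mult tw_mult iota_mult A.m_assoc intro!: sum.cong)

lemma ex_balance:
 assumes "a : \<A>" "set w <= \<A>" "c : \<K>" "Suc i < length w"
 shows "ex t a (w[i := w ! i ** \<iota> c]) = ex t a (w[Suc i := \<iota> c ** w ! Suc i])"
 using assms
proof (induction w arbitrary: t a i)
 case (Cons y w)
 show ?case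
 proof (cases i)
 case 0
 then obtain z w' where w: "w = z # w'" using Cons.prems by (cases w) auto
 have "ex (t + j) (a ** \<iota> (tw t (co (y ** \<iota> c) j))) (z # w') = ex (t + j) (a ** \<iota> (tw t (co y j))) ((\<iota> c ** z) # w')"
 if "j : {1..<n}" for j
 using that Cons.prems w ex_balance_0[of "a ** \<iota> (tw t (co y j))" z c "t + j" w']
 by (simp add: co_mult_iota tw_mult tw_tw iota_mult A.m_assoc del: ex.simps)
 then show ?thesis using 0 w by (simp del: ex.simps(2) add: ex.simps(2)[of t a])
 next
 case (Suc i')
 then show ?thesis using Cons by (auto intro!: sum.cong)
 qed
qed simp

lemma ex_cyclic:
 assumes "a : \<A>" "set w <= \<A>" "c : \<K>" "w ~= []"
 shows "eqv t (ex t (\<iota> c ** a) w) (ex t a (w[length w - 1 := w ! (length w - 1) ** \<iota> c]))"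
 using assms
proof (induction w arbitrary: t a)
 case (Cons y w)
 show ?case
 proof (cases "w = []")
 case True
 have "eqv (t + j) (ex (t + j) (\<iota> c ** a ** \<iota> (tw t (co y j))) []) (ex (t + j) (a ** \<iota> (tw t (co (y ** \<iota> c) j))) [])" if "j : {1..<n}" for j
 using that Cons.prems eqv_g_twist[of "a ** \<iota> (tw t (co y j))" c "t + j" "[]"]
 by (simp add: co_mult_iota tw_mult tw_tw iota_mult A.m_assoc)
 from ex_Cons_eqv[OF this] show ?thesis using True by simp
 next
 case False
 have "eqv (t + j) (ex (t + j) (\<iota> c ** a ** \<iota> (tw t (co y j))) w)
 (ex (t + j) (a ** \<iota> (tw t (co y j))) (w[length w - 1 := w ! (length w - 1) ** \<iota> c]))" if "j : {1..<n}" for j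
 using that Cons.prems Cons.IH[of "a ** \<iota> (tw t (co y j))" "t + j"] False by (simp add: A.m_assoc)
 from ex_Cons_eqv[OF this] show ?thesis using False by (cases w) simp_all
 qed
qed simp

lemma ex_normalized:
 assumes "a : \<A>" "set w <= \<A>" "i < length w" "w ! i : \<iota> ` \<K>"
 shows "eqv t (ex t a w) 0"
 using assms
proof (induction w arbitrary: t a i)
 case (Cons y w)
 have "eqv (t + j) (ex (t + j) (a ** \<iota> (tw t (co y j))) w) 0" if j: "j : {1..<n}" for j
 proof (cases i)
 case 0
 then have "co y j = \<zero>\<^bsub>K\<^esub>" using Cons.prems j by (auto simp: co_iota)
 then show ?thesis using Cons.prems ex_zero[of w "t + j"] by simp
 next
 case (Suc i')
 then show ?thesis using Cons.prems j by (intro Cons.IH[of _ i']) auto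
 qed
 from ex_Cons_eqv[OF this] show ?case by (simp add: pre_simps)
qed simp

lemma ex_mono:
 assumes "a : \<A>" "redw v"
 shows "eqv t (ex t a (map X v)) (g a v)"
 using assms
proof (induction v arbitrary: t a)
 case (Cons i v)
 have "eqv (t + j) (ex (t + j) (a ** \<iota> (tw t (co (X i) j))) (map X v)) (if j = i then g a v else 0)" if j: "j : {1..<n}" for j
 proof (cases "j = i")
 case True
 then show ?thesis using Cons.prems Cons.IH[of a "t + j"] j by (simp add: co_X_small)
 next
 case False
 then show ?thesis using Cons.prems ex_zero[of "map X v" "t + j"] j by (auto simp: co_X_small)
 qed
 from ex_Cons_eqv[OF this]
 have "eqv t (ex t a (map X (i # v))) (\<Sum>j\<in>{1..<n}. pre j (if j = i then g a v else 0))" by simp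
 also have "(\<Sum>j\<in>{1..<n}. pre j (if j = i then g a v else 0)) = (\<Sum>j\<in>{1..<n}. if j = i then g a (i # v) else 0)"
 by (intro sum.cong) (auto simp: pre_simps)
 also have "... = g a (i # v)" using Cons.prems by (simp add: sum.delta)
 finally show ?case .
qed simp

subsection \<open>Tensor classes with monomial entries\<close>

lemma tens_gens_Cons: "a # w : tens_gens r \<longleftrightarrow> a : \<A> & set w <= \<A> & length w = r"
 by (auto simp: tens_gens_def)

lemma cl_add_0:
 assumes "a : \<A>" "a' : \<A>" "set w <= \<A>" "length w = r"
 shows "cl r ((a \<oplus> a') # w) = cl r (a # w) \<oplus>\<^bsub>\<N> r\<^esub> cl r (a' # w)"
 using cl_add[of "a # w" r 0 a a'] assms by (simp add: tens_gens_Cons)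

lemma cl_smult_0:
 assumes "a : \<A>" "e : carrier k" "set w <= \<A>" "length w = r"
 shows "cl r ((e \<odot> a) # w) = e \<odot>\<^bsub>\<N> r\<^esub> cl r (a # w)"
 using cl_smult[of "a # w" r 0 e a] assms by (simp add: tens_gens_Cons)

lemma cl_add_at:
 assumes "a : \<A>" "y : \<A>" "y' : \<A>" "set v <= \<A>" "set w <= \<A>" "length v + length w + 1 = r"
 shows "cl r (a # v @ (y \<oplus> y') # w) = cl r (a # v @ y # w) \<oplus>\<^bsub>\<N> r\<^esub> cl r (a # v @ y' # w)"
 using cl_add[of "a # v @ y # w" r "length v + 1" y y'] assms by (simp add: tens_gens_Cons list_update_append)

lemma cl_normal_at:
 assumes "a : \<A>" "c : \<K>" "set v <= \<A>" "set w <= \<A>" "length v + length w + 1 = r"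
 shows "cl r (a # v @ \<iota> c # w) = \<zero>\<^bsub>\<N> r\<^esub>"
 using assms by (intro cl_zero[of _ r "length v + 1"]) (auto simp: tens_gens_Cons nth_append)

lemma cl_finsum_at:
 assumes "a : \<A>" "set v <= \<A>" "set w <= \<A>" "length v + length w + 1 = r"
 and "finite I" "!!i. i : I ==> y i : \<A>"
 shows "cl r (a # v @ (\<Oplus>i\<in>I. y i) # w) = (\<Oplus>\<^bsub>\<N> r\<^esub>i\<in>I. cl r (a # v @ y i # w))"
 using assms(5,6)
proof (induction I)
 case empty
 have "cl r (a # v @ \<iota> \<zero>\<^bsub>K\<^esub> # w) = \<zero>\<^bsub>\<N> r\<^esub>" using assms(1-4) by (intro cl_normal_at) auto
 then show ?case by simp
next
 case (insert i I)
 have "(\<Oplus>i\<in>I. y i) : \<A>" using insert by (intro A.M.finsum_closed) auto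
 then show ?case using insert assms(1-4)
 by (simp add: A.M.finsum_insert NM.M.finsum_insert cl_add_at Pi_def tens_gens_Cons)
qed

lemma cl_adjacent:
 assumes "set (v @ y # z # w) <= \<A>" "c : \<K>" "length v + length w + 1 = r"
 shows "cl r (v @ (y ** \<iota> c) # z # w) = cl r (v @ y # (\<iota> c ** z) # w)"
 using cl_balance[of "v @ y # z # w" r "length v" c] assms
 by (simp add: tens_gens_def nx_def list_update_append nth_append)

lemma cl_wrap:
 assumes "a : \<A>" "set (v @ [y]) <= \<A>" "c : \<K>" "length v + 1 = r"
 shows "cl r (a # v @ [y ** \<iota> c]) = cl r ((\<iota> c ** a) # v @ [y])"
 using cl_balance[of "a # v @ [y]" r "length v + 1" c] assms
 by (auto simp: tens_gens_def nx_def list_update_append nth_append)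

lemma cl_move:
 assumes "a : \<A>" "c : \<K>" "y : \<A>" "set w <= \<A>" "length v + length w + 1 = r"
 shows "cl r (a # map X v @ (\<iota> c ** y) # w) = cl r ((a ** \<iota> (tw (sum_list v) c)) # map X v @ y # w)"
 using assms(2-5)
proof (induction v arbitrary: c y w rule: rev_induct)
 case Nil
 then show ?case using cl_adjacent[of "[]" a y w c r] assms(1) by simp
next
 case (snoc i v)
 have "cl r (a # map X (v @ [i]) @ (\<iota> c ** y) # w) = cl r ((a # map X v) @ (X i ** \<iota> c) # y # w)"
 using cl_adjacent[of "a # map X v" "X i" y w c r] assms(1) snoc.prems by (auto simp: image_subset_iff)
 also have "... = cl r (a # map X v @ (\<iota> (tw i c) ** X i) # y # w)" using snoc.prems by (simp add: X_iota)
 also have "... = cl r ((a ** \<iota> (tw (sum_list v) (tw i c))) # map X v @ X i # y # w)"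
 using snoc.prems by (intro snoc.IH) auto
 finally show ?case by (simp add: tw_tw)
qed

text \<open>Evaluation of a chain, with a monomial prefix \<open>v\<close> inserted behind the coefficient.\<close>

definition evp :: "nat => nat list => 'x chain => ('x list => 'k) set"
 where "evp r v = frag_eval (\<N> r) (%p. if fst p : \<A> & length v + length (snd p) = r
 then cl r (fst p # map X v @ map X (snd p)) else \<zero>\<^bsub>\<N> r\<^esub>)"

lemma evp_atom:
 "(if fst p : \<A> & length v + length (snd p) = r
 then cl r (fst p # map X v @ map X (snd p)) else \<zero>\<^bsub>\<N> r\<^esub>) : carrier (\<N> r)"
 by (auto simp: tens_gens_Cons)

lemma evp_closed [simp]: "evp r v u : carrier (\<N> r)"
 and evp_add: "evp r v (u + u') = evp r v u \<oplus>\<^bsub>\<N> r\<^esub> evp r v u'"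
 and evp_neg: "evp r v (- u) = \<ominus>\<^bsub>\<N> r\<^esub> evp r v u"
 and evp_diff: "evp r v (u - u') = evp r v u \<ominus>\<^bsub>\<N> r\<^esub> evp r v u'"
 and evp_zero [simp]: "evp r v 0 = \<zero>\<^bsub>\<N> r\<^esub>"
 and evp_sum: "evp r v (sum f I) = (\<Oplus>\<^bsub>\<N> r\<^esub>i\<in>I. evp r v (f i))"
 unfolding evp_def
 by (rule NM.M.frag_eval_closed[OF evp_atom] NM.M.frag_eval_add[OF evp_atom] NM.M.frag_eval_neg[OF evp_atom]
 NM.M.frag_eval_diff[OF evp_atom] NM.M.frag_eval_zero[OF evp_atom] NM.M.frag_eval_sum[OF evp_atom])+

lemma evp_g: "[|a : \<A>; length v + length w = r|] ==> evp r v (g a w) = cl r (a # map X v @ map X w)"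
 unfolding evp_def by (subst NM.M.frag_eval_of[OF evp_atom]) simp

lemma evp_g': "~ (a : \<A> & length v + length w = r) ==> evp r v (g a w) = \<zero>\<^bsub>\<N> r\<^esub>"
 unfolding evp_def by (subst NM.M.frag_eval_of[OF evp_atom]) auto

lemma evp_pre: "evp r v (pre i u) = evp r (v @ [i]) u"
proof -
 have "Poly_Mapping.keys u <= UNIV" by simp
 then show ?thesis
 proof (induction u rule: frag_induction)
 case (one p)
 have "evp r v (g a (i # w)) = evp r (v @ [i]) (g a w)" for a w
 by (cases "a : \<A> & length v + length (i # w) = r") (auto simp: evp_g evp_g')
 then show ?case by (simp add: pre_def lift_def)
 qed (simp_all add: pre_simps evp_diff)
qed

text \<open>Evaluation inverts the expansion.\<close>

lemma evp_expand:
 assumes "a : \<A>" "set w <= \<A>" "length v + length w = r"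
 shows "evp r v (ex (sum_list v) a w) = cl r (a # map X v @ w)"
 using assms
proof (induction w arbitrary: v a)
 case Nil
 then show ?case by (simp add: evp_g)
next
 case (Cons b w)
 have b: "b : \<A>" using Cons.prems by simp
 let ?f = "%j. cl r (a # map X v @ (\<iota> (co b j) ** X j) # w)"
 have f: "?f : {..<n} \<rightarrow> carrier (\<N> r)" using Cons.prems b by (auto simp: tens_gens_Cons)
 have "cl r (a # map X v @ b # w) = cl r (a # map X v @ (\<Oplus>j\<in>{..<n}. \<iota> (co b j) ** X j) # w)"
 using expand[OF b] by simp
 also have "... = (\<Oplus>\<^bsub>\<N> r\<^esub>j\<in>{..<n}. ?f j)"
 using Cons.prems b by (intro cl_finsum_at) (auto simp: image_subset_iff)
 also have "... = (\<Oplus>\<^bsub>\<N> r\<^esub>j\<in>{1..<n}. ?f j)"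
 proof (rule NM.M.add.finprod_mono_neutral_cong_right)
 fix j assume "j : {..<n} - {1..<n}"
 then have "j = 0" "0 < n" by auto
 then show "?f j = \<zero>\<^bsub>\<N> r\<^esub>" using Cons.prems b cl_normal_at[of a "co b 0" "map X v" w r]
 by (auto simp: image_subset_iff)
 qed (use f in auto)
 also have "... = (\<Oplus>\<^bsub>\<N> r\<^esub>j\<in>{1..<n}. evp r v (pre j (ex (sum_list v + j) (a ** \<iota> (tw (sum_list v) (co b j))) w)))"
 proof (rule NM.M.finsum_cong')
 fix j assume j: "j : {1..<n}"
 have "?f j = cl r ((a ** \<iota> (tw (sum_list v) (co b j))) # map X v @ X j # w)"
 using Cons.prems b j by (intro cl_move) auto
 also have "... = evp r (v @ [j]) (ex (sum_list (v @ [j])) (a ** \<iota> (tw (sum_list v) (co b j))) w)"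
 using Cons.prems b j by (subst Cons.IH) auto
 finally show "?f j = evp r v (pre j (ex (sum_list v + j) (a ** \<iota> (tw (sum_list v) (co b j))) w))"
 by (simp add: evp_pre)
 qed auto
 finally show ?case by (simp add: evp_sum)
qed

abbreviation ev :: "nat => 'x chain => ('x list => 'k) set" where "ev r \<equiv> evp r []"

lemma ev_expand: "a # w : tens_gens r ==> ev r (ex 0 a w) = cl r (a # w)"
 using evp_expand[of a w "[]" r] by (simp add: tens_gens_Cons)

text \<open>A scalar that has travelled through the word returns to the coefficient with the twist prescribed by the
relations for \<open>t = 0\<close>.\<close>

lemma ev_N: "u : N 0 ==> ev r u = \<zero>\<^bsub>\<N> r\<^esub>"
proof (induction rule: N.induct)
 case (N_diff u v)
 then show ?case by (simp add: evp_diff a_minus_def NM.M.r_neg)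
next
 case (N_add a b w)
 have cl: "cl r (y # map X w) : carrier (\<N> r)" if "y : \<A>" "length w = r" for y
 using that by (simp add: tens_gens_Cons image_subset_iff)
 show ?case
 proof (cases "length w = r")
 case True
 then have "ev r (g (a \<oplus> b) w) = ev r (g a w + g b w)"
 using N_add by (simp add: evp_add evp_g cl_add_0 image_subset_iff)
 then show ?thesis by (simp add: diff_diff_eq evp_diff a_minus_def NM.M.r_neg del: evp_add)
 next
 case False
 then show ?thesis by (simp add: evp_diff evp_g' a_minus_def NM.M.r_neg)
 qed
next
 case (N_twist a d w)
 have "ev r (g (\<iota> d ** a) w) = ev r (g (a ** \<iota> (tw (0 + sum_list w) d)) w)"
 proof (cases "length w = r")
 case l: True
 show ?thesis
 proof (cases w rule: rev_cases)
 case Nil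
 then show ?thesis using N_twist l cl_balance[of "[a]" 0 0 d] by (simp add: evp_g nx_def tens_gens_Cons)
 next
 case (snoc v i)
 have "cl r ((\<iota> d ** a) # map X v @ [X i]) = cl r (a # map X v @ [X i ** \<iota> d])"
 using N_twist l snoc by (intro cl_wrap[symmetric]) auto
 also have "... = cl r (a # map X v @ [\<iota> (tw i d) ** X i])" using N_twist by (simp add: X_iota)
 also have "... = cl r ((a ** \<iota> (tw (sum_list v) (tw i d))) # map X v @ [X i])"
 using N_twist l snoc by (intro cl_move) auto
 finally show ?thesis using N_twist l snoc by (simp add: evp_g tw_tw)
 qed
 next
 case False
 then show ?thesis by (simp add: evp_g')
 qed
 then show ?case by (simp add: evp_diff a_minus_def NM.M.r_neg)
qed simp

lemma ev_eqv: "eqv 0 u v ==> ev r u = ev r v"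
proof -
 assume "eqv 0 u v"
 then have "ev r u \<ominus>\<^bsub>\<N> r\<^esub> ev r v = \<zero>\<^bsub>\<N> r\<^esub>"
 using ev_N[of "u - v" r] by (simp add: eqv_def evp_diff)
 then show ?thesis by (rule NM.M.diff_zero_iff[OF evp_closed evp_closed, THEN iffD1])
qed

end

section \<open>Linear maps defined on chains\<close>

context monogenic_algebra
begin

definition Sp :: "('x \<times> nat list) set => 'x chain set" where "Sp S = {u. Poly_Mapping.keys u <= S}"

lemma Sp_zero [simp]: "0 : Sp S"
 and Sp_add: "[|u : Sp S; v : Sp S|] ==> u + v : Sp S"
 and Sp_diff: "[|u : Sp S; v : Sp S|] ==> u - v : Sp S"
 and Sp_g [simp]: "g a w : Sp S \<longleftrightarrow> (a, w) : S"
 and Sp_mono: "[|u : Sp S; S <= S'|] ==> u : Sp S'"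
 using Poly_Mapping.keys_add[of u v] keys_diff[of u v] by (auto simp: Sp_def)

lemma Sp_neg: "u : Sp S ==> - u : Sp S"
 using Sp_diff[of 0 S u] by simp

lemma Sp_sum: "(!!i. i : I ==> f i : Sp S) ==> sum f I : Sp S"
 by (induction I rule: infinite_finite_induct) (auto intro: Sp_add)

lemma Sp_induct [consumes 1, case_names zero gen diff]:
 assumes "u : Sp S" "Q 0" "!!a w. (a, w) : S ==> Q (g a w)" "!!u v. [|Q u; Q v|] ==> Q (u - v)"
 shows "Q u"
proof -
 have "Poly_Mapping.keys u <= S" using assms(1) by (simp add: Sp_def)
 then show ?thesis
 proof (induction u rule: frag_induction)
 case (one p)
 then show ?case using assms(3)[of "fst p" "snd p"] by simp
 qed (use assms in auto)
qed

lemma Sp_lift: "[|u : Sp S; !!a w. (a, w) : S ==> G a w : Sp S'|] ==> lift G u : Sp S'"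
 by (induction u rule: Sp_induct) (auto simp: lift_diff intro: Sp_diff)

lemma Ca_Sp: "Ca = Sp (\<A> \<times> UNIV)"
 by (simp add: Ca_def Sp_def)

definition addi :: "('x chain => 'x chain) => bool" where "addi F \<longleftrightarrow> (ALL u v. F (u - v) = F u - F v)"

lemma addi_zero: "addi F ==> F 0 = 0"
 unfolding addi_def by (metis diff_self)

lemma addi_add: "addi F ==> F (u + v) = F u + F v"
 unfolding addi_def by (metis add_diff_cancel diff_add_cancel)

lemma Sp_eqv:
 assumes "u : Sp S" "addi F" "addi F'" "!!a w. (a, w) : S ==> eqv t (F (g a w)) (F' (g a w))"
 shows "eqv t (F u) (F' u)"
 using assms(1)
proof (induction u rule: Sp_induct)
 case (diff u v)
 then show ?case using assms(2,3) by (simp add: addi_def eqv_diff)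
qed (simp_all add: assms(4) addi_zero[OF assms(2)] addi_zero[OF assms(3)])

text \<open>Additive operators on chains that carry the congruence for one twist into that for another
 and commute with scalars up to congruence.\<close>

definition op :: "nat => nat => ('x chain => 'x chain) => bool"
 where "op t t' F \<longleftrightarrow> addi F & (ALL u:N t. F u : N t') & (ALL u:Ca. F u : Ca)
 & (ALL e:carrier k. ALL u:Ca. eqv t' (F (sm e u)) (sm e (F u)))"

lemma opD:
 assumes "op t t' F"
 shows "addi F" "u : N t ==> F u : N t'" "u : Ca ==> F u : Ca"
 "[|e : carrier k; u : Ca|] ==> eqv t' (F (sm e u)) (sm e (F u))"
 using assms by (auto simp: op_def)

lemma op_eqv: "[|op t t' F; eqv t u v|] ==> eqv t' (F u) (F v)"
 using opD(1)[of t t' F] opD(2)[of t t' F "u - v"] by (simp add: eqv_def addi_def)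

lemma op_lift:
 assumes "!!w. wd (t + sum_list w) t' (%a. G a w)" and "!!a w. a : \<A> ==> G a w : Ca"
 shows "op t t' (lift G)"
 unfolding op_def
proof (intro conjI ballI)
 show "addi (lift G)" by (simp add: addi_def lift_diff)
 show "lift G u : N t'" if "u : N t" for u using lift_N[OF assms(1) that] .
 show "lift G u : Ca" if "u : Ca" for u
 using that assms(2) unfolding Ca_Sp by (intro Sp_lift) auto
 show "eqv t' (lift G (sm e u)) (sm e (lift G u))" if "e : carrier k" "u : Ca" for e u
 using lift_sm[OF assms(1) that(2,1)] .
qed

lemma op_comp: "[|op t t' F; op t' t'' F'|] ==> op t t'' (%u. F' (F u))"
 unfolding op_def
proof (intro conjI ballI; elim conjE)
 fix e u
 assume *: "e : carrier k" "u : Ca" "ALL u:N t'. F' u : N t''" "addi F'" "ALL u:Ca. F u : Ca"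
 "ALL e:carrier k. ALL u:Ca. eqv t' (F (sm e u)) (sm e (F u))"
 "ALL e:carrier k. ALL u:Ca. eqv t'' (F' (sm e u)) (sm e (F' u))"
 have "F (sm e u) - sm e (F u) : N t'" using * by (simp add: eqv_def)
 then have "eqv t'' (F' (F (sm e u))) (F' (sm e (F u)))"
 using *(3)[rule_format, of "F (sm e u) - sm e (F u)"] *(4) by (simp add: eqv_def addi_def)
 moreover have "eqv t'' (F' (sm e (F u))) (sm e (F' (F u)))" using * by blast
 ultimately show "eqv t'' (F' (F (sm e u))) (sm e (F' (F u)))" by (rule eqv_trans)
qed (auto simp: addi_def)

lemma sm_add: "sm e (u + v) = sm e u + sm e v" and sm_neg: "sm e (- u) = - sm e u"
 by (simp_all add: sm_simps)

lemma op_add: "[|op t t' F; op t t' F'|] ==> op t t' (%u. F u + F' u)"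
 unfolding op_def by (auto simp: addi_def sm_add Ca_Sp intro: N_plus Sp_add eqv_add)

lemma op_neg: "op t t' F ==> op t t' (%u. - F u)"
 unfolding op_def by (auto simp: addi_def sm_neg Ca_Sp intro: N_neg Sp_neg eqv_neg)

lemma op_id: "op t t (%u. u)"
 by (auto simp: op_def addi_def)

lemma Ca_closure: "0 : Ca" "[|u : Ca; v : Ca|] ==> u + v : Ca" "[|u : Ca; v : Ca|] ==> u - v : Ca"
 "u : Ca ==> - u : Ca" "(!!i. i : I ==> f i : Ca) ==> sum f I : Ca" "g a w : Ca \<longleftrightarrow> a : \<A>"
 unfolding Ca_Sp by (auto intro: Sp_add Sp_diff Sp_neg Sp_sum)

lemma Ca_pre: "u : Ca ==> pre i u : Ca"
 unfolding Ca_Sp pre_def by (rule Sp_lift) auto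

lemma Ca_R: "a : \<A> ==> R m a w : Ca"
 by (auto simp: R_def Ca_closure)

lemma Ca_bt: "a : \<A> ==> bt a w : Ca"
 by (induction w rule: induct_list012) (auto intro!: Ca_closure Ca_R Ca_pre simp: Ca_closure(6))

lemma op_bb: "op t t bb"
proof (rule op_lift[OF wd_b0])
 show "b0 a w : Ca" if "a : \<A>" for a w
 using that Ca_bt[OF that, of w] by (cases w) (auto simp: Ca_closure simp del: bt.simps)
qed

lemma op_ss: "op t t ss"
 by (rule op_lift[OF wd_s0], rename_tac a w, case_tac w) (auto simp: Ca_closure)

lemma op_PP: "op t (t + n) PP"
 by (rule op_lift[OF wd_P0], rename_tac a w, case_tac w rule: word_cases) (auto simp: Ca_closure)

lemma op_QQ: "op (t + n) t QQ"
 by (rule op_lift[OF wd_Q0]) (auto simp: Q0_def Ca_closure)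

lemma op_pp: "op t t pp"
 by (rule op_lift[OF wd_p0], rename_tac a w, case_tac w rule: word_cases) (auto simp: Ca_closure)

lemma op_dd2: "op (t + n) t dd2"
 by (rule op_lift[OF wd_d0], rename_tac a w, case_tac w) (auto simp: Ca_closure)

definition functional :: "nat => ('k, 'y, 'q) module_scheme => ('x chain => 'y) => bool"
 where "functional t M \<Phi> \<longleftrightarrow> (ALL u. \<Phi> u : carrier M) & (ALL u v. \<Phi> (u + v) = \<Phi> u \<oplus>\<^bsub>M\<^esub> \<Phi> v)
 & (ALL u:N t. \<Phi> u = \<zero>\<^bsub>M\<^esub>) & (ALL e:carrier k. ALL u:Ca. \<Phi> (sm e u) = e \<odot>\<^bsub>M\<^esub> \<Phi> u)"

lemma functionalD:
 assumes "functional t M \<Phi>"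
 shows "\<Phi> u : carrier M" "\<Phi> (u + v) = \<Phi> u \<oplus>\<^bsub>M\<^esub> \<Phi> v" "u : N t ==> \<Phi> u = \<zero>\<^bsub>M\<^esub>"
 "[|e : carrier k; u : Ca|] ==> \<Phi> (sm e u) = e \<odot>\<^bsub>M\<^esub> \<Phi> u"
 using assms by (auto simp: functional_def)

lemma functional_eqv:
 assumes "module k M" "functional t M \<Phi>" "eqv t u v"
 shows "\<Phi> u = \<Phi> v"
proof -
 interpret M: module k M by fact
 have "\<Phi> ((u - v) + v) = \<Phi> v"
 unfolding functionalD(2)[OF assms(2)] using assms(3) functionalD(1,3)[OF assms(2)] by (simp add: eqv_def)
 then show ?thesis by simp
qed

lemma functional_diff:
 assumes "module k M" "functional t M \<Phi>"
 shows "\<Phi> (u - v) = \<Phi> u \<ominus>\<^bsub>M\<^esub> \<Phi> v"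
proof -
 interpret M: module k M by fact
 note F = functionalD[OF assms(2)]
 have "\<Phi> (u - v) \<oplus>\<^bsub>M\<^esub> \<Phi> v = \<Phi> u" using F(2)[of "u - v" v] by simp
 then show ?thesis using F(1) by (metis M.add.inv_solve_right a_minus_def)
qed

lemma functional_comp:
 assumes "op t t' F" "module k M" "functional t' M \<Phi>"
 shows "functional t M (%u. \<Phi> (F u))"
 using functionalD[OF assms(3)] functional_eqv[OF assms(2,3)] opD[OF assms(1)] addi_add[OF opD(1)[OF assms(1)]]
 unfolding functional_def by (metis (no_types, lifting))

lemma functional_ev: "functional 0 (\<N> r) (ev r)"
 unfolding functional_def
proof (intro conjI ballI allI)
 fix e u assume e: "e : carrier k" and u: "u : Ca"
 show "ev r (sm e u) = e \<odot>\<^bsub>\<N> r\<^esub> ev r u"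
 using u unfolding Ca_Sp
 proof (induction u rule: Sp_induct)
 case (gen a w)
 then show ?case using e
 by (cases "length w = r") (auto simp: sm_simps evp_g evp_g' cl_smult_0 NM.smult_r_null)
 next
 case (diff u v)
 then show ?case using e by (simp add: sm_simps evp_diff a_minus_def NM.smult_r_distr NM.smult_r_minus)
 qed (use e in \<open>simp add: sm_simps NM.smult_r_null\<close>)
qed (auto simp: evp_add ev_N)

text \<open>Chains on reduced words of length \<open>r\<close>.\<close>

definition Cr :: "nat => 'x chain set" where "Cr r = Sp (\<A> \<times> {w. length w = r & redw w})"

lemma Cr_pre: "[|u : Cr r; i : {1..<n}|] ==> pre i u : Cr (Suc r)"
 unfolding Cr_def pre_def by (rule Sp_lift) auto

lemma Cr_ex: "[|a : \<A>; set w <= \<A>|] ==> ex t a w : Cr (length w)"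
proof (induction w arbitrary: t a)
 case (Cons b w)
 have "pre j (ex (t + j) (a ** \<iota> (tw t (co b j))) w) : Cr (Suc (length w))" if "j : {1..<n}" for j
 using Cons that by (intro Cr_pre Cons.IH) auto
 then show ?case unfolding ex.simps list.size Cr_def add.right_neutral add_Suc_right by (intro Sp_sum)
qed (simp add: Cr_def)

text \<open>The expansion respects all relations of the tensor product, so that linear maps may be prescribed on
monomial words modulo the twisted relations alone.\<close>

lemma ex_chain_hom:
 fixes M :: "('k, 'y, 'q) module_scheme"
 assumes M: "module k M" and \<Phi>: "functional 0 M \<Phi>"
 shows "EX h:mod_hom k (\<N> r) M. ALL u:Cr r. h (ev r u) = \<Phi> u"
proof -
 interpret M: module k M by fact
 note F = functionalD[OF \<Phi>] and E = functional_eqv[OF M \<Phi>]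
 let ?F = "%l. \<Phi> (ex 0 (hd l) (tl l))"
 have exCa: "ex 0 a w : Ca" if "a : \<A>" "set w <= \<A>" for a w
 using Cr_ex[OF that, of 0] unfolding Cr_def Ca_Sp by (rule Sp_mono) auto
 have gens: "EX a w. l = a # w & a : \<A> & set w <= \<A> & length w = r" if "l : tens_gens r" for l
 using that by (cases l) (auto simp: tens_gens_def)
 have upd: "set (w[i := y]) <= \<A>" if "set w <= \<A>" "y : \<A>" for w i y
 using that set_update_subset_insert[of w i y] by blast
 have ml: "multilinear r ?F M"
 unfolding multilinear_def
 proof (intro conjI ballI allI impI)
 show "?F l : carrier M" for l by (rule F(1))
 fix l i assume l: "l : tens_gens r" and i: "i <= r"
 then obtain y w where lw: "l = y # w" "y : \<A>" "set w <= \<A>" "length w = r" using gens by blast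
 {
 fix a a' assume a: "a : \<A>" "a' : \<A>"
 show "?F (l[i := a \<oplus> a']) = ?F (l[i := a]) \<oplus>\<^bsub>M\<^esub> ?F (l[i := a'])"
 proof (cases i)
 case 0
 then show ?thesis using E[OF ad_plus[OF ex_add[OF lw(3), of 0] a]] lw F(2) by simp
 next
 case (Suc j)
 then show ?thesis using E[OF ex_add_at[OF lw(2,3) a, of j 0]] lw i F(2) by simp
 qed
 next
 fix c a assume a: "c : carrier k" "a : \<A>"
 show "?F (l[i := c \<odot> a]) = c \<odot>\<^bsub>M\<^esub> ?F (l[i := a])"
 proof (cases i)
 case 0
 then show ?thesis using a lw F(4)[OF a(1) exCa] by (simp add: ex_smult)
 next
 case (Suc j)
 then show ?thesis using a lw i F(4)[OF a(1) exCa] upd[OF lw(3) a(2)] by (simp add: ex_smult_at)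
 qed
 next
 fix c assume c: "c : \<K>"
 show "?F (l[i := l ! i ** \<iota> c]) = ?F (l[nx r i := \<iota> c ** l ! nx r i])"
 proof (cases i)
 case 0
 show ?thesis
 proof (cases w)
 case Nil
 then show ?thesis using 0 lw c E[OF eqv_g_twist[of y c 0 "[]"]] by (simp add: nx_def)
 next
 case (Cons b w')
 then show ?thesis using 0 lw c ex_balance_0[of y b c 0 w'] by (auto simp: nx_def simp del: ex.simps)
 qed
 next
 case (Suc j)
 show ?thesis
 proof (cases "i = r")
 case True
 have "w ~= []" using lw True Suc by auto
 then show ?thesis using Suc True lw c E[OF ex_cyclic[OF lw(2,3) c, of 0]] by (auto simp: nx_def)
 next
 case False
 then show ?thesis using Suc i lw c ex_balance[OF lw(2,3) c, of j 0] by (simp add: nx_def)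
 qed
 qed
 }
 qed
 have nz: "normalized r ?F M"
 unfolding normalized_def
 proof (intro ballI allI impI)
 fix l i assume l: "l : tens_gens r" and i: "1 <= i" "i <= r" "l ! i : \<iota> ` \<K>"
 then obtain y w where lw: "l = y # w" "y : \<A>" "set w <= \<A>" "length w = r" using gens by blast
 obtain j where j: "i = Suc j" using i by (cases i) auto
 have "\<Phi> 0 = \<zero>\<^bsub>M\<^esub>" by (intro F(3) N_zero)
 then show "?F l = \<zero>\<^bsub>M\<^esub>" using E[OF ex_normalized[OF lw(2,3), of j 0]] i lw j by simp
 qed
 obtain h where h: "h : mod_hom k (\<N> r) M" "!!l. l : tens_gens r ==> h (cl r l) = ?F l"
 using ex_norm_hom[OF M ml nz] by blast
 have "h (ev r u) = \<Phi> u" if "u : Cr r" for u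
 using that unfolding Cr_def
 proof (induction u rule: Sp_induct)
 case zero
 then show ?case using mod_hom_zero[OF norm_module M h(1)] F(3)[OF N_zero] by simp
 next
 case (gen a w)
 then show ?case using h(2)[of "a # map X w"] E[OF ex_mono[of a w 0]] by (simp add: evp_g tens_gens_Cons)
 next
 case (diff u v)
 then show ?case using mod_hom_minus[OF norm_module M h(1)]
 by (simp add: evp_diff functional_diff[OF M \<Phi>])
 qed
 then show ?thesis using h(1) by blast
qed

text \<open>The quotient by the span of the monomial tensors is zero by the universal property.\<close>

lemma ev_surj: "y : carrier (\<N> r) ==> EX u:Cr r. y = ev r u"
proof -
 assume y: "y : carrier (\<N> r)"
 have sub: "submodule (ev r ` Cr r) k (\<N> r)"
 proof (rule submoduleI[OF norm_module])
 show "ev r ` Cr r <= carrier (\<N> r)" by auto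
 show "\<zero>\<^bsub>\<N> r\<^esub> : ev r ` Cr r" by (rule image_eqI[of _ _ 0]) (auto simp: Cr_def)
 show "a \<oplus>\<^bsub>\<N> r\<^esub> b : ev r ` Cr r" if "a : ev r ` Cr r" "b : ev r ` Cr r" for a b
 using that unfolding Cr_def by (auto simp: evp_add[symmetric] intro!: imageI Sp_add)
 show "c \<odot>\<^bsub>\<N> r\<^esub> a : ev r ` Cr r" if c: "c : carrier k" and a: "a : ev r ` Cr r" for a c
 proof -
 obtain u where u: "a = ev r u" "u : Cr r" using a by blast
 have "u : Ca" using u(2) unfolding Cr_def Ca_Sp by (rule Sp_mono) auto
 then have "c \<odot>\<^bsub>\<N> r\<^esub> a = ev r (sm c u)" using functionalD(4)[OF functional_ev c] u by simp
 moreover have "sm c u : Cr r"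
 using u(2) c unfolding Cr_def sm_def by (intro Sp_lift) auto
 ultimately show ?thesis by blast
 qed
 qed
 interpret Q: mod_quotient k "\<N> r" "ev r ` Cr r"
 by (intro mod_quotient.intro norm_module sub)
 have z: "restrict (%_. \<zero>\<^bsub>quot_mod (\<N> r) (ev r ` Cr r)\<^esub>) (carrier (\<N> r)) : mod_hom k (\<N> r) (quot_mod (\<N> r) (ev r ` Cr r))"
 proof -
 interpret QM: module k "quot_mod (\<N> r) (ev r ` Cr r)" by (rule Q.quot_module)
 show ?thesis by (intro mod_hom_restrictI norm_module) (auto simp: QM.smult_r_null)
 qed
 have "restrict Q.q (carrier (\<N> r)) = restrict (%_. \<zero>\<^bsub>quot_mod (\<N> r) (ev r ` Cr r)\<^esub>) (carrier (\<N> r))"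
 proof (rule norm_hom_eqI[OF Q.quot_module Q.q_hom z])
 fix l assume l: "l : tens_gens r"
 then obtain a w where lw: "l = a # w" by (cases l) (auto simp: tens_gens_def)
 have "cl r l : ev r ` Cr r"
 using ev_expand[of a w r] l Cr_ex[of a w 0] lw by (auto simp: tens_gens_Cons)
 then show "restrict Q.q (carrier (\<N> r)) (cl r l) = restrict (%_. \<zero>\<^bsub>quot_mod (\<N> r) (ev r ` Cr r)\<^esub>) (carrier (\<N> r)) (cl r l)"
 using l by (simp add: Q.q_eq_zero_iff)
 qed
 from fun_cong[OF this, of y] have "Q.q y = \<zero>\<^bsub>quot_mod (\<N> r) (ev r ` Cr r)\<^esub>" using y by simp
 then show ?thesis using Q.q_eq_zero_iff[OF y] by blast
qed

lemma chain_hom_eqI: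
 fixes M :: "('k, 'y, 'q) module_scheme"
 assumes M: "module k M" and h: "h : mod_hom k (\<N> r) M" "h' : mod_hom k (\<N> r) M"
 and eq: "!!a w. [|a : \<A>; redw w; length w = r|] ==> h (cl r (a # map X w)) = h' (cl r (a # map X w))"
 shows "h = h'"
proof (rule mod_hom_eqI[OF h])
 fix y assume "y : carrier (\<N> r)"
 then obtain u where u: "u : Cr r" "y = ev r u" using ev_surj by blast
 have "h (ev r u) = h' (ev r u)"
 using u(1) unfolding Cr_def
 proof (induction u rule: Sp_induct)
 case zero
 then show ?case using mod_hom_zero[OF norm_module M h(1)] mod_hom_zero[OF norm_module M h(2)] by simp
 next
 case (gen a w)
 then show ?case using eq[of a w] by (simp add: evp_g)
 next
 case (diff u v)
 then show ?case using mod_hom_minus[OF norm_module M h(1)] mod_hom_minus[OF norm_module M h(2)] by (simp add: evp_diff)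
 qed
 then show "h y = h' y" using u by simp
qed

subsection \<open>The Hochschild boundary on chains\<close>

text \<open>The faces after the first one, for a tensor whose entries behind the coefficient \<open>a\<close> start with \<open>v\<close>.\<close>

fun fb :: "'x => 'x list => 'x list => ('x list \<Rightarrow>\<^sub>0 int)" where
 "fb a v [] = 0"
| "fb a v [y] = - frag_of ((y ** a) # v)"
| "fb a v (y # z # w) = - frag_of (a # v @ (y ** z) # w) - fb a (v @ [y]) (z # w)"

lemma fb_eq:
 "fb a v w = (\<Sum>q\<in>{1..length w}. frag_cmul ((- 1) ^ q) (frag_of (dd (length v + length w) (length v + q) (a # v @ w))))"
proof (induction w arbitrary: v rule: induct_list012)
 case (3 y z w)
 let ?D = "%v w q. frag_of (dd (length v + length w) (length v + q) (a # v @ w))"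
 have "(\<Sum>q\<in>{1..length (y # z # w)}. frag_cmul ((- 1) ^ q) (?D v (y # z # w) q))
 = frag_cmul (- 1) (?D v (y # z # w) 1) + (\<Sum>q\<in>{1..length (z # w)}. frag_cmul ((- 1) ^ Suc q) (?D v (y # z # w) (Suc q)))"
 proof -
 have "(\<Sum>q\<in>{1..Suc m}. F q) = F 1 + (\<Sum>q\<in>{1..m}. F (Suc q))" for m and F :: "nat => 'x list \<Rightarrow>\<^sub>0 int"
 by (induction m) (simp_all add: add.assoc)
 from this[of "%q. frag_cmul ((- 1) ^ q) (?D v (y # z # w) q)" "length (z # w)"] show ?thesis by simp
 qed
 also have "?D v (y # z # w) 1 = frag_of (a # v @ (y ** z) # w)"
 by (simp add: dd_def nth_append)
 also have "(\<Sum>q\<in>{1..length (z # w)}. frag_cmul ((- 1) ^ Suc q) (?D v (y # z # w) (Suc q)))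
 = - (\<Sum>q\<in>{1..length (z # w)}. frag_cmul ((- 1) ^ q) (?D (v @ [y]) (z # w) q))"
 by (simp add: sum_negf[symmetric])
 also have "... = - fb a (v @ [y]) (z # w)" by (simp only: 3(2))
 finally show ?case by simp
qed (simp_all add: dd_def nth_append)

lemma fd_fb:
 assumes "length w = Suc r"
 shows "fd (Suc r) (a # w) = frag_of ((a ** hd w) # tl w) + fb a [] w"
proof -
 have "fd (Suc r) (a # w) = frag_of (dd (Suc r) 0 (a # w)) + (\<Sum>q\<in>{1..Suc r}. frag_cmul ((- 1) ^ q) (frag_of (dd (Suc r) q (a # w))))"
 by (simp add: fd_def atMost_atLeast0 sum.atLeast_Suc_atMost)
 also have "dd (Suc r) 0 (a # w) = (a ** hd w) # tl w"
 using assms by (cases w) (auto simp: dd_def)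
 finally show ?thesis using assms by (simp add: fb_eq)
qed

lemma evp_R:
 assumes "a : \<A>" "length v + length w + 1 = r"
 shows "evp r v (R m a w) = cl r (a # map X v @ X m # map X w)"
proof (cases "m = 0 \<or> m < n")
 case True
 then show ?thesis
 using assms cl_normal_at[of a "\<one>\<^bsub>K\<^esub>" "map X v" "map X w" r] by (cases "m = 0") (auto simp: R_def evp_g)
next
 case False
 have "cl r (a # map X v @ X m # map X w) = evp r v (ex (sum_list v) a (X m # map X w))"
 using assms by (intro evp_expand[symmetric]) auto
 also have "ex (sum_list v) a (X m # map X w) = (\<Sum>j\<in>{1..<n}. pre j (ex (sum_list v + j) (a ** cf m j) (map X w)))"
 by (auto simp: co_X tw_fixed alpha_cK intro!: sum.cong)
 also have "evp r v ... = evp r v (\<Sum>j\<in>{1..<n}. g (a ** cf m j) (j # w))"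
 unfolding evp_sum
 proof (rule NM.M.finsum_cong')
 fix j assume j: "j : {1..<n}"
 have "evp r (v @ [j]) (ex (sum_list (v @ [j])) (a ** cf m j) (map X w)) = cl r ((a ** cf m j) # map X (v @ [j]) @ map X w)"
 using assms by (intro evp_expand) auto
 then show "evp r v (pre j (ex (sum_list v + j) (a ** cf m j) (map X w))) = evp r v (g (a ** cf m j) (j # w))"
 using assms by (simp add: evp_pre evp_g)
 qed auto
 finally show ?thesis using False by (simp add: R_def)
qed

lemma evp_bt:
 assumes "a : \<A>" "length v + length w = Suc r"
 shows "val r (fb a (map X v) (map X w)) = evp r v (bt a w)"
 using assms
proof (induction w arbitrary: v rule: induct_list012)
 case (2 i)
 then show ?case by (simp add: val_neg evp_neg val_of evp_g tens_gens_Cons)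
next
 case (3 i j w)
 have "X i ** X j = X (i + j)" by (simp add: X_add)
 then show ?case using 3(2)[of "v @ [i]"] 3(3,4)
 by (simp add: val_diff val_neg evp_neg evp_diff val_of tens_gens_Cons evp_R evp_pre)
qed simp

lemma norm_b_ev: "u : Cr (Suc r) ==> norm_b (Suc r) (ev (Suc r) u) = ev r (bb u)"
 unfolding Cr_def
proof (induction u rule: Sp_induct)
 case zero
 then show ?case using mod_hom_zero[OF norm_module norm_module norm_b_spec(1)] by simp
next
 case (gen a w)
 then obtain i w' where w: "w = i # w'" by (cases w) auto
 have "norm_b (Suc r) (ev (Suc r) (g a w)) = val r (fd (Suc r) (a # map X w))"
 using gen by (simp add: evp_g norm_b_spec(2) tens_gens_Cons)
 also have "... = val r (frag_of ((a ** X i) # map X w')) \<oplus>\<^bsub>\<N> r\<^esub> ev r (bt a w)"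
 using gen w evp_bt[of a "[]" w r] by (simp add: fd_fb val_add)
 also have "... = ev r (bb (g a w))"
 using gen w by (simp add: evp_add evp_g val_of tens_gens_Cons del: bt.simps)
 finally show ?case .
next
 case (diff u v)
 then show ?case using mod_hom_minus[OF norm_module norm_module norm_b_spec(1)]
 by (simp add: evp_diff lift_diff)
qed

end

section \<open>The weight filtration\<close>

context monogenic_algebra
begin

text \<open>Elements of degree at most \<open>d\<close> in \<open>x\<close>. For \<open>d \<ge> n - 1\<close> this is
the whole algebra.\<close>

inductive_set Adeg :: "nat => 'x set" for d where
 Adeg_zero: "\<zero> : Adeg d"
| Adeg_add: "[|a : Adeg d; b : Adeg d|] ==> a \<oplus> b : Adeg d"
| Adeg_gen: "[|c : \<K>; i <= d; i < n|] ==> \<iota> c ** X i : Adeg d"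

lemma Adeg_closed: "a : Adeg d ==> a : \<A>"
 by (induction rule: Adeg.induct) auto

lemma Adeg_mono: "[|a : Adeg d; d <= d'|] ==> a : Adeg d'"
 by (induction rule: Adeg.induct) (auto intro: Adeg.intros)

lemma Adeg_finsum: "[|!!i. i : I ==> f i : Adeg d|] ==> (\<Oplus>i\<in>I. f i) : Adeg d"
proof (induction I rule: infinite_finite_induct)
 case (insert i I)
 then show ?case by (subst A.M.finsum_insert) (auto intro: Adeg_add Adeg_closed)
qed (auto intro: Adeg_zero)

lemma Adeg_X: "[|c : \<K>; m <= d|] ==> \<iota> c ** X m : Adeg d"
proof -
 assume c: "c : \<K>" and m: "m <= d"
 have "\<iota> c ** X m = \<iota> c ** (\<Oplus>l\<in>{..<n}. cf m l ** X l)"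
 using X_reduce[of m] by simp
 also have "... = (\<Oplus>l\<in>{..<n}. \<iota> c ** (cf m l ** X l))"
 using c by (intro A.finsum_rdistr) auto
 also have "... : Adeg d"
 proof (rule Adeg_finsum)
 fix l assume l: "l : {..<n}"
 show "\<iota> c ** (cf m l ** X l) : Adeg d"
 proof (cases "l <= m")
 case True
 then show ?thesis using Adeg_gen[of "c \<otimes>\<^bsub>K\<^esub> cK m l" l d] l m c by (simp add: iota_mult A.m_assoc)
 next
 case False
 then show ?thesis using c_gt[of m l] l c Adeg_zero by simp
 qed
 qed
 finally show ?thesis .
qed

lemma Adeg_iota: "c : \<K> ==> \<iota> c : Adeg d"
 using Adeg_X[of c 0 d] by simp

lemma Adeg_mult:
 assumes "a : Adeg d" and [simp]: "p : \<A>" "q : \<A>"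
 and gen: "!!c i. [|c : \<K>; i <= d; i < n|] ==> p ** (\<iota> c ** X i) ** q : Adeg d'"
 shows "p ** a ** q : Adeg d'"
 using assms(1)
proof (induction rule: Adeg.induct)
 case (Adeg_add a b)
 then show ?case using Adeg_closed by (simp add: A.l_distr A.r_distr Adeg.Adeg_add)
qed (auto intro: gen Adeg_zero)

lemma Adeg_X_right: "a : Adeg d ==> a ** X m : Adeg (d + m)"
 using Adeg_mult[of a d "\<one>" "X m" "d + m"] Adeg_closed[of a d] Adeg_X
 by (simp add: A.m_assoc flip: X_add)

lemma Adeg_X_left: "a : Adeg d ==> X m ** a : Adeg (m + d)"
proof -
 assume a: "a : Adeg d"
 have "X m ** (\<iota> c ** X i) = \<iota> (tw m c) ** X (m + i)" if "c : \<K>" for c i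
 using that by (simp add: A.m_assoc[symmetric] X_iota) (simp add: A.m_assoc X_add)
 then show ?thesis using Adeg_mult[OF a, of "X m" "\<one>" "m + d"] Adeg_closed[OF a] Adeg_X by simp
qed

lemma Adeg_iota_left: "[|a : Adeg d; c : \<K>|] ==> \<iota> c ** a : Adeg d"
proof -
 assume a: "a : Adeg d" and c: "c : \<K>"
 have "\<iota> c ** (\<iota> c' ** X i) = \<iota> (c \<otimes>\<^bsub>K\<^esub> c') ** X i" if "c' : \<K>" for c' i
 using that c by (simp add: iota_mult A.m_assoc)
 then show ?thesis using Adeg_mult[OF a, of "\<iota> c" "\<one>" d] Adeg_closed[OF a] Adeg_X c by simp
qed

lemma Adeg_iota_right: "[|a : Adeg d; c : \<K>|] ==> a ** \<iota> c : Adeg d"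
proof -
 assume a: "a : Adeg d" and c: "c : \<K>"
 have "\<iota> c' ** X i ** \<iota> c = \<iota> (c' \<otimes>\<^bsub>K\<^esub> tw i c) ** X i" if "c' : \<K>" for c' i
 using that c by (simp add: iota_mult A.m_assoc X_iota)
 then show ?thesis using Adeg_mult[OF a, of "\<one>" "\<iota> c" d] Adeg_closed[OF a] Adeg_X c by simp
qed

lemma Adeg_smult: "[|a : Adeg d; e : carrier k|] ==> e \<odot> a : Adeg d"
 using Adeg_iota_left[of a d "e \<odot>\<^bsub>K\<^esub> \<one>\<^bsub>K\<^esub>"] Adeg_closed[of a d] by (simp add: smult_iota)

lemma Adeg_u: "a : Adeg d ==> a ** uq m : Adeg (d + (m - n))"
proof (induction m)
 case 0
 then show ?case using Adeg_closed[of a d] Adeg_zero by simp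
next
 case (Suc m)
 note a = Adeg_closed[OF Suc.prems]
 consider "Suc m < n" | "Suc m = n" | "n <= m" by linarith
 then show ?case
 proof cases
 case 1
 then show ?thesis using a Adeg_zero u_small[of "Suc m"] by simp
 next
 case 2
 then show ?thesis using a Suc.prems u_n by simp
 next
 case 3
 have "a ** uq m ** x : Adeg (d + (m - n) + 1)"
 using Adeg_X_right[OF Suc.IH[OF Suc.prems], of 1] by simp
 moreover have "a ** cf m (n - 1) : Adeg (d + (m - n) + 1)"
 by (rule Adeg_mono[OF Adeg_iota_right[OF Suc.prems]]) auto
 ultimately have "a ** uq m ** x \<oplus> a ** cf m (n - 1) : Adeg (d + (m - n) + 1)" by (rule Adeg_add)
 then show ?thesis using a 3 by (simp add: A.r_distr A.m_assoc Suc_diff_le)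
 qed
qed

lemma Adeg_all: "a : \<A> ==> a : Adeg (n - 1)"
proof -
 assume a: "a : \<A>"
 have "(\<Oplus>i\<in>{..<n}. \<iota> (co a i) ** X i) : Adeg (n - 1)"
 using a by (intro Adeg_finsum Adeg_gen) auto
 then show ?thesis using expand[OF a] by simp
qed

text \<open>The weight of a word at twist \<open>t\<close> includes \<open>t\<close>, so that it is preserved when
\<open>PP\<close> trades a factor of degree \<open>n\<close> for the twist.\<close>

definition gens :: "nat => nat => nat => ('x \<times> nat list) set"
 where "gens r t W = {(a, w). length w = r & redw w & (EX d. a : Adeg d & d + sum_list w + t <= W)}"

abbreviation Ch :: "nat => nat => nat => 'x chain set" where "Ch r t W \<equiv> Sp (gens r t W)"

lemma gensI: "[|length w = r; redw w; a : Adeg d; d + sum_list w + t <= W|] ==> (a, w) : gens r t W"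
 by (auto simp: gens_def)

lemma gensE:
 assumes "(a, w) : gens r t W"
 obtains d where "length w = r" "redw w" "a : Adeg d" "a : \<A>" "d + sum_list w + t <= W"
 using assms Adeg_closed by (auto simp: gens_def)

lemma Ch_Cr: "u : Ch r t W ==> u : Cr r"
 unfolding Cr_def
proof (erule Sp_mono, rule subrelI)
 fix a w assume "(a, w) : gens r t W"
 then show "(a, w) : \<A> \<times> {w. length w = r & redw w}" by (rule gensE) blast
qed

lemma Ch_mono: "[|u : Ch r t W; W <= W'|] ==> u : Ch r t W'"
 by (rule Sp_mono) (auto simp: gens_def intro: order_trans)

lemma Cr_Ch: "u : Cr r ==> u : Ch r t (n + r * n + t)"
 unfolding Cr_def
proof (erule Sp_mono, rule subrelI)
 fix a w assume "(a, w) : \<A> \<times> {w. length w = r & redw w}"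
 then have a: "a : \<A>" and w: "redw w" and r: "r = length w" by auto
 have "sum_list w <= length w * n" using w by (induction w) auto
 then show "(a, w) : gens r t (n + r * n + t)" unfolding r
 by (intro gensI[OF refl w Adeg_all[OF a]]) simp
qed

lemma Ch_empty: "W < t ==> u : Ch 0 t W ==> u = 0"
 by (auto simp: Sp_def gens_def)

lemma Ch_pre: "[|u : Ch r (t + i) W; i : {1..<n}|] ==> pre i u : Ch (Suc r) t W"
 unfolding pre_def by (rule Sp_lift, assumption) (auto elim!: gensE intro!: gensI)

lemma Ch_g: "[|a : Adeg d; redw w; length w = r; d + sum_list w + t <= W|] ==> g a w : Ch r t W"
 by (rule Sp_g[THEN iffD2, OF gensI])

lemma Ch_R: "[|a : Adeg d; redw w; length w = r; d + m + sum_list w + t <= W|] ==> R m a w : Ch (Suc r) t W"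
proof -
 assume *: "a : Adeg d" "redw w" "length w = r" "d + m + sum_list w + t <= W"
 have 1: "g a (m # w) : Ch (Suc r) t W" if "m < n" "m ~= 0" using * that by (intro Ch_g[of _ d]) auto
 have 2: "g (a ** cf m l) (l # w) : Ch (Suc r) t W" if "~ m < n" "l : {1..<n}" for l
 using * that by (intro Ch_g[OF Adeg_iota_right[OF *(1)]]) auto
 show ?thesis unfolding R_def by (auto simp del: Sp_g intro!: 1 2 Sp_sum)
qed

lemma Ch_bt: "[|a : Adeg d; redw w; length w = Suc r; d + sum_list w + t <= W|] ==> bt a w : Ch r t W"
proof (induction w arbitrary: r t rule: induct_list012)
 case (2 i)
 then show ?case using Adeg_X_left[of a d i] by (auto intro!: Sp_neg gensI)
next
 case (3 i j w)
 then obtain r' where r': "r = Suc r'" by (cases r) auto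
 have "R (i + j) a w : Ch r t W" using 3 r' by (auto intro!: Ch_R)
 moreover have "pre i (bt a (j # w)) : Ch r t W"
 unfolding r' using 3 r' by (intro Ch_pre "3.IH"(2)) auto
 ultimately show ?case by (auto intro!: Sp_diff Sp_neg)
qed simp

lemma Ch_bb: "u : Ch (Suc r) t W ==> bb u : Ch r t W"
proof (erule Sp_lift, erule gensE)
 fix a w d
 assume *: "length w = Suc r" "redw w" "a : Adeg d" "d + sum_list w + t <= W"
 then obtain i w' where w: "w = i # w'" by (cases w) auto
 have "g (a ** X i) w' : Ch r t W" using * w by (intro Ch_g[OF Adeg_X_right[OF *(3)]]) auto
 then show "b0 a w : Ch r t W" using Ch_bt[OF *(3,2,1,4)] w by (auto intro!: Sp_add simp del: bt.simps)
qed

lemma Ch_ss: "u : Ch r t W ==> ss u : Ch (Suc r) t W"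
proof (erule Sp_lift, erule gensE)
 fix a w d
 assume *: "length w = r" "redw w" "a : Adeg d" "d + sum_list w + t <= W"
 then show "s0 a w : Ch (Suc r) t W"
 proof (cases w)
 case (Cons i w')
 have "g (a ** X (i - l - 1)) (1 # l # w') : Ch (Suc r) t W" if "l : {1..<i}" for l
 using * Cons that n_ge_2 by (intro Ch_g[OF Adeg_X_right[OF *(3)]]) auto
 then show ?thesis using Cons by (auto intro!: Sp_sum simp del: Sp_g)
 qed simp
qed

lemma Ch_PP: "u : Ch (Suc (Suc r)) t W ==> PP u : Ch r (t + n) W"
proof (erule Sp_lift, erule gensE)
 fix a w d
 assume *: "length w = Suc (Suc r)" "redw w" "a : Adeg d" "d + sum_list w + t <= W"
 then obtain i j w' where w: "w = i # j # w'" by (metis length_Suc_conv)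
 have "g (a ** uq (i + j)) w' : Ch r (t + n) W" if "~ i + j < n"
 using * w that by (intro Ch_g[OF Adeg_u[OF *(3)]]) auto
 then show "P0 a w : Ch r (t + n) W" using w by (auto simp del: Sp_g)
qed

lemma PP_short: "[|u : Cr r; r < 2|] ==> PP u = 0"
 unfolding Cr_def
proof (induction u rule: Sp_induct)
 case (gen a w)
 then show ?case by (cases w rule: word_cases) auto
qed (auto simp: lift_diff)

lemma Ch_QQ: "u : Ch r (t + n) W ==> QQ u : Ch (Suc (Suc r)) t W"
proof (erule Sp_lift, erule gensE)
 fix a w d
 assume *: "length w = r" "redw w" "a : Adeg d" "a : \<A>" "d + sum_list w + (t + n) <= W"
 have "g (a ** Z i l) (1 # l # w) : Ch (Suc (Suc r)) t W" if "l : {1..<i}" "i <= n" for i l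
 proof -
 have "a ** L (n - i) ** X (i - l - 1) : Adeg (d + (i - l - 1))"
 by (intro Adeg_X_right Adeg_iota_right * lam_closed) simp
 then have "a ** Z i l : Adeg (d + (i - l - 1))" using * by (simp add: A.m_assoc)
 then show ?thesis using * that n_ge_2 by (intro Ch_g) auto
 qed
 then show "Q0 a w : Ch (Suc (Suc r)) t W" unfolding Q0_def by (intro Sp_sum) auto
qed

lemma Ch_pp: "u : Ch 1 t W ==> pp u : Ch 1 t W"
proof (erule Sp_lift, erule gensE)
 fix a w d
 assume *: "length w = 1" "redw w" "a : Adeg d" "d + sum_list w + t <= W"
 then obtain i where w: "w = [i]" by (cases w) auto
 have "g (X (i - l - 1) ** a ** X l) [1] : Ch 1 t W" if "l < i" for l
 using * w that n_ge_2 by (intro Ch_g[OF Adeg_X_right[OF Adeg_X_left[OF *(3)]]]) auto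
 then show "p0 a w : Ch 1 t W" using w by (auto intro!: Sp_sum simp del: Sp_g)
qed

lemma Ch_sm: "[|u : Ch r t W; e : carrier k|] ==> sm e u : Ch r t W"
 unfolding sm_def by (erule Sp_lift) (auto elim!: gensE intro: gensI Adeg_smult)

lemma Cr_bb: "u : Cr (Suc r) ==> bb u : Cr r"
 using Cr_Ch[of u "Suc r" 0] Ch_bb Ch_Cr by blast

lemma Cr_PP: "u : Cr (Suc (Suc r)) ==> PP u : Cr r"
 using Cr_Ch[of u "Suc (Suc r)" 0] Ch_PP[of u r 0] Ch_Cr by blast

lemma Cr_QQ: "u : Cr r ==> QQ u : Cr (Suc (Suc r))"
 using Cr_Ch[of u r n] Ch_QQ[of u r 0] Ch_Cr by (metis add_0)

lemma Cr_0: "0 : Cr r" and Cr_diff: "[|u : Cr r; v : Cr r|] ==> u - v : Cr r"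
 and Cr_add: "[|u : Cr r; v : Cr r|] ==> u + v : Cr r" and Cr_neg: "u : Cr r ==> - u : Cr r"
 unfolding Cr_def by (auto intro: Sp_diff Sp_add Sp_neg)

subsection \<open>The Connes operator and the filtration\<close>

lemma ev_Ch_submodule: "submodule (ev r ` Ch r t W) k (\<N> r)"
proof (rule submoduleI[OF norm_module])
 show "ev r ` Ch r t W <= carrier (\<N> r)" by auto
 show "\<zero>\<^bsub>\<N> r\<^esub> : ev r ` Ch r t W" by (rule image_eqI[of _ _ 0]) auto
 show "a \<oplus>\<^bsub>\<N> r\<^esub> b : ev r ` Ch r t W" if "a : ev r ` Ch r t W" "b : ev r ` Ch r t W" for a b
 using that by (auto simp: evp_add[symmetric] intro!: imageI Sp_add)
 show "c \<odot>\<^bsub>\<N> r\<^esub> a : ev r ` Ch r t W" if c: "c : carrier k" and a: "a : ev r ` Ch r t W" for a c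
 proof -
 obtain u where u: "a = ev r u" "u : Ch r t W" using a by blast
 have "u : Ca" using u(2) unfolding Ca_Sp by (rule Sp_mono) (auto elim: gensE)
 then have "c \<odot>\<^bsub>\<N> r\<^esub> a = ev r (sm c u)" using functionalD(4)[OF functional_ev c] u by simp
 then show ?thesis using Ch_sm[OF u(2) c] by blast
 qed
qed

lemma submodule_finsum:
 assumes "submodule H k (\<N> r)" "finite I" "!!i. i : I ==> f i : H"
 shows "(\<Oplus>\<^bsub>\<N> r\<^esub>i\<in>I. f i) : H"
proof -
 note H = submoduleD[OF assms(1)]
 have "(\<Oplus>\<^bsub>\<N> r\<^esub>i\<in>I. f i) : H & f : I \<rightarrow> carrier (\<N> r)"
 using assms(2,3)
 proof (induction I)
 case (insert i I)
 have f: "f i : H" "f i : carrier (\<N> r)" "(\<Oplus>\<^bsub>\<N> r\<^esub>i\<in>I. f i) : H" "f : I \<rightarrow> carrier (\<N> r)"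
 using insert H(1) by auto
 then show ?case using insert(1,2) H(3) by (simp add: NM.M.finsum_insert)
 qed (use H in auto)
 then show ?thesis ..
qed

lemma Ch_coefficient:
 assumes "a : Adeg d" "redw v" "redw w" "length v + length w + 1 = r" "d + sum_list v + sum_list w <= W"
 shows "cl r (\<one> # map X v @ a # map X w) : ev r ` Ch r 0 W"
 using assms(1)
proof (induction rule: Adeg.induct)
 note S = submoduleD[OF ev_Ch_submodule[of r 0 W]]
 {
 case Adeg_zero
 show ?case using cl_normal_at[of "\<one>" "\<zero>\<^bsub>K\<^esub>" "map X v" "map X w" r] assms S by simp
 next
 case (Adeg_add a b)
 then show ?case using assms S Adeg_closed by (simp add: cl_add_at)
 next
 case (Adeg_gen c i)
 have "cl r (\<one> # map X v @ (\<iota> c ** X i) # map X w) = cl r ((\<one> ** \<iota> (tw (sum_list v) c)) # map X v @ X i # map X w)"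
 using Adeg_gen assms by (intro cl_move) auto
 also have "... : ev r ` Ch r 0 W"
 proof (cases "i = 0")
 case True
 then show ?thesis using cl_normal_at[of "\<iota> (tw (sum_list v) c)" "\<one>\<^bsub>K\<^esub>" "map X v" "map X w" r] Adeg_gen assms S by simp
 next
 case False
 let ?u = "g (\<iota> (tw (sum_list v) c)) (v @ i # w)"
 have "?u : Ch r 0 W" using Adeg_gen assms False by (intro Ch_g[OF Adeg_iota[of _ 0]]) auto
 moreover have "ev r ?u = cl r (\<iota> (tw (sum_list v) c) # map X v @ X i # map X w)"
 using Adeg_gen assms by (simp add: evp_g)
 ultimately show ?thesis using Adeg_gen by force
 qed
 finally show ?case .
 }
qed

text \<open>A cyclic rotation moves \<open>a\<close> behind the unit; expanding it there produces letters of total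
size at most its degree.\<close>

lemma norm_B_ev_Ch: "y : ev r ` Ch r 0 W ==> norm_B r y : ev (Suc r) ` Ch (Suc r) 0 W"
proof -
 assume "y : ev r ` Ch r 0 W"
 then obtain u where u: "y = ev r u" "u : Ch r 0 W" by blast
 note S = submoduleD[OF ev_Ch_submodule[of "Suc r" 0 W]]
 have "norm_B r (ev r u) : ev (Suc r) ` Ch (Suc r) 0 W"
 using u(2)
 proof (induction u rule: Sp_induct)
 case zero
 then show ?case using mod_hom_zero[OF norm_module norm_module norm_B_spec(1)] S by simp
 next
 case (gen a w)
 then obtain d where w: "length w = r" "redw w" "a : Adeg d" "a : \<A>" "d + sum_list w + 0 <= W" by (rule gensE)
 have l: "a # map X w : tens_gens r" using w by (simp add: tens_gens_Cons)
 have "norm_B r (ev r (g a w)) = (\<Oplus>\<^bsub>\<N> (Suc r)\<^esub>i\<in>{..r}. sign (i * r) \<odot>\<^bsub>\<N> (Suc r)\<^esub> cl (Suc r) (rl i (a # map X w)))"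
 using norm_B_spec(2)[OF l] val_fB[OF l] w by (simp add: evp_g)
 also have "... : ev (Suc r) ` Ch (Suc r) 0 W"
 proof (rule submodule_finsum[OF ev_Ch_submodule])
 fix i assume i: "i : {..r}"
 have "cl (Suc r) (rl i (a # map X w)) : ev (Suc r) ` Ch (Suc r) 0 W"
 proof (cases i)
 case 0
 then show ?thesis using Ch_coefficient[OF w(3), of "[]" w "Suc r" W] w by (simp add: rot_def)
 next
 case (Suc j)
 have "sum_list w = sum_list (take j w) + sum_list (drop j w)"
 by (metis append_take_drop_id sum_list_append)
 then have "cl (Suc r) (\<one> # map X (drop j w) @ a # map X (take j w)) : ev (Suc r) ` Ch (Suc r) 0 W"
 using w i Suc set_take_subset[of j w] set_drop_subset[of j w] by (intro Ch_coefficient[OF w(3)]) auto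
 then show ?thesis using Suc by (simp add: rot_def drop_map take_map)
 qed
 then show "sign (i * r) \<odot>\<^bsub>\<N> (Suc r)\<^esub> cl (Suc r) (rl i (a # map X w)) : ev (Suc r) ` Ch (Suc r) 0 W"
 using S by simp
 qed simp
 finally show ?case .
 next
 case (diff u v)
 have "a \<ominus>\<^bsub>\<N> (Suc r)\<^esub> b : ev (Suc r) ` Ch (Suc r) 0 W" if "a : ev (Suc r) ` Ch (Suc r) 0 W" "b : ev (Suc r) ` Ch (Suc r) 0 W" for a b
 using that by (auto simp: evp_diff[symmetric] intro!: imageI Sp_diff)
 then show ?case using diff mod_hom_minus[OF norm_module norm_module norm_B_spec(1)] by (simp add: evp_diff)
 qed
 then show ?thesis using u by simp
qed

subsection \<open>The homotopy\<close>

text \<open>The homotopy \<open>- \<Sum>QQ\<^sup>j ss PP\<^sup>j\<close>, cut off at \<open>j = m\<close>. On words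
of length \<open>r\<close> the terms with \<open>2 j > r\<close> vanish.\<close>

fun H :: "nat => 'x chain => 'x chain" where
 "H 0 u = - ss u"
| "H (Suc m) u = - ss u + QQ (H m (PP u))"

lemma op_H: "op t t (H m)"
proof (induction m arbitrary: t)
 case 0
 then show ?case using op_neg[OF op_ss[of t]] by (simp add: H.simps[abs_def])
next
 case (Suc m)
 show ?case unfolding H.simps(2)
 using op_add[OF op_neg[OF op_ss[of t]] op_comp[OF op_comp[OF op_PP[of t] Suc[of "t + n"]] op_QQ[of t]]] .
qed

lemma Ch_H: "u : Ch r t W ==> H m u : Ch (Suc r) t W"
proof (induction m arbitrary: u r t)
 case 0
 then show ?case by (simp add: Sp_neg Ch_ss)
next
 case (Suc m)
 have "QQ (H m (PP u)) : Ch (Suc r) t W"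
 proof (cases "r < 2")
 case True
 then show ?thesis using PP_short[OF Ch_Cr[OF Suc.prems]] addi_zero[OF opD(1)[OF op_H]] by simp
 next
 case False
 then obtain r' where r: "r = Suc (Suc r')" by (metis add_2_eq_Suc le_add_diff_inverse not_less)
 then show ?thesis using Suc.IH[OF Ch_PP[OF Suc.prems[unfolded r]]] Ch_QQ by simp
 qed
 then show ?case using Suc.prems by (simp add: Sp_diff Ch_ss)
qed

lemma Cr_H: "u : Cr r ==> H m u : Cr (Suc r)"
 using Cr_Ch[of u r 0] Ch_H Ch_Cr by blast

fun l0 :: "'x => nat list => 'x chain" where
 "l0 a [] = g a []"
| "l0 a [i] = p0 a [i]"
| "l0 a (i # j # w) = 0"

text \<open>The composite \<open>\<phi>\<psi>\<close> on chains.\<close>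

fun Pi0 :: "nat => 'x chain => 'x chain" where
 "Pi0 0 u = lift l0 u"
| "Pi0 (Suc m) u = lift l0 u + QQ (Pi0 m (PP u))"

lemma addi_lift: "addi (lift G)"
 by (simp add: addi_def lift_diff)

lemma addi_comp: "[|addi F; addi G|] ==> addi (%u. F (G u))"
 by (simp add: addi_def)

lemma addi_plus: "[|addi F; addi G|] ==> addi (%u. F u + G u)"
 by (simp add: addi_def)

lemma addi_Pi0: "addi (Pi0 m)"
proof (induction m)
 case 0
 show ?case unfolding addi_def Pi0.simps by (simp only: lift_diff) simp
next
 case (Suc m)
 show ?case unfolding Pi0.simps
 by (rule addi_plus[OF addi_lift addi_comp[OF addi_lift addi_comp[OF Suc addi_lift]]])
qed

lemma addi_H: "addi (H m)"
 by (rule opD(1)[OF op_H])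

lemma QQ_bb:
 assumes "u : Cr (Suc r)"
 shows "eqv t (bb (QQ u)) (QQ (bb u))"
 using assms unfolding Cr_def
proof (rule Sp_eqv)
 show "addi (%u. bb (QQ u))" "addi (%u. QQ (bb u))" by (rule addi_comp[OF addi_lift addi_lift])+
 fix a w assume "(a, w) : \<A> \<times> {w. length w = Suc r & redw w}"
 then show "eqv t (bb (QQ (g a w))) (QQ (bb (g a w)))" by (cases w) (auto simp del: b0.simps intro!: Q_b_Suc)
qed

lemma PP_bb: "u : Cr r ==> eqv (t + n) (PP (bb u)) (bb (PP u))"
 unfolding Cr_def
 by (erule Sp_eqv[OF _ addi_comp[OF addi_lift addi_lift] addi_comp[OF addi_lift addi_lift]]) (auto intro!: PP_b)

lemma homotopy_short:
 assumes "u : Cr r" "r < 2"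
 shows "- bb (ss u) - ss (bb u) = u - lift l0 u"
 using assms(1) unfolding Cr_def
proof (induction u rule: Sp_induct)
 case (gen a w)
 show ?case
 proof (cases w rule: word_cases)
 case (2 i)
 then show ?thesis using gen homotopy_1[of a i] by (simp add: lift_diff lift_add lift_neg del: s0.simps(2) p0.simps)
 qed (use gen assms(2) in auto)
next
 case (diff u v)
 then show ?case by (simp add: lift_diff algebra_simps)
qed simp

lemma homotopy_long:
 assumes "u : Cr (Suc (Suc r))"
 shows "eqv t (- bb (ss u) - ss (bb u)) (u - QQ (PP u))"
 using assms unfolding Cr_def
proof (rule Sp_eqv)
 fix a w assume aw: "(a, w) : \<A> \<times> {w. length w = Suc (Suc r) & redw w}"
 then obtain i j v where w: "w = i # j # v" by (cases w rule: word_cases) auto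
 have "eqv t (- (bb (s0 a w) + ss (b0 a w))) (- (QQ (P0 a w) - g a w))"
 unfolding w using aw w by (intro eqv_neg homotopy_2) auto
 then show "eqv t (- bb (ss (g a w)) - ss (bb (g a w))) (g a w - QQ (PP (g a w)))" by simp
qed (auto simp: addi_def lift_diff)

text \<open>Induction along \<open>H (Suc m) = - ss + QQ (H m) PP\<close>: the defect \<open>QQ PP\<close> of
\<open>ss\<close> is corrected by the homotopy for the shorter word.\<close>

lemma homotopy_chain:
 "[|u : Cr r; r <= 2 * m + 1|] ==> eqv t (bb (H m u) + H m (bb u)) (u - Pi0 m u)"
proof (induction m arbitrary: r u t)
 case 0
 then show ?case using homotopy_short[of u r] by (simp add: lift_neg)
next
 case (Suc m)
 have H0: "H m 0 = 0" by (rule addi_zero[OF addi_H])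
 have Pi00: "Pi0 m 0 = 0" by (rule addi_zero[OF addi_Pi0])
 have E: "bb (H (Suc m) u) + H (Suc m) (bb u)
 = (- bb (ss u) - ss (bb u)) + (bb (QQ (H m (PP u))) + QQ (H m (PP (bb u))))"
 by (simp only: H.simps lift_add lift_neg) (simp add: algebra_simps)
 show ?case
 proof (cases "r < 2")
 case True
 have "PP (bb u) = 0"
 proof (cases r)
 case 0
 have "bb u = 0" using Suc.prems(1) unfolding 0 Cr_def
 by (induction u rule: Sp_induct) (auto simp: lift_diff)
 then show ?thesis by simp
 next
 case (Suc r')
 then show ?thesis using True Cr_bb[of u r'] Suc.prems(1) PP_short[of "bb u" r'] by simp
 qed
 then show ?thesis unfolding E using homotopy_short[OF Suc.prems(1) True] PP_short[OF Suc.prems(1) True] H0 Pi00 by simp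
 next
 case False
 then obtain r' where r: "r = Suc (Suc r')" by (metis add_2_eq_Suc le_add_diff_inverse not_less)
 note u = Suc.prems(1)[unfolded r]
 let ?v = "PP u"
 have v: "?v : Cr r'" by (rule Cr_PP[OF u])
 have 1: "eqv t (bb (QQ (H m ?v))) (QQ (bb (H m ?v)))" by (rule QQ_bb[OF Cr_H[OF v]])
 have 2: "eqv t (QQ (H m (PP (bb u)))) (QQ (H m (bb ?v)))"
 by (intro QQ_eqv op_eqv[OF op_H] PP_bb[OF u])
 have 3: "eqv t (QQ (bb (H m ?v) + H m (bb ?v))) (QQ (?v - Pi0 m ?v))"
 using Suc.prems(2) r by (intro QQ_eqv Suc.IH[OF v]) simp
 have 4: "eqv t (bb (QQ (H m ?v)) + QQ (H m (PP (bb u)))) (QQ ?v - QQ (Pi0 m ?v))"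
 using eqv_trans[OF eqv_add[OF 1 2] 3[unfolded lift_add lift_diff]] .
 have 5: "lift l0 u = 0" using u unfolding Cr_def
 proof (induction u rule: Sp_induct)
 case (gen a w)
 then show ?case by (cases w rule: word_cases) auto
 qed (auto simp: lift_diff)
 show ?thesis unfolding E Pi0.simps 5 using eqv_add[OF homotopy_long[OF u, of t] 4] by simp
 qed
qed

end

section \<open>The Ore extension and its quotient by \<open>f\<close>\<close>

text \<open>Summation over a triangle by rows and by columns.\<close>

lemma (in abelian_monoid) finsum_triangle:
 assumes "!!i l. F i l : carrier G"
 shows "(\<Oplus>j\<in>{..m::nat}. \<Oplus>i\<in>{..j}. F i (j - i)) = (\<Oplus>i\<in>{..m}. \<Oplus>l\<in>{..m - i}. F i l)"
proof (induction m)
 case 0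
 then show ?case using assms by simp
next
 case (Suc m)
 have "(\<Oplus>i\<in>{..Suc m}. \<Oplus>l\<in>{..Suc m - i}. F i l) = F (Suc m) 0 \<oplus> (\<Oplus>i\<in>{..m}. \<Oplus>l\<in>{..Suc m - i}. F i l)"
 using assms by (simp add: atMost_Suc finsum_insert Pi_def)
 also have "(\<Oplus>i\<in>{..m}. \<Oplus>l\<in>{..Suc m - i}. F i l) = (\<Oplus>i\<in>{..m}. F i (Suc m - i) \<oplus> (\<Oplus>l\<in>{..m - i}. F i l))"
 using assms by (intro finsum_cong') (auto simp: Suc_diff_le atMost_Suc finsum_insert Pi_def)
 also have "... = (\<Oplus>i\<in>{..m}. F i (Suc m - i)) \<oplus> (\<Oplus>i\<in>{..m}. \<Oplus>l\<in>{..m - i}. F i l)"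
 using assms by (intro finsum_addf) auto
 also have "F (Suc m) 0 \<oplus> ... = (\<Oplus>i\<in>{..Suc m}. F i (Suc m - i)) \<oplus> (\<Oplus>i\<in>{..m}. \<Oplus>l\<in>{..m - i}. F i l)"
 using assms by (simp add: atMost_Suc finsum_insert Pi_def a_assoc)
 also have "(\<Oplus>i\<in>{..m}. \<Oplus>l\<in>{..m - i}. F i l) = (\<Oplus>j\<in>{..m}. \<Oplus>i\<in>{..j}. F i (j - i))" by (rule Suc[symmetric])
 finally show ?case using assms by (simp add: atMost_Suc finsum_insert Pi_def)
qed

lemma (in abelian_monoid) finsum_reverse:
 assumes "!!i. F i : carrier G"
 shows "(\<Oplus>i\<in>{..m::nat}. F (m - i)) = (\<Oplus>i\<in>{..m}. F i)"
proof -
 have "inj_on (%i. m - i) {..m}" by (auto simp: inj_on_def)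
 moreover have "(%i. m - i) ` {..m} = {..m}"
 proof (intro equalityI subsetI)
 fix j assume "j : {..m}"
 then have "j = m - (m - j)" "m - j : {..m}" by auto
 then show "j : (%i. m - i) ` {..m}" by (rule image_eqI)
 qed auto
 ultimately show ?thesis using finsum_reindex[of F "%i. m - i" "{..m}"] assms by (simp add: Pi_def)
qed

lemma (in abelian_monoid) finsum_single:
 assumes "finite I" "i : I" "F i : carrier G" "!!j. [|j : I; j ~= i|] ==> F j = \<zero>"
 shows "(\<Oplus>j\<in>I. F j) = F i"
proof -
 have "F j : carrier G" if "j : I" for j using assms(3,4) that by (cases "j = i") auto
 then have "(\<Oplus>j\<in>I. F j) = (\<Oplus>j\<in>{i}. F j)"
 using assms by (intro add.finprod_mono_neutral_cong_right) auto
 then show ?thesis using assms by simp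
qed

locale ore_extension =
 fixes k :: "('k, 'r) ring_scheme" and K :: "('k, 'a, 'm) module_scheme" (structure) and \<alpha> :: "'a => 'a"
 assumes k_cring: "cring k" and K_algebra: "assoc_algebra k K" and alpha_hom: "\<alpha> : alg_hom k K K"
begin

sublocale k: cring k by (rule k_cring)
sublocale K: assoc_algebra k K by (rule K_algebra)

abbreviation Ox where "Ox \<equiv> ore_ext K \<alpha>"

abbreviation ore_carrier ("\<O>") where "\<O> \<equiv> carrier (ore_ext K \<alpha>)"
abbreviation ore_mult (infixl "\<star>" 70) where "p \<star> q \<equiv> p \<otimes>\<^bsub>Ox\<^esub> q"
abbreviation ore_add (infixl "\<boxplus>" 65) where "p \<boxplus> q \<equiv> p \<oplus>\<^bsub>Ox\<^esub> q"

lemma pow_alpha [simp]: "c : carrier K ==> (\<alpha> ^^ i) c : carrier K"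
 and pow_alpha_mult: "[|c : carrier K; d : carrier K|] ==> (\<alpha> ^^ i) (c \<otimes> d) = (\<alpha> ^^ i) c \<otimes> (\<alpha> ^^ i) d"
 and pow_alpha_add: "[|c : carrier K; d : carrier K|] ==> (\<alpha> ^^ i) (c \<oplus> d) = (\<alpha> ^^ i) c \<oplus> (\<alpha> ^^ i) d"
 and pow_alpha_one [simp]: "(\<alpha> ^^ i) \<one> = \<one>"
 and pow_alpha_smult: "[|e : carrier k; c : carrier K|] ==> (\<alpha> ^^ i) (e \<odot> c) = e \<odot> (\<alpha> ^^ i) c"
proof -
 have cl: "(\<alpha> ^^ i) c : carrier K" if "c : carrier K" for c i
 by (induction i) (use alpha_hom that in \<open>auto simp: alg_hom_def ring_hom_def\<close>)
 then show "c : carrier K ==> (\<alpha> ^^ i) c : carrier K" .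
 show "[|c : carrier K; d : carrier K|] ==> (\<alpha> ^^ i) (c \<otimes> d) = (\<alpha> ^^ i) c \<otimes> (\<alpha> ^^ i) d"
 by (induction i) (use alpha_hom cl in \<open>auto simp: alg_hom_def ring_hom_def\<close>)
 show "[|c : carrier K; d : carrier K|] ==> (\<alpha> ^^ i) (c \<oplus> d) = (\<alpha> ^^ i) c \<oplus> (\<alpha> ^^ i) d"
 by (induction i) (use alpha_hom cl in \<open>auto simp: alg_hom_def ring_hom_def\<close>)
 show "(\<alpha> ^^ i) \<one> = \<one>"
 by (induction i) (use alpha_hom in \<open>auto simp: alg_hom_def ring_hom_def\<close>)
 show "[|e : carrier k; c : carrier K|] ==> (\<alpha> ^^ i) (e \<odot> c) = e \<odot> (\<alpha> ^^ i) c"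
 by (induction i) (use alpha_hom cl in \<open>auto simp: alg_hom_def ring_hom_def\<close>)
qed

lemma pow_alpha_zero [simp]: "(\<alpha> ^^ i) \<zero> = \<zero>"
 using pow_alpha_add[of "\<zero>" "\<zero>" i] by (metis K.M.add.r_cancel_one' K.M.l_zero K.M.zero_closed pow_alpha)

lemma pow_alpha_finsum:
 assumes "finite I" "!!i. i : I ==> F i : carrier K"
 shows "(\<alpha> ^^ m) (\<Oplus>i\<in>I. F i) = (\<Oplus>i\<in>I. (\<alpha> ^^ m) (F i))"
 using assms
proof (induction I)
 case (insert i I)
 have "(\<Oplus>i\<in>I. F i) : carrier K" using insert by (intro K.M.finsum_closed) auto
 then show ?case using insert by (simp add: K.M.finsum_insert pow_alpha_add Pi_def)
qed simp

lemma O_carrier: "p : \<O> \<longleftrightarrow> (ALL i. p i : carrier K) & (EX N. ALL i>=N. p i = \<zero>)"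
proof -
 have "(EX N. ALL i>N. p i = \<zero>) \<longleftrightarrow> (EX N. ALL i>=N. p i = \<zero>)"
 by (meson Suc_le_eq less_imp_le)
 then show ?thesis by (auto simp: ore_ext_def up_def bound_def)
qed

lemma O_coeff [simp]: "p : \<O> ==> p i : carrier K"
 by (simp add: O_carrier)

lemma O_simps: "\<zero>\<^bsub>Ox\<^esub> = (%i. \<zero>)" "p \<boxplus> q = (%i. p i \<oplus> q i)" "e \<odot>\<^bsub>Ox\<^esub> p = (%i. e \<odot> p i)"
 "\<one>\<^bsub>Ox\<^esub> = (%i. if i = 0 then \<one> else \<zero>)"
 "p \<star> q = (%m. \<Oplus>i\<in>{..m}. p i \<otimes> (\<alpha> ^^ i) (q (m - i)))"
 by (simp_all add: ore_ext_def)

lemma O_mult_closed: "[|p : \<O>; q : \<O>|] ==> p \<star> q : \<O>"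
proof -
 assume p: "p : \<O>" and q: "q : \<O>"
 obtain N N' where N: "!!i. i >= N ==> p i = \<zero>" "!!i. i >= N' ==> q i = \<zero>"
 using p q O_carrier by meson
 have "(p \<star> q) m = \<zero>" if m: "m >= N + N'" for m
 proof -
 have "p i \<otimes> (\<alpha> ^^ i) (q (m - i)) = \<zero>" for i
 proof (cases "N <= i")
 case True
 then show ?thesis using N(1) q by simp
 next
 case False
 then have "q (m - i) = \<zero>" using m by (intro N(2)) simp
 then show ?thesis using p by simp
 qed
 then show ?thesis by (simp add: O_simps)
 qed
 moreover have "(p \<star> q) m : carrier K" for m
 using p q by (auto simp: O_simps intro!: K.M.finsum_closed)
 ultimately show ?thesis unfolding O_carrier by blast
qed

lemma O_one_closed: "\<one>\<^bsub>Ox\<^esub> : \<O>"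
 unfolding O_carrier O_simps by (auto intro: exI[of _ 1])

lemma O_assoc:
 assumes p: "p : \<O>" and q: "q : \<O>" and r: "r : \<O>"
 shows "p \<star> q \<star> r = p \<star> (q \<star> r)"
proof
 fix m
 let ?F = "%i l. p i \<otimes> (\<alpha> ^^ i) (q l) \<otimes> (\<alpha> ^^ (i + l)) (r (m - (i + l)))"
 have F: "?F i l : carrier K" for i l using assms by simp
 have "(p \<star> q \<star> r) m = (\<Oplus>j\<in>{..m}. \<Oplus>i\<in>{..j}. ?F i (j - i))"
 unfolding O_simps
 proof (rule K.M.finsum_cong')
 fix j assume "j : {..m}"
 have "(\<Oplus>i\<in>{..j}. p i \<otimes> (\<alpha> ^^ i) (q (j - i))) \<otimes> (\<alpha> ^^ j) (r (m - j))
 = (\<Oplus>i\<in>{..j}. p i \<otimes> (\<alpha> ^^ i) (q (j - i)) \<otimes> (\<alpha> ^^ j) (r (m - j)))"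
 using assms by (intro K.finsum_ldistr) auto
 also have "... = (\<Oplus>i\<in>{..j}. ?F i (j - i))"
 using assms by (intro K.M.finsum_cong') auto
 finally show "(\<Oplus>i\<in>{..j}. p i \<otimes> (\<alpha> ^^ i) (q (j - i))) \<otimes> (\<alpha> ^^ j) (r (m - j)) = (\<Oplus>i\<in>{..j}. ?F i (j - i))" .
 qed (use F in \<open>auto intro: K.M.finsum_closed\<close>)
 also have "... = (\<Oplus>i\<in>{..m}. \<Oplus>l\<in>{..m - i}. ?F i l)"
 by (rule K.M.finsum_triangle[OF F])
 also have "... = (p \<star> (q \<star> r)) m"
 unfolding O_simps
 proof (rule K.M.finsum_cong'[symmetric])
 fix i assume i: "i : {..m}"
 have "p i \<otimes> (\<alpha> ^^ i) (\<Oplus>l\<in>{..m - i}. q l \<otimes> (\<alpha> ^^ l) (r (m - i - l)))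
 = p i \<otimes> (\<Oplus>l\<in>{..m - i}. (\<alpha> ^^ i) (q l \<otimes> (\<alpha> ^^ l) (r (m - i - l))))"
 using assms by (subst pow_alpha_finsum) auto
 also have "... = (\<Oplus>l\<in>{..m - i}. p i \<otimes> (\<alpha> ^^ i) (q l \<otimes> (\<alpha> ^^ l) (r (m - i - l))))"
 using assms by (intro K.finsum_rdistr) auto
 also have "... = (\<Oplus>l\<in>{..m - i}. ?F i l)"
 using assms by (intro K.M.finsum_cong') (auto simp: pow_alpha_mult funpow_add K.m_assoc)
 finally show "p i \<otimes> (\<alpha> ^^ i) (\<Oplus>l\<in>{..m - i}. q l \<otimes> (\<alpha> ^^ l) (r (m - i - l))) = (\<Oplus>l\<in>{..m - i}. ?F i l)" .
 qed (use F in \<open>auto intro: K.M.finsum_closed\<close>)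
 finally show "(p \<star> q \<star> r) m = (p \<star> (q \<star> r)) m" .
qed

lemma O_add_closed: "[|p : \<O>; q : \<O>|] ==> p \<boxplus> q : \<O>"
proof -
 assume p: "p : \<O>" and q: "q : \<O>"
 obtain N N' where "!!i. i >= N ==> p i = \<zero>" "!!i. i >= N' ==> q i = \<zero>"
 using p q O_carrier by meson
 then have "EX N. ALL i>=N. (p \<boxplus> q) i = \<zero>"
 by (intro exI[of _ "max N N'"]) (simp add: O_simps)
 moreover have "(p \<boxplus> q) i : carrier K" for i using p q by (simp add: O_simps)
 ultimately show ?thesis unfolding O_carrier by blast
qed

lemma O_smult_closed: "[|e : carrier k; p : \<O>|] ==> e \<odot>\<^bsub>Ox\<^esub> p : \<O>"
proof -
 assume e: "e : carrier k" and p: "p : \<O>"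
 obtain N where "!!i. i >= N ==> p i = \<zero>" using p O_carrier by meson
 then have "EX N. ALL i>=N. (e \<odot>\<^bsub>Ox\<^esub> p) i = \<zero>"
 by (intro exI[of _ N]) (simp add: O_simps K.smult_r_null e)
 moreover have "(e \<odot>\<^bsub>Ox\<^esub> p) i : carrier K" for i using e p by (simp add: O_simps)
 ultimately show ?thesis unfolding O_carrier by blast
qed

lemma O_algebra: "assoc_algebra k Ox"
proof -
 have neg: "(\<ominus>\<^bsub>k\<^esub> \<one>\<^bsub>k\<^esub>) \<odot>\<^bsub>Ox\<^esub> p \<boxplus> p = \<zero>\<^bsub>Ox\<^esub>" if "p : \<O>" for p
 using that by (simp add: O_simps K.smult_l_minus K.M.l_neg)
 have ab: "abelian_group Ox"
 proof (rule abelian_groupI)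
 fix p q r assume *: "p : \<O>" "q : \<O>"
 show "p \<boxplus> q : \<O>" using * by (rule O_add_closed)
 show "p \<boxplus> q = q \<boxplus> p" using * by (simp add: O_simps K.M.a_comm)
 show "p \<boxplus> q \<boxplus> r = p \<boxplus> (q \<boxplus> r)" if "r : \<O>" using * that by (simp add: O_simps K.M.a_assoc)
 next
 show "\<zero>\<^bsub>Ox\<^esub> : \<O>" unfolding O_carrier by (simp add: O_simps)
 fix p assume p: "p : \<O>"
 show "\<zero>\<^bsub>Ox\<^esub> \<boxplus> p = p" using p by (simp add: O_simps)
 show "EX q:\<O>. q \<boxplus> p = \<zero>\<^bsub>Ox\<^esub>"
 using neg[OF p] O_smult_closed[OF _ p, of "\<ominus>\<^bsub>k\<^esub> \<one>\<^bsub>k\<^esub>"] by auto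
 qed
 interpret Ox: abelian_group Ox by (rule ab)
 have m: "module k Ox"
 by (intro moduleI k_cring ab O_smult_closed)
 (auto simp: O_simps K.smult_l_distr K.smult_r_distr K.smult_assoc1)
 have r: "ring Ox"
 proof (rule ringI[OF ab])
 show "Group.monoid Ox"
 proof (rule monoidI)
 fix p assume p: "p : \<O>"
 show "\<one>\<^bsub>Ox\<^esub> \<star> p = p"
 proof
 fix m
 have "(\<one>\<^bsub>Ox\<^esub> \<star> p) m = (\<one>\<^bsub>Ox\<^esub> 0) \<otimes> (\<alpha> ^^ 0) (p (m - 0))"
 unfolding O_simps(5) using p by (subst K.M.finsum_single[of _ 0]) (auto simp: O_simps)
 then show "(\<one>\<^bsub>Ox\<^esub> \<star> p) m = p m" using p by (simp add: O_simps)
 qed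
 show "p \<star> \<one>\<^bsub>Ox\<^esub> = p"
 proof
 fix m
 have "(p \<star> \<one>\<^bsub>Ox\<^esub>) m = p m \<otimes> (\<alpha> ^^ m) (\<one>\<^bsub>Ox\<^esub> (m - m))"
 unfolding O_simps(5) using p by (subst K.M.finsum_single[of _ m]) (auto simp: O_simps)
 then show "(p \<star> \<one>\<^bsub>Ox\<^esub>) m = p m" using p by (simp add: O_simps)
 qed
 qed (auto intro: O_mult_closed O_one_closed O_assoc)
 fix p q r assume *: "p : \<O>" "q : \<O>" "r : \<O>"
 show "(p \<boxplus> q) \<star> r = p \<star> r \<boxplus> q \<star> r"
 proof
 fix m
 show "((p \<boxplus> q) \<star> r) m = (p \<star> r \<boxplus> q \<star> r) m"
 unfolding O_simps using * by (subst K.M.finsum_addf[symmetric]) (auto simp: K.l_distr intro!: K.M.finsum_cong')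
 qed
 show "r \<star> (p \<boxplus> q) = r \<star> p \<boxplus> r \<star> q"
 proof
 fix m
 show "(r \<star> (p \<boxplus> q)) m = (r \<star> p \<boxplus> r \<star> q) m"
 unfolding O_simps using * by (subst K.M.finsum_addf[symmetric]) (auto simp: K.r_distr pow_alpha_add intro!: K.M.finsum_cong')
 qed
 qed
 have sl: "(e \<odot>\<^bsub>Ox\<^esub> p) \<star> q = e \<odot>\<^bsub>Ox\<^esub> (p \<star> q)" "p \<star> (e \<odot>\<^bsub>Ox\<^esub> q) = e \<odot>\<^bsub>Ox\<^esub> (p \<star> q)"
 if "e : carrier k" "p : \<O>" "q : \<O>" for e p q
 unfolding O_simps using that
 by (auto simp: K.finsum_smult_ldistr K.smult_mult_left K.smult_mult_right pow_alpha_smult intro!: ext K.M.finsum_cong')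
 show ?thesis by (intro assoc_algebra.intro m r assoc_algebra_axioms.intro sl)
qed

sublocale Ox: assoc_algebra k Ox by (rule O_algebra)

lemma O_finsum:
 assumes "finite I" "!!i. i : I ==> F i : \<O>"
 shows "(\<Oplus>\<^bsub>Ox\<^esub>i\<in>I. F i) m = (\<Oplus>i\<in>I. F i m)"
 using assms
proof (induction I)
 case (insert i I)
 then show ?case by (simp add: Ox.M.finsum_insert K.M.finsum_insert Pi_def) (simp add: O_simps)
qed (simp add: O_simps)

lemma O_minus: "[|p : \<O>; q : \<O>|] ==> (p \<ominus>\<^bsub>Ox\<^esub> q) i = p i \<ominus> q i"
proof -
 assume *: "p : \<O>" "q : \<O>"
 have "(p \<ominus>\<^bsub>Ox\<^esub> q) \<boxplus> q = p" using * by (simp add: a_minus_def Ox.M.a_assoc Ox.M.l_neg)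
 then have "(p \<ominus>\<^bsub>Ox\<^esub> q) i \<oplus> q i = p i" by (metis O_simps(2))
 then show ?thesis using * O_coeff[of "p \<ominus>\<^bsub>Ox\<^esub> q" i] by (metis K.M.add.inv_solve_right Ox.M.minus_closed O_coeff a_minus_def)
qed

definition mon :: "'a => nat => nat => 'a" where "mon c j = (%i. if i = j then c else \<zero>)"

lemma mon_closed [simp]: "c : carrier K ==> mon c j : \<O>"
proof -
 assume c: "c : carrier K"
 have "EX N. ALL i>=N. mon c j i = \<zero>" by (intro exI[of _ "Suc j"]) (simp add: mon_def)
 moreover have "mon c j i : carrier K" for i using c by (simp add: mon_def)
 ultimately show ?thesis unfolding O_carrier by blast
qed

lemma mon_mult_coeff:
 assumes "c : carrier K" "p : \<O>"
 shows "(mon c j \<star> p) m = (if j <= m then c \<otimes> (\<alpha> ^^ j) (p (m - j)) else \<zero>)"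
proof (cases "j <= m")
 case True
 then show ?thesis unfolding O_simps(5) using assms by (subst K.M.finsum_single[of _ j]) (auto simp: mon_def)
next
 case False
 have "(\<Oplus>i\<in>{..m}. mon c j i \<otimes> (\<alpha> ^^ i) (p (m - i))) = (\<Oplus>i\<in>{..m}. \<zero>)"
 using False assms by (intro K.M.finsum_cong') (auto simp: mon_def)
 then show ?thesis using False by (simp add: O_simps(5))
qed

lemma mon_mult: "[|c : carrier K; d : carrier K|] ==> mon c i \<star> mon d j = mon (c \<otimes> (\<alpha> ^^ i) d) (i + j)"
 by (rule ext, subst mon_mult_coeff, assumption, erule mon_closed) (auto simp: mon_def)

lemma mon_one: "mon \<one> 0 = \<one>\<^bsub>Ox\<^esub>"
 by (auto simp: mon_def O_simps)

lemma const_mon: "ore_const K c = mon c 0" and var_mon: "ore_var K = mon \<one> 1"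
 by (auto simp: mon_def ore_const_def ore_var_def)

lemma var_closed [simp]: "ore_var K : \<O>"
 by (simp add: var_mon)

lemma var_pow: "ore_var K [^]\<^bsub>Ox\<^esub> j = mon \<one> j"
 by (induction j) (simp_all add: mon_one var_mon mon_mult)

lemma mon_const_var: "c : carrier K ==> mon c j = ore_const K c \<star> ore_var K [^]\<^bsub>Ox\<^esub> j"
 by (simp add: const_mon var_pow mon_mult)

lemma O_expand:
 assumes "p : \<O>" "!!i. i >= N ==> p i = \<zero>"
 shows "p = (\<Oplus>\<^bsub>Ox\<^esub>i\<in>{..<N}. mon (p i) i)"
proof
 fix m
 have "(\<Oplus>\<^bsub>Ox\<^esub>i\<in>{..<N}. mon (p i) i) m = (\<Oplus>i\<in>{..<N}. mon (p i) i m)"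
 using assms by (intro O_finsum) auto
 also have "... = p m"
 proof (cases "m < N")
 case True
 then show ?thesis using assms by (subst K.M.finsum_single[of _ m]) (auto simp: mon_def)
 next
 case False
 have "(\<Oplus>i\<in>{..<N}. mon (p i) i m) = (\<Oplus>i\<in>{..<N}. \<zero>)"
 using False by (intro K.M.finsum_cong') (auto simp: mon_def)
 then show ?thesis using False assms by simp
 qed
 finally show "p m = (\<Oplus>\<^bsub>Ox\<^esub>i\<in>{..<N}. mon (p i) i) m" by simp
qed

end

locale monogenic = monogenic_data k K \<alpha> n lam
 for k :: "('k, 'r) ring_scheme" and K :: "('k, 'a, 'm) module_scheme" (structure)
 and \<alpha> :: "'a => 'a" and n :: nat and lam :: "nat => 'a" +
 assumes k_cring: "cring k" and K_algebra: "assoc_algebra k K" and alpha_hom: "\<alpha> : alg_hom k K K"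
 and n_ge_2: "n >= 2" and lam_0: "lam 0 = \<one>"
 and lam_pos_closed: "[|1 <= i; i <= n|] ==> lam i : carrier K"
 and alpha_lam_pos: "[|1 <= i; i <= n|] ==> \<alpha> (lam i) = lam i"
 and lam_comm_pos: "[|1 <= i; i <= n; c : carrier K|] ==> lam i \<otimes> c = (\<alpha> ^^ i) c \<otimes> lam i"
begin

sublocale ore_extension k K \<alpha>
 by (intro ore_extension.intro k_cring K_algebra alpha_hom)

lemma lam_all:
 assumes "i <= n"
 shows "lam i : carrier K" "\<alpha> (lam i) = lam i"
 "c : carrier K ==> lam i \<otimes> c = (\<alpha> ^^ i) c \<otimes> lam i"
 using assms lam_pos_closed[of i] alpha_lam_pos[of i] lam_comm_pos[of i c] pow_alpha_one[of 1] lam_0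
 by (cases "i = 0"; simp)+

lemma const_closed [simp]: "c : carrier K ==> ore_const K c : \<O>"
 by (simp add: const_mon)

lemma f_coeff: "f m = (if m <= n then lam (n - m) else \<zero>)"
proof -
 have "f m = (\<Oplus>\<^bsub>Ox\<^esub>i\<in>{..n}. mon (lam i) (n - i)) m"
 unfolding f_def by (rule arg_cong[where f = "%p. p m"], rule Ox.M.finsum_cong')
 (auto simp: mon_const_var lam_all)
 also have "... = (\<Oplus>i\<in>{..n}. mon (lam i) (n - i) m)"
 using lam_all by (intro O_finsum) auto
 also have "... = (if m <= n then lam (n - m) else \<zero>)"
 proof (cases "m <= n")
 case True
 then show ?thesis using lam_all by (subst K.M.finsum_single[of _ "n - m"]) (auto simp: mon_def)
 next
 case False
 have "(\<Oplus>i\<in>{..n}. mon (lam i) (n - i) m) = (\<Oplus>i\<in>{..n}. \<zero>)"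
 using False by (intro K.M.finsum_cong') (auto simp: mon_def)
 then show ?thesis using False by simp
 qed
 finally show ?thesis .
qed

lemma f_closed [simp]: "f : \<O>"
proof -
 have "f i : carrier K" for i using lam_all by (simp add: f_coeff)
 moreover have "EX N. ALL i>=N. f i = \<zero>" by (intro exI[of _ "Suc n"]) (simp add: f_coeff)
 ultimately show ?thesis unfolding O_carrier by blast
qed

lemma f_fixed: "(\<alpha> ^^ j) (f m) = f m"
 by (induction j) (use lam_all in \<open>auto simp: f_coeff\<close>, use pow_alpha_zero[of 1] in simp)

lemma f_comm: "c : carrier K ==> f i \<otimes> (\<alpha> ^^ i) c = (\<alpha> ^^ n) c \<otimes> f i"
proof (cases "i <= n")
 case True
 assume c: "c : carrier K"
 have "(\<alpha> ^^ (n - i)) ((\<alpha> ^^ i) c) = (\<alpha> ^^ (n - i + i)) c" by (simp only: funpow_add o_apply)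
 then show ?thesis using True c lam_all(3)[of "n - i" "(\<alpha> ^^ i) c"] by (simp add: f_coeff)
qed (simp add: f_coeff)

text \<open>The normality of \<open>f\<close>: it can be moved across any element at the cost of the twist \<open>\<alpha>\<^sup>n\<close>.\<close>

lemma f_normal:
 assumes p: "p : \<O>"
 shows "(%i. (\<alpha> ^^ n) (p i)) : \<O>" "f \<star> p = (%i. (\<alpha> ^^ n) (p i)) \<star> f"
proof -
 obtain N where "!!i. i >= N ==> p i = \<zero>" using p O_carrier by meson
 then have "EX N. ALL i>=N. (\<alpha> ^^ n) (p i) = \<zero>" by (intro exI[of _ N]) simp
 then show "(%i. (\<alpha> ^^ n) (p i)) : \<O>" using p unfolding O_carrier by auto
 show "f \<star> p = (%i. (\<alpha> ^^ n) (p i)) \<star> f"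
 proof
 fix m
 have "(f \<star> p) m = (\<Oplus>i\<in>{..m}. (\<alpha> ^^ n) (p (m - i)) \<otimes> f (m - (m - i)))"
 unfolding O_simps using p by (intro K.M.finsum_cong') (auto simp: f_comm)
 also have "... = (\<Oplus>i\<in>{..m}. (\<alpha> ^^ n) (p i) \<otimes> f (m - i))"
 using p by (intro K.M.finsum_reverse[of "%i. (\<alpha> ^^ n) (p i) \<otimes> f (m - i)"]) auto
 also have "... = ((%i. (\<alpha> ^^ n) (p i)) \<star> f) m"
 unfolding O_simps by (simp add: f_fixed)
 finally show "(f \<star> p) m = ((%i. (\<alpha> ^^ n) (p i)) \<star> f) m" .
 qed
qed

lemma f_var: "f \<star> ore_var K = ore_var K \<star> f"
proof -
 have "(%i. (\<alpha> ^^ n) (ore_var K i)) = ore_var K" by (auto simp: ore_var_def)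
 then show ?thesis using f_normal(2)[OF var_closed] by simp
qed

abbreviation J where "J \<equiv> Idl\<^bsub>Ox\<^esub> {f}"

text \<open>By normality the left multiples of \<open>f\<close> are also closed under right multiplication.\<close>

lemma J_eq: "J = (%q. q \<star> f) ` \<O>"
proof
 let ?I = "(%q. q \<star> f) ` \<O>"
 have "ideal ?I Ox"
 proof (rule idealI[OF Ox.ring_axioms])
 have neg: "\<ominus>\<^bsub>Ox\<^esub> (q \<star> f) : ?I" if "q : \<O>" for q
 using that by (intro image_eqI[of _ _ "\<ominus>\<^bsub>Ox\<^esub> q"]) (auto simp: Ox.l_minus)
 have add: "a \<boxplus> b : ?I" if ab: "a : ?I" "b : ?I" for a b
 proof -
 obtain q q' where "q : \<O>" "q' : \<O>" "a = q \<star> f" "b = q' \<star> f" using ab by blast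
 then show ?thesis by (intro image_eqI[of _ _ "q \<boxplus> q'"]) (simp_all add: Ox.l_distr)
 qed
 have neg': "\<ominus>\<^bsub>Ox\<^esub> a : ?I" if "a : ?I" for a using that neg by auto
 have "?I <= \<O>" "?I ~= {}" using Ox.M.zero_closed by auto
 then show "subgroup ?I (add_monoid Ox)"
 using add neg' by (intro Ox.M.add.subgroupI) (simp_all flip: a_inv_def)
 fix a p assume a: "a : ?I" and p: "p : \<O>"
 then obtain q where q: "q : \<O>" "a = q \<star> f" by blast
 have "p \<star> a = (p \<star> q) \<star> f" using p q by (simp add: Ox.m_assoc)
 then show "p \<star> a : ?I" using p q by blast
 let ?p = "%i. (\<alpha> ^^ n) (p i)"
 have "a \<star> p = (q \<star> ?p) \<star> f" using p q f_normal[OF p] by (simp add: Ox.m_assoc)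
 then show "a \<star> p : ?I" using q f_normal(1)[OF p] by blast
 qed
 moreover have "f : ?I" by (rule image_eqI[of _ _ "\<one>\<^bsub>Ox\<^esub>"]) auto
 ultimately show "J <= ?I" by (intro Ox.genideal_minimal) auto
 interpret J: ideal J Ox by (rule Ox.genideal_ideal) simp
 show "?I <= J" using Ox.genideal_self'[of f] J.I_l_closed by auto
qed

sublocale J: ideal J Ox by (rule Ox.genideal_ideal) simp

lemma J_submodule: "submodule J k Ox"
proof (rule submoduleI[OF Ox.module_axioms])
 show "J <= \<O>" by auto
 fix e a assume e: "e : carrier k" and "a : J"
 then obtain q where q: "q : \<O>" "a = q \<star> f" unfolding J_eq by blast
 have "e \<odot>\<^bsub>Ox\<^esub> a = (e \<odot>\<^bsub>Ox\<^esub> q) \<star> f" using e q by (simp add: Ox.smult_mult_left)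
 then show "e \<odot>\<^bsub>Ox\<^esub> a : J" unfolding J_eq using e q by blast
qed auto

sublocale Q: mod_quotient k Ox J
 by (intro mod_quotient.intro Ox.module_axioms J_submodule)

lemma to_A_q: "to_A p = Q.q p"
 by (simp add: to_A_def)

lemma carrier_A: "carrier A = to_A ` \<O>"
 unfolding A_def Q.carrier_quot to_A_q[abs_def] ..

lemma to_A_closed [simp]: "p : \<O> ==> to_A p : carrier A"
 by (simp add: carrier_A)

lemma to_A_add: "[|p : \<O>; q : \<O>|] ==> to_A (p \<boxplus> q) = to_A p \<oplus>\<^bsub>A\<^esub> to_A q"
 unfolding A_def to_A_q by (rule Q.add_quot[symmetric])

lemma to_A_smult: "[|e : carrier k; p : \<O>|] ==> to_A (e \<odot>\<^bsub>Ox\<^esub> p) = e \<odot>\<^bsub>A\<^esub> to_A p"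
 unfolding A_def to_A_q by (rule Q.smult_quot[symmetric])

lemma to_A_mult: "[|p : \<O>; q : \<O>|] ==> to_A (p \<star> q) = to_A p \<otimes>\<^bsub>A\<^esub> to_A q"
 unfolding A_def to_A_def quot_mod_def by (simp add: FactRing_def J.rcoset_mult_add)

lemma to_A_one: "to_A \<one>\<^bsub>Ox\<^esub> = \<one>\<^bsub>A\<^esub>"
 unfolding A_def to_A_def quot_mod_def by (simp add: FactRing_def)

lemma to_A_zero: "to_A \<zero>\<^bsub>Ox\<^esub> = \<zero>\<^bsub>A\<^esub>"
 unfolding A_def to_A_q by (rule Q.zero_quot[symmetric])

lemma to_A_finsum: "(!!i. i : I ==> F i : \<O>) ==> to_A (\<Oplus>\<^bsub>Ox\<^esub>i\<in>I. F i) = (\<Oplus>\<^bsub>A\<^esub>i\<in>I. to_A (F i))"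
 unfolding A_def to_A_q by (rule Q.q_finsum) auto

lemma to_A_eq_iff: "[|p : \<O>; q : \<O>|] ==> to_A p = to_A q \<longleftrightarrow> p \<ominus>\<^bsub>Ox\<^esub> q : J"
 unfolding to_A_q by (rule Q.q_eq_iff)

lemma A_algebra: "assoc_algebra k A"
proof -
 have m: "module k A" unfolding A_def by (rule Q.quot_module)
 then interpret A: module k A .
 note hom = to_A_add[symmetric] to_A_mult[symmetric] to_A_smult[symmetric] to_A_one[symmetric]
 have r: "ring A"
 proof (rule ringI[OF A.M.abelian_group_axioms])
 show "Group.monoid A"
 by (rule monoidI) (auto simp: carrier_A hom Ox.m_assoc intro!: imageI)
 fix a b c assume "a : carrier A" "b : carrier A" "c : carrier A"
 then show "(a \<oplus>\<^bsub>A\<^esub> b) \<otimes>\<^bsub>A\<^esub> c = a \<otimes>\<^bsub>A\<^esub> c \<oplus>\<^bsub>A\<^esub> b \<otimes>\<^bsub>A\<^esub> c" "c \<otimes>\<^bsub>A\<^esub> (a \<oplus>\<^bsub>A\<^esub> b) = c \<otimes>\<^bsub>A\<^esub> a \<oplus>\<^bsub>A\<^esub> c \<otimes>\<^bsub>A\<^esub> b"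
 by (auto simp: carrier_A hom Ox.l_distr Ox.r_distr)
 qed
 have s: "(e \<odot>\<^bsub>A\<^esub> a) \<otimes>\<^bsub>A\<^esub> b = e \<odot>\<^bsub>A\<^esub> (a \<otimes>\<^bsub>A\<^esub> b)" "a \<otimes>\<^bsub>A\<^esub> (e \<odot>\<^bsub>A\<^esub> b) = e \<odot>\<^bsub>A\<^esub> (a \<otimes>\<^bsub>A\<^esub> b)"
 if "e : carrier k" "a : carrier A" "b : carrier A" for e a b
 using that by (auto simp: carrier_A hom Ox.smult_mult_left Ox.smult_mult_right)
 show ?thesis by (intro assoc_algebra.intro m r assoc_algebra_axioms.intro s)
qed

lemma emb_hom: "emb : alg_hom k K A"
proof -
 have add: "mon (c \<oplus> d) 0 = mon c 0 \<boxplus> mon d 0" if "c : carrier K" "d : carrier K" for c d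
 using that by (auto simp: mon_def O_simps)
 have smult: "mon (e \<odot> c) 0 = e \<odot>\<^bsub>Ox\<^esub> mon c 0" if "e : carrier k" for e c
 using that by (auto simp: mon_def O_simps K.smult_r_null)
 have mult: "mon (c \<otimes> d) 0 = mon c 0 \<star> mon d 0" if "c : carrier K" "d : carrier K" for c d
 using that by (simp add: mon_mult)
 show ?thesis unfolding alg_hom_def ring_hom_def
 by (auto simp: emb_def const_mon add mult smult to_A_add to_A_mult to_A_smult mon_one to_A_one)
qed

lemma O_minus_zero: "[|p : \<O>; q : \<O>; q i = p i|] ==> (p \<ominus>\<^bsub>Ox\<^esub> q) i = \<zero>"
 by (subst O_minus) (simp_all add: a_minus_def K.M.r_neg)

lemma emb_closed [simp]: "c : carrier K ==> emb c : carrier A"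
 by (simp add: emb_def)

subsection \<open>Division by \<open>f\<close>\<close>

lemma f_division:
 assumes "p : \<O>"
 shows "EX q:\<O>. EX s:\<O>. (ALL i>=n. s i = \<zero>) & p = q \<star> f \<boxplus> s"
proof -
 obtain N where "ALL i>=N. p i = \<zero>" using assms O_carrier by meson
 then show ?thesis using assms
 proof (induction N arbitrary: p)
 case 0
 then have p: "p = \<zero>\<^bsub>Ox\<^esub>" by (auto simp: O_simps(1))
 have "ALL i>=n. \<zero>\<^bsub>Ox\<^esub> i = \<zero>" by (simp add: O_simps(1))
 then show ?case unfolding p by (intro bexI[of _ "\<zero>\<^bsub>Ox\<^esub>"]) simp_all
 next
 case (Suc N)
 show ?case
 proof (cases "N < n")
 case True
 then show ?thesis using Suc.prems by (intro bexI[of _ "\<zero>\<^bsub>Ox\<^esub>"] bexI[of _ p]) auto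
 next
 case False
 let ?m = "mon (p N) (N - n)"
 have m: "?m : \<O>" using Suc.prems by simp
 have "(p \<ominus>\<^bsub>Ox\<^esub> ?m \<star> f) i = \<zero>" if i: "i >= N" for i
 proof -
 have "(?m \<star> f) i = p N \<otimes> f (i - (N - n))"
 using Suc.prems i False by (simp add: mon_mult_coeff f_fixed)
 moreover have "f (i - (N - n)) = (if i = N then \<one> else \<zero>)"
 using i False lam_0 by (auto simp: f_coeff)
 ultimately have "(?m \<star> f) i = p i" using Suc.prems i by (cases "i = N") auto
 then show ?thesis using Suc.prems m by (intro O_minus_zero) simp_all
 qed
 then obtain q s where qs: "q : \<O>" "s : \<O>" "ALL i>=n. s i = \<zero>"
 "p \<ominus>\<^bsub>Ox\<^esub> ?m \<star> f = q \<star> f \<boxplus> s"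
 using Suc.IH[of "p \<ominus>\<^bsub>Ox\<^esub> ?m \<star> f"] Suc.prems m by auto
 have "p = ?m \<star> f \<boxplus> (p \<ominus>\<^bsub>Ox\<^esub> ?m \<star> f)"
 using Suc.prems m by (simp add: a_minus_def Ox.M.a_lcomm Ox.M.r_neg)
 also have "... = (?m \<boxplus> q) \<star> f \<boxplus> s" using qs m by (simp add: Ox.l_distr Ox.M.a_assoc)
 finally show ?thesis using qs m by blast
 qed
 qed
qed

text \<open>As \<open>f\<close> is monic, the top coefficient of \<open>q\<close> survives in \<open>q f\<close>.\<close>

lemma f_top: 
 assumes q: "q : \<O>" and z: "ALL i>=n. (q \<star> f) i = \<zero>"
 shows "q = \<zero>\<^bsub>Ox\<^esub>"
proof -
 obtain N where "ALL i>=N. q i = \<zero>" using q O_carrier by meson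
 then have "ALL i. q i = \<zero>"
 proof (induction N)
 case (Suc N)
 have "(q \<star> f) (N + n) = q N \<otimes> (\<alpha> ^^ N) (f (N + n - N))"
 unfolding O_simps
 proof (rule K.M.finsum_single)
 fix j assume "j : {..N + n}" "j ~= N"
 then consider "j < N" | "Suc N <= j" by fastforce
 then show "q j \<otimes> (\<alpha> ^^ j) (f (N + n - j)) = \<zero>"
 proof cases
 case 1
 then have "~ N + n - j <= n" by linarith
 then have "f (N + n - j) = \<zero>" by (simp only: f_coeff if_False)
 then show ?thesis using q by simp
 next
 case 2
 then show ?thesis using Suc.prems q by simp
 qed
 qed (use q in auto)
 then have "q N = \<zero>" using z q by (simp add: f_fixed, simp add: f_coeff lam_0)
 then show ?case using Suc by (metis Suc_leI le_neq_implies_less)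
 qed simp
 then show ?thesis by (auto simp: O_simps)
qed

lemma f_division_unique:
 assumes "q : \<O>" "q' : \<O>" "s : \<O>" "s' : \<O>"
 and s: "ALL i>=n. s i = \<zero>" "ALL i>=n. s' i = \<zero>"
 and eq: "q \<star> f \<boxplus> s = q' \<star> f \<boxplus> s'"
 shows "q = q'" "s = s'"
proof -
 note [simp] = assms(1-4)
 have 1: "(q \<ominus>\<^bsub>Ox\<^esub> q') \<star> f = q \<star> f \<ominus>\<^bsub>Ox\<^esub> q' \<star> f"
 by (simp add: a_minus_def Ox.l_distr Ox.l_minus)
 have "((q \<ominus>\<^bsub>Ox\<^esub> q') \<star> f) i = \<zero>" if "i >= n" for i
 proof -
 have "(q \<star> f) i \<oplus> s i = (q' \<star> f) i \<oplus> s' i" using fun_cong[OF eq, of i] by (simp add: O_simps(2))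
 then have "(q \<star> f) i = (q' \<star> f) i" using s that by simp
 then show ?thesis unfolding 1 by (intro O_minus_zero) simp_all
 qed
 then have "ALL i>=n. ((q \<ominus>\<^bsub>Ox\<^esub> q') \<star> f) i = \<zero>" by blast
 then have "q \<ominus>\<^bsub>Ox\<^esub> q' = \<zero>\<^bsub>Ox\<^esub>" by (intro f_top) simp
 then show q: "q = q'" using Ox.M.diff_zero_iff[of q q'] by simp
 show "s = s'" using eq unfolding q by simp
qed

lemma ex_remainder: "a : carrier A ==> EX s:\<O>. (ALL i>=n. s i = \<zero>) & a = to_A s"
proof -
 assume "a : carrier A"
 then obtain p where p: "p : \<O>" "a = to_A p" unfolding carrier_A by blast
 obtain q s where qs: "q : \<O>" "s : \<O>" "ALL i>=n. s i = \<zero>" "p = q \<star> f \<boxplus> s"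
 using f_division[OF p(1)] by blast
 have "p \<ominus>\<^bsub>Ox\<^esub> s = q \<star> f" using qs by (simp add: a_minus_def Ox.M.a_assoc Ox.M.r_neg)
 then have "to_A p = to_A s" using p(1) qs(1,2) by (simp add: to_A_eq_iff J_eq)
 then show ?thesis using p qs by blast
qed

lemma remainder_unique:
 assumes "s : \<O>" "s' : \<O>" "ALL i>=n. s i = \<zero>" "ALL i>=n. s' i = \<zero>" "to_A s = to_A s'"
 shows "s = s'"
proof -
 have "s \<ominus>\<^bsub>Ox\<^esub> s' : J" using assms by (simp add: to_A_eq_iff)
 then obtain q where q: "q : \<O>" "s \<ominus>\<^bsub>Ox\<^esub> s' = q \<star> f" unfolding J_eq by blast
 have "s = q \<star> f \<boxplus> s'" using assms unfolding q(2)[symmetric] by (simp add: a_minus_def Ox.M.a_assoc Ox.M.l_neg)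
 then have "\<zero>\<^bsub>Ox\<^esub> \<star> f \<boxplus> s = q \<star> f \<boxplus> s'" using assms by simp
 from f_division_unique(2)[OF _ q(1) assms(1-4) this] show ?thesis by simp
qed

text \<open>The remainder of degree less than \<open>n\<close> that represents a class; its values are the
coordinates in the basis \<open>1, x, \<dots>, x\<^sup>n\<^sup>-\<^sup>1\<close>.\<close>

definition rem :: "(nat => 'a) set => nat => 'a"
 where "rem a = (SOME s. s : \<O> & (ALL i>=n. s i = \<zero>) & a = to_A s)"

lemma rem:
 assumes "a : carrier A"
 shows "rem a : \<O>" "ALL i>=n. rem a i = \<zero>" "a = to_A (rem a)"
proof -
 have "EX s. s : \<O> & (ALL i>=n. s i = \<zero>) & a = to_A s" using ex_remainder[OF assms] by blast
 from someI_ex[OF this] show "rem a : \<O>" "ALL i>=n. rem a i = \<zero>" "a = to_A (rem a)"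
 unfolding rem_def by blast+
qed

interpretation A: assoc_algebra k A by (rule A_algebra)

lemma x_closed' [simp]: "x : carrier A"
 by (simp add: x_def)

lemma to_A_pow: "to_A (ore_var K [^]\<^bsub>Ox\<^esub> (j::nat)) = x [^]\<^bsub>A\<^esub> j"
 by (induction j) (simp_all add: to_A_one to_A_mult x_def)

lemma to_A_mon: "c : carrier K ==> to_A (mon c j) = emb c \<otimes>\<^bsub>A\<^esub> x [^]\<^bsub>A\<^esub> j"
proof -
 assume c: "c : carrier K"
 have "ore_const K c : \<O>" using c by (simp add: const_mon)
 then show ?thesis unfolding mon_const_var[OF c] emb_def to_A_pow[symmetric] by (rule to_A_mult) simp
qed

lemma to_A_expand:
 assumes "p : \<O>" "!!i. i >= N ==> p i = \<zero>"
 shows "to_A p = (\<Oplus>\<^bsub>A\<^esub>i\<in>{..<N}. emb (p i) \<otimes>\<^bsub>A\<^esub> x [^]\<^bsub>A\<^esub> i)"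
proof -
 have "to_A p = to_A (\<Oplus>\<^bsub>Ox\<^esub>i\<in>{..<N}. mon (p i) i)" by (rule arg_cong[OF O_expand[OF assms]])
 also have "... = (\<Oplus>\<^bsub>A\<^esub>i\<in>{..<N}. to_A (mon (p i) i))" using assms(1) by (intro to_A_finsum) simp
 also have "... = (\<Oplus>\<^bsub>A\<^esub>i\<in>{..<N}. emb (p i) \<otimes>\<^bsub>A\<^esub> x [^]\<^bsub>A\<^esub> i)"
 using assms(1) by (intro A.M.finsum_cong') (auto simp: to_A_mon)
 finally show ?thesis .
qed

lemma monogenic_algebra: "monogenic_algebra k K emb A \<alpha> n lam x rem"
proof (intro monogenic_algebra.intro relative_algebra.intro monogenic_algebra_axioms.intro)
 show "cring k" "assoc_algebra k A" "assoc_algebra k K" "emb : alg_hom k K A" "\<alpha> : alg_hom k K K" "2 <= n"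
 "lam 0 = \<one>" "x : carrier A"
 by (fact k_cring A_algebra K_algebra emb_hom alpha_hom n_ge_2 lam_0 x_closed')+
 show "lam i : carrier K" "\<alpha> (lam i) = lam i" if "i <= n" for i using lam_all that by auto
 show "lam i \<otimes> c = (\<alpha> ^^ i) c \<otimes> lam i" if "i <= n" "c : carrier K" for i c using lam_all that by auto
 show "x \<otimes>\<^bsub>A\<^esub> emb c = emb (\<alpha> c) \<otimes>\<^bsub>A\<^esub> x" if c: "c : carrier K" for c
 proof -
 have "\<alpha> c : carrier K" using pow_alpha[OF c, of 1] by simp
 then have "ore_var K \<star> ore_const K c = ore_const K (\<alpha> c) \<star> ore_var K"
 using c by (simp add: var_mon const_mon mon_mult)
 then show ?thesis using c \<open>\<alpha> c : carrier K\<close> by (simp add: x_def emb_def to_A_mult[symmetric] const_mon)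
 qed
 show "(\<Oplus>\<^bsub>A\<^esub>i\<in>{..n}. emb (lam (n - i)) \<otimes>\<^bsub>A\<^esub> x [^]\<^bsub>A\<^esub> i) = \<zero>\<^bsub>A\<^esub>"
 proof -
 have "to_A f = (\<Oplus>\<^bsub>A\<^esub>i\<in>{..<Suc n}. emb (f i) \<otimes>\<^bsub>A\<^esub> x [^]\<^bsub>A\<^esub> i)"
 by (rule to_A_expand) (auto simp: f_coeff)
 also have "... = (\<Oplus>\<^bsub>A\<^esub>i\<in>{..n}. emb (lam (n - i)) \<otimes>\<^bsub>A\<^esub> x [^]\<^bsub>A\<^esub> i)"
 unfolding lessThan_Suc_atMost by (rule A.M.finsum_cong') (auto simp: f_coeff lam_all)
 finally have "to_A f = (\<Oplus>\<^bsub>A\<^esub>i\<in>{..n}. emb (lam (n - i)) \<otimes>\<^bsub>A\<^esub> x [^]\<^bsub>A\<^esub> i)" .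
 moreover have "to_A f = to_A \<zero>\<^bsub>Ox\<^esub>"
 using Ox.genideal_self'[of f] by (simp add: to_A_eq_iff a_minus_def)
 ultimately show ?thesis by (simp add: to_A_zero)
 qed
 show "rem a i : carrier K" if "a : carrier A" for a i using rem(1)[OF that] by simp
 show "a = (\<Oplus>\<^bsub>A\<^esub>i\<in>{..<n}. emb (rem a i) \<otimes>\<^bsub>A\<^esub> x [^]\<^bsub>A\<^esub> i)" if "a : carrier A" for a
 using to_A_expand[OF rem(1)[OF that], of n] rem(2,3)[OF that] by simp
 show "rem (\<Oplus>\<^bsub>A\<^esub>i\<in>{..<n}. emb (cs i) \<otimes>\<^bsub>A\<^esub> x [^]\<^bsub>A\<^esub> i) j = cs j"
 if cs: "!!i. i < n ==> cs i : carrier K" and j: "j < n" for cs j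
 proof -
 let ?s = "%i. if i < n then cs i else \<zero>"
 have s: "?s : \<O>"
 proof -
 have "EX N. ALL i>=N. ?s i = \<zero>" by (intro exI[of _ n]) simp
 moreover have "?s i : carrier K" for i using cs by simp
 ultimately show ?thesis unfolding O_carrier by blast
 qed
 have "to_A ?s = (\<Oplus>\<^bsub>A\<^esub>i\<in>{..<n}. emb (?s i) \<otimes>\<^bsub>A\<^esub> x [^]\<^bsub>A\<^esub> i)"
 by (rule to_A_expand[OF s]) simp
 also have "... = (\<Oplus>\<^bsub>A\<^esub>i\<in>{..<n}. emb (cs i) \<otimes>\<^bsub>A\<^esub> x [^]\<^bsub>A\<^esub> i)"
 using cs by (intro A.M.finsum_cong') auto
 finally have e: "(\<Oplus>\<^bsub>A\<^esub>i\<in>{..<n}. emb (cs i) \<otimes>\<^bsub>A\<^esub> x [^]\<^bsub>A\<^esub> i) = to_A ?s" by simp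
 have "rem (to_A ?s) = ?s"
 using rem[of "to_A ?s"] s by (intro remainder_unique) auto
 then show ?thesis using j unfolding e by simp
 qed
qed

end

context monogenic
begin

sublocale monogenic_algebra k K emb A \<alpha> n lam x rem
 by (rule monogenic_algebra)

section \<open>The small complex\<close>

lemma deg_less_iff: "s : \<O> ==> (s = \<zero>\<^bsub>Ox\<^esub> \<or> deg K s < n) \<longleftrightarrow> (ALL i>=n. s i = \<zero>)"
proof -
 assume s: "s : \<O>"
 have up: "s : up K" using s by (simp add: ore_ext_def)
 have d: "deg K s = (LEAST m. bound \<zero> m s)"
 using up by (simp add: deg_def UP_def)
 obtain N where "ALL i>=N. s i = \<zero>" using s O_carrier by meson
 then have "bound \<zero> N s" by (auto simp: bound_def)
 then have b: "bound \<zero> (deg K s) s" unfolding d by (rule LeastI)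
 show ?thesis
 proof
 assume "s = \<zero>\<^bsub>Ox\<^esub> \<or> deg K s < n"
 then show "ALL i>=n. s i = \<zero>"
 proof
 assume "s = \<zero>\<^bsub>Ox\<^esub>"
 then show ?thesis by (simp add: O_simps(1))
 next
 assume "deg K s < n"
 then show ?thesis using b by (auto simp: bound_def)
 qed
 next
 assume *: "ALL i>=n. s i = \<zero>"
 have "bound \<zero> (n - 1) s"
 proof (rule bound.intro)
 fix m assume "n - 1 < m"
 then show "s m = \<zero>" using * n_ge_2 by simp
 qed
 then have "deg K s <= n - 1" unfolding d by (rule Least_le)
 then show "s = \<zero>\<^bsub>Ox\<^esub> \<or> deg K s < n" using n_ge_2 by auto
 qed
qed

lemma overline_eq:
 assumes "q : \<O>" "s : \<O>" "ALL i>=n. s i = \<zero>" "p = q \<star> f \<boxplus> s"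
 shows "overline p = q"
 unfolding overline_def
proof (rule the_equality)
 show "q : \<O> & (EX s:\<O>. p = q \<star> f \<boxplus> s & (s = \<zero>\<^bsub>Ox\<^esub> \<or> deg K s < n))"
 using assms deg_less_iff by blast
 fix q' assume "q' : \<O> & (EX s:\<O>. p = q' \<star> f \<boxplus> s & (s = \<zero>\<^bsub>Ox\<^esub> \<or> deg K s < n))"
 then obtain s' where s': "q' : \<O>" "s' : \<O>" "p = q' \<star> f \<boxplus> s'" "s' = \<zero>\<^bsub>Ox\<^esub> \<or> deg K s' < n" by blast
 then have "ALL i>=n. s' i = \<zero>" using deg_less_iff[OF s'(2)] by blast
 from f_division_unique(1)[OF s'(1) assms(1) s'(2) assms(2) this assms(3)] show "q' = q"
 using s'(3) assms(4) by simp
qed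

text \<open>From \<open>x\<^sup>m = q f + s\<close> and \<open>f x = x f\<close> follows
\<open>x\<^sup>m\<^sup>+\<^sup>1 = (q x) f + s x\<close>, and the leading coefficient of \<open>s
x\<close> is divided once more.\<close>

lemma overline_step:
 assumes q: "q : \<O>" and s: "s : \<O>" "ALL i>=n. s i = \<zero>"
 and e: "ore_var K [^]\<^bsub>Ox\<^esub> m = q \<star> f \<boxplus> s"
 defines "c \<equiv> mon (s (n - 1)) 0"
 defines "s' \<equiv> s \<star> ore_var K \<ominus>\<^bsub>Ox\<^esub> c \<star> f"
 shows "s' : \<O>" "ALL i>=n. s' i = \<zero>"
 "ore_var K [^]\<^bsub>Ox\<^esub> Suc m = (q \<star> ore_var K \<boxplus> c) \<star> f \<boxplus> s'"
proof -
 have c: "c : \<O>" using s by (simp add: c_def)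
 show s'c: "s' : \<O>" using s c by (simp add: s'_def)
 have sx: "(s \<star> ore_var K) i = s (i - 1)" if "i >= 1" for i
 proof -
 have "(s \<star> ore_var K) i = s (i - 1) \<otimes> (\<alpha> ^^ (i - 1)) (ore_var K (i - (i - 1)))"
 unfolding O_simps using that s(1) by (intro K.M.finsum_single) (auto simp: ore_var_def)
 then show ?thesis using that s(1) by (simp add: ore_var_def)
 qed
 have cf: "(c \<star> f) i = s (n - 1) \<otimes> f i" for i
 unfolding c_def using s(1) by (simp add: mon_mult_coeff)
 have "(c \<star> f) i = (s \<star> ore_var K) i" if i: "i >= n" for i
 proof (cases "i = n")
 case True
 then show ?thesis using s(1) n_ge_2 sx[of n] lam_0 unfolding cf by (simp add: f_coeff)
 next
 case False
 then have "s (i - 1) = \<zero>" using i s(2) by simp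
 then show ?thesis using False i s(1) n_ge_2 sx[of i] unfolding cf by (simp add: f_coeff)
 qed
 then show "ALL i>=n. s' i = \<zero>" unfolding s'_def using s(1) c by (intro allI impI O_minus_zero) auto
 have "ore_var K [^]\<^bsub>Ox\<^esub> Suc m = (q \<star> f \<boxplus> s) \<star> ore_var K" by (simp add: e)
 also have "... = q \<star> (ore_var K \<star> f) \<boxplus> s \<star> ore_var K"
 using q s(1) by (simp add: Ox.l_distr Ox.m_assoc f_var)
 also have "s \<star> ore_var K = c \<star> f \<boxplus> s'"
 unfolding s'_def using s(1) c by (simp add: a_minus_def Ox.M.a_lcomm Ox.M.r_neg)
 finally show "ore_var K [^]\<^bsub>Ox\<^esub> Suc m = (q \<star> ore_var K \<boxplus> c) \<star> f \<boxplus> s'"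
 using q c s'c by (simp add: Ox.l_distr Ox.m_assoc Ox.M.a_assoc)
qed

lemma to_A_overline: "to_A (overline (ore_var K [^]\<^bsub>Ox\<^esub> m)) = uq m"
proof -
 have "EX q:\<O>. EX s:\<O>. (ALL i>=n. s i = \<zero>) & ore_var K [^]\<^bsub>Ox\<^esub> m = q \<star> f \<boxplus> s & to_A q = uq m"
 proof (induction m)
 case 0
 have "ALL i>=n. \<one>\<^bsub>Ox\<^esub> i = \<zero>" using n_ge_2 by (simp add: O_simps(4))
 then show ?case by (intro bexI[of _ "\<zero>\<^bsub>Ox\<^esub>"] bexI[of _ "\<one>\<^bsub>Ox\<^esub>"]) (simp_all add: to_A_zero)
 next
 case (Suc m)
 then obtain q s where qs: "q : \<O>" "s : \<O>" "ALL i>=n. s i = \<zero>"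
 "ore_var K [^]\<^bsub>Ox\<^esub> m = q \<star> f \<boxplus> s" "to_A q = uq m" by blast
 have "q \<star> f : J" unfolding J_eq using qs(1) by blast
 moreover have "ore_var K [^]\<^bsub>Ox\<^esub> m \<ominus>\<^bsub>Ox\<^esub> s = q \<star> f" using qs by (simp add: a_minus_def Ox.M.a_assoc Ox.M.r_neg)
 ultimately have "to_A (ore_var K [^]\<^bsub>Ox\<^esub> m) = to_A s" using qs(2) by (simp add: to_A_eq_iff)
 then have "rem (X m) = s" using rem[of "X m"] qs(2,3) by (intro remainder_unique) (auto simp: to_A_pow)
 then have "s (n - 1) = cK m (n - 1)" using co_X[of "n - 1" m] n_ge_2 by simp
 then have "to_A (mon (s (n - 1)) 0) = cf m (n - 1)" by (simp add: emb_def const_mon)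
 then have "to_A (q \<star> ore_var K \<boxplus> mon (s (n - 1)) 0) = uq (Suc m)"
 using qs by (simp add: to_A_add to_A_mult x_def[symmetric])
 then show ?case using overline_step[OF qs(1-4)] qs(1,2)
 by (intro bexI[of _ "q \<star> ore_var K \<boxplus> mon (s (n - 1)) 0"] bexI[of _ "s \<star> ore_var K \<ominus>\<^bsub>Ox\<^esub> mon (s (n - 1)) 0 \<star> f"]) auto
 qed
 then show ?thesis using overline_eq by metis
qed

subsection \<open>Its modules\<close>

text \<open>Degree \<open>r\<close> of the small complex corresponds to chains on the single word \<open>sw r\<close>
at twist \<open>st r\<close>.\<close>

definition st :: "nat => nat" where "st r = r div 2 * n"

definition sw :: "nat => nat list" where "sw r = (if even r then [] else [1])"

lemma S_ker_eq: "S_ker r = comm_sub (st r + sum_list (sw r))"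
 by (simp add: S_ker_def st_def sw_def Let_def)

lemma comm_gens: "{a \<otimes>\<^bsub>A\<^esub> emb ((\<alpha> ^^ j) c) \<ominus>\<^bsub>A\<^esub> emb c \<otimes>\<^bsub>A\<^esub> a | a c. a : carrier A & c : carrier K} <= carrier A"
 by (auto intro!: A.M.minus_closed)

sublocale SQ: mod_quotient k A "S_ker r" for r
 unfolding S_ker_eq comm_sub_def
 by (intro mod_quotient.intro A.module_axioms mod_span_submodule(1) comm_gens)

lemma S_module: "module k (S_mod r)"
 unfolding S_mod_def by (rule SQ.quot_module)

sublocale SM: module k "S_mod r" for r by (rule S_module)

lemma carrier_S: "carrier (S_mod r) = S_class r ` carrier A"
 unfolding S_mod_def S_class_def[abs_def] by (rule SQ.carrier_quot)

lemma S_class_closed [simp]: "a : carrier A ==> S_class r a : carrier (S_mod r)"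
 by (simp add: carrier_S)

lemma S_class_add: "[|a : carrier A; b : carrier A|] ==> S_class r (a \<oplus>\<^bsub>A\<^esub> b) = S_class r a \<oplus>\<^bsub>S_mod r\<^esub> S_class r b"
 unfolding S_mod_def S_class_def by (rule SQ.add_quot[symmetric])

lemma S_class_smult: "[|e : carrier k; a : carrier A|] ==> S_class r (e \<odot>\<^bsub>A\<^esub> a) = e \<odot>\<^bsub>S_mod r\<^esub> S_class r a"
 unfolding S_mod_def S_class_def by (rule SQ.smult_quot[symmetric])

lemma S_class_minus: "[|a : carrier A; b : carrier A|] ==> S_class r (a \<ominus>\<^bsub>A\<^esub> b) = S_class r a \<ominus>\<^bsub>S_mod r\<^esub> S_class r b"
proof -
 have "restrict (S_class r) (carrier A) : mod_hom k A (S_mod r)"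
 using SQ.q_hom[of r] unfolding S_mod_def S_class_def[abs_def] .
 from mod_hom_minus[OF A.module_axioms S_module this]
 show "[|a : carrier A; b : carrier A|] ==> S_class r (a \<ominus>\<^bsub>A\<^esub> b) = S_class r a \<ominus>\<^bsub>S_mod r\<^esub> S_class r b" by simp
qed

lemma S_class_twist:
 assumes "a : carrier A" "c : carrier K"
 shows "S_class r (emb c \<otimes>\<^bsub>A\<^esub> a) = S_class r (a \<otimes>\<^bsub>A\<^esub> emb (tw (st r + sum_list (sw r)) c))"
proof -
 have "a \<otimes>\<^bsub>A\<^esub> emb (tw (st r + sum_list (sw r)) c) \<ominus>\<^bsub>A\<^esub> emb c \<otimes>\<^bsub>A\<^esub> a : S_ker r"
 unfolding S_ker_eq comm_sub_def using assms
 by (intro mod_span_submodule(2)[OF A.module_axioms comm_gens, THEN subsetD]) blast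
 then show ?thesis unfolding S_class_def using assms by (subst eq_commute, subst SQ.q_eq_iff) simp_all
qed

lemma S_hom_eqI:
 assumes "h : mod_hom k (S_mod r) M" "h' : mod_hom k (S_mod r) M"
 and "!!a. a : carrier A ==> h (S_class r a) = h' (S_class r a)"
 shows "h = h'"
 by (rule SQ.quot_hom_eqI[OF assms[unfolded S_mod_def S_class_def]])

lemma ex_S_hom:
 fixes M :: "('k, 'y, 'q) module_scheme"
 assumes M: "module k M" and \<Phi>: "functional (st r) M \<Phi>"
 shows "EX h:mod_hom k (S_mod r) M. ALL a:carrier A. h (S_class r a) = \<Phi> (g a (sw r))"
proof -
 note F = functionalD[OF \<Phi>] and E = functional_eqv[OF M \<Phi>]
 interpret M: module k M by fact
 let ?h = "restrict (%a. \<Phi> (g a (sw r))) (carrier A)"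
 have h: "?h : mod_hom k A M"
 proof (rule mod_hom_restrictI[OF A.module_axioms])
 fix c a assume "c : carrier k" "a : carrier A"
 then show "\<Phi> (g (c \<odot>\<^bsub>A\<^esub> a) (sw r)) = c \<odot>\<^bsub>M\<^esub> \<Phi> (g a (sw r))"
 using F(4)[of c "g a (sw r)"] by (simp add: sm_simps Ca_closure)
 qed (use F(1,2) E[OF eqv_g_add] in auto)
 have "?h y = \<zero>\<^bsub>M\<^esub>" if "y : S_ker r" for y
 proof (rule mod_span_in_kernel[OF A.module_axioms M comm_gens h _ that[unfolded S_ker_eq comm_sub_def]])
 fix y assume "y : {a \<otimes>\<^bsub>A\<^esub> emb (tw (st r + sum_list (sw r)) c) \<ominus>\<^bsub>A\<^esub> emb c \<otimes>\<^bsub>A\<^esub> a | a c. a : carrier A & c : carrier K}"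
 then obtain a c where ac: "a : carrier A" "c : carrier K"
 "y = a \<otimes>\<^bsub>A\<^esub> emb (tw (st r + sum_list (sw r)) c) \<ominus>\<^bsub>A\<^esub> emb c \<otimes>\<^bsub>A\<^esub> a" by blast
 have "?h y = ?h (a \<otimes>\<^bsub>A\<^esub> emb (tw (st r + sum_list (sw r)) c)) \<ominus>\<^bsub>M\<^esub> ?h (emb c \<otimes>\<^bsub>A\<^esub> a)"
 unfolding ac(3) using ac by (intro mod_hom_minus[OF A.module_axioms M h]) auto
 then show "?h y = \<zero>\<^bsub>M\<^esub>" using ac(1,2) E[OF eqv_g_twist[OF ac(1,2)], of "sw r"] F(1) by (simp add: a_minus_def M.r_neg)
 qed
 from SQ.ex_quot_hom[OF M h this] show ?thesis unfolding S_mod_def S_class_def by auto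
qed

definition evS :: "nat => (nat => 'a) set chain => (nat => 'a) set set"
 where "evS r = frag_eval (S_mod r) (%p. if fst p : carrier A & snd p = sw r then S_class r (fst p) else \<zero>\<^bsub>S_mod r\<^esub>)"

lemma evS_atom: "(if fst p : carrier A & snd p = sw r then S_class r (fst p) else \<zero>\<^bsub>S_mod r\<^esub>) : carrier (S_mod r)"
 by auto

lemma evS_closed [simp]: "evS r u : carrier (S_mod r)"
 and evS_add: "evS r (u + v) = evS r u \<oplus>\<^bsub>S_mod r\<^esub> evS r v"
 and evS_neg: "evS r (- u) = \<ominus>\<^bsub>S_mod r\<^esub> evS r u"
 and evS_diff: "evS r (u - v) = evS r u \<ominus>\<^bsub>S_mod r\<^esub> evS r v"
 and evS_zero [simp]: "evS r 0 = \<zero>\<^bsub>S_mod r\<^esub>"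
 and evS_sum: "evS r (sum F I) = (\<Oplus>\<^bsub>S_mod r\<^esub>i\<in>I. evS r (F i))"
 unfolding evS_def
 by (rule SM.M.frag_eval_closed[OF evS_atom] SM.M.frag_eval_add[OF evS_atom] SM.M.frag_eval_neg[OF evS_atom]
 SM.M.frag_eval_diff[OF evS_atom] SM.M.frag_eval_zero[OF evS_atom] SM.M.frag_eval_sum[OF evS_atom])+

lemma evS_g: "evS r (g a w) = (if a : carrier A & w = sw r then S_class r a else \<zero>\<^bsub>S_mod r\<^esub>)"
 unfolding evS_def by (subst SM.M.frag_eval_of[OF evS_atom]) simp

lemma functional_evS: "functional (st r) (S_mod r) (evS r)"
 unfolding functional_def
proof (intro conjI ballI allI)
 fix u assume "u : N (st r)"
 then show "evS r u = \<zero>\<^bsub>S_mod r\<^esub>"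
 proof (induction rule: N.induct)
 case (N_diff u v)
 then show ?case by (simp add: evS_diff a_minus_def SM.M.r_neg)
 next
 case (N_add a b w)
 then have "evS r (g (a \<oplus>\<^bsub>A\<^esub> b) w) = evS r (g a w + g b w)" by (simp add: evS_add evS_g S_class_add)
 then show ?case by (simp add: diff_diff_eq evS_diff a_minus_def SM.M.r_neg)
 next
 case (N_twist a d w)
 then show ?case using S_class_twist[of a d r] by (simp add: evS_diff evS_g a_minus_def SM.M.r_neg)
 qed simp
next
 fix e u assume e: "e : carrier k" and u: "u : Ca"
 show "evS r (sm e u) = e \<odot>\<^bsub>S_mod r\<^esub> evS r u"
 using u unfolding Ca_Sp
 proof (induction u rule: Sp_induct)
 case (gen a w)
 then show ?case using e by (simp add: sm_simps evS_g S_class_smult SM.smult_r_null)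
 next
 case (diff u v)
 then show ?case using e by (simp add: sm_simps evS_diff a_minus_def SM.smult_r_distr SM.smult_r_minus)
 qed (use e in \<open>simp add: sm_simps SM.smult_r_null\<close>)
qed (auto simp: evS_add)

lemma evS_eqv: "eqv (st r) u v ==> evS r u = evS r v"
 by (rule functional_eqv[OF S_module functional_evS])

definition Cs :: "nat => (nat => 'a) set chain set" where "Cs r = Sp (carrier A \<times> {sw r})"

lemma S_surj: "c : carrier (S_mod r) ==> EX a:carrier A. c = evS r (g a (sw r))"
 by (auto simp: carrier_S evS_g)

lemma S_hom_ev:
 assumes M: "module k M" and h: "h : mod_hom k (S_mod r) M" and \<Phi>: "functional t M \<Phi>"
 and eq: "!!a. a : carrier A ==> h (S_class r a) = \<Phi> (g a (sw r))" and u: "u : Cs r"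
 shows "h (evS r u) = \<Phi> u"
 using u unfolding Cs_def
proof (induction u rule: Sp_induct)
 case zero
 then show ?case using mod_hom_zero[OF S_module M h] functionalD(3)[OF \<Phi> N_zero] by simp
next
 case (gen a w)
 then show ?case using eq by (simp add: evS_g)
next
 case (diff u v)
 then show ?case using mod_hom_minus[OF S_module M h] by (simp add: evS_diff functional_diff[OF M \<Phi>])
qed

subsection \<open>Its differential\<close>

definition dch :: "nat => (nat => 'a) set chain => (nat => 'a) set chain"
 where "dch r = (if odd r then bb else dd2)"

lemma op_dch: "op (st (Suc r)) (st r) (dch (Suc r))"
proof (cases "even r")
 case True
 then have "st (Suc r) = st r" by (simp add: st_def)
 then show ?thesis using True op_bb by (simp add: dch_def)
next
 case False
 then have "st (Suc r) = st r + n" by (simp add: st_def odd_Suc_div_two)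
 then show ?thesis using False op_dd2 by (simp add: dch_def)
qed

lemma S_d_value:
 assumes a: "a : carrier A"
 shows "evS r (dch (Suc r) (g a (sw (Suc r)))) = (if odd (Suc r)
 then S_class r (a \<otimes>\<^bsub>A\<^esub> x \<ominus>\<^bsub>A\<^esub> x \<otimes>\<^bsub>A\<^esub> a)
 else (\<Oplus>\<^bsub>S_mod r\<^esub> i\<in>{1..n}. \<Oplus>\<^bsub>S_mod r\<^esub> l\<in>{..<i}.
 S_class r (emb (lam (n - i)) \<otimes>\<^bsub>A\<^esub> X (i - l - 1) \<otimes>\<^bsub>A\<^esub> a \<otimes>\<^bsub>A\<^esub> X l)))"
proof (cases "even r")
 case True
 then have s: "sw (Suc r) = [1]" "sw r = []" by (simp_all add: sw_def)
 have "evS r (dch (Suc r) (g a (sw (Suc r)))) = evS r (g (a \<otimes>\<^bsub>A\<^esub> x) [] - g (x \<otimes>\<^bsub>A\<^esub> a) [])"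
 using True a by (simp add: dch_def s)
 also have "... = S_class r (a \<otimes>\<^bsub>A\<^esub> x) \<ominus>\<^bsub>S_mod r\<^esub> S_class r (x \<otimes>\<^bsub>A\<^esub> a)"
 using a by (simp only: evS_diff evS_g s) simp
 also have "... = S_class r (a \<otimes>\<^bsub>A\<^esub> x \<ominus>\<^bsub>A\<^esub> x \<otimes>\<^bsub>A\<^esub> a)" using a by (simp add: S_class_minus)
 finally show ?thesis using True by simp
next
 case False
 then have s: "sw (Suc r) = []" "sw r = [1]" by (simp_all add: sw_def)
 let ?F = "%i l. g (L (n - i) \<otimes>\<^bsub>A\<^esub> X (i - l - 1) \<otimes>\<^bsub>A\<^esub> a \<otimes>\<^bsub>A\<^esub> X l) [1]"
 have "dch (Suc r) (g a (sw (Suc r))) = (\<Sum>i\<le>n. \<Sum>l<i. ?F i l)"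
 using False by (simp add: dch_def s)
 also have "... = (\<Sum>i\<in>{1..n}. \<Sum>l<i. ?F i l)"
 by (rule sum.mono_neutral_right) (auto simp: Suc_le_eq)
 finally have "evS r (dch (Suc r) (g a (sw (Suc r)))) = (\<Oplus>\<^bsub>S_mod r\<^esub>i\<in>{1..n}. \<Oplus>\<^bsub>S_mod r\<^esub>l\<in>{..<i}. evS r (?F i l))"
 by (simp only: evS_sum)
 also have "... = (\<Oplus>\<^bsub>S_mod r\<^esub> i\<in>{1..n}. \<Oplus>\<^bsub>S_mod r\<^esub> l\<in>{..<i}.
 S_class r (emb (lam (n - i)) \<otimes>\<^bsub>A\<^esub> X (i - l - 1) \<otimes>\<^bsub>A\<^esub> a \<otimes>\<^bsub>A\<^esub> X l))"
 using a by (intro SM.M.finsum_cong') (auto intro!: SM.M.finsum_closed SM.M.finsum_cong' simp: evS_g s)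
 finally show ?thesis using False by simp
qed

lemma S_d:
 "S_d (Suc r) : mod_hom k (S_mod (Suc r)) (S_mod r)"
 "u : Cs (Suc r) ==> S_d (Suc r) (evS (Suc r) u) = evS r (dch (Suc r) u)"
proof -
 have F: "functional (st (Suc r)) (S_mod r) (%u. evS r (dch (Suc r) u))"
 by (rule functional_comp[OF op_dch S_module functional_evS])
 obtain h where h: "h : mod_hom k (S_mod (Suc r)) (S_mod r)"
 "!!a. a : carrier A ==> h (S_class (Suc r) a) = evS r (dch (Suc r) (g a (sw (Suc r))))"
 using ex_S_hom[OF S_module F] by blast
 have "S_d (Suc r) = h"
 unfolding S_d_def diff_Suc_1
 proof (rule the_homI[OF h(1)])
 fix h' assume h': "h' : mod_hom k (S_mod (Suc r)) (S_mod r)"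
 "ALL a:carrier A. h' (S_class (Suc r) a) = (if odd (Suc r)
 then S_class r (a \<otimes>\<^bsub>A\<^esub> x \<ominus>\<^bsub>A\<^esub> x \<otimes>\<^bsub>A\<^esub> a)
 else (\<Oplus>\<^bsub>S_mod r\<^esub> i\<in>{1..n}. \<Oplus>\<^bsub>S_mod r\<^esub> l\<in>{..<i}.
 S_class r (emb (lam (n - i)) \<otimes>\<^bsub>A\<^esub> X (i - l - 1) \<otimes>\<^bsub>A\<^esub> a \<otimes>\<^bsub>A\<^esub> X l)))"
 show "h' = h" by (rule S_hom_eqI[OF h'(1) h(1)]) (simp only: h'(2)[rule_format] h(2) S_d_value)
 qed (intro ballI, subst h(2), assumption, rule S_d_value)
 then show "S_d (Suc r) : mod_hom k (S_mod (Suc r)) (S_mod r)"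
 "u : Cs (Suc r) ==> S_d (Suc r) (evS (Suc r) u) = evS r (dch (Suc r) u)"
 using h(1) S_hom_ev[OF S_module h(1) F h(2)] by auto
qed

end

context monogenic
begin

subsection \<open>Iterates of the operators\<close>

lemma op_QQm: "op (t + m * n) t (QQ ^^ m)"
proof (induction m arbitrary: t)
 case 0
 then show ?case using op_id[of t] by (simp add: id_def)
next
 case (Suc m)
 show ?case using op_comp[OF Suc[of "t + n"] op_QQ[of t]] by (simp add: o_def algebra_simps)
qed

lemma op_PPm: "op t (t + m * n) (PP ^^ m)"
proof (induction m)
 case 0
 then show ?case using op_id[of t] by (simp add: id_def)
next
 case (Suc m)
 show ?case using op_comp[OF Suc op_PP[of "t + m * n"]] by (simp add: o_def algebra_simps)
qed

lemma QQm_Ch: "u : Ch r (t + m * n) W ==> (QQ ^^ m) u : Ch (r + 2 * m) t W"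
proof (induction m arbitrary: t)
 case (Suc m)
 have "(QQ ^^ m) u : Ch (r + 2 * m) (t + n) W" using Suc.prems by (intro Suc.IH) (simp add: algebra_simps)
 from Ch_QQ[OF this] show ?case by simp
qed simp

lemma PPm_Ch: "u : Ch (r + 2 * m) t W ==> (PP ^^ m) u : Ch r (t + m * n) W"
proof (induction m arbitrary: r)
 case (Suc m)
 have "(PP ^^ m) u : Ch (Suc (Suc r)) (t + m * n) W" using Suc.prems by (intro Suc.IH) simp
 from Ch_PP[OF this] show ?case by (simp add: algebra_simps)
qed simp

lemma Cr_QQm: "u : Cr r ==> (QQ ^^ m) u : Cr (r + 2 * m)"
 using Cr_Ch[of u r "m * n"] QQm_Ch[of u r 0 m] Ch_Cr by (metis add_0)

lemma Cr_PPm: "u : Cr (r + 2 * m) ==> (PP ^^ m) u : Cr r"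
 using Cr_Ch[of u "r + 2 * m" 0] PPm_Ch[of u r m 0] Ch_Cr by blast

lemma QQm_bb: "u : Cr (Suc r) ==> eqv t (bb ((QQ ^^ m) u)) ((QQ ^^ m) (bb u))"
proof (induction m arbitrary: t)
 case (Suc m)
 have "(QQ ^^ m) u : Cr (Suc (r + 2 * m))" using Cr_QQm[OF Suc.prems, of m] by simp
 from eqv_trans[OF QQ_bb[OF this] QQ_eqv[OF Suc.IH[OF Suc.prems]]] show ?case by simp
qed simp

lemma PPm_bb: "u : Cr (r + 2 * m) ==> eqv (t + m * n) ((PP ^^ m) (bb u)) (bb ((PP ^^ m) u))"
proof (induction m arbitrary: r)
 case (Suc m)
 have u: "u : Cr (Suc (Suc r) + 2 * m)" using Suc.prems by simp
 have "eqv (t + m * n + n) (PP ((PP ^^ m) (bb u))) (PP (bb ((PP ^^ m) u)))"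
 by (intro PP_eqv Suc.IH[OF u])
 from eqv_trans[OF this PP_bb[OF Cr_PPm[OF u]]] show ?case by (simp add: algebra_simps)
qed simp

lemma PP_QQ: "u : Ca ==> PP (QQ u) = u"
 unfolding Ca_Sp by (induction u rule: Sp_induct) (auto simp: lift_diff PP_Q)

lemma PPm_QQm: "u : Ca ==> (PP ^^ m) ((QQ ^^ m) u) = u"
proof (induction m)
 case (Suc m)
 have "(QQ ^^ m) u : Ca" by (rule opD(3)[OF op_QQm[of 0] Suc.prems])
 moreover have "(PP ^^ Suc m) v = (PP ^^ m) (PP v)" for v by (simp add: funpow_swap1)
 moreover have "(QQ ^^ Suc m) u = QQ ((QQ ^^ m) u)" by simp
 ultimately show ?case using Suc by (simp only: PP_QQ)
qed simp

lemma addi_QQm: "addi (QQ ^^ m)"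
 by (rule opD(1)[OF op_QQm[of 0]])

lemma addi_sum: "addi F ==> F (sum G I) = (\<Sum>i\<in>I. F (G i))"
 by (induction I rule: infinite_finite_induct) (auto simp: addi_zero addi_add)

subsection \<open>The map \<open>phi\<close>\<close>

lemma II_Suc: "II (Suc m) = (%(i, is). i # is) ` ({1..n} \<times> II m)"
proof (intro equalityI subsetI)
 fix js assume js: "js : II (Suc m)"
 then obtain i is' where "js = i # is'" by (cases js) (auto simp: II_def)
 then show "js : (%(i, is). i # is) ` ({1..n} \<times> II m)"
 using js by (intro image_eqI[of _ _ "(i, is')"]) (auto simp: II_def)
qed (auto simp: II_def)

lemma JJ_Cons: "JJ (i # is) = (%(l, ls). l # ls) ` ({1..<i} \<times> JJ is)"
proof (intro equalityI subsetI)
 fix js assume js: "js : JJ (i # is)"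
 then obtain l ls where "js = l # ls" by (cases js) (auto simp: JJ_def)
 then show "js : (%(l, ls). l # ls) ` ({1..<i} \<times> JJ is)"
 using js by (intro image_eqI[of _ _ "(l, ls)"]) (auto simp: JJ_def All_less_Suc2)
qed (auto simp: JJ_def All_less_Suc2)

lemma sum_II_Suc: "(\<Sum>is\<in>II (Suc m). G is) = (\<Sum>i\<in>{1..n}. \<Sum>is\<in>II m. G (i # is))"
 unfolding II_Suc sum.cartesian_product by (subst sum.reindex) (auto simp: inj_on_def case_prod_beta intro!: sum.cong)

lemma sum_JJ_Cons: "(\<Sum>ls\<in>JJ (i # is). G ls) = (\<Sum>l\<in>{1..<i}. \<Sum>ls\<in>JJ is. G (l # ls))"
 unfolding JJ_Cons sum.cartesian_product by (subst sum.reindex) (auto simp: inj_on_def case_prod_beta intro!: sum.cong)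

lemma JJ_Nil: "JJ [] = {[]}" and II_0: "II 0 = {[]}"
 by (auto simp: JJ_def II_def)

definition gap :: "nat list => nat list => nat"
 where "gap is ls = sum_list (map2 (%i l. i - l - 1) is ls)"

lemma gap_eq: "ls : JJ is ==> (\<Sum>j<length is. is ! j - ls ! j) - length is = gap is ls"
proof -
 assume ls: "ls : JJ is"
 then have "length ls = length is" by (simp add: JJ_def)
 then have "(\<Sum>j<length is. is ! j - ls ! j) = gap is ls + length is"
 using ls
 proof (induction ls "is" rule: list_induct2)
 case (Cons l ls i "is")
 then have "l < i" "ls : JJ is" by (auto simp: JJ_Cons)
 then show ?case using Cons by (simp add: sum.lessThan_Suc_shift gap_def del: sum.lessThan_Suc)
 qed (simp add: gap_def)
 then show ?thesis by simp
qed

definition wt :: "nat list => nat list"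
 where "wt ls = concat (map (%l. [1, l]) (rev ls))"

lemma map_wt: "map X (wt ls) = x_tilde ls"
 by (simp add: wt_def x_tilde_def map_concat o_def)

lemma length_wt: "length (wt ls) = 2 * length ls"
 by (induction ls) (auto simp: wt_def)

lemma lam_prod_fixed: "is : II m ==> lam_prod is : carrier K & \<alpha> (lam_prod is) = lam_prod is"
proof (induction m arbitrary: "is")
 case 0
 then show ?case by (simp add: II_0 lam_prod_def)
next
 case (Suc m)
 then obtain i js where "is = i # js" "i : {1..n}" "js : II m" unfolding II_Suc by auto
 then show ?case using Suc.IH[of js] lam_closed[of "n - i"] alpha_lam[of "n - i"] by (simp add: lam_prod_def alpha_mult)
qed

lemma X_lam_prod: "is : II m ==> X i \<otimes>\<^bsub>A\<^esub> emb (lam_prod is) = emb (lam_prod is) \<otimes>\<^bsub>A\<^esub> X i"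
 using lam_prod_fixed[of "is" m] by (simp add: X_iota tw_fixed)

text \<open>The innermost pair \<open>x \<otimes> x\<^sup>l\<close> is created first, so that the first index of a
multi-index is the one applied first.\<close>

lemma QQm_g:
 assumes "a : carrier A"
 shows "(QQ ^^ m) (g a w) = (\<Sum>is\<in>II m. \<Sum>ls\<in>JJ is. g (a \<otimes>\<^bsub>A\<^esub> (emb (lam_prod is) \<otimes>\<^bsub>A\<^esub> X (gap is ls))) (wt ls @ w))"
 using assms
proof (induction m arbitrary: a w)
 case 0
 then show ?case by (simp add: II_0 JJ_Nil lam_prod_def gap_def wt_def)
next
 case (Suc m)
 let ?c = "%i l. a \<otimes>\<^bsub>A\<^esub> (L (n - i) \<otimes>\<^bsub>A\<^esub> X (i - l - 1))"
 have "(QQ ^^ Suc m) (g a w) = (QQ ^^ m) (\<Sum>i\<le>n. \<Sum>l\<in>{1..<i}. g (?c i l) (1 # l # w))"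
 by (simp add: funpow_swap1 Q0_def)
 also have "... = (\<Sum>i\<le>n. \<Sum>l\<in>{1..<i}. (QQ ^^ m) (g (?c i l) (1 # l # w)))"
 by (simp only: addi_sum[OF addi_QQm])
 also have "... = (\<Sum>i\<in>{1..n}. \<Sum>l\<in>{1..<i}. (QQ ^^ m) (g (?c i l) (1 # l # w)))"
 by (rule sum.mono_neutral_right) (auto simp: Suc_le_eq)
 also have "... = (\<Sum>i\<in>{1..n}. \<Sum>l\<in>{1..<i}. \<Sum>is\<in>II m. \<Sum>ls\<in>JJ is.
 g (a \<otimes>\<^bsub>A\<^esub> (emb (lam_prod (i # is)) \<otimes>\<^bsub>A\<^esub> X (gap (i # is) (l # ls)))) (wt (l # ls) @ w))"
 proof (intro sum.cong refl)
 fix i l assume il: "i : {1..n}" "l : {1..<i}"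
 have c: "?c i l : carrier A" using Suc.prems by simp
 show "(QQ ^^ m) (g (?c i l) (1 # l # w)) = (\<Sum>is\<in>II m. \<Sum>ls\<in>JJ is.
 g (a \<otimes>\<^bsub>A\<^esub> (emb (lam_prod (i # is)) \<otimes>\<^bsub>A\<^esub> X (gap (i # is) (l # ls)))) (wt (l # ls) @ w))"
 unfolding Suc.IH[OF c]
 proof (intro sum.cong refl)
 fix js ls assume js: "js : II m" "ls : JJ js"
 have lp: "lam_prod js : carrier K" "emb (lam_prod (i # js)) = L (n - i) \<otimes>\<^bsub>A\<^esub> emb (lam_prod js)"
 using lam_prod_fixed[OF js(1)] by (simp_all add: lam_prod_def iota_mult lam_closed)
 have "?c i l \<otimes>\<^bsub>A\<^esub> (emb (lam_prod js) \<otimes>\<^bsub>A\<^esub> X (gap js ls))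
 = a \<otimes>\<^bsub>A\<^esub> (L (n - i) \<otimes>\<^bsub>A\<^esub> ((X (i - l - 1) \<otimes>\<^bsub>A\<^esub> emb (lam_prod js)) \<otimes>\<^bsub>A\<^esub> X (gap js ls)))"
 using Suc.prems lp(1) by (simp add: A.m_assoc)
 also have "... = a \<otimes>\<^bsub>A\<^esub> ((L (n - i) \<otimes>\<^bsub>A\<^esub> emb (lam_prod js)) \<otimes>\<^bsub>A\<^esub> (X (i - l - 1) \<otimes>\<^bsub>A\<^esub> X (gap js ls)))"
 unfolding X_lam_prod[OF js(1)] using Suc.prems lp(1) by (simp add: A.m_assoc)
 also have "... = a \<otimes>\<^bsub>A\<^esub> (emb (lam_prod (i # js)) \<otimes>\<^bsub>A\<^esub> X (gap (i # js) (l # ls)))"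
 by (simp add: lp(2) X_add gap_def)
 finally show "g (?c i l \<otimes>\<^bsub>A\<^esub> (emb (lam_prod js) \<otimes>\<^bsub>A\<^esub> X (gap js ls))) (wt ls @ 1 # l # w)
 = g (a \<otimes>\<^bsub>A\<^esub> (emb (lam_prod (i # js)) \<otimes>\<^bsub>A\<^esub> X (gap (i # js) (l # ls)))) (wt (l # ls) @ w)"
 by (simp add: wt_def)
 qed
 qed
 also have "... = (\<Sum>is\<in>II (Suc m). \<Sum>ls\<in>JJ is. g (a \<otimes>\<^bsub>A\<^esub> (emb (lam_prod is) \<otimes>\<^bsub>A\<^esub> X (gap is ls))) (wt ls @ w))"
 unfolding sum_II_Suc sum_JJ_Cons by (intro sum.cong refl sum.swap)
 finally show ?case .
qed

lemma phi_value:
 assumes a: "a : carrier A"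
 shows "ev r ((QQ ^^ (r div 2)) (g a (sw r))) =
 (let m = r div 2 in
 \<Oplus>\<^bsub>rel.norm_mod r\<^esub> is\<in>II m. \<Oplus>\<^bsub>rel.norm_mod r\<^esub> ls\<in>JJ is.
 rel.tens_class r
 ((emb (lam_prod is) \<otimes>\<^bsub>A\<^esub> a \<otimes>\<^bsub>A\<^esub> X ((\<Sum>j<m. is ! j - ls ! j) - m))
 # x_tilde ls @ (if even r then [] else [x])))"
proof -
 define m where "m = r div 2"
 have "ev r ((QQ ^^ m) (g a (sw r))) = (\<Oplus>\<^bsub>rel.norm_mod r\<^esub> is\<in>II m. \<Oplus>\<^bsub>rel.norm_mod r\<^esub> ls\<in>JJ is.
 ev r (g (a \<otimes>\<^bsub>A\<^esub> (emb (lam_prod is) \<otimes>\<^bsub>A\<^esub> X (gap is ls))) (wt ls @ sw r)))"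
 by (simp only: QQm_g[OF a] evp_sum)
 also have "... = (\<Oplus>\<^bsub>rel.norm_mod r\<^esub> is\<in>II m. \<Oplus>\<^bsub>rel.norm_mod r\<^esub> ls\<in>JJ is.
 rel.tens_class r
 ((emb (lam_prod is) \<otimes>\<^bsub>A\<^esub> a \<otimes>\<^bsub>A\<^esub> X ((\<Sum>j<m. is ! j - ls ! j) - m))
 # x_tilde ls @ (if even r then [] else [x])))"
 proof -
 have e: "ev r (g (a \<otimes>\<^bsub>A\<^esub> (emb (lam_prod js) \<otimes>\<^bsub>A\<^esub> X (gap js ls))) (wt ls @ sw r)) = rel.tens_class r
 ((emb (lam_prod js) \<otimes>\<^bsub>A\<^esub> a \<otimes>\<^bsub>A\<^esub> X ((\<Sum>j<m. js ! j - ls ! j) - m))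
 # x_tilde ls @ (if even r then [] else [x]))" (is "_ = ?R")
 and cl: "rel.tens_class r
 ((emb (lam_prod js) \<otimes>\<^bsub>A\<^esub> a \<otimes>\<^bsub>A\<^esub> X ((\<Sum>j<m. js ! j - ls ! j) - m))
 # x_tilde ls @ (if even r then [] else [x])) : carrier (rel.norm_mod r)"
 if js: "js : II m" "ls : JJ js" for js ls
 proof -
 note lp = lam_prod_fixed[OF js(1)]
 have len: "length js = m" "length ls = m" using js by (auto simp: II_def JJ_def)
 have gap: "gap js ls = (\<Sum>j<m. js ! j - ls ! j) - m" using gap_eq[OF js(2)] len by simp
 let ?b = "a \<otimes>\<^bsub>A\<^esub> X (gap js ls)"
 have b: "?b : carrier A" using a by simp
 have lr: "length (wt ls @ sw r) = r"
 using len by (cases "even r") (auto simp: length_wt sw_def m_def)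
 have w: "map X (wt ls @ sw r) = x_tilde ls @ (if even r then [] else [x])"
 by (simp add: map_wt sw_def)
 have "a \<otimes>\<^bsub>A\<^esub> (emb (lam_prod js) \<otimes>\<^bsub>A\<^esub> X (gap js ls)) = ?b \<otimes>\<^bsub>A\<^esub> emb (lam_prod js)"
 using a lp X_lam_prod[OF js(1)] by (simp add: A.m_assoc)
 then have "ev r (g (a \<otimes>\<^bsub>A\<^esub> (emb (lam_prod js) \<otimes>\<^bsub>A\<^esub> X (gap js ls))) (wt ls @ sw r)) = ev r (g (emb (lam_prod js) \<otimes>\<^bsub>A\<^esub> ?b) (wt ls @ sw r))"
 using ev_eqv[OF eqv_g_fixed[OF b, of "lam_prod js" 0 "wt ls @ sw r"], of r] lp by simp
 also have "... = ?R" using a lp lr w gap by (simp add: evp_g A.m_assoc)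
 finally show "ev r (g (a \<otimes>\<^bsub>A\<^esub> (emb (lam_prod js) \<otimes>\<^bsub>A\<^esub> X (gap js ls))) (wt ls @ sw r)) = ?R" .
 from this[symmetric] show "?R : carrier (rel.norm_mod r)" by (simp only: evp_closed)
 qed
 show ?thesis
 proof (rule NM.M.finsum_cong'[OF refl])
 fix js assume js: "js : II m"
 show "(\<Oplus>\<^bsub>rel.norm_mod r\<^esub> ls\<in>JJ js. ev r (g (a \<otimes>\<^bsub>A\<^esub> (emb (lam_prod js) \<otimes>\<^bsub>A\<^esub> X (gap js ls))) (wt ls @ sw r)))
 = (\<Oplus>\<^bsub>rel.norm_mod r\<^esub> ls\<in>JJ js. rel.tens_class r
 ((emb (lam_prod js) \<otimes>\<^bsub>A\<^esub> a \<otimes>\<^bsub>A\<^esub> X ((\<Sum>j<m. js ! j - ls ! j) - m))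
 # x_tilde ls @ (if even r then [] else [x])))"
 by (rule NM.M.finsum_cong'[OF refl _ e[OF js]]) (intro Pi_I cl[OF js])
 qed (intro Pi_I NM.M.finsum_closed cl)
 qed
 finally show ?thesis by (simp add: m_def Let_def)
qed

lemma phi:
 "phi r : mod_hom k (S_mod r) (rel.norm_mod r)"
 "u : Cs r ==> phi r (evS r u) = ev r ((QQ ^^ (r div 2)) u)"
proof -
 have F: "functional (st r) (rel.norm_mod r) (%u. ev r ((QQ ^^ (r div 2)) u))"
 using functional_comp[OF op_QQm[of 0 "r div 2"] norm_module functional_ev] by (simp add: st_def)
 obtain h where h: "h : mod_hom k (S_mod r) (rel.norm_mod r)"
 "!!a. a : carrier A ==> h (S_class r a) = ev r ((QQ ^^ (r div 2)) (g a (sw r)))"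
 using ex_S_hom[OF norm_module F] by blast
 have "phi r = h"
 unfolding phi_def
 proof (rule the_homI[OF h(1)], intro ballI, subst h(2), assumption, rule phi_value)
 fix h' assume h': "h' : mod_hom k (S_mod r) (rel.norm_mod r)"
 "ALL a:carrier A. h' (S_class r a) = (let m = r div 2 in
 \<Oplus>\<^bsub>rel.norm_mod r\<^esub> is\<in>II m. \<Oplus>\<^bsub>rel.norm_mod r\<^esub> ls\<in>JJ is.
 rel.tens_class r
 ((emb (lam_prod is) \<otimes>\<^bsub>A\<^esub> a \<otimes>\<^bsub>A\<^esub> X ((\<Sum>j<m. is ! j - ls ! j) - m))
 # x_tilde ls @ (if even r then [] else [x])))"
 show "h' = h" by (rule S_hom_eqI[OF h'(1) h(1)]) (simp only: h'(2)[rule_format] h(2) phi_value)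
 qed
 then show "phi r : mod_hom k (S_mod r) (rel.norm_mod r)"
 "u : Cs r ==> phi r (evS r u) = ev r ((QQ ^^ (r div 2)) u)"
 using h(1) S_hom_ev[OF norm_module h(1) F h(2)] by auto
qed

subsection \<open>The map \<open>psi\<close>\<close>

lemma overline_prod_short: "length w < 2 ==> overline_prod w = \<one>\<^bsub>A\<^esub>"
 by (simp add: overline_prod_def)

lemma overline_prod_Cons: "overline_prod (i # j # w) = uq (i + j) \<otimes>\<^bsub>A\<^esub> overline_prod w"
proof -
 have "[0..<length (i # j # w) div 2] = 0 # map Suc [0..<length w div 2]"
 by (simp add: map_Suc_upt upt_conv_Cons)
 then show ?thesis unfolding overline_prod_def by (simp add: foldr_map o_def to_A_overline)
qed

lemma overline_prod_closed [simp]: "overline_prod w : carrier A"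
 by (induction w rule: induct_list012) (simp_all add: overline_prod_short overline_prod_Cons)

lemma PPm_g:
 assumes "a : carrier A"
 shows "eqv (t + length w div 2 * n) ((PP ^^ (length w div 2)) (g a w)) (g (a \<otimes>\<^bsub>A\<^esub> overline_prod w) (drop (2 * (length w div 2)) w))"
 using assms
proof (induction w arbitrary: a t rule: induct_list012)
 case (3 i j w)
 let ?m = "length w div 2"
 have "eqv (t + n) (PP (g a (i # j # w))) (g (a \<otimes>\<^bsub>A\<^esub> uq (i + j)) w)"
 unfolding lift_g by (rule P0_eqv[OF "3.prems"])
 from op_eqv[OF op_PPm[of "t + n" ?m] this]
 have "eqv (t + n + ?m * n) ((PP ^^ Suc ?m) (g a (i # j # w))) ((PP ^^ ?m) (g (a \<otimes>\<^bsub>A\<^esub> uq (i + j)) w))"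
 by (simp add: funpow_swap1)
 also have "eqv (t + n + ?m * n) ... (g (a \<otimes>\<^bsub>A\<^esub> uq (i + j) \<otimes>\<^bsub>A\<^esub> overline_prod w) (drop (2 * ?m) w))"
 using "3.prems" by (intro "3.IH"(1)) simp
 finally show ?case using "3.prems" by (simp add: overline_prod_Cons A.m_assoc algebra_simps)
qed (simp_all add: overline_prod_short)

text \<open>The map \<open>psi\<close> on chains.\<close>

definition psc :: "nat => (nat => 'a) set chain => (nat => 'a) set chain"
 where "psc r u = (if even r then (PP ^^ (r div 2)) u else pp ((PP ^^ (r div 2)) u))"

lemma op_psc: "op 0 (st r) (psc r)"
proof (cases "even r")
 case True
 then have "psc r = PP ^^ (r div 2)" by (auto simp: psc_def)
 then show ?thesis using op_PPm[of 0 "r div 2"] by (simp add: st_def)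
next
 case False
 then have "psc r = (%u. pp ((PP ^^ (r div 2)) u))" by (auto simp: psc_def)
 then show ?thesis using op_comp[OF op_PPm[of 0 "r div 2"] op_pp] by (simp add: st_def)
qed

lemma Cs_Cr: "Cs (Suc 0) <= Cr 1" and Cr_0_Cs: "even r ==> Cr 0 = Cs r"
proof -
 show "Cs (Suc 0) <= Cr 1" unfolding Cs_def Cr_def using n_ge_2 by (auto simp: sw_def elim!: Sp_mono)
 have "{w. length w = 0 & redw w} = {[]}" by auto
 then show "even r ==> Cr 0 = Cs r" unfolding Cs_def Cr_def by (simp add: sw_def)
qed

lemma pp_Cs: "u : Cr 1 ==> odd r ==> pp u : Cs r"
 unfolding Cr_def Cs_def
proof (erule Sp_lift)
 fix a w assume r: "odd r" and aw: "(a, w) : carrier A \<times> {w. length w = 1 & redw w}"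
 then obtain i where "w = [i]" by (cases w) auto
 then show "p0 a w : Sp (carrier A \<times> {sw r})" using aw r by (auto simp: sw_def intro!: Sp_sum)
qed

lemma half_Cr: "u : Cr r ==> (PP ^^ (r div 2)) u : Cr (r mod 2)"
 using Cr_PPm[of u "r mod 2" "r div 2"] by simp

lemma psc_Cs: "u : Cr r ==> psc r u : Cs r"
 using half_Cr[of u r] Cr_0_Cs[of r] pp_Cs[of _ r] by (cases "even r") (auto simp: psc_def odd_iff_mod_2_eq_one)

lemma psi_value:
 assumes a: "a : carrier A" and w: "length w = r" "redw w"
 shows "evS r (psc r (g a w)) = (if even r
 then S_class r (a \<otimes>\<^bsub>A\<^esub> overline_prod w)
 else (\<Oplus>\<^bsub>S_mod r\<^esub> l\<in>{..<last w}.
 S_class r (X (last w - l - 1) \<otimes>\<^bsub>A\<^esub> a \<otimes>\<^bsub>A\<^esub> overline_prod w \<otimes>\<^bsub>A\<^esub> X l)))"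
proof (cases "even r")
 case True
 have "eqv (st r) (psc r (g a w)) (g (a \<otimes>\<^bsub>A\<^esub> overline_prod w) [])"
 using PPm_g[OF a, of 0 w] True w(1) by (simp add: st_def psc_def)
 then show ?thesis using evS_eqv a True by (simp add: evS_g sw_def)
next
 case False
 have d: "drop (2 * (r div 2)) w = [last w]"
 proof -
 have "w ~= []" "2 * (r div 2) = length w - 1" using False w(1) by (auto elim: oddE)
 then show ?thesis by (metis append_butlast_last_id append_eq_conv_conj length_butlast)
 qed
 let ?b = "a \<otimes>\<^bsub>A\<^esub> overline_prod w"
 have "eqv (st r) ((PP ^^ (r div 2)) (g a w)) (g ?b [last w])"
 using PPm_g[OF a, of 0 w] d w(1) by (simp add: st_def)
 then have "eqv (st r) (psc r (g a w)) (p0 ?b [last w])"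
 using pp_eqv[of "st r" _ "g ?b [last w]"] False by (simp add: psc_def del: p0.simps)
 then have "evS r (psc r (g a w)) = evS r (p0 ?b [last w])" by (rule evS_eqv)
 also have "... = (\<Oplus>\<^bsub>S_mod r\<^esub>l\<in>{..<last w}. evS r (g (X (last w - l - 1) \<otimes>\<^bsub>A\<^esub> ?b \<otimes>\<^bsub>A\<^esub> X l) [1]))"
 by (simp only: p0.simps evS_sum)
 also have "... = (\<Oplus>\<^bsub>S_mod r\<^esub>l\<in>{..<last w}. S_class r (X (last w - l - 1) \<otimes>\<^bsub>A\<^esub> a \<otimes>\<^bsub>A\<^esub> overline_prod w \<otimes>\<^bsub>A\<^esub> X l))"
 using a False by (intro SM.M.finsum_cong') (auto simp: evS_g sw_def A.m_assoc)
 finally show ?thesis using False by simp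
qed

lemma psi:
 "psi r : mod_hom k (rel.norm_mod r) (S_mod r)"
 "u : Cr r ==> psi r (ev r u) = evS r (psc r u)"
proof -
 have F: "functional 0 (S_mod r) (%u. evS r (psc r u))"
 by (rule functional_comp[OF op_psc S_module functional_evS])
 obtain h where h1: "h : mod_hom k (rel.norm_mod r) (S_mod r)" and h2: "ALL u:Cr r. h (ev r u) = evS r (psc r u)"
 using ex_chain_hom[OF S_module F, of r] by (elim bexE)
 note h = h1 bspec[OF h2]
 have hv: "h (rel.tens_class r (a # map X w)) = (if even r
 then S_class r (a \<otimes>\<^bsub>A\<^esub> overline_prod w)
 else (\<Oplus>\<^bsub>S_mod r\<^esub> l\<in>{..<last w}.
 S_class r (X (last w - l - 1) \<otimes>\<^bsub>A\<^esub> a \<otimes>\<^bsub>A\<^esub> overline_prod w \<otimes>\<^bsub>A\<^esub> X l)))"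
 if "a : carrier A" "length w = r & redw w" for a w
 using h(2)[of "g a w"] psi_value[of a w r] that by (simp add: Cr_def evp_g)
 have "psi r = h"
 unfolding psi_def
 proof (rule the_homI[OF h(1)], intro ballI allI impI, rule hv)
 fix h' assume h': "h' : mod_hom k (rel.norm_mod r) (S_mod r)"
 "ALL a:carrier A. ALL is. length is = r & redw is --> h' (rel.tens_class r (a # map X is)) = (if even r
 then S_class r (a \<otimes>\<^bsub>A\<^esub> overline_prod is)
 else (\<Oplus>\<^bsub>S_mod r\<^esub> l\<in>{..<last is}.
 S_class r (X (last is - l - 1) \<otimes>\<^bsub>A\<^esub> a \<otimes>\<^bsub>A\<^esub> overline_prod is \<otimes>\<^bsub>A\<^esub> X l)))"
 show "h' = h"
 proof (rule chain_hom_eqI[OF S_module h'(1) h(1)])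
 fix a w assume *: "a : carrier A" "redw w" "length w = r"
 then have "length w = r & redw w" by blast
 from h'(2)[rule_format, OF *(1) this] hv[OF *(1) this]
 show "h' (rel.tens_class r (a # map X w)) = h (rel.tens_class r (a # map X w))" by simp
 qed
 qed
 then show "psi r : mod_hom k (rel.norm_mod r) (S_mod r)" "u : Cr r ==> psi r (ev r u) = evS r (psc r u)"
 using h by auto
qed

end

context monogenic
begin

subsection \<open>Chain identities for the retraction\<close>

lemma pp_bb_1: "u : Cr 1 ==> bb (pp u) = bb u"
 unfolding Cr_def
proof (induction u rule: Sp_induct)
 case (gen a w)
 then obtain i where "w = [i]" by (cases w) auto
 then show ?case using gen bb_p0[of a i] by (simp del: b0.simps p0.simps)
qed (auto simp: lift_diff)

lemma pp_bb_2: "u : Cr 2 ==> eqv t (pp (bb u)) (dd2 (PP u))"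
 unfolding Cr_def
proof (erule Sp_eqv[OF _ addi_comp[OF addi_lift addi_lift] addi_comp[OF addi_lift addi_lift]])
 fix a w assume aw: "(a, w) : carrier A \<times> {w. length w = 2 & redw w}"
 then obtain i j where "w = [i, j]" by (cases w rule: word_cases) auto
 then show "eqv t (pp (bb (g a w))) (dd2 (PP (g a w)))" using aw pp_b[of a t i j] by (simp del: b0.simps p0.simps P0.simps)
qed

lemma QQ_bb_0: "u : Cr 0 ==> eqv t (bb (QQ u)) (dd2 u)"
 unfolding Cr_def
 by (erule Sp_eqv[OF _ addi_comp[OF addi_lift addi_lift] addi_lift]) (auto simp del: d0.simps intro: Q_b_0)

lemma pp_Cs_id: "u : Cs r ==> odd r ==> pp u = u"
 unfolding Cs_def by (induction u rule: Sp_induct) (auto simp: sw_def lift_diff)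

lemma dch_Cs: "u : Cs (Suc r) ==> dch (Suc r) u : Cs r"
 unfolding Cs_def
proof (cases "even r")
 case True
 assume "u : Sp (carrier A \<times> {sw (Suc r)})"
 then show "dch (Suc r) u : Sp (carrier A \<times> {sw r})"
 using True by (auto simp: dch_def sw_def elim!: Sp_lift intro!: Sp_add Sp_neg Sp_diff)
next
 case False
 assume "u : Sp (carrier A \<times> {sw (Suc r)})"
 then show "dch (Suc r) u : Sp (carrier A \<times> {sw r})"
 using False by (auto simp: dch_def sw_def elim!: Sp_lift intro!: Sp_sum)
qed

lemma Cs_mod: "u : Cs r ==> u : Cr (r mod 2)"
proof -
 assume "u : Cs r"
 moreover have "Cs r <= Cr (r mod 2)"
 proof (cases "even r")
 case True
 then show ?thesis using Cr_0_Cs by (simp add: even_iff_mod_2_eq_zero)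
 next
 case False
 then have "Cs r = Cs (Suc 0)" by (simp add: Cs_def sw_def)
 then show ?thesis using Cs_Cr False by (simp add: odd_iff_mod_2_eq_one)
 qed
 ultimately show ?thesis by blast
qed

lemma Cs_Ca: "u : Cs r ==> u : Ca"
 unfolding Cs_def Ca_Sp by (rule Sp_mono) auto

lemma QQm_Cr: "u : Cs r ==> (QQ ^^ (r div 2)) u : Cr r"
 using Cr_QQm[OF Cs_mod, of u r "r div 2"] by simp

lemma phi_chain: "u : Cs (Suc r) ==> eqv 0 (bb ((QQ ^^ (Suc r div 2)) u)) ((QQ ^^ (r div 2)) (dch (Suc r) u))"
proof (cases "even r")
 case True
 assume u: "u : Cs (Suc r)"
 have "Suc r mod 2 = Suc 0" using True by (simp add: mod_Suc even_iff_mod_2_eq_zero)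
 then have "u : Cr (Suc 0)" using Cs_mod[OF u] by simp
 from QQm_bb[OF this, of 0 "r div 2"] show ?thesis using True by (simp add: dch_def)
next
 case False
 assume u: "u : Cs (Suc r)"
 have "Suc r mod 2 = 0" using False by (simp add: mod_Suc odd_iff_mod_2_eq_one)
 then have u0: "u : Cr 0" using Cs_mod[OF u] by simp
 let ?m = "r div 2"
 have "(QQ ^^ (Suc r div 2)) u = (QQ ^^ ?m) (QQ u)" using False by (simp add: odd_Suc_div_two funpow_swap1)
 moreover have "eqv 0 (bb ((QQ ^^ ?m) (QQ u))) ((QQ ^^ ?m) (bb (QQ u)))"
 using Cr_QQ[OF u0] by (intro QQm_bb)
 moreover have "eqv 0 ((QQ ^^ ?m) (bb (QQ u))) ((QQ ^^ ?m) (dd2 u))"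
 by (rule op_eqv[OF op_QQm QQ_bb_0[OF u0]])
 ultimately show ?thesis using False by (auto simp: dch_def intro: eqv_trans)
qed

lemma psi_chain: "u : Cr (Suc r) ==> eqv (st r) (psc r (bb u)) (dch (Suc r) (psc (Suc r) u))"
proof -
 assume u: "u : Cr (Suc r)"
 let ?m = "r div 2" and ?v = "(PP ^^ (r div 2)) u"
 show ?thesis
 proof (cases "even r")
 case True
 then have u1: "u : Cr (1 + 2 * ?m)" using u by simp
 have "bb (pp ?v) = bb ?v" by (rule pp_bb_1[OF Cr_PPm[OF u1]])
 then show ?thesis using True PPm_bb[OF u1, of 0] by (simp add: psc_def dch_def st_def)
 next
 case False
 then have u2: "u : Cr (2 + 2 * ?m)" using u by (auto elim!: oddE)
 have "eqv (st r) (pp ((PP ^^ ?m) (bb u))) (pp (bb ?v))"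
 using PPm_bb[OF u2, of 0] by (intro pp_eqv) (simp add: st_def)
 moreover have "eqv (st r) (pp (bb ?v)) (dd2 (PP ?v))"
 by (rule pp_bb_2[OF Cr_PPm[OF u2]])
 ultimately show ?thesis using False by (auto simp: psc_def dch_def odd_Suc_div_two intro: eqv_trans)
 qed
qed

lemma psc_QQm: "u : Cs r ==> psc r ((QQ ^^ (r div 2)) u) = u"
 using PPm_QQm[OF Cs_Ca, of u r "r div 2"] pp_Cs_id[of u r] by (simp add: psc_def)

lemma psc_Suc_Suc: "psc (Suc (Suc r)) u = psc r (PP u)"
 by (simp add: psc_def funpow_swap1)

lemma lift_l0:
 assumes "u : Cr r"
 shows "lift l0 u = (if r = 0 then u else if r = 1 then pp u else 0)"
 using assms unfolding Cr_def
proof (induction u rule: Sp_induct)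
 case (gen a w)
 then show ?case by (cases w rule: word_cases) auto
qed (auto simp: lift_diff)

lemma Pi0_psc: "[|u : Cr r; r <= 2 * m + 1|] ==> Pi0 m u = (QQ ^^ (r div 2)) (psc r u)"
proof (induction m arbitrary: r u)
 case 0
 then have "r = 0 \<or> r = 1" by auto
 then show ?case using lift_l0[OF 0(1)] by (auto simp: psc_def)
next
 case (Suc m)
 show ?case
 proof (cases "r < 2")
 case True
 then have "r = 0 \<or> r = 1" by auto
 then show ?thesis using lift_l0[OF Suc.prems(1)] PP_short[OF Suc.prems(1) True] addi_zero[OF addi_Pi0, of m] by (auto simp: psc_def)
 next
 case False
 then obtain r' where r: "r = Suc (Suc r')" by (metis add_2_eq_Suc le_add_diff_inverse not_less)
 have "Pi0 m (PP u) = (QQ ^^ (r' div 2)) (psc r' (PP u))"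
 using Suc.prems r by (intro Suc.IH Cr_PP) auto
 then show ?thesis using lift_l0[OF Suc.prems(1)] r by (simp add: psc_Suc_Suc)
 qed
qed

lemma H_stable: "[|u : Cr r; r <= 2 * m + 1|] ==> H (Suc m) u = H m u"
proof (induction m arbitrary: r u)
 case 0
 then show ?case using PP_short[OF 0(1)] by simp
next
 case (Suc m)
 show ?case
 proof (cases "r < 2")
 case True
 then show ?thesis using PP_short[OF Suc.prems(1) True] addi_zero[OF addi_H, of m] by simp
 next
 case False
 then obtain r' where r: "r = Suc (Suc r')" by (metis add_2_eq_Suc le_add_diff_inverse not_less)
 have "H (Suc m) (PP u) = H m (PP u)" using Suc.prems r by (intro Suc.IH Cr_PP) auto
 then show ?thesis using H.simps(2)[of "Suc m" u] H.simps(2)[of m u] by (simp only:)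
 qed
qed

subsection \<open>The deformation retraction\<close>

definition hh :: "nat => ((nat => 'a) set list => 'k) set => ((nat => 'a) set list => 'k) set"
 where "hh r = (SOME h. h : mod_hom k (rel.norm_mod r) (rel.norm_mod (Suc r)) & (ALL u:Cr r. h (ev r u) = ev (Suc r) (H r u)))"

lemma hh: "hh r : mod_hom k (rel.norm_mod r) (rel.norm_mod (Suc r))"
 "u : Cr r ==> hh r (ev r u) = ev (Suc r) (H r u)"
proof -
 have "functional 0 (rel.norm_mod (Suc r)) (%u. ev (Suc r) (H r u))"
 by (rule functional_comp[OF op_H norm_module functional_ev])
 from ex_chain_hom[OF norm_module this, of r, unfolded Bex_def]
 have "hh r : mod_hom k (rel.norm_mod r) (rel.norm_mod (Suc r)) & (ALL u:Cr r. hh r (ev r u) = ev (Suc r) (H r u))"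
 unfolding hh_def by (rule someI_ex)
 then show "hh r : mod_hom k (rel.norm_mod r) (rel.norm_mod (Suc r))"
 "u : Cr r ==> hh r (ev r u) = ev (Suc r) (H r u)" by (rule conjunct1, elim conjE bspec)
qed

text \<open>The largest weight of a chain \<open>(a, sw r)\<close> at twist \<open>st r\<close>, attained for
\<open>a\<close> of degree \<open>n - 1\<close>.\<close>

definition top_wt :: "nat => nat" where "top_wt r = st r + sum_list (sw r) + (n - 1)"

definition WW :: "nat => nat => ((nat => 'a) set list => 'k) set set"
 where "WW r j = ev j ` Ch j 0 (top_wt r)"

lemma top_wt_eq: "top_wt r = r div 2 * n + (n - 1) + r mod 2"
 by (cases "even r") (auto simp: top_wt_def st_def sw_def odd_iff_mod_2_eq_one even_iff_mod_2_eq_zero)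

lemma top_wt_mono: "r <= r' ==> top_wt r <= top_wt r'"
proof -
 have "top_wt r <= top_wt (Suc r)" for r
 using n_ge_2 by (cases "even r") (auto simp: top_wt_eq odd_Suc_div_two mod_Suc odd_iff_mod_2_eq_one even_iff_mod_2_eq_zero)
 then show "r <= r' ==> top_wt r <= top_wt r'" by (rule lift_Suc_mono_le)
qed

lemma top_wt_step: "r + 2 <= j ==> top_wt r < st j + sum_list (sw j)"
proof -
 assume j: "r + 2 <= j"
 obtain i where j: "j = Suc (Suc i)" "r <= i" using j by (intro that[of "j - 2"]) auto
 have "top_wt i < st j + sum_list (sw j)" using n_ge_2 by (simp add: j top_wt_def st_def sw_def)
 then show ?thesis using top_wt_mono[OF j(2)] by simp
qed

text \<open>At twist \<open>st j\<close> the word \<open>sw j\<close> alone already has too large a weight.\<close>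

lemma psc_vanish:
 assumes u: "u : Ch j 0 W" and W: "W < st j + sum_list (sw j)"
 shows "psc j u = 0"
proof -
 have v: "(PP ^^ (j div 2)) u : Ch (j mod 2) (st j) W"
 using PPm_Ch[of u "j mod 2" "j div 2" 0 W] u by (simp add: st_def)
 show ?thesis
 proof (cases "even j")
 case True
 then have "(PP ^^ (j div 2)) u = 0" using v W by (intro Ch_empty) (auto simp: sw_def even_iff_mod_2_eq_zero)
 then show ?thesis using True by (simp add: psc_def)
 next
 case False
 have "(PP ^^ (j div 2)) u : Sp {}"
 using v
 proof (rule Sp_mono)
 show "gens (j mod 2) (st j) W <= {}"
 proof (rule subsetI, clarify)
 fix a w assume "(a, w) : gens (j mod 2) (st j) W"
 then obtain d where d: "length w = j mod 2" "redw w" "d + sum_list w + st j <= W" by (rule gensE)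
 then obtain i where "w = [i]" "1 <= i" using False by (cases w) (auto simp: odd_iff_mod_2_eq_one)
 then have False using d(3) W False by (simp add: sw_def)
 then show "(a, w) : {}" ..
 qed
 qed
 then have "(PP ^^ (j div 2)) u = 0" by (simp add: Sp_def)
 then show ?thesis using False by (simp add: psc_def)
 qed
qed

lemma S_ev_surj: "c : carrier (S_mod r) ==> EX u:Cs r. c = evS r u"
proof -
 assume "c : carrier (S_mod r)"
 then obtain a where "a : carrier A" "c = evS r (g a (sw r))" using S_surj by blast
 then show ?thesis by (intro bexI[of _ "g a (sw r)"]) (simp_all add: Cs_def)
qed

lemma phi_psi:
 assumes u: "u : Cr r" and m: "r <= 2 * m + 1"
 shows "phi r (psi r (ev r u)) = ev r (Pi0 m u)"
 using psi(2)[OF u] phi(2)[OF psc_Cs[OF u]] Pi0_psc[OF u m] by simp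

theorem S_retract: "mixed_retract k rel.norm_mod rel.norm_b rel.norm_B S_mod S_d phi psi hh WW"
proof (intro mixed_retract.intro norm_mixed_complex mixed_retract_axioms.intro)
 show "module k (S_mod r)" for r by (rule S_module)
 show "S_d (Suc r) : mod_hom k (S_mod (Suc r)) (S_mod r)" for r by (rule S_d(1))
 show "phi r : mod_hom k (S_mod r) (rel.norm_mod r)" for r by (rule phi(1))
 show "psi r : mod_hom k (rel.norm_mod r) (S_mod r)" for r by (rule psi(1))
 show "hh r : mod_hom k (rel.norm_mod r) (rel.norm_mod (Suc r))" for r by (rule hh(1))
 fix r
 show "rel.norm_b (Suc r) (phi (Suc r) c) = phi r (S_d (Suc r) c)" if c: "c : carrier (S_mod (Suc r))" for c
 proof -
 obtain u where u: "u : Cs (Suc r)" "c = evS (Suc r) u" using S_ev_surj[OF c] by blast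
 show ?thesis unfolding u(2) phi(2)[OF u(1)] S_d(2)[OF u(1)] phi(2)[OF dch_Cs[OF u(1)]] norm_b_ev[OF QQm_Cr[OF u(1)]]
 by (rule ev_eqv[OF phi_chain[OF u(1)]])
 qed
 show "psi r (rel.norm_b (Suc r) y) = S_d (Suc r) (psi (Suc r) y)" if y: "y : carrier (rel.norm_mod (Suc r))" for y
 proof -
 obtain u where u: "u : Cr (Suc r)" "y = ev (Suc r) u" using ev_surj[OF y] by blast
 show ?thesis unfolding u(2) norm_b_ev[OF u(1)] psi(2)[OF Cr_bb[OF u(1)]] psi(2)[OF u(1)] S_d(2)[OF psc_Cs[OF u(1)]]
 by (rule evS_eqv[OF psi_chain[OF u(1)]])
 qed
 show "psi r (phi r c) = c" if c: "c : carrier (S_mod r)" for c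
 proof -
 obtain u where u: "u : Cs r" "c = evS r u" using S_ev_surj[OF c] by blast
 show ?thesis unfolding u(2) phi(2)[OF u(1)] psi(2)[OF QQm_Cr[OF u(1)]] psc_QQm[OF u(1)] ..
 qed
 show "rel.norm_b 1 (hh 0 y) = y \<ominus>\<^bsub>rel.norm_mod 0\<^esub> phi 0 (psi 0 y)" if y: "y : carrier (rel.norm_mod 0)" for y
 proof -
 obtain u where u: "u : Cr 0" "y = ev 0 u" using ev_surj[OF y] by blast
 have z: "H 0 (bb u) = 0"
 using u(1) unfolding Cr_def by (induction u rule: Sp_induct) (auto simp: lift_diff)
 have "rel.norm_b 1 (hh 0 y) = ev 0 (bb (H 0 u))"
 unfolding u(2) hh(2)[OF u(1)] One_nat_def by (rule norm_b_ev[OF Cr_H[OF u(1)]])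
 also have "... = ev 0 (u - Pi0 0 u)"
 using ev_eqv[OF homotopy_chain[OF u(1), of 0 0]] z by (simp only: add_0_right)
 finally have e: "rel.norm_b 1 (hh 0 y) = ev 0 (u - Pi0 0 u)" .
 have p: "phi 0 (psi 0 (ev 0 u)) = ev 0 (Pi0 0 u)" by (rule phi_psi[OF u(1)]) simp
 show ?thesis using e unfolding u(2) evp_diff p .
 qed
 show "rel.norm_b (Suc (Suc r)) (hh (Suc r) y) \<oplus>\<^bsub>rel.norm_mod (Suc r)\<^esub> hh r (rel.norm_b (Suc r) y)
 = y \<ominus>\<^bsub>rel.norm_mod (Suc r)\<^esub> phi (Suc r) (psi (Suc r) y)" if y: "y : carrier (rel.norm_mod (Suc r))" for y
 proof -
 obtain u where u: "u : Cr (Suc r)" "y = ev (Suc r) u" using ev_surj[OF y] by blast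
 have "H (Suc r) (bb u) = H r (bb u)" by (rule H_stable[OF Cr_bb[OF u(1)]]) simp
 then have e: "eqv 0 (bb (H (Suc r) u) + H r (bb u)) (u - Pi0 (Suc r) u)"
 using homotopy_chain[OF u(1), of "Suc r" 0] by simp
 have p: "phi (Suc r) (psi (Suc r) (ev (Suc r) u)) = ev (Suc r) (Pi0 (Suc r) u)"
 by (rule phi_psi[OF u(1)]) simp
 show ?thesis
 unfolding u(2) hh(2)[OF u(1)] norm_b_ev[OF Cr_H[OF u(1)]] norm_b_ev[OF u(1)] hh(2)[OF Cr_bb[OF u(1)]] p
 evp_add[symmetric] evp_diff[symmetric]
 by (rule ev_eqv[OF e])
 qed
 fix j
 show "WW r j <= carrier (rel.norm_mod j)" by (auto simp: WW_def)
 show "y \<ominus>\<^bsub>rel.norm_mod j\<^esub> z : WW r j" if yz: "y : WW r j" "z : WW r j" for y z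
 proof -
 obtain u where u: "y = ev j u" "u : Ch j 0 (top_wt r)" using yz(1) unfolding WW_def by (rule imageE)
 obtain v where v: "z = ev j v" "v : Ch j 0 (top_wt r)" using yz(2) unfolding WW_def by (rule imageE)
 show ?thesis unfolding WW_def u(1) v(1) evp_diff[symmetric] by (rule imageI[OF Sp_diff[OF u(2) v(2)]])
 qed
 show "WW r j <= WW r' j" if "r <= r'" for r'
 unfolding WW_def using Ch_mono top_wt_mono[OF that] by (intro image_mono subsetI)
 show "phi r c : WW r r" if c: "c : carrier (S_mod r)" for c
 proof -
 obtain a where a: "a : carrier A" "c = evS r (g a (sw r))" using S_surj[OF c] by blast
 have s: "g a (sw r) : Cs r" using a by (simp add: Cs_def)
 have "g a (sw r) : Ch (r mod 2) (st r) (top_wt r)"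
 using n_ge_2 by (intro Ch_g[OF Adeg_all[OF a(1)]]) (auto simp: top_wt_def sw_def even_iff_mod_2_eq_zero odd_iff_mod_2_eq_one)
 then have "(QQ ^^ (r div 2)) (g a (sw r)) : Ch r 0 (top_wt r)"
 using QQm_Ch[of "g a (sw r)" "r mod 2" 0 "r div 2" "top_wt r"] by (simp add: st_def)
 then show ?thesis unfolding a(2) phi(2)[OF s] WW_def by (rule imageI)
 qed
 show "rel.norm_B j y : WW r (Suc j)" if "y : WW r j" for y
 using that unfolding WW_def by (rule norm_B_ev_Ch)
 show "hh j y : WW r (Suc j)" if y: "y : WW r j" for y
 proof -
 obtain u where u: "u : Ch j 0 (top_wt r)" "y = ev j u" using y unfolding WW_def by (rule imageE)
 show ?thesis unfolding u(2) hh(2)[OF Ch_Cr[OF u(1)]] WW_def by (rule imageI[OF Ch_H[OF u(1)]])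
 qed
 show "psi j y = \<zero>\<^bsub>S_mod j\<^esub>" if y: "y : WW r j" and j: "r + 2 <= j" for y
 proof -
 obtain u where u: "u : Ch j 0 (top_wt r)" "y = ev j u" using y unfolding WW_def by (rule imageE)
 show ?thesis unfolding u(2) psi(2)[OF Ch_Cr[OF u(1)]] psc_vanish[OF u(1) top_wt_step[OF j]] by simp
 qed
qed

end

theorem theorem3p2:
  fixes k :: "('k, 'r) ring_scheme" and K :: "('k, 'a, 'm) module_scheme"
    and \<alpha> :: "'a \<Rightarrow> 'a" and n :: nat and lam :: "nat \<Rightarrow> 'a"
  assumes "cring k"
    and "assoc_algebra k K"
    and "\<alpha> \<in> alg_hom k K K"
    and "n \<ge> 2"
    and "lam 0 = \<one>\<^bsub>K\<^esub>"
    and "\<And>i. \<lbrakk>1 \<le> i; i \<le> n\<rbrakk> \<Longrightarrow> lam i \<in> carrier K"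
    and "\<And>i. \<lbrakk>1 \<le> i; i \<le> n\<rbrakk> \<Longrightarrow> \<alpha> (lam i) = lam i"
    and "\<And>i c. \<lbrakk>1 \<le> i; i \<le> n; c \<in> carrier K\<rbrakk> \<Longrightarrow> lam i \<otimes>\<^bsub>K\<^esub> c = (\<alpha> ^^ i) c \<otimes>\<^bsub>K\<^esub> lam i"
  shows "mixed_complex k (monogenic_data.S_mod k K \<alpha> n lam)
           (monogenic_data.S_d k K \<alpha> n lam) (monogenic_data.S_D k K \<alpha> n lam)
       \<and> (\<forall>r. mod_isomorphic k
            (cyclic_homology (monogenic_data.S_mod k K \<alpha> n lam)
               (monogenic_data.S_d k K \<alpha> n lam) (monogenic_data.S_D k K \<alpha> n lam) r)
            (relative_algebra_data.HC k K (monogenic_data.emb K \<alpha> n lam)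
               (monogenic_data.A K \<alpha> n lam) r))"
proof -
  interpret monogenic k K \<alpha> n lam
    by (intro monogenic.intro assms)
  interpret R: mixed_retract k rel.norm_mod rel.norm_b rel.norm_B S_mod S_d phi psi hh WW
    by (rule S_retract)
  have "S_D = R.D"
    by (rule ext) (simp add: S_D_def R.D_def)
  then show ?thesis
    using R.mixed_complex_retract R.cyclic_homology_retract unfolding rel.HC_def by simp
qed

end
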